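(* For all integers $1\le n,m\le 6$, the complete bipartite graph $K_{n,m}$ is linearly free.
   Context: Graphs are regarded as topological 1-complexes. An embedding $f:G\to\mathbb{R}^3$ is linear if every edge is mapped onto a straight line segment, and free if $\pi_1(\mathbb{R}^3-f(G))$ is a free group. A simple connected graph is linearly free if every linear embedding of it into $\mathbb{R}^3$ is free. *)

theory Defs
  imports "HOL-Analysis.Analysis" "HOL-Algebra.Generated_Groups"
begin

definition path_class :: "'a::topological_space set \<Rightarrow> (real \<Rightarrow> 'a) \<Rightarrow> (real \<Rightarrow> 'a) set" where
  "path_class S p = {q. homotopic_paths S p q}"

definition fundamental_group :: "'a::topological_space set \<Rightarrow> 'a \<Rightarrow> (real \<Rightarrow> 'a) set monoid" where
  "fundamental_group S a =
     \<lparr> carrier = {path_class S p | p. path p \<and> path_image p \<subseteq> S \<and> pathstart p = a \<and> pathfinish p = a},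
       mult = (\<lambda>A B. path_class S ((SOME p. p \<in> A) +++ (SOME q. q \<in> B))),
       one = path_class S (\<lambda>t. a) \<rparr>"

text \<open>Words in letters and their inverses: (True, x) stands for x, (False, x) for its inverse.\<close>

fun reduced_word :: "(bool \<times> 'a) list \<Rightarrow> bool" where
  "reduced_word ((b, x) # (c, y) # w) = (\<not> (x = y \<and> b \<noteq> c) \<and> reduced_word ((c, y) # w))"
| "reduced_word _ = True"

fun eval_word :: "('a, 'b) monoid_scheme \<Rightarrow> (bool \<times> 'a) list \<Rightarrow> 'a" where
  "eval_word G [] = \<one>\<^bsub>G\<^esub>"
| "eval_word G ((b, x) # w) = (if b then x else inv\<^bsub>G\<^esub> x) \<otimes>\<^bsub>G\<^esub> eval_word G w"

definition is_free_group :: "('a, 'b) monoid_scheme \<Rightarrow> bool" where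
  "is_free_group G \<longleftrightarrow> group G \<and>
     (\<exists>X \<subseteq> carrier G. generate G X = carrier G \<and>
        (\<forall>w. w \<noteq> [] \<and> snd ` set w \<subseteq> X \<and> reduced_word w \<longrightarrow> eval_word G w \<noteq> \<one>\<^bsub>G\<^esub>))"

definition simple_graph :: "'v set \<Rightarrow> 'v set set \<Rightarrow> bool" where
  "simple_graph V E \<longleftrightarrow> (\<forall>e\<in>E. \<exists>u v. u \<in> V \<and> v \<in> V \<and> u \<noteq> v \<and> e = {u, v})"

definition edge_segment :: "('v \<Rightarrow> real^3) \<Rightarrow> 'v set \<Rightarrow> (real^3) set" where
  "edge_segment \<phi> e = convex hull (\<phi> ` e)"

definition graph_image :: "'v set \<Rightarrow> 'v set set \<Rightarrow> ('v \<Rightarrow> real^3) \<Rightarrow> (real^3) set" where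
  "graph_image V E \<phi> = \<phi> ` V \<union> \<Union> (edge_segment \<phi> ` E)"

text \<open>A linear embedding: vertices to distinct points, edges to straight segments,
  such that the resulting map of the 1-complex is injective.\<close>

definition linear_embedding :: "'v set \<Rightarrow> 'v set set \<Rightarrow> ('v \<Rightarrow> real^3) \<Rightarrow> bool" where
  "linear_embedding V E \<phi> \<longleftrightarrow>
     inj_on \<phi> V \<and>
     (\<forall>e\<in>E. \<forall>w\<in>V. w \<notin> e \<longrightarrow> \<phi> w \<notin> edge_segment \<phi> e) \<and>
     (\<forall>e1\<in>E. \<forall>e2\<in>E. e1 \<noteq> e2 \<longrightarrow> edge_segment \<phi> e1 \<inter> edge_segment \<phi> e2 = \<phi> ` (e1 \<inter> e2))"

definition free_embedding :: "'v set \<Rightarrow> 'v set set \<Rightarrow> ('v \<Rightarrow> real^3) \<Rightarrow> bool" where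
  "free_embedding V E \<phi> \<longleftrightarrow>
     (\<forall>a \<in> - graph_image V E \<phi>. is_free_group (fundamental_group (- graph_image V E \<phi>) a))"

definition linearly_free :: "'v set \<Rightarrow> 'v set set \<Rightarrow> bool" where
  "linearly_free V E \<longleftrightarrow> (\<forall>\<phi>. linear_embedding V E \<phi> \<longrightarrow> free_embedding V E \<phi>)"

definition Knm_vertices :: "nat \<Rightarrow> nat \<Rightarrow> (nat + nat) set" where
  "Knm_vertices n m = Inl ` {..<n} \<union> Inr ` {..<m}"

definition Knm_edges :: "nat \<Rightarrow> nat \<Rightarrow> (nat + nat) set set" where
  "Knm_edges n m = {{Inl i, Inr j} | i j. i < n \<and> j < m}"

end

theory Submission
  imports Defs
begin

text \<open>
  Fix a direction in general position and sweep the complement of the embedded graph by height. As long as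
  every vertex but one has an edge going upwards, each passage through a vertex only attaches free generators,
  so the fundamental group is free. In a complete bipartite graph whose highest vertex is red, a red vertex is
  a local maximum exactly if it lies above all blue vertices, and no blue vertex is. If there are two such red
  vertices \<open>r1\<close> and \<open>r2\<close>, then the edge from the highest blue vertex \<open>b1\<close> to \<open>r2\<close> can be slid across the
  triangle \<open>b1 r1 r2\<close>, which meets the other edges only in its corners, and replaced by the edge from
  \<open>r2\<close> to \<open>r1\<close>: one local maximum remains.

  It remains to find a direction with at most two local maxima. If every generic direction had three, the
  colour of the maxima could not change with the direction: at a change three red vertices would lie at the
  height of a blue one and, by genericity, on a line through it, two of them on the same side. With at most
  six vertices of this colour, a direction and its opposite then show that each red vertex sees all blue
  vertices on one side in every generic direction, hence along one ray, which is impossible. If one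
  class is a single vertex, the graph is a star and its complement is simply connected.
\<close>

section \<open>Invariants of paths\<close>

text \<open>The obstacle is where freeness can be lost. Passing a local maximum glues in a region
  whose overlap with the part below contains a loop around the vertex, and this may impose a
  relation. At a single highest vertex it does not: the loop can be blown up from the vertex until
  it lies below the whole graph, where it bounds.

  At a vertex with several strands going up, one strand is chosen as a spine and the others are
  thickened to triangular sectors spanned with it. Deleting these as well leaves the fundamental
  group of the part below unchanged. Each sector is then restored as a convex wall that meets the
  rest in two convex pieces, and adds one generator.

  That overlap is disconnected, so van Kampen's theorem with a single base point does not apply.
  Invariants are therefore functors on the fundamental groupoid (\<open>path_functor\<close>),
  extended over a wall by a potential whose jump between the two pieces is arbitrary; this
  arbitrariness is the freeness of the new generator.\<close>

definition path_functor :: "'a::topological_space set \<Rightarrow> ((real \<Rightarrow> 'a) \<Rightarrow> 'h::group_add) \<Rightarrow> bool" where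
  "path_functor M f \<longleftrightarrow>
     (\<forall>p q. homotopic_paths M p q \<longrightarrow> f p = f q) \<and>
     (\<forall>p q. path p \<and> path q \<and> path_image p \<subseteq> M \<and> path_image q \<subseteq> M \<and> pathfinish p = pathstart q
        \<longrightarrow> f (p +++ q) = f p + f q)"

lemma path_functor_homotopic: "path_functor M f \<Longrightarrow> homotopic_paths M p q \<Longrightarrow> f p = f q"
  by (auto simp: path_functor_def)

lemma path_functor_join:
  "path_functor M f \<Longrightarrow> path p \<Longrightarrow> path q \<Longrightarrow> path_image p \<subseteq> M \<Longrightarrow> path_image q \<subseteq> M \<Longrightarrow>
    pathfinish p = pathstart q \<Longrightarrow> f (p +++ q) = f p + f q"
  by (auto simp: path_functor_def)

lemma path_functor_mono: "path_functor M f \<Longrightarrow> A \<subseteq> M \<Longrightarrow> path_functor A f"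
  unfolding path_functor_def by (meson homotopic_paths_subset subset_trans)

lemma path_functor_const:
  fixes a :: "'a::real_normed_vector"
  assumes "path_functor M f" "a \<in> M"
  shows "f (linepath a a) = 0"
proof -
  have "homotopic_paths M (linepath a a +++ linepath a a) (linepath a a)"
    using homotopic_paths_rid[of "linepath a a" M] assms by simp
  then have "f (linepath a a) + f (linepath a a) = f (linepath a a)"
    using path_functor_join[OF assms(1), of "linepath a a" "linepath a a"] assms
      path_functor_homotopic[OF assms(1)] by fastforce
  then show ?thesis
    using add_left_cancel[of "f (linepath a a)" "f (linepath a a)" 0] by simp
qed

lemma path_functor_reverse:
  fixes p :: "real \<Rightarrow> 'a::real_normed_vector"
  assumes f: "path_functor M f" and p: "path p" "path_image p \<subseteq> M"
  shows "f (reversepath p) = - f p"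
proof -
  have "f (p +++ reversepath p) = f (linepath (pathstart p) (pathstart p))"
    by (rule path_functor_homotopic[OF f homotopic_paths_rinv]) (use p in auto)
  moreover have "f (p +++ reversepath p) = f p + f (reversepath p)"
    by (rule path_functor_join[OF f]) (use p in auto)
  moreover have "f (linepath (pathstart p) (pathstart p)) = 0"
    by (rule path_functor_const[OF f]) (use p pathstart_in_path_image in auto)
  ultimately show ?thesis
    by (metis minus_unique)
qed

lemma homotopic_paths_convex:
  fixes S :: "'a::real_normed_vector set"
  assumes "convex S" "path p" "path q" "path_image p \<subseteq> S" "path_image q \<subseteq> S"
    "pathstart p = pathstart q" "pathfinish p = pathfinish q"
  shows "homotopic_paths S p q"
proof (rule homotopic_paths_linear)
  fix t :: real assume "t \<in> {0..1}"
  then show "closed_segment (p t) (q t) \<subseteq> S"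
    using assms(1,4,5) by (intro closed_segment_subset) (auto simp: path_image_def)
qed (use assms in auto)

section \<open>Gluing path invariants over an open cover\<close>

locale local_functor =
  fixes \<U> :: "'a::real_normed_vector set set" and f :: "(real \<Rightarrow> 'a) \<Rightarrow> 'h::group_add"
  assumes open_cover: "\<And>U. U \<in> \<U> \<Longrightarrow> open U"
    and is_functor: "\<And>U. U \<in> \<U> \<Longrightarrow> path_functor U f"
begin

text \<open>A convex parameter domain makes the two routes from \<open>a\<close> to \<open>c\<close>
  homotopic, and \<open>h\<close> carries the homotopy into a single member of the cover. The
  subdivisions of paths and of homotopies both rest on this identity.\<close>

lemma triangle:
  fixes K :: "'b::real_normed_vector set"
  assumes K: "convex K" "continuous_on K h" "h ` K \<subseteq> U" "U \<in> \<U>" and "a \<in> K" "b \<in> K" "c \<in> K"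
  shows "f (h \<circ> linepath a b) + f (h \<circ> linepath b c) = f (h \<circ> linepath a c)"
proof -
  have seg: "closed_segment a b \<subseteq> K" "closed_segment b c \<subseteq> K" "closed_segment a c \<subseteq> K"
    using assms by (simp_all add: closed_segment_subset)
  have pth: "path (h \<circ> linepath x y)" "path_image (h \<circ> linepath x y) \<subseteq> U"
    if "closed_segment x y \<subseteq> K" for x y
    using that K by (auto intro!: path_continuous_image continuous_on_subset[OF K(2)] simp: path_image_compose)
  have "homotopic_paths K (linepath a b +++ linepath b c) (linepath a c)"
    using seg by (intro homotopic_paths_convex K) (auto simp: path_image_join)
  then have "homotopic_paths U (h \<circ> (linepath a b +++ linepath b c)) (h \<circ> linepath a c)"
    using K by (intro homotopic_paths_continuous_image) auto
  then have "f (h \<circ> (linepath a b +++ linepath b c)) = f (h \<circ> linepath a c)"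
    by (rule path_functor_homotopic[OF is_functor[OF K(4)]])
  moreover have "f (h \<circ> (linepath a b +++ linepath b c)) = f (h \<circ> linepath a b) + f (h \<circ> linepath b c)"
    unfolding path_compose_join
    by (rule path_functor_join[OF is_functor[OF K(4)]]) (use pth seg in \<open>auto simp: pathfinish_compose pathstart_compose\<close>)
  ultimately show ?thesis by simp
qed

definition edge :: "(real \<Rightarrow> 'a) \<Rightarrow> nat \<Rightarrow> nat \<Rightarrow> 'h" where
  "edge p N k = f (p \<circ> linepath (real k / real N) (real (Suc k) / real N))"

definition total :: "nat \<Rightarrow> (real \<Rightarrow> 'a) \<Rightarrow> 'h" where
  "total N p = sum_list (map (edge p N) [0..<N])"

definition grid_ok :: "nat \<Rightarrow> (real \<Rightarrow> 'a) \<Rightarrow> bool" where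
  "grid_ok N p \<longleftrightarrow> 0 < N \<and> (\<forall>k<N. \<exists>U\<in>\<U>. p ` {real k / real N .. real (Suc k) / real N} \<subseteq> U)"

lemma grid_okD: "grid_ok N p \<Longrightarrow> k < N \<Longrightarrow> \<exists>U\<in>\<U>. p ` {real k / real N .. real (Suc k) / real N} \<subseteq> U"
  by (simp only: grid_ok_def)

lemma grid_interval:
  assumes "k < N"
  shows "{real k / real N .. real (Suc k) / real N} \<subseteq> {0..1}"
proof -
  have "real (Suc k) / real N \<le> 1" "0 \<le> real k / real N"
    using assms by (simp_all add: divide_le_eq_1)
  then show ?thesis by (meson atLeastatMost_subset_iff)
qed

lemma block:
  assumes p: "path p" and "0 < N" "m \<le> n" "n \<le> N" and U: "p ` {real m / real N .. real n / real N} \<subseteq> U" "U \<in> \<U>"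
  shows "sum_list (map (edge p N) [m..<n]) = f (p \<circ> linepath (real m / real N) (real n / real N))"
proof -
  let ?K = "{real m / real N .. real n / real N}"
  have "real n / real N \<le> 1" "0 \<le> real m / real N"
    using assms(2,4) by simp_all
  then have sub: "?K \<subseteq> {0..1}" by (meson atLeastatMost_subset_iff)
  then have cont: "continuous_on ?K p"
    using p continuous_on_subset unfolding path_def by blast
  have inK: "real k / real N \<in> ?K" if "m \<le> k" "k \<le> n" for k
    using that assms(2) by (auto simp: divide_right_mono)
  have tri: "f (p \<circ> linepath a b) + f (p \<circ> linepath b c) = f (p \<circ> linepath a c)"
    if "a \<in> ?K" "b \<in> ?K" "c \<in> ?K" for a b c
    using triangle[OF _ cont U that] by (simp add: convex_real_interval)
  have "k \<le> n \<Longrightarrow> sum_list (map (edge p N) [m..<k]) = f (p \<circ> linepath (real m / real N) (real k / real N))" if "m \<le> k" for k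
    using that
  proof (induction k rule: dec_induct)
    case base
    have "f (p \<circ> linepath (real m / real N) (real m / real N)) = 0"
      using tri[OF inK inK inK, of m m m] assms(3)
        add_left_cancel[of "f (p \<circ> linepath (real m / real N) (real m / real N))" "f (p \<circ> linepath (real m / real N) (real m / real N))" 0]
      by (simp del: linepath_refl)
    then show ?case unfolding \<open>f (p \<circ> linepath (real m / real N) (real m / real N)) = 0\<close> by simp
  next
    case (step k)
    then have "sum_list (map (edge p N) [m..<Suc k]) = f (p \<circ> linepath (real m / real N) (real k / real N)) + edge p N k"
      by (simp add: comp_def)
    also have "\<dots> = f (p \<circ> linepath (real m / real N) (real (Suc k) / real N))"
      unfolding edge_def using step by (intro tri inK) auto
    finally show ?case .
  qed
  from this[OF \<open>m \<le> n\<close>] show ?thesis by simp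
qed

lemma sum_list_blocks:
  "sum_list (map g [0..<N * M]) = sum_list (map (\<lambda>k. sum_list (map g [k * M..<Suc k * M])) [0..<N])"
  for g :: "nat \<Rightarrow> 'h"
proof (induction N)
  case (Suc N)
  have e: "[0..<Suc N * M] = [0..<N * M] @ [N * M..<Suc N * M]"
    using upt_add_eq_append[of 0 "N * M" M] by (simp add: add.commute)
  show ?case
    unfolding e map_append sum_list_append Suc.IH upt_Suc_append[OF le0] by (simp del: mult_Suc)
qed simp

text \<open>Each coarse piece lies in one member of the cover, so \<open>block\<close> collapses its
  \<open>M\<close> fine pieces. Two grids are then compared through the product of their
  sizes.\<close>

lemma total_refine:
  assumes p: "path p" and N: "grid_ok N p" and M: "0 < M"
  shows "total (N * M) p = total N p"
proof -
  have "sum_list (map (edge p (N * M)) [k * M..<Suc k * M]) = edge p N k" if kN: "k < N" for k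
  proof -
    have e: "real (k * M) / real (N * M) = real k / real N" "real (Suc k * M) / real (N * M) = real (Suc k) / real N"
      using M unfolding of_nat_mult by auto
    obtain U where U: "U \<in> \<U>" "p ` {real k / real N .. real (Suc k) / real N} \<subseteq> U"
      using grid_okD[OF N kN] by blast
    have "Suc k * M \<le> N * M" using kN by (intro mult_le_mono1) auto
    moreover have "0 < N * M" using N M by (simp add: grid_ok_def)
    moreover have "p ` {real (k * M) / real (N * M) .. real (Suc k * M) / real (N * M)} \<subseteq> U"
      unfolding e by (rule U(2))
    ultimately have "sum_list (map (edge p (N * M)) [k * M..<Suc k * M])
        = f (p \<circ> linepath (real (k * M) / real (N * M)) (real (Suc k * M) / real (N * M)))"
      by (intro block[OF p _ _ _ _ U(1)]) (simp_all only: mult_le_mono1 le_SucI order_refl)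
    then show ?thesis
      unfolding e edge_def[of p N] .
  qed
  then have "map (\<lambda>k. sum_list (map (edge p (N * M)) [k * M..<Suc k * M])) [0..<N] = map (edge p N) [0..<N]"
    by (simp add: map_eq_conv)
  then show ?thesis
    unfolding total_def sum_list_blocks by metis
qed

lemma total_unique:
  assumes "path p" "grid_ok N p" "grid_ok M p"
  shows "total N p = total M p"
  using total_refine[OF assms(1,2), of M] total_refine[OF assms(1,3), of N] assms
  by (simp add: grid_ok_def mult.commute)

text \<open>The Lebesgue number lemma for the cover pulled back along \<open>h\<close>. Preimages
  are open only relative to \<open>K\<close>, so open sets \<open>V U\<close> of the ambient space
  with the same trace on \<open>K\<close> are chosen first.\<close>

lemma lebesgue_grid:
  fixes h :: "'b::metric_space \<Rightarrow> 'a"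
  assumes "compact K" "continuous_on K h" "h ` K \<subseteq> \<Union>\<U>" 
  obtains \<delta> where "\<delta> > 0" "\<And>T. T \<subseteq> K \<Longrightarrow> T \<noteq> {} \<Longrightarrow> diameter T < \<delta> \<Longrightarrow> bounded T \<Longrightarrow> \<exists>U\<in>\<U>. h ` T \<subseteq> U"
proof (cases "K = {}")
  case True then show ?thesis using that[of 1] by auto
next
  case False
  have "\<forall>U\<in>\<U>. \<exists>V. open V \<and> V \<inter> K = h -` U \<inter> K"
    using assms(2) open_cover continuous_on_open_invariant[of K h] by blast
  then obtain V where V: "\<And>U. U \<in> \<U> \<Longrightarrow> open (V U) \<and> V U \<inter> K = h -` U \<inter> K"
    by metis
  have ne: "V ` \<U> \<noteq> {}" using False assms(3) by auto
  have sub: "K \<subseteq> \<Union>(V ` \<U>)"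
  proof
    fix x assume x: "x \<in> K"
    then obtain U where U: "U \<in> \<U>" "h x \<in> U" using assms(3) by blast
    then have "x \<in> V U" using V[OF U(1)] x by blast
    then show "x \<in> \<Union>(V ` \<U>)" using U(1) by blast
  qed
  have op: "open B" if "B \<in> V ` \<U>" for B using that V by blast
  obtain \<delta> where \<delta>: "0 < \<delta>" "\<And>T. \<lbrakk>T \<subseteq> K; diameter T < \<delta>\<rbrakk> \<Longrightarrow> \<exists>B \<in> V ` \<U>. T \<subseteq> B"
    by (rule Lebesgue_number_lemma[OF assms(1) ne sub op]) blast+
  show ?thesis
  proof (rule that[OF \<delta>(1)])
    fix T assume T: "T \<subseteq> K" "diameter T < \<delta>"
    then obtain U where U: "U \<in> \<U>" "T \<subseteq> V U" using \<delta>(2) by blast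
    have "h ` T \<subseteq> U" using V[OF U(1)] T(1) U(2) by blast
    then show "\<exists>U\<in>\<U>. h ` T \<subseteq> U" using U(1) by blast
  qed
qed

lemma ex_grid:
  assumes "path p" "path_image p \<subseteq> \<Union>\<U>"
  obtains N where "grid_ok N p"
proof -
  obtain \<delta> where \<delta>: "\<delta> > 0" "\<And>T. T \<subseteq> {0..1} \<Longrightarrow> T \<noteq> {} \<Longrightarrow> diameter T < \<delta> \<Longrightarrow> bounded T \<Longrightarrow> \<exists>U\<in>\<U>. p ` T \<subseteq> U"
    using lebesgue_grid[of "{0..1::real}" p] assms by (auto simp: path_def path_image_def)
  obtain N :: nat where N: "N > 0" "1 / real N < \<delta>"
    using \<delta>(1) by (metis nat_approx_posE zero_less_Suc)
  have "grid_ok N p" unfolding grid_ok_def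
  proof (intro conjI allI impI \<delta>(2))
    fix k assume "k < N"
    then show "{real k / real N .. real (Suc k) / real N} \<subseteq> {0..1}"
      by (rule grid_interval)
    show "{real k / real N .. real (Suc k) / real N} \<noteq> {}"
    proof -
      have "real k / real N \<le> real (Suc k) / real N" by (simp add: divide_right_mono)
      then show ?thesis unfolding atLeastatMost_empty_iff by blast
    qed
    have "diameter {real k / real N .. real (Suc k) / real N} = 1 / real N"
    proof -
      have "\<not> real (Suc k) / real N < real k / real N" by (simp add: not_less divide_right_mono)
      then show ?thesis by (simp only: diameter_closed_interval if_False) (simp add: add_divide_distrib)
    qed
    then show "diameter {real k / real N .. real (Suc k) / real N} < \<delta>" using N by simp
  qed (use N in auto)
  then show ?thesis by (rule that)
qed


text \<open>The choice is harmless: by \<open>total_unique\<close> the sum is the same for every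
  admissible grid.\<close>

definition glued :: "(real \<Rightarrow> 'a) \<Rightarrow> 'h" where
  "glued p = total (SOME N. grid_ok N p) p"

lemma glued_eq: "path p \<Longrightarrow> grid_ok N p \<Longrightarrow> glued p = total N p"
  unfolding glued_def by (rule total_unique) (auto intro: someI)

lemma glued_small:
  assumes "path p" "path_image p \<subseteq> U" "U \<in> \<U>"
  shows "glued p = f p"
proof -
  have "grid_ok 1 p" using assms by (auto simp: grid_ok_def path_image_def)
  moreover have "p \<circ> linepath 0 1 = p" by (auto simp: linepath_def)
  ultimately show ?thesis
    using glued_eq[OF assms(1), of 1] by (simp add: total_def edge_def)
qed

lemma piece_path:
  assumes p: "path p" and k: "k < N" and U: "p ` {real k / real N .. real (Suc k) / real N} \<subseteq> U"
  shows "path (p \<circ> linepath (real k / real N) (real (Suc k) / real N)) \<and>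
    path_image (p \<circ> linepath (real k / real N) (real (Suc k) / real N)) \<subseteq> U"
proof -
  have "real k / real N \<le> real (Suc k) / real N" by (simp add: divide_right_mono)
  then have "closed_segment (real k / real N) (real (Suc k) / real N) = {real k / real N .. real (Suc k) / real N}"
    by (rule closed_segment_eq_real_ivl1)
  moreover have "continuous_on {real k / real N .. real (Suc k) / real N} p"
    using p grid_interval[OF k] unfolding path_def by (rule continuous_on_subset)
  ultimately show ?thesis using U
    by (auto intro!: path_continuous_image simp: path_image_compose simp del: of_nat_Suc)
qed

text \<open>With \<open>N\<close> pieces on either half, the grid of the join with
  \<open>N + N\<close> pieces reproduces both grids exactly, up to the substitution of
  \<open>2 * x - c\<close> for \<open>x\<close>, where \<open>c\<close> is 0 on the left half and 1
  on the right one.\<close>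

lemma total_join:
  assumes p: "grid_ok N p" "path p" and q: "grid_ok N q" "path q" and pq: "pathfinish p = pathstart q"
  shows "grid_ok (N + N) (p +++ q) \<and> total (N + N) (p +++ q) = total N p + total N q"
proof -
  let ?r = "p +++ q"
  let ?I = "\<lambda>M k. {real k / real M .. real (Suc k) / real M}"
  have N: "N > 0" using p by (simp add: grid_ok_def)
  have left: "?r x = p (2 * x)" if "x \<le> 1/2" for x using that by (simp add: joinpaths_def)
  have right: "?r x = q (2 * x - 1)" if "x \<ge> 1/2" for x
    using that pq by (cases "x * 2 = 1") (auto simp: joinpaths_def pathfinish_def pathstart_def mult.commute)
  have seg: "linepath (real k / real M) (real (Suc k) / real M) x \<in> ?I M k" if "x \<in> {0..1}" for x M k
  proof -
    have "real k / real M \<le> real (Suc k) / real M" by (simp add: divide_right_mono)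
    then have "closed_segment (real k / real M) (real (Suc k) / real M) = ?I M k"
      by (rule closed_segment_eq_real_ivl1)
    with that show ?thesis by (metis linepath_in_path path_image_linepath)
  qed
  have r: "path ?r" using p q pq by simp
  have piece: "(\<exists>U\<in>\<U>. ?r ` ?I (N+N) k \<subseteq> U) \<and> edge ?r (N+N) k = edge s N j"
    if s: "path s" "grid_ok N s" and j: "j < N" "k < N + N" and eq: "\<And>x. x \<in> ?I (N+N) k \<Longrightarrow> ?r x = s (2 * x - c)"
      and k: "2 * (real k / real (N+N)) - c = real j / real N" for s j k c
  proof -
    have k2: "2 * (real (Suc k) / real (N+N)) - c = real (Suc j) / real N"
      using k N by (simp add: field_simps)
    have img: "?r ` ?I (N+N) k \<subseteq> s ` ?I N j"
    proof
      fix y assume "y \<in> ?r ` ?I (N+N) k"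
      then obtain x where x: "x \<in> ?I (N+N) k" "y = ?r x" by blast
      have "2 * x - c \<in> ?I N j"
        unfolding k[symmetric] k2[symmetric] using x(1) by (simp del: of_nat_Suc of_nat_add)
      then show "y \<in> s ` ?I N j" using eq[OF x(1)] x(2) by auto
    qed
    obtain U where U: "U \<in> \<U>" "s ` ?I N j \<subseteq> U"
      using s(2) j unfolding grid_ok_def by blast
    have lin: "2 * linepath a b t - c = (1 - t) * (2 * a - c) + t * (2 * b - c)" for a b t :: real
      by (simp add: linepath_def algebra_simps)
    have pth: "path (?r \<circ> linepath (real k / real (N+N)) (real (Suc k) / real (N+N)))"
      using piece_path[OF r j(2) subset_UNIV] by blast
    have "edge ?r (N+N) k = edge s N j" unfolding edge_def
    proof (rule path_functor_homotopic[OF is_functor[OF U(1)] homotopic_paths_eq])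
      show "path_image (?r \<circ> linepath (real k / real (N+N)) (real (Suc k) / real (N+N))) \<subseteq> U"
        using seg[of _ k "N+N"] img U unfolding path_image_def by fastforce
      fix t :: real assume t: "t \<in> {0..1}"
      have "2 * linepath (real k / real (N+N)) (real (Suc k) / real (N+N)) t - c
        = (1 - t) * (2 * (real k / real (N+N)) - c) + t * (2 * (real (Suc k) / real (N+N)) - c)"
        by (rule lin)
      also have "\<dots> = linepath (real j / real N) (real (Suc j) / real N) t"
        unfolding k k2 by (simp add: linepath_def)
      finally show "(?r \<circ> linepath (real k / real (N+N)) (real (Suc k) / real (N+N))) t =
          (s \<circ> linepath (real j / real N) (real (Suc j) / real N)) t"
        using eq[OF seg[OF t]] by (simp del: of_nat_Suc of_nat_add)
    qed (rule pth)
    then show ?thesis using img U by blast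
  qed
  have L: "(\<exists>U\<in>\<U>. ?r ` ?I (N+N) k \<subseteq> U) \<and> edge ?r (N+N) k = edge p N k" if "k < N" for k
  proof (rule piece[where c=0])
    fix x assume "x \<in> ?I (N+N) k"
    then have "x \<le> real (Suc k) / real (N+N)" by simp
    also have "\<dots> \<le> 1/2" using that N by (simp add: field_simps)
    finally show "?r x = p (2 * x - 0)" by (simp add: left)
  qed (use p that in \<open>auto simp: field_simps\<close>)
  have R: "(\<exists>U\<in>\<U>. ?r ` ?I (N+N) (N+k) \<subseteq> U) \<and> edge ?r (N+N) (N+k) = edge q N k" if "k < N" for k
  proof (rule piece[where c=1])
    fix x assume "x \<in> ?I (N+N) (N+k)"
    then have "real (N+k) / real (N+N) \<le> x" by simp
    moreover have "1/2 \<le> real (N+k) / real (N+N)" using that N by (simp add: field_simps)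
    ultimately have "1/2 \<le> x" by (rule order_trans[rotated])
    then show "?r x = q (2 * x - 1)" by (rule right)
  qed (use q that N in \<open>auto simp: field_simps\<close>)
  have "grid_ok (N+N) ?r" unfolding grid_ok_def
  proof (intro conjI allI impI)
    fix k assume "k < N + N"
    then show "\<exists>U\<in>\<U>. ?r ` ?I (N+N) k \<subseteq> U"
      using L[of k] R[of "k - N"] by (cases "k < N") auto
  qed (use N in simp)
  moreover have "total (N+N) ?r = total N p + total N q"
  proof -
    have e: "[0..<N+N] = [0..<N] @ map (\<lambda>k. k + N) [0..<N]"
      unfolding map_add_upt by (rule upt_add_eq_append) simp
    have "map (edge ?r (N+N)) [0..<N] = map (edge p N) [0..<N]"
      using L by simp
    moreover have "map (edge ?r (N+N)) (map (\<lambda>k. k + N) [0..<N]) = map (edge q N) [0..<N]"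
      using R by (simp add: add.commute)
    ultimately show ?thesis
      unfolding total_def e map_append sum_list_append by (simp only:)
  qed
  ultimately show ?thesis ..
qed

lemma grid_ok_refine:
  assumes "grid_ok N p" "0 < M"
  shows "grid_ok (N * M) p"
  unfolding grid_ok_def
proof (intro conjI allI impI)
  show "0 < N * M" using assms by (simp add: grid_ok_def)
  fix k assume k: "k < N * M"
  have N: "N > 0" using assms by (simp add: grid_ok_def)
  define j where "j = k div M"
  have j: "j < N" using k assms(2) by (simp add: j_def less_mult_imp_div_less)
  have "real (j * M) \<le> real k" "real (Suc k) \<le> real (Suc j * M)"
    unfolding j_def of_nat_le_iff
    using assms(2) by (auto simp: Suc_le_eq dividend_less_div_times intro: div_times_less_eq_dividend)
  then have "real j / real N \<le> real k / real (N * M)" "real (Suc k) / real (N * M) \<le> real (Suc j) / real N"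
    using N assms(2) by (simp_all add: divide_simps del: of_nat_Suc) (simp_all add: algebra_simps)
  then have "{real k / real (N * M)..real (Suc k) / real (N * M)} \<subseteq> {real j / real N..real (Suc j) / real N}"
    by (meson atLeastatMost_subset_iff)
  then show "\<exists>U\<in>\<U>. p ` {real k / real (N * M)..real (Suc k) / real (N * M)} \<subseteq> U"
    using assms(1) j unfolding grid_ok_def by (meson image_mono subset_trans)
qed

lemma glued_join:
  assumes "path p" "path q" "path_image p \<subseteq> \<Union>\<U>" "path_image q \<subseteq> \<Union>\<U>" "pathfinish p = pathstart q"
  shows "glued (p +++ q) = glued p + glued q"
proof -
  obtain M N where MN: "grid_ok M p" "grid_ok N q" using assms ex_grid by metis
  then have "grid_ok (M * N) p" "grid_ok (M * N) q"
    using grid_ok_refine[OF MN(1), of N] grid_ok_refine[OF MN(2), of M] by (auto simp: grid_ok_def mult.commute)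
  with total_join[of "M * N" p q] show ?thesis
    using assms by (simp add: glued_eq[of _ "M * N"] glued_eq[of _ "M * N + M * N"])
qed

lemma f_cong:
  assumes "U \<in> \<U>" "path p" "path_image p \<subseteq> U" "\<And>t. t \<in> {0..1} \<Longrightarrow> p t = q t"
  shows "f p = f q"
  by (rule path_functor_homotopic[OF is_functor[OF assms(1)] homotopic_paths_eq]) (use assms in auto)

lemma linepath_in_Icc:
  assumes "(a::real) \<le> b" "t \<in> {0..1}"
  shows "linepath a b t \<in> {a..b}"
  using linepath_in_path[OF assms(2), of a b] assms(1) by (simp add: closed_segment_eq_real_ivl1)

lemma total_cong:
  assumes p: "path p" "grid_ok N p" and eq: "\<And>t. t \<in> {0..1} \<Longrightarrow> p t = q t"
  shows "grid_ok N q \<and> total N q = total N p"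
proof
  have im: "q ` {real k / real N .. real (Suc k) / real N} = p ` {real k / real N .. real (Suc k) / real N}" if "k < N" for k
    using subsetD[OF grid_interval[OF that]] eq by (intro image_cong) metis+
  show "grid_ok N q" using p im unfolding grid_ok_def by simp
  have "edge q N k = edge p N k" if k: "k < N" for k
  proof -
    obtain U where U: "U \<in> \<U>" "p ` {real k / real N .. real (Suc k) / real N} \<subseteq> U"
      using p k unfolding grid_ok_def by blast
    have "linepath (real k / real N) (real (Suc k) / real N) t \<in> {0..1}" if "t \<in> {0..1}" for t
    proof -
      have "real k / real N \<le> real (Suc k) / real N" by (simp add: divide_right_mono)
      from linepath_in_Icc[OF this that] show ?thesis using grid_interval[OF k] by blast
    qed
    then show ?thesis
      unfolding edge_def using piece_path[OF p(1) k U(2)] eq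
      by (intro f_cong[OF U(1), symmetric]) auto
  qed
  then show "total N q = total N p"
    unfolding total_def by (intro arg_cong[where f=sum_list]) (simp add: map_eq_conv)
qed

text \<open>The unit square of the homotopy is cut into cells, each mapped into one member of the
  cover. Every cell commutes, so the sums along neighbouring rows differ only by the values on the
  two lateral sides, and those sides are constant because the homotopy fixes end points.\<close>

lemma glued_homotopic:
  assumes "homotopic_paths (\<Union>\<U>) p q"
  shows "glued p = glued q"
proof -
  obtain h where h: "continuous_on ({0..1} \<times> {0..1}) h" "h \<in> ({0..1} \<times> {0..1}) \<rightarrow> \<Union>\<U>"
    and h01: "\<And>x. x \<in> {0..1} \<Longrightarrow> h (0,x) = p x" "\<And>x. x \<in> {0..1} \<Longrightarrow> h (1,x) = q x"
    and ends: "\<And>t. t \<in> {0..1::real} \<Longrightarrow> h (t,0) = p 0 \<and> h (t,1) = p 1"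
    using assms unfolding homotopic_paths by (auto simp: pathstart_def pathfinish_def)
  have pq: "path p" "path q"
    using assms homotopic_paths_imp_path by blast+
  obtain \<delta> where \<delta>: "\<delta> > 0" and Leb: "\<And>T. T \<subseteq> {0..1} \<times> {0..1} \<Longrightarrow> T \<noteq> {} \<Longrightarrow> diameter T < \<delta> \<Longrightarrow> bounded T
      \<Longrightarrow> \<exists>U\<in>\<U>. h ` T \<subseteq> U"
    using lebesgue_grid[OF compact_Times[OF compact_Icc compact_Icc] h(1)] h(2) by blast
  \<comment> \<open>A cell has sides \<open>1 / N\<close>, hence diameter at most
    \<open>2 / N\<close>.\<close>
  obtain N :: nat where N: "N > 0" "2 / real N < \<delta>"
  proof -
    obtain n where "1 / real (Suc n) < \<delta> / 2" using \<delta> nat_approx_posE[of "\<delta>/2"] by auto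
    then show ?thesis using that[of "Suc n"] by (simp add: field_simps)
  qed
  define I where "I k = {real k / real N .. real (Suc k) / real N}" for k
  have I01: "I k \<subseteq> {0..1}" if "k < N" for k unfolding I_def by (rule grid_interval[OF that])
  have ne: "real k / real N \<le> real (Suc k) / real N" for k by (simp add: divide_right_mono)
  then have ends_I: "real k / real N \<in> I k" "real (Suc k) / real N \<in> I k" for k
    unfolding I_def by (simp_all del: of_nat_Suc)
  have cell: "\<exists>U\<in>\<U>. h ` (I j \<times> I k) \<subseteq> U" if "j < N" "k < N" for j k
  proof (rule Leb)
    show "I j \<times> I k \<subseteq> {0..1} \<times> {0..1}" using I01 that by blast
    show "I j \<times> I k \<noteq> {}" using ends_I by blast
    show "bounded (I j \<times> I k)" by (auto simp: I_def bounded_Times)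
    have w: "dist x y \<le> 1 / real N" if "x \<in> I k" "y \<in> I k" for x y k
      using that N unfolding I_def dist_real_def by (auto simp: add_divide_distrib)
    have "diameter (I j \<times> I k) \<le> 2 / real N"
    proof (rule diameter_le)
      show "I j \<times> I k \<noteq> {} \<or> 0 \<le> 2 / real N" by simp
      fix x y assume xy: "x \<in> I j \<times> I k" "y \<in> I j \<times> I k"
      have "dist x y \<le> dist (fst x) (fst y) + dist (snd x) (snd y)"
        unfolding dist_prod_def by (rule sqrt_sum_squares_le_sum) auto
      also have "\<dots> \<le> 1 / real N + 1 / real N" using xy by (intro add_mono w) auto
      finally show "norm (x - y) \<le> 2 / real N" by (simp add: dist_norm)
    qed
    then show "diameter (I j \<times> I k) < \<delta>" using N by simp
  qed
  \<comment> \<open>\<open>E\<close> runs along the paths, \<open>V\<close> along the homotopy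
    parameter.\<close>
  define E where "E j k = f (h \<circ> linepath (real j / real N, real k / real N) (real j / real N, real (Suc k) / real N))" for j k
  define V where "V j k = f (h \<circ> linepath (real j / real N, real k / real N) (real (Suc j) / real N, real k / real N))" for j k
  \<comment> \<open>Both routes around the cell equal the value on its diagonal.\<close>
  have square: "E j k + V j (Suc k) = V j k + E (Suc j) k" if jk: "j < N" "k < N" for j k
  proof -
    obtain U where U: "U \<in> \<U>" "h ` (I j \<times> I k) \<subseteq> U" using cell[OF jk] by blast
    have "convex (I j \<times> I k)" unfolding I_def by (intro convex_Times convex_real_interval)
    moreover have "continuous_on (I j \<times> I k) h"
      using h(1) I01 jk by (meson Sigma_mono continuous_on_subset)
    ultimately have tri: "f (h \<circ> linepath a b) + f (h \<circ> linepath b c) = f (h \<circ> linepath a c)"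
      if "a \<in> I j \<times> I k" "b \<in> I j \<times> I k" "c \<in> I j \<times> I k" for a b c
      using triangle[OF _ _ U(2,1)] that by blast
    show ?thesis unfolding E_def V_def
      by (subst tri, use ends_I in blast, use ends_I in blast, use ends_I in blast,
          subst tri, use ends_I in blast, use ends_I in blast, use ends_I in blast) simp
  qed
  have V0: "V j k = 0" if "j < N" "k = 0 \<or> k = N" for j k
  proof -
    define c where "c = real k / real N"
    have c: "c = 0 \<or> c = 1" using that N by (auto simp: c_def)
    then have hc: "h (t, c) = p c" if "t \<in> {0..1}" for t using ends[OF that] by auto
    have "(0, c) \<in> {0..1::real} \<times> {0..1::real}" using c by auto
    then have "h (0, c) \<in> \<Union>\<U>" using h(2) by blast
    then obtain U where U: "U \<in> \<U>" "p c \<in> U" using hc[of 0] by auto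
    have const: "f (linepath (p c) (p c)) = 0"
      by (rule path_functor_const[OF is_functor[OF U(1)] U(2)])
    have "f (linepath (p c) (p c)) = f (h \<circ> linepath (real j / real N, c) (real (Suc j) / real N, c))"
    proof (rule f_cong[OF U(1)])
      fix t :: real assume t: "t \<in> {0..1}"
      have "linepath (real j / real N, c) (real (Suc j) / real N, c) t = (linepath (real j / real N) (real (Suc j) / real N) t, c)"
        by (simp add: linepath_def algebra_simps del: of_nat_Suc)
      moreover have "linepath (real j / real N) (real (Suc j) / real N) t \<in> {0..1}"
        using linepath_in_Icc[OF ne[of j] t] I01[OF that(1)] unfolding I_def by blast
      ultimately show "linepath (p c) (p c) t = (h \<circ> linepath (real j / real N, c) (real (Suc j) / real N, c)) t"
        using hc by simp
    qed (use U in auto)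
    then show ?thesis unfolding V_def c_def[symmetric] using const by simp
  qed
  have tele: "m \<le> N \<Longrightarrow> sum_list (map (E j) [0..<m]) + V j m = sum_list (map (E (Suc j)) [0..<m])" if "j < N" for j m
  proof (induction m)
    case 0 then show ?case using V0[OF that] by simp
  next
    case (Suc m)
    have "sum_list (map (E j) [0..<Suc m]) + V j (Suc m) = sum_list (map (E j) [0..<m]) + (V j m + E (Suc j) m)"
      using square[OF that, of m] Suc.prems by (simp add: add.assoc)
    also have "\<dots> = sum_list (map (E (Suc j)) [0..<m]) + E (Suc j) m"
      using Suc by (simp add: add.assoc[symmetric])
    finally show ?case by simp
  qed
  have rows: "j \<le> N \<Longrightarrow> sum_list (map (E 0) [0..<N]) = sum_list (map (E j) [0..<N])" for j
  proof (induction j)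
    case (Suc j)
    then show ?case using tele[of j N] V0[of j N] by simp
  qed simp
  have row: "glued (\<lambda>t. h (real j / real N, t)) = sum_list (map (E j) [0..<N])" if "j \<le> N" for j
  proof -
    have "real j / real N \<le> real N / real N" by (rule divide_right_mono) (use that in simp_all)
    then have j01: "real j / real N \<in> {0..1}" using N(1) by simp
    have pth: "path (\<lambda>t. h (real j / real N, t))" unfolding path_def
      by (rule continuous_on_compose2[OF h(1)]) (use j01 in \<open>auto intro!: continuous_intros\<close>)
    have ok: "grid_ok N (\<lambda>t. h (real j / real N, t))" unfolding grid_ok_def
    proof (intro conjI allI impI)
      fix k assume k: "k < N"
      \<comment> \<open>The last row \<open>j = N\<close> has no cells beyond it and borrows those
        of index \<open>N - 1\<close>.\<close>
      define i where "i = (if j < N then j else j - 1)"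
      have i: "i < N" "real j / real N \<in> I i"
        using that N ends_I[of j] ends_I(2)[of "j - 1"] by (auto simp: i_def simp del: of_nat_Suc)
      obtain U where U: "U \<in> \<U>" "h ` (I i \<times> I k) \<subseteq> U" using cell[OF i(1) k] by blast
      have "(\<lambda>t. h (real j / real N, t)) ` I k \<subseteq> h ` (I i \<times> I k)" using i(2) by blast
      then have "(\<lambda>t. h (real j / real N, t)) ` I k \<subseteq> U" using U(2) by (rule subset_trans)
      then show "\<exists>U\<in>\<U>. (\<lambda>t. h (real j / real N, t)) ` {real k / real N..real (Suc k) / real N} \<subseteq> U"
        unfolding I_def[symmetric] using U(1) by (rule bexI)
    qed (use N in auto)
    have "(\<lambda>t. h (c, t)) \<circ> linepath a b = h \<circ> linepath (c, a) (c, b)" for a b c :: real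
      by (rule ext) (simp add: linepath_def algebra_simps)
    then show ?thesis
      unfolding glued_eq[OF pth ok] total_def edge_def E_def by (simp del: of_nat_Suc)
  qed
  have glue_cong: "glued r = glued s" if rs: "path r" "path_image r \<subseteq> \<Union>\<U>" "\<And>t. t \<in> {0..1} \<Longrightarrow> r t = s t" for r s
  proof -
    obtain M where M: "grid_ok M r" by (rule ex_grid[OF rs(1,2)])
    have "path s" using rs(1,3) unfolding path_def by (metis continuous_on_cong)
    then show ?thesis using total_cong[OF rs(1) M rs(3)] glued_eq[OF rs(1) M] glued_eq[OF \<open>path s\<close>] by metis
  qed
  have im: "path_image p \<subseteq> \<Union>\<U>" "path_image q \<subseteq> \<Union>\<U>" using homotopic_paths_imp_subset[OF assms] by auto
  have "glued p = glued (\<lambda>t. h (real 0 / real N, t))"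
    by (rule glue_cong) (use pq im h01 in auto)
  also have "\<dots> = glued (\<lambda>t. h (real N / real N, t))"
    using row[of 0] row[of N] rows[of N] by simp
  also have "\<dots> = glued q"
    by (rule glue_cong[symmetric]) (use pq im h01 N in auto)
  finally show ?thesis .
qed

lemma path_functor_glued: "path_functor (\<Union>\<U>) glued"
  unfolding path_functor_def using glued_homotopic glued_join by blast

end

text \<open>On \<open>E\<close> the extension is the coboundary of the potential \<open>s\<close>,
  which is a functor for any \<open>s\<close>; the hypothesis makes it agree with \<open>f\<close>
  on the overlap, so the two glue over the cover \<open>{A, E}\<close>. The order of the terms
  matters, since \<open>group_add\<close> is not commutative.\<close>

lemma path_functor_extend:
  fixes A E :: "'a::real_normed_vector set" and f :: "(real \<Rightarrow> 'a) \<Rightarrow> 'h::group_add"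
  assumes "open A" "open E" "path_functor A f"
    and s: "\<And>p. path p \<Longrightarrow> path_image p \<subseteq> A \<inter> E \<Longrightarrow> f p = - s (pathstart p) + s (pathfinish p)"
  obtains F where "path_functor (A \<union> E) F"
    "\<And>p. path p \<Longrightarrow> path_image p \<subseteq> A \<Longrightarrow> F p = f p"
    "\<And>p. path p \<Longrightarrow> path_image p \<subseteq> E \<Longrightarrow> F p = - s (pathstart p) + s (pathfinish p)"
proof -
  define f0 where "f0 p = (if path p \<and> path_image p \<subseteq> E then - s (pathstart p) + s (pathfinish p) else f p)" for p
  have A: "f0 p = f p" if "path p" "path_image p \<subseteq> A" for p
    using s[of p] that by (auto simp: f0_def)
  have fA: "path_functor A f0"
    unfolding path_functor_def
  proof (intro conjI allI impI)
    fix p q assume "homotopic_paths A p q"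
    then show "f0 p = f0 q"
      using A homotopic_paths_imp_path homotopic_paths_imp_subset path_functor_homotopic[OF assms(3)] by metis
  next
    fix p q :: "real \<Rightarrow> 'a" assume "path p \<and> path q \<and> path_image p \<subseteq> A \<and> path_image q \<subseteq> A \<and> pathfinish p = pathstart q"
    then show "f0 (p +++ q) = f0 p + f0 q"
      by (subst (1 2 3) A) (auto simp: path_image_join path_functor_join[OF assms(3)])
  qed
  have fE: "path_functor E f0"
    unfolding path_functor_def
  proof (intro conjI allI impI)
    fix p q assume "homotopic_paths E p q"
    then show "f0 p = f0 q"
      using homotopic_paths_imp_path[of E p q] homotopic_paths_imp_subset[of E p q]
        homotopic_paths_imp_pathstart[of E p q] homotopic_paths_imp_pathfinish[of E p q] by (simp add: f0_def)
  next
    fix p q :: "real \<Rightarrow> 'a" assume "path p \<and> path q \<and> path_image p \<subseteq> E \<and> path_image q \<subseteq> E \<and> pathfinish p = pathstart q"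
    then show "f0 (p +++ q) = f0 p + f0 q"
      by (auto simp: f0_def path_image_join add.assoc[symmetric])
  qed
  interpret local_functor "{A, E}" f0
    by unfold_locales (use assms fA fE in auto)
  show ?thesis
  proof (rule that)
    show "path_functor (A \<union> E) glued" using path_functor_glued by simp
    show "glued p = f p" if "path p" "path_image p \<subseteq> A" for p
      using glued_small[OF that] A[OF that] by simp
    show "glued p = - s (pathstart p) + s (pathfinish p)" if "path p" "path_image p \<subseteq> E" for p
      using glued_small[OF that] that by (simp add: f0_def)
  qed
qed

lemma path_cover_induct:
  fixes A E :: "'a::real_normed_vector set"
  assumes "open A" "open E" and p: "path p" "path_image p \<subseteq> A \<union> E"
    and base: "\<And>q. path q \<Longrightarrow> path_image q \<subseteq> A \<or> path_image q \<subseteq> E \<Longrightarrow> P q"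
    and join: "\<And>q r. P q \<Longrightarrow> P r \<Longrightarrow> path q \<Longrightarrow> path r \<Longrightarrow> path_image q \<subseteq> A \<union> E \<Longrightarrow> path_image r \<subseteq> A \<union> E
        \<Longrightarrow> pathfinish q = pathstart r \<Longrightarrow> P (q +++ r)"
    and hom: "\<And>q r. P q \<Longrightarrow> homotopic_paths (A \<union> E) q r \<Longrightarrow> P r"
  shows "P p"
proof -
  \<comment> \<open>The constant functor 0 only serves to provide a grid subordinate to
    \<open>{A, E}\<close>.\<close>
  interpret local_functor "{A, E}" "\<lambda>_. 0 :: int"
    by unfold_locales (use assms in \<open>auto simp: path_functor_def\<close>)
  obtain N where N: "grid_ok N p" using ex_grid[OF p(1)] p(2) by auto
  have small: "P (subpath (real k / real N) (real (Suc k) / real N) p)" if "k < N" for k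
  proof (rule base)
    have i: "real k / real N \<in> {0..1}" "real (Suc k) / real N \<in> {0..1}"
      using that by (simp_all add: divide_le_eq_1)
    show "path (subpath (real k / real N) (real (Suc k) / real N) p)"
      using p(1) i by simp
    have "real k / real N \<le> real (Suc k) / real N" by (simp add: divide_right_mono)
    then have "path_image (subpath (real k / real N) (real (Suc k) / real N) p) = p ` {real k / real N..real (Suc k) / real N}"
      by (simp add: path_image_subpath del: of_nat_Suc)
    then show "path_image (subpath (real k / real N) (real (Suc k) / real N) p) \<subseteq> A \<or>
        path_image (subpath (real k / real N) (real (Suc k) / real N) p) \<subseteq> E"
      using N that unfolding grid_ok_def by auto
  qed
  have N0: "N > 0" using N by (simp add: grid_ok_def)
  have "Suc k \<le> N \<Longrightarrow> P (subpath 0 (real (Suc k) / real N) p)" for k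
  proof (induction k)
    case 0 then show ?case using small[of 0] N0 by simp
  next
    case (Suc k)
    have i: "0 \<in> {0..1::real}" "real (Suc k) / real N \<in> {0..1}" "real (Suc (Suc k)) / real N \<in> {0..1}"
      using Suc.prems by (simp_all add: divide_le_eq_1)
    let ?s = "subpath 0 (real (Suc k) / real N) p" and ?t = "subpath (real (Suc k) / real N) (real (Suc (Suc k)) / real N) p"
    have im: "path_image ?s \<subseteq> A \<union> E" "path_image ?t \<subseteq> A \<union> E"
      using path_image_subpath_subset[OF i(1,2)] path_image_subpath_subset[OF i(2,3)] p(2) by blast+
    have "P (?s +++ ?t)"
      by (rule join) (use Suc small i p(1) im in \<open>auto simp del: of_nat_Suc\<close>)
    then show ?case
      by (rule hom) (rule homotopic_join_subpaths[OF p i])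
  qed
  from this[of "N - 1"] N0 show ?thesis by simp
qed

section \<open>Freely generated loops\<close>

declare linepath_trivial [simp del]

section \<open>The action of letters on reduced words\<close>

typedef 'a bijection = "{f :: 'a \<Rightarrow> 'a. bij f}"
  morphisms bij_fun Bij by (rule exI[of _ id]) simp

setup_lifting type_definition_bijection

instantiation bijection :: (type) group_add
begin
lift_definition zero_bijection :: "'a bijection" is id by simp
lift_definition plus_bijection :: "'a bijection \<Rightarrow> 'a bijection \<Rightarrow> 'a bijection" is "(\<circ>)"
  by (rule bij_comp)
lift_definition uminus_bijection :: "'a bijection \<Rightarrow> 'a bijection" is "inv_into UNIV" by (rule bij_imp_bij_inv)
definition minus_bijection :: "'a bijection \<Rightarrow> 'a bijection \<Rightarrow> 'a bijection" where "minus_bijection x y = x + (- y)"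
instance
proof
  fix a b c :: "'a bijection"
  show "a + b + c = a + (b + c)" by transfer (simp add: comp_assoc)
  show "0 + a = a" "a + 0 = a" by (transfer, simp)+
  show "- a + a = 0" by transfer (simp add: bij_is_inj)
  show "a + - b = a - b" by (simp add: minus_bijection_def)
qed
end

type_synonym word_perm = "(bool \<times> nat) list bijection"

text \<open>Left multiplication by a letter followed by free reduction. Words that are not reduced
  stay fixed, which makes the map a permutation of all lists.\<close>

definition push_letter :: "bool \<Rightarrow> nat \<Rightarrow> (bool \<times> nat) list \<Rightarrow> (bool \<times> nat) list" where
  "push_letter b i w = (if reduced_word w
     then (case w of (c, j) # v \<Rightarrow> if i = j \<and> b \<noteq> c then v else (b, i) # w | [] \<Rightarrow> [(b, i)]) else w)"

lemma reduced_word_tl: "reduced_word (l # w) \<Longrightarrow> reduced_word w"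
  by (cases l; cases w) auto

lemma reduced_push: "reduced_word w \<Longrightarrow> reduced_word (push_letter b i w)"
  by (cases w) (auto simp: push_letter_def intro: reduced_word_tl)

lemma push_push: "push_letter (\<not> b) i (push_letter b i w) = w"
proof (cases "reduced_word w")
  case True
  note r = True
  show ?thesis
  proof (cases w)
    case Nil then show ?thesis by (simp add: push_letter_def)
  next
    case (Cons l v)
    obtain c j where l: "l = (c, j)" by (cases l)
    show ?thesis
    proof (cases "i = j \<and> b \<noteq> c")
      case True
      then have "push_letter b i w = v" using r Cons l by (simp add: push_letter_def)
      moreover have "reduced_word v" using r Cons reduced_word_tl by blast
      moreover have "push_letter (\<not> b) i v = w" 
        using r Cons l True \<open>reduced_word v\<close> by (cases v) (auto simp: push_letter_def)
      ultimately show ?thesis by simp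
    next
      case False
      then have "push_letter b i w = (b, i) # w" using r Cons l by (auto simp: push_letter_def)
      moreover have "reduced_word ((b, i) # w)" using reduced_push[OF r, of b i] calculation by simp
      ultimately show ?thesis by (simp add: push_letter_def)
    qed
  qed
qed (simp add: push_letter_def)

lemma bij_push: "bij (push_letter b i)"
proof (rule bijI')
  show "(push_letter b i x = push_letter b i y) = (x = y)" for x y by (metis push_push)
  show "\<exists>x. y = push_letter b i x" for y by (metis push_push)
qed

lift_definition letter_perm :: "nat \<Rightarrow> word_perm" is "push_letter True" by (rule bij_push)

definition signed :: "bool \<Rightarrow> 'h::group_add \<Rightarrow> 'h" where "signed b h = (if b then h else - h)"

lemma bij_fun_signed: "bij_fun (signed b (letter_perm i)) = push_letter b i"
proof (cases b)
  case True then show ?thesis by (simp add: signed_def letter_perm.rep_eq)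
next
  case False
  have "inv_into UNIV (push_letter True i) = push_letter False i"
    using push_push[of True i] push_push[of False i] by (intro inv_equality) auto
  then show ?thesis using False by (simp add: signed_def letter_perm.rep_eq uminus_bijection.rep_eq)
qed

text \<open>The letters of a reduced word are pushed one after the other, beginning with the last,
  and never cancel; so the empty word is rebuilt into \<open>w\<close>. Hence a nonempty reduced
  word never acts as the identity: this is van der Waerden's argument for normal forms.\<close>

lemma word_perm_Nil:
  "reduced_word w \<Longrightarrow> bij_fun (sum_list (map (\<lambda>(b, i). signed b (letter_perm i)) w)) [] = w"
proof (induction w)
  case Nil then show ?case by (simp add: zero_bijection.rep_eq)
next
  case (Cons l w)
  obtain b i where l: "l = (b, i)" by (cases l)
  have w: "reduced_word w" using Cons.prems reduced_word_tl by blast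
  have "push_letter b i w = l # w"
    using Cons.prems l w by (cases w) (auto simp: push_letter_def)
  then show ?case using Cons.IH[OF w] l by (simp add: plus_bijection.rep_eq bij_fun_signed)
qed

section \<open>Chains of paths and their cancellation\<close>

fun chain :: "'a::real_normed_vector set \<Rightarrow> 'a \<Rightarrow> (real \<Rightarrow> 'a) list \<Rightarrow> 'a \<Rightarrow> bool" where
  "chain M a [] b \<longleftrightarrow> a = b \<and> a \<in> M"
| "chain M a (p # ps) b \<longleftrightarrow> path p \<and> path_image p \<subseteq> M \<and> pathstart p = a \<and> chain M (pathfinish p) ps b"

fun cat :: "'a::real_normed_vector \<Rightarrow> (real \<Rightarrow> 'a) list \<Rightarrow> (real \<Rightarrow> 'a)" where
  "cat a [] = linepath a a"
| "cat a (p # ps) = p +++ cat (pathfinish p) ps"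

lemma cat_path: "chain M a ps b \<Longrightarrow>
   path (cat a ps) \<and> path_image (cat a ps) \<subseteq> M \<and> pathstart (cat a ps) = a \<and> pathfinish (cat a ps) = b"
  by (induction ps arbitrary: a) (auto simp: path_image_join)

lemma chain_append: "chain M a (ps @ qs) b \<longleftrightarrow> (\<exists>c. chain M a ps c \<and> chain M c qs b)"
proof (induction ps arbitrary: a)
  case Nil
  have "chain M a qs b \<Longrightarrow> a \<in> M" by (cases qs) (use pathstart_in_path_image in fastforce)+
  then show ?case by auto
qed auto

lemma cat_append:
  "chain M a ps c \<Longrightarrow> chain M c qs b \<Longrightarrow> homotopic_paths M (cat a ps +++ cat c qs) (cat a (ps @ qs))"
proof (induction ps arbitrary: a)
  case Nil
  then show ?case using cat_path[OF Nil(2)] by (auto intro: homotopic_paths_lid')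
next
  case (Cons p ps)
  have P: "path p" "path_image p \<subseteq> M" "pathstart p = a" "chain M (pathfinish p) ps c" using Cons.prems by auto
  note c = cat_path[OF P(4)] cat_path[OF Cons.prems(2)]
  have "homotopic_paths M (p +++ (cat (pathfinish p) ps +++ cat c qs)) ((p +++ cat (pathfinish p) ps) +++ cat c qs)"
    using P c by (intro homotopic_paths_assoc) auto
  moreover have "homotopic_paths M (p +++ (cat (pathfinish p) ps +++ cat c qs)) (p +++ cat (pathfinish p) (ps @ qs))"
    using P c by (intro homotopic_paths_join Cons.IH Cons.prems) auto
  ultimately show ?case
    using homotopic_paths_sym homotopic_paths_trans by fastforce
qed

text \<open>Writes \<open>p\<close> as the product of a list of paths up to homotopy. For lists,
  associativity and units hold on the nose, so identities between concatenations reduce to equality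
  of lists and \<open>rep_cancel\<close>.\<close>

definition rep :: "'a::real_normed_vector set \<Rightarrow> (real \<Rightarrow> 'a) \<Rightarrow> 'a \<Rightarrow> (real \<Rightarrow> 'a) list \<Rightarrow> 'a \<Rightarrow> bool" where
  "rep M p a ps b \<longleftrightarrow> chain M a ps b \<and> homotopic_paths M p (cat a ps)"

lemma rep_single: "path p \<Longrightarrow> path_image p \<subseteq> M \<Longrightarrow> pathstart p = a \<Longrightarrow> pathfinish p = b \<Longrightarrow> rep M p a [p] b"
  unfolding rep_def by (auto intro: homotopic_paths_sym[OF homotopic_paths_rid'])

lemma rep_nil: "a \<in> M \<Longrightarrow> rep M (linepath a a) a [] a"
  unfolding rep_def by auto

lemma rep_ends: "rep M p a ps b \<Longrightarrow> path p \<and> path_image p \<subseteq> M \<and> pathstart p = a \<and> pathfinish p = b"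
  unfolding rep_def
  using cat_path homotopic_paths_imp_path homotopic_paths_imp_subset homotopic_paths_imp_pathstart
    homotopic_paths_imp_pathfinish by metis

lemma rep_join:
  assumes "rep M p a ps c" "rep M q c qs b"
  shows "rep M (p +++ q) a (ps @ qs) b"
proof -
  have "homotopic_paths M (p +++ q) (cat a ps +++ cat c qs)"
    using assms rep_ends[OF assms(1)] rep_ends[OF assms(2)] unfolding rep_def
    by (intro homotopic_paths_join) auto
  then show ?thesis
    using assms cat_append unfolding rep_def chain_append by (metis homotopic_paths_trans)
qed

lemma rep_cancel:
  assumes "rep M p a (ps @ x # y # qs) b" and y: "y = reversepath x \<or> x = reversepath y"
  shows "rep M p a (ps @ qs) b"
proof -
  have y: "y = reversepath x" using y by auto
  obtain c where c: "chain M a ps c" "chain M c (x # y # qs) b"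
    using assms unfolding rep_def chain_append by blast
  then have x: "path x" "path_image x \<subseteq> M" "pathstart x = c" and q: "chain M c qs b"
    using y by auto
  note pq = cat_path[OF c(1)] cat_path[OF q]
  have "homotopic_paths M (x +++ (y +++ cat c qs)) ((x +++ y) +++ cat c qs)"
    using x y pq by (intro homotopic_paths_assoc) auto
  also have "homotopic_paths M ((x +++ y) +++ cat c qs) (linepath c c +++ cat c qs)"
    using x y pq homotopic_paths_rinv[of x M] by (intro homotopic_paths_join) auto
  also have "homotopic_paths M (linepath c c +++ cat c qs) (cat c qs)"
    using pq by (intro homotopic_paths_lid') auto
  finally have xy: "homotopic_paths M (cat c (x # y # qs)) (cat c qs)"
    using x y by simp
  have "homotopic_paths M p (cat a (ps @ x # y # qs))" using assms unfolding rep_def by blast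
  also have "homotopic_paths M \<dots> (cat a ps +++ cat c (x # y # qs))"
    by (rule homotopic_paths_sym[OF cat_append[OF c]])
  also have "homotopic_paths M \<dots> (cat a ps +++ cat c qs)"
    using pq xy cat_path[OF c(2)] by (intro homotopic_paths_join) auto
  also have "homotopic_paths M \<dots> (cat a (ps @ qs))"
    by (rule cat_append[OF c(1) q])
  finally show ?thesis using c q unfolding rep_def chain_append by blast
qed

lemma rep_eq: "rep M p a ps b \<Longrightarrow> rep M q a ps b \<Longrightarrow> homotopic_paths M p q"
  unfolding rep_def using homotopic_paths_sym homotopic_paths_trans by blast

section \<open>Subgroups and homomorphisms in terms of loops\<close>

definition loopin :: "'a::topological_space set \<Rightarrow> 'a \<Rightarrow> (real \<Rightarrow> 'a) \<Rightarrow> bool" where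
  "loopin M a p \<longleftrightarrow> path p \<and> path_image p \<subseteq> M \<and> pathstart p = a \<and> pathfinish p = a"

text \<open>Represents the subgroup generated by the classes of \<open>L\<close>; closing under
  homotopy keeps quotients out of the argument.\<close>

inductive gen :: "'a::real_normed_vector set \<Rightarrow> 'a \<Rightarrow> (real \<Rightarrow> 'a) set \<Rightarrow> (real \<Rightarrow> 'a) \<Rightarrow> bool"
  for M a L where
  gen_base: "p \<in> L \<Longrightarrow> loopin M a p \<Longrightarrow> gen M a L p"
| gen_const: "a \<in> M \<Longrightarrow> gen M a L (linepath a a)"
| gen_rev: "gen M a L p \<Longrightarrow> gen M a L (reversepath p)"
| gen_join: "gen M a L p \<Longrightarrow> gen M a L q \<Longrightarrow> gen M a L (p +++ q)"
| gen_hom: "gen M a L p \<Longrightarrow> homotopic_paths M p q \<Longrightarrow> gen M a L q"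

lemma gen_loop: "gen M a L p \<Longrightarrow> loopin M a p"
proof (induction rule: gen.induct)
  case (gen_hom p q)
  then show ?case using homotopic_paths_imp_path homotopic_paths_imp_subset homotopic_paths_imp_pathstart
    homotopic_paths_imp_pathfinish unfolding loopin_def by metis
qed (auto simp: loopin_def path_image_join)

lemma gen_mono: "gen M a L p \<Longrightarrow> M \<subseteq> N \<Longrightarrow> L \<subseteq> K \<Longrightarrow> gen N a K p"
proof (induction rule: gen.induct)
  case (gen_base p) then show ?case by (intro gen.gen_base) (auto simp: loopin_def)
next
  case (gen_hom p q) then show ?case by (meson gen.gen_hom homotopic_paths_subset)
qed (auto intro: gen.intros)

definition loop_hom :: "'a::topological_space set \<Rightarrow> 'a \<Rightarrow> ((real \<Rightarrow> 'a) \<Rightarrow> 'h::group_add) \<Rightarrow> bool" where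
  "loop_hom M a f \<longleftrightarrow>
     (\<forall>p q. loopin M a p \<and> homotopic_paths M p q \<longrightarrow> f p = f q) \<and>
     (\<forall>p q. loopin M a p \<and> loopin M a q \<longrightarrow> f (p +++ q) = f p + f q)"

lemma loopin_homotopic: "loopin M a p \<Longrightarrow> homotopic_paths M p q \<Longrightarrow> loopin M a q"
  using homotopic_paths_imp_path homotopic_paths_imp_subset homotopic_paths_imp_pathstart
    homotopic_paths_imp_pathfinish unfolding loopin_def by metis

lemma loopin_join: "loopin M a p \<Longrightarrow> loopin M a q \<Longrightarrow> loopin M a (p +++ q)"
  by (auto simp: loopin_def path_image_join)

lemma loopin_mono: "loopin M a p \<Longrightarrow> M \<subseteq> N \<Longrightarrow> loopin N a p"
  by (auto simp: loopin_def)

lemma functor_loop_hom: "path_functor M f \<Longrightarrow> loop_hom M a f"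
  unfolding path_functor_def loop_hom_def loopin_def by auto

text \<open>Every path is closed up to a loop by chosen connecting paths from \<open>a\<close>, and
  \<open>f\<close> is applied to that loop. Choosing the constant path at \<open>a\<close> itself
  makes the extension agree with \<open>f\<close> on loops.\<close>

lemma loop_hom_functor:
  fixes f :: "(real \<Rightarrow> 'a::real_normed_vector) \<Rightarrow> 'h::group_add"
  assumes "path_connected M" "a \<in> M" "loop_hom M a f"
  obtains F where "path_functor M F" "\<And>p. loopin M a p \<Longrightarrow> F p = f p"
proof -
  have "\<exists>c. path c \<and> path_image c \<subseteq> M \<and> pathstart c = a \<and> pathfinish c = P \<and> (P = a \<longrightarrow> c = linepath a a)" if "P \<in> M" for P
  proof (cases "P = a")
    case True then show ?thesis using assms(2) by (intro exI[of _ "linepath a a"]) auto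
  next
    case False then show ?thesis using assms(1,2) that unfolding path_connected_def by blast
  qed
  then obtain c where c: "\<And>P. P \<in> M \<Longrightarrow> path (c P) \<and> path_image (c P) \<subseteq> M \<and> pathstart (c P) = a \<and> pathfinish (c P) = P"
    and ca: "c a = linepath a a" using assms(2) by metis
  define F where "F p = f (c (pathstart p) +++ (p +++ reversepath (c (pathfinish p))))" for p
  have ends: "pathstart p \<in> M" "pathfinish p \<in> M" if "path p" "path_image p \<subseteq> M" for p
    using that pathstart_in_path_image pathfinish_in_path_image by blast+
  have r1: "rep M (c P) a [c P] P" "rep M (reversepath (c P)) P [reversepath (c P)] a" if "P \<in> M" for P
    using c[OF that] by (auto intro!: rep_single)
  have rp: "rep M p (pathstart p) [p] (pathfinish p)" if "path p" "path_image p \<subseteq> M" for p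
    using that by (auto intro!: rep_single)
  have R: "rep M (c (pathstart p) +++ (p +++ reversepath (c (pathfinish p)))) a
      ([c (pathstart p)] @ [p] @ [reversepath (c (pathfinish p))]) a" if "path p" "path_image p \<subseteq> M" for p
    by (rule rep_join[OF r1(1)[OF ends(1)[OF that]] rep_join[OF rp[OF that] r1(2)[OF ends(2)[OF that]]]])
  have loop: "loopin M a (c (pathstart p) +++ (p +++ reversepath (c (pathfinish p))))" if "path p" "path_image p \<subseteq> M" for p
    using rep_ends[OF R[OF that]] by (simp add: loopin_def)
  have hom: "f p = f q" if "loopin M a p" "homotopic_paths M p q" for p q
    using assms(3) that unfolding loop_hom_def by blast
  show ?thesis
  proof (rule that)
    show "path_functor M F" unfolding path_functor_def
    proof (intro conjI allI impI)
      fix p q assume h: "homotopic_paths M p q"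
      have pq: "path p" "path_image p \<subseteq> M" "pathstart p = pathstart q" "pathfinish p = pathfinish q"
        using h homotopic_paths_imp_path homotopic_paths_imp_subset homotopic_paths_imp_pathstart homotopic_paths_imp_pathfinish by blast+
      have "homotopic_paths M (c (pathstart p) +++ (p +++ reversepath (c (pathfinish p))))
          (c (pathstart q) +++ (q +++ reversepath (c (pathfinish q))))"
        using pq h c[OF ends(1)[OF pq(1,2)]] c[OF ends(2)[OF pq(1,2)]] by (auto intro!: homotopic_paths_join)
      then show "F p = F q" unfolding F_def by (rule hom[OF loop[OF pq(1,2)]])
    next
      fix p q :: "real \<Rightarrow> 'a" assume pq: "path p \<and> path q \<and> path_image p \<subseteq> M \<and> path_image q \<subseteq> M \<and> pathfinish p = pathstart q"
      have pq_eq: "pathfinish p = pathstart q" using pq by blast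
      let ?p = "c (pathstart p) +++ (p +++ reversepath (c (pathfinish p)))"
      let ?q = "c (pathstart q) +++ (q +++ reversepath (c (pathfinish q)))"
      let ?r = "c (pathstart p) +++ ((p +++ q) +++ reversepath (c (pathfinish q)))"
      have "rep M (?p +++ ?q) a ([c (pathstart p), p] @ reversepath (c (pathfinish p)) # c (pathstart q) # [q, reversepath (c (pathfinish q))]) a"
        using rep_join[OF R R, of p q] pq by simp
      then have "rep M (?p +++ ?q) a ([c (pathstart p), p] @ [q, reversepath (c (pathfinish q))]) a"
        by (rule rep_cancel) (use pq in auto)
      moreover have "rep M ?r a ([c (pathstart p)] @ (([p] @ [q]) @ [reversepath (c (pathfinish q))])) a"
        by (rule rep_join[OF r1(1)[OF ends(1)] rep_join[OF rep_join[OF rp rp[of q, folded pq_eq]] r1(2)[OF ends(2)]]])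
          (use pq in auto)
      ultimately have "homotopic_paths M (?p +++ ?q) ?r" by (auto intro: rep_eq)
      then have "f (?p +++ ?q) = f ?r" using pq loop loopin_join hom by blast
      moreover have "f (?p +++ ?q) = f ?p + f ?q"
        using assms(3) loop pq unfolding loop_hom_def by blast
      ultimately show "F (p +++ q) = F p + F q" using pq by (simp add: F_def)
    qed
    fix p assume p: "loopin M a p"
    then have e: "pathstart p = a" "pathfinish p = a" by (auto simp: loopin_def)
    have "rep M (c (pathstart p) +++ (p +++ reversepath (c (pathfinish p)))) a ([] @ [p] @ []) a"
      unfolding e ca reversepath_linepath
      by (rule rep_join[OF rep_nil rep_join[OF rep_single rep_nil]]) (use assms(2) p in \<open>auto simp: loopin_def\<close>)
    then have "homotopic_paths M p (c (pathstart p) +++ (p +++ reversepath (c (pathfinish p))))"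
      using p by (intro rep_eq[OF rep_single]) (auto simp: loopin_def)
    then show "F p = f p" unfolding F_def using hom p by metis
  qed
qed

text \<open>
  The universal property of a basis is required only for homomorphisms into the permutations of words: there
  the action of the letters on reduced words already separates the elements of a free group.
\<close>

definition freely_generated :: "'a::real_normed_vector set \<Rightarrow> 'a \<Rightarrow> bool" where
  "freely_generated M a \<longleftrightarrow> path_connected M \<and> a \<in> M \<and>
     (\<exists>(k::nat) x. (\<forall>i<k. loopin M a (x i)) \<and> (\<forall>p. loopin M a p \<longrightarrow> gen M a (x ` {..<k}) p) \<and>
        (\<forall>g :: nat \<Rightarrow> word_perm. \<exists>f. loop_hom M a f \<and> (\<forall>i<k. f (x i) = g i)))"

section \<open>Free generation under change of space\<close>

text \<open>The inclusion induces an isomorphism of fundamental groups at \<open>a\<close>: the last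
  two clauses are surjectivity and injectivity. Path connectedness is carried from \<open>A\<close>
  to \<open>B\<close> only, the direction in which the sweep moves.\<close>

definition pi1_eq :: "'a::real_normed_vector set \<Rightarrow> 'a set \<Rightarrow> 'a \<Rightarrow> bool" where
  "pi1_eq A B a \<longleftrightarrow> A \<subseteq> B \<and> a \<in> A \<and> (path_connected A \<longrightarrow> path_connected B) \<and>
     (\<forall>p. loopin B a p \<longrightarrow> (\<exists>q. loopin A a q \<and> homotopic_paths B p q)) \<and>
     (\<forall>p q. loopin A a p \<and> loopin A a q \<and> homotopic_paths B p q \<longrightarrow> homotopic_paths A p q)"

lemma pi1_eq_refl: "a \<in> A \<Longrightarrow> pi1_eq A A a"
  by (auto simp: pi1_eq_def loopin_def intro!: exI[of _ "_::real \<Rightarrow> 'a"])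

lemma pi1_eq_trans:
  assumes AB: "pi1_eq A B a" and BC: "pi1_eq B C a"
  shows "pi1_eq A C a"
  unfolding pi1_eq_def
proof (intro conjI allI impI)
  show "A \<subseteq> C" "a \<in> A" using AB BC by (auto simp: pi1_eq_def)
  show "path_connected C" if "path_connected A" using that AB BC by (auto simp: pi1_eq_def)
next
  fix p assume "loopin C a p"
  then obtain q where q: "loopin B a q" "homotopic_paths C p q" using BC by (auto simp: pi1_eq_def)
  then obtain r where r: "loopin A a r" "homotopic_paths B q r" using AB by (auto simp: pi1_eq_def)
  have "homotopic_paths C q r" using r BC by (auto simp: pi1_eq_def intro: homotopic_paths_subset)
  then show "\<exists>q. loopin A a q \<and> homotopic_paths C p q" using q r homotopic_paths_trans by blast
next
  fix p q assume h: "loopin A a p \<and> loopin A a q \<and> homotopic_paths C p q"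
  have "A \<subseteq> B" using AB by (simp add: pi1_eq_def)
  then have "loopin B a p" "loopin B a q" using h loopin_mono by blast+
  then have "homotopic_paths B p q" using h BC unfolding pi1_eq_def by blast
  then show "homotopic_paths A p q" using h AB unfolding pi1_eq_def by blast
qed

text \<open>The homotopy moves every loop to its image under \<open>r\<close>, which lies in
  \<open>A\<close>. Since it preserves \<open>A\<close> and fixes \<open>a\<close>, a loop of
  \<open>A\<close> is moved without leaving \<open>A\<close>, and this gives injectivity. Points of
  \<open>A\<close> other than \<open>a\<close> may move, so less is asked than of a strong
  deformation retraction.\<close>

lemma pi1_eq_deform:
  fixes A B :: "'a::real_normed_vector set"
  assumes hom: "homotopic_with_canon (\<lambda>h. h ` A \<subseteq> A \<and> h a = a) B B id r"
    and r: "r ` B \<subseteq> A" and AB: "A \<subseteq> B" "a \<in> A"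
  shows "pi1_eq A B a" and "path_connected B \<Longrightarrow> path_connected A"
proof -
  obtain h where h0: "continuous_map (prod_topology (top_of_set {0..1::real}) (top_of_set B)) (top_of_set B) h"
    "\<forall>x. h (0, x) = id x" "\<forall>x. h (1, x) = r x"
    "\<forall>t\<in>{0..1}. (\<lambda>x. h (t, x)) ` A \<subseteq> A \<and> h (t, a) = a"
    using hom unfolding homotopic_with_def by blast
  have h: "continuous_on ({0..1} \<times> B) h" "h ` ({0..1} \<times> B) \<subseteq> B"
    using h0(1) by (auto simp: image_subset_iff Pi_iff)
  have h01: "\<And>x. h (0, x) = x" "\<And>x. h (1, x) = r x" using h0 by auto
  have hA: "\<And>t x. t \<in> {0..1} \<Longrightarrow> x \<in> A \<Longrightarrow> h (t, x) \<in> A" and ha: "\<And>t. t \<in> {0..1} \<Longrightarrow> h (t, a) = a"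
    using h0(4) by blast+
  have r_cont: "continuous_on B r"
    using homotopic_with_imp_continuous[OF hom] by blast
  have track: "homotopic_paths S p (r \<circ> p)"
    if p: "path p" "path_image p \<subseteq> B" "pathstart p = a" "pathfinish p = a"
      and S: "\<And>t s. t \<in> {0..1} \<Longrightarrow> s \<in> {0..1} \<Longrightarrow> h (t, p s) \<in> S" for S p
    unfolding homotopic_paths
  proof (intro exI[of _ "\<lambda>(t, s). h (t, p s)"] conjI ballI)
    have "continuous_on ({0..1} \<times> {0..1}) (\<lambda>y. h (fst y, p (snd y)))"
    proof (rule continuous_on_compose2[OF h(1)])
      show "continuous_on ({0..1} \<times> {0..1}) (\<lambda>y. (fst y, p (snd y)))"
        by (intro continuous_on_Pair continuous_on_fst continuous_on_id
            continuous_on_compose2[OF p(1)[unfolded path_def] continuous_on_snd[OF continuous_on_id]]) auto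
      show "(\<lambda>y. (fst y, p (snd y))) ` ({0..1} \<times> {0..1}) \<subseteq> {0..1} \<times> B"
        using p(2) by (auto simp: path_image_def)
    qed
    then show "continuous_on ({0..1} \<times> {0..1}) (\<lambda>(t, s). h (t, p s))" by (simp add: case_prod_unfold)
    show "(\<lambda>(t, s). h (t, p s)) \<in> {0..1} \<times> {0..1} \<rightarrow> S" using S by auto
  qed (use p h01 ha in \<open>auto simp: pathstart_def pathfinish_def\<close>)
  have rl: "loopin A a (r \<circ> p)" if "loopin B a p" for p
    using that r r_cont ha[of 1] h01(2)[of a]
    by (auto simp: loopin_def pathstart_compose pathfinish_compose path_image_compose
        intro!: path_continuous_image continuous_on_subset[OF r_cont])
  have trA: "\<exists>g. path g \<and> path_image g \<subseteq> S \<and> pathstart g = x \<and> pathfinish g = r x"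
    if "x \<in> B" "\<And>t. t \<in> {0..1} \<Longrightarrow> h (t, x) \<in> S" for x S
  proof (intro exI[of _ "\<lambda>t. h (t, x)"] conjI)
    show "path (\<lambda>t. h (t, x))" unfolding path_def
      by (rule continuous_on_compose2[OF h(1)]) (use that in \<open>auto intro!: continuous_intros\<close>)
  qed (use that h01 in \<open>auto simp: path_image_def pathstart_def pathfinish_def\<close>)
  have j: "path_component S x (r x)" if "x \<in> B" "\<And>t. t \<in> {0..1} \<Longrightarrow> h (t, x) \<in> S" for x S
    unfolding path_component_def using trA[OF that] by blast
  have pcB: "path_connected B" if "path_connected A"
    unfolding path_connected_component
  proof (intro ballI)
    fix x y assume xy: "x \<in> B" "y \<in> B"
    have "path_component B (r x) (r y)"
      using that xy r AB(1) unfolding path_connected_component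
      by (meson image_subset_iff path_component_of_subset)
    then show "path_component B x y"
      using j[of x B] j[of y B] xy h(2) path_component_trans path_component_sym by (metis SigmaI image_subset_iff)
  qed
  show "path_connected A" if "path_connected B"
    unfolding path_connected_component
  proof (intro ballI)
    fix x y assume xy: "x \<in> A" "y \<in> A"
    have "path_connected (r ` B)" by (rule path_connected_continuous_image[OF r_cont that])
    then have "path_component A (r x) (r y)"
      using xy AB(1) r unfolding path_connected_component by (meson imageI path_component_of_subset subsetD)
    then show "path_component A x y"
      using j[of x A] j[of y A] xy hA AB(1) path_component_trans path_component_sym by (metis subsetD)
  qed
  show "pi1_eq A B a"
    unfolding pi1_eq_def
  proof (intro conjI allI impI pcB)
    fix p assume p: "loopin B a p"
    have "homotopic_paths B p (r \<circ> p)"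
      by (rule track) (use p h(2) in \<open>auto simp: loopin_def image_subset_iff path_image_def\<close>)
    then show "\<exists>q. loopin A a q \<and> homotopic_paths B p q" using rl[OF p] by blast
  next
    fix p q assume h: "loopin A a p \<and> loopin A a q \<and> homotopic_paths B p q"
    have A: "homotopic_paths A p (r \<circ> p)" if "loopin A a p" for p
      by (rule track) (use that AB hA in \<open>auto simp: loopin_def image_subset_iff path_image_def\<close>)
    have "homotopic_paths A (r \<circ> p) (r \<circ> q)"
      using h r r_cont by (intro homotopic_paths_continuous_image[of B]) auto
    then show "homotopic_paths A p q"
      using A[of p] A[of q] h homotopic_paths_sym homotopic_paths_trans by metis
  qed (use AB in auto)
qed

lemma compact_subset_chain:
  fixes A :: "nat \<Rightarrow> 'a::topological_space set"
  assumes "compact K" "K \<subseteq> (\<Union>n. A n)" "\<And>n. open (A n)" "incseq A"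
  obtains n where "K \<subseteq> A n"
proof -
  obtain C where C: "finite C" "K \<subseteq> (\<Union>n\<in>C. A n)"
    by (rule compactE_image[OF assms(1), of UNIV A]) (use assms in auto)
  have "K \<subseteq> A (Max (insert 0 C))"
  proof
    fix x assume "x \<in> K"
    then obtain n where n: "n \<in> C" "x \<in> A n" using C by blast
    then have "n \<le> Max (insert 0 C)" using C by simp
    then show "x \<in> A (Max (insert 0 C))" using n assms(4) by (meson incseqD subsetD)
  qed
  then show ?thesis by (rule that)
qed

text \<open>Loops and homotopies have compact images, and a compact subset of the increasing open
  union lies in a single \<open>A n\<close>.\<close>

lemma pi1_eq_limit:
  fixes A :: "nat \<Rightarrow> 'a::real_normed_vector set"
  assumes eq: "\<And>n. pi1_eq A0 (A n) a" and op: "\<And>n. open (A n)" and inc: "incseq A"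
  shows "pi1_eq A0 (\<Union>n. A n) a"
  unfolding pi1_eq_def
proof (intro conjI allI impI)
  show "A0 \<subseteq> (\<Union>n. A n)" "a \<in> A0" using eq[of 0] by (auto simp: pi1_eq_def)
next
  assume "path_connected A0"
  then have pc: "path_connected (A n)" for n using eq by (simp add: pi1_eq_def)
  show "path_connected (\<Union>n. A n)"
    unfolding path_connected_component
  proof (intro ballI)
    fix x y assume "x \<in> (\<Union>n. A n)" "y \<in> (\<Union>n. A n)"
    then obtain m n where "x \<in> A m" "y \<in> A n" by blast
    then have "x \<in> A (max m n)" "y \<in> A (max m n)" using inc by (meson incseqD max.cobounded1 max.cobounded2 subsetD)+
    then have "path_component (A (max m n)) x y" using pc unfolding path_connected_component by blast
    then show "path_component (\<Union>n. A n) x y" by (rule path_component_of_subset[rotated]) blast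
  qed
next
  fix p assume p: "loopin (\<Union>n. A n) a p"
  have c: "compact (path_image p)" using p by (simp add: loopin_def compact_path_image)
  obtain n where "path_image p \<subseteq> A n"
    by (rule compact_subset_chain[OF c _ op inc]) (use p in \<open>auto simp: loopin_def\<close>)
  then have "loopin (A n) a p" using p by (simp add: loopin_def)
  then obtain q where "loopin A0 a q" "homotopic_paths (A n) p q" using eq[of n] by (auto simp: pi1_eq_def)
  then show "\<exists>q. loopin A0 a q \<and> homotopic_paths (\<Union>n. A n) p q"
    by (meson UN_upper UNIV_I homotopic_paths_subset)
next
  fix p q assume pq: "loopin A0 a p \<and> loopin A0 a q \<and> homotopic_paths (\<Union>n. A n) p q"
  then obtain h :: "real \<times> real \<Rightarrow> 'a" where h: "continuous_on ({0..1} \<times> {0..1}) h" "h \<in> ({0..1} \<times> {0..1}) \<rightarrow> (\<Union>n. A n)"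
    and h': "\<forall>x\<in>{0..1}. h (0, x) = p x" "\<forall>x\<in>{0..1}. h (1, x) = q x"
       "\<forall>t\<in>{0..1}. pathstart (h \<circ> Pair t) = pathstart p \<and> pathfinish (h \<circ> Pair t) = pathfinish p"
    unfolding homotopic_paths by blast
  have c: "compact (h ` ({0..1} \<times> {0..1}))" by (intro compact_continuous_image h compact_Times compact_Icc)
  obtain n where n: "h ` ({0..1} \<times> {0..1}) \<subseteq> A n"
    by (rule compact_subset_chain[OF c _ op inc]) (use h in blast)
  have "homotopic_paths (A n) p q"
    unfolding homotopic_paths using h h' n by (intro exI[of _ h]) blast
  then show "homotopic_paths A0 p q" using eq[of n] pq by (auto simp: pi1_eq_def)
qed

text \<open>\<open>\<rho>\<close> pulls a loop of \<open>B\<close> back to \<open>A\<close>.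
  Injectivity makes the result well defined up to homotopy in \<open>A\<close>, so a homomorphism on
  \<open>A\<close> composed with \<open>\<rho>\<close> is one on \<open>B\<close>.\<close>

lemma freely_generated_mono:
  assumes eq: "pi1_eq A B a" and "freely_generated A a"
  shows "freely_generated B a"
proof -
  obtain k x where x: "\<forall>i<k. loopin A a (x i)" and g: "\<forall>p. loopin A a p \<longrightarrow> gen A a (x ` {..<k}) p"
    and u: "\<forall>g :: nat \<Rightarrow> word_perm. \<exists>f. loop_hom A a f \<and> (\<forall>i<k. f (x i) = g i)" and pc: "path_connected A" "a \<in> A"
    using assms(2) unfolding freely_generated_def by blast
  have sub: "A \<subseteq> B" using eq by (simp add: pi1_eq_def)
  define \<rho> where "\<rho> p = (SOME q. loopin A a q \<and> homotopic_paths B p q)" for p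
  have \<rho>: "loopin A a (\<rho> p) \<and> homotopic_paths B p (\<rho> p)" if "loopin B a p" for p
  proof -
    have "\<exists>q. loopin A a q \<and> homotopic_paths B p q" using eq that unfolding pi1_eq_def by blast
    then show ?thesis unfolding \<rho>_def by (rule someI_ex)
  qed
  have inj: "homotopic_paths A p q" if "loopin A a p" "loopin A a q" "homotopic_paths B p q" for p q
    using eq that by (auto simp: pi1_eq_def)
  have gB: "gen B a (x ` {..<k}) p" if p: "loopin B a p" for p
  proof -
    have "gen B a (x ` {..<k}) (\<rho> p)" using g \<rho>[OF p] sub by (blast intro: gen_mono)
    then show ?thesis using \<rho>[OF p] by (blast intro: gen_hom homotopic_paths_sym)
  qed
  have uB: "\<exists>f. loop_hom B a f \<and> (\<forall>i<k. f (x i) = g i)" for g :: "nat \<Rightarrow> word_perm"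
  proof -
    obtain f where f: "loop_hom A a f" "\<forall>i<k. f (x i) = g i" using u by blast
    have same: "f (\<rho> p) = f q" if "loopin B a p" "loopin A a q" "homotopic_paths B p q" for p q
      using f(1) inj[of "\<rho> p" q] \<rho>[OF that(1)] that
      by (metis homotopic_paths_sym homotopic_paths_trans loop_hom_def)
    have "loop_hom B a (f \<circ> \<rho>)" unfolding loop_hom_def
    proof (intro conjI allI impI)
      fix p q assume h: "loopin B a p \<and> homotopic_paths B p q"
      then have "loopin B a q" by (blast intro: loopin_homotopic)
      then show "(f \<circ> \<rho>) p = (f \<circ> \<rho>) q"
        using same[of p "\<rho> q"] \<rho>[of q] h by (simp, metis homotopic_paths_trans)
    next
      fix p q assume pq: "loopin B a p \<and> loopin B a q"
      have "f (\<rho> (p +++ q)) = f (\<rho> p +++ \<rho> q)"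
        using pq \<rho>[of p] \<rho>[of q]
        by (intro same loopin_join homotopic_paths_join) (auto simp: loopin_def)
      then show "(f \<circ> \<rho>) (p +++ q) = (f \<circ> \<rho>) p + (f \<circ> \<rho>) q"
        using f(1) pq \<rho>[of p] \<rho>[of q] by (simp add: loop_hom_def)
    qed
    moreover have "(f \<circ> \<rho>) (x i) = g i" if "i < k" for i
      using same[of "x i" "x i"] x sub f(2) that by (auto simp: loopin_def)
    ultimately show ?thesis by blast
  qed
  show ?thesis unfolding freely_generated_def
    using eq pc gB uB x sub loopin_mono unfolding pi1_eq_def by blast
qed

text \<open>Generators are replaced by homotopic loops of \<open>A\<close>, and homomorphisms
  restrict. Path connectedness of \<open>A\<close> cannot be read off from \<open>pi1_eq\<close>,
  hence the extra hypothesis.\<close>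

lemma freely_generated_antimono:
  assumes eq: "pi1_eq A B a" and "freely_generated B a" and pcA: "path_connected A"
  shows "freely_generated A a"
proof -
  obtain k x where x: "\<forall>i<k. loopin B a (x i)" and g: "\<forall>p. loopin B a p \<longrightarrow> gen B a (x ` {..<k}) p"
    and u: "\<forall>g :: nat \<Rightarrow> word_perm. \<exists>f. loop_hom B a f \<and> (\<forall>i<k. f (x i) = g i)"
    using assms(2) unfolding freely_generated_def by blast
  have sub: "A \<subseteq> B" "a \<in> A" using eq by (auto simp: pi1_eq_def)
  have "\<forall>i. \<exists>y. i < k \<longrightarrow> loopin A a y \<and> homotopic_paths B (x i) y" using x eq by (auto simp: pi1_eq_def)
  then obtain y where y: "\<And>i. i < k \<Longrightarrow> loopin A a (y i) \<and> homotopic_paths B (x i) (y i)" by metis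
  have G: "\<exists>q. gen A a (y ` {..<k}) q \<and> homotopic_paths B p q" if "gen B a (x ` {..<k}) p" for p
    using that
  proof (induction rule: gen.induct)
    case (gen_base p)
    then show ?case using y by (auto intro!: gen.gen_base)
  next
    case gen_const
    then show ?case using sub by (auto intro!: exI[of _ "linepath a a"] gen.gen_const)
  next
    case (gen_rev p)
    then show ?case using homotopic_paths_reversepath gen.gen_rev by metis
  next
    case (gen_join p q)
    then obtain p' q' where "gen A a (y ` {..<k}) p'" "homotopic_paths B p p'"
      "gen A a (y ` {..<k}) q'" "homotopic_paths B q q'" by blast
    then show ?case using gen_loop[OF gen_join(1)] gen_loop[OF gen_join(2)]
      by (intro exI[of _ "p' +++ q'"] conjI gen.gen_join homotopic_paths_join) (auto simp: loopin_def)
  next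
    case (gen_hom p q)
    then show ?case using homotopic_paths_sym homotopic_paths_trans by blast
  qed
  have gA: "gen A a (y ` {..<k}) p" if p: "loopin A a p" for p
  proof -
    obtain q where q: "gen A a (y ` {..<k}) q" "homotopic_paths B p q"
      using G g loopin_mono[OF p sub(1)] by blast
    then have "homotopic_paths A p q" using eq p gen_loop[OF q(1)] unfolding pi1_eq_def by blast
    then show ?thesis using q(1) by (blast intro: gen_hom homotopic_paths_sym)
  qed
  have uA: "\<exists>f. loop_hom A a f \<and> (\<forall>i<k. f (y i) = g i)" for g :: "nat \<Rightarrow> word_perm"
  proof -
    obtain f where f: "loop_hom B a f" "\<forall>i<k. f (x i) = g i" using u by blast
    have "loop_hom A a f"
      using f(1) sub unfolding loop_hom_def by (meson homotopic_paths_subset loopin_mono)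
    moreover have "f (y i) = g i" if "i < k" for i
      using f y[OF that] x that unfolding loop_hom_def by metis
    ultimately show ?thesis by blast
  qed
  show ?thesis unfolding freely_generated_def
    using pcA sub gA uA y by blast
qed

section \<open>Gluing\<close>

text \<open>The generation half of van Kampen's theorem. A path splits into pieces in
  \<open>A\<close> and pieces in \<open>E\<close>, each closed up by connectors from
  \<open>a\<close>; a piece in \<open>E\<close> depends only on its end points because
  \<open>E\<close> is simply connected. The hypothesis \<open>bridge\<close> treats one such piece
  for each point of the overlap, and this is enough because two connectors within \<open>A\<close>
  differ by a loop of \<open>A\<close>.\<close>

lemma gen_vk:
  fixes A E :: "'a::real_normed_vector set"
  assumes op: "open A" "open E" and pcA: "path_connected A" and a: "a \<in> A"
    and scE: "simply_connected E" and e0: "e0 \<in> A \<inter> E"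
    and LA: "\<And>p. loopin A a p \<Longrightarrow> gen (A \<union> E) a L p"
    and bridge: "\<And>P. P \<in> A \<inter> E \<Longrightarrow> \<exists>c q c'. path c \<and> path_image c \<subseteq> A \<and> pathstart c = a \<and> pathfinish c = P \<and>
        path q \<and> path_image q \<subseteq> E \<and> pathstart q = P \<and> pathfinish q = e0 \<and>
        path c' \<and> path_image c' \<subseteq> A \<and> pathstart c' = a \<and> pathfinish c' = e0 \<and>
        gen (A \<union> E) a L (c +++ (q +++ reversepath c'))"
    and p: "loopin (A \<union> E) a p"
  shows "gen (A \<union> E) a L p"
proof -
  let ?M = "A \<union> E"
  have scE': "homotopic_paths E p q" if "path p" "path q" "path_image p \<subseteq> E" "path_image q \<subseteq> E"
     "pathstart p = pathstart q" "pathfinish p = pathfinish q" for p q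
    using scE[unfolded simply_connected_eq_homotopic_paths, THEN conjunct2, rule_format, of p q] that by simp
  have pcE: "path_connected E" using scE simply_connected_imp_path_connected by blast
  obtain c0 where c0: "path c0" "path_image c0 \<subseteq> A" "pathstart c0 = a" "pathfinish c0 = e0"
    using pcA a e0 unfolding path_connected_def by blast
  \<comment> \<open>Connectors to points of \<open>A\<close> stay in \<open>A\<close>; the others
    enter \<open>E\<close> through \<open>e0\<close>. The connector to \<open>a\<close> is constant,
    so closing up a loop at \<open>a\<close> changes nothing.\<close>
  have "\<exists>c. path c \<and> path_image c \<subseteq> ?M \<and> pathstart c = a \<and> pathfinish c = P \<and>
      (P \<in> A \<longrightarrow> path_image c \<subseteq> A) \<and> (P = a \<longrightarrow> c = linepath a a) \<and>
      (P \<notin> A \<longrightarrow> (\<exists>r. path r \<and> path_image r \<subseteq> E \<and> pathstart r = e0 \<and> pathfinish r = P \<and> c = c0 +++ r))" if "P \<in> ?M" for P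
  proof (cases "P \<in> A")
    case True
    show ?thesis
    proof (cases "P = a")
      case True then show ?thesis using a by (intro exI[of _ "linepath a a"]) auto
    next
      case False
      obtain c where "path c" "path_image c \<subseteq> A" "pathstart c = a" "pathfinish c = P"
        using pcA a True unfolding path_connected_def by blast
      then show ?thesis using True False by (intro exI[of _ c]) auto
    qed
  next
    case False
    then obtain r where "path r" "path_image r \<subseteq> E" "pathstart r = e0" "pathfinish r = P"
      using pcE e0 \<open>P \<in> ?M\<close> unfolding path_connected_def by blast
    then show ?thesis using False c0 a by (intro exI[of _ "c0 +++ r"]) (auto simp: path_image_join)
  qed
  then obtain c where c: "\<And>P. P \<in> ?M \<Longrightarrow> path (c P) \<and> path_image (c P) \<subseteq> ?M \<and> pathstart (c P) = a \<and> pathfinish (c P) = P"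
    and cA: "\<And>P. P \<in> A \<Longrightarrow> path_image (c P) \<subseteq> A" and ca: "c a = linepath a a"
    and cE: "\<And>P. P \<in> ?M \<Longrightarrow> P \<notin> A \<Longrightarrow> \<exists>r. path r \<and> path_image r \<subseteq> E \<and> pathstart r = e0 \<and> pathfinish r = P \<and> c P = c0 +++ r"
    using a by (metis Un_iff)
  define conj where "conj p = c (pathstart p) +++ (p +++ reversepath (c (pathfinish p)))" for p
  note G = gen_join gen_rev gen_hom
  have endM: "pathstart p \<in> ?M" "pathfinish p \<in> ?M" if "path p" "path_image p \<subseteq> ?M" for p
    using that pathstart_in_path_image pathfinish_in_path_image by blast+
  have r1: "rep ?M (c P) a [c P] P" "rep ?M (reversepath (c P)) P [reversepath (c P)] a" if "P \<in> ?M" for P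
    using c[OF that] by (auto intro!: rep_single)
  have rp: "rep ?M p (pathstart p) [p] (pathfinish p)" if "path p" "path_image p \<subseteq> ?M" for p
    using that by (auto intro!: rep_single)
  have rconj: "rep ?M (conj p) a ([c (pathstart p)] @ [p] @ [reversepath (c (pathfinish p))]) a" if "path p" "path_image p \<subseteq> ?M" for p
    unfolding conj_def by (rule rep_join[OF r1(1)[OF endM(1)[OF that]] rep_join[OF rp[OF that] r1(2)[OF endM(2)[OF that]]]])
  have conj_hom: "homotopic_paths ?M (conj p) (conj q)" if "homotopic_paths ?M p q" for p q
  proof -
    have "path p" "path_image p \<subseteq> ?M" "pathstart p = pathstart q" "pathfinish p = pathfinish q"
      using that homotopic_paths_imp_path homotopic_paths_imp_subset homotopic_paths_imp_pathstart homotopic_paths_imp_pathfinish by blast+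
    then show ?thesis using that c[OF endM(1), of p] c[OF endM(2), of p] unfolding conj_def by (auto intro!: homotopic_paths_join)
  qed
  have conj_join: "homotopic_paths ?M (conj p +++ conj q) (conj (p +++ q))"
    if pq: "path p" "path_image p \<subseteq> ?M" "path q" "path_image q \<subseteq> ?M" "pathfinish p = pathstart q" for p q
  proof -
    have "rep ?M (conj p +++ conj q) a ([c (pathstart p), p] @ reversepath (c (pathfinish p)) # c (pathstart q) # [q, reversepath (c (pathfinish q))]) a"
      using rep_join[OF rconj[OF pq(1,2)] rconj[OF pq(3,4)]] by simp
    then have "rep ?M (conj p +++ conj q) a ([c (pathstart p), p] @ [q, reversepath (c (pathfinish q))]) a"
      by (rule rep_cancel) (use pq in auto)
    moreover have "rep ?M (conj (p +++ q)) a ([c (pathstart p)] @ (([p] @ [q]) @ [reversepath (c (pathfinish q))])) a"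
      unfolding conj_def pathstart_join pathfinish_join
      by (rule rep_join[OF r1(1)[OF endM(1)] rep_join[OF rep_join[OF rp rp[of q, folded pq(5)]] r1(2)[OF endM(2)]]])
        (use pq in auto)
    ultimately show ?thesis by (auto intro: rep_eq)
  qed
  have conjA: "gen ?M a L (conj p)" if "path p" "path_image p \<subseteq> A" for p
  proof (rule LA)
    have "pathstart p \<in> A" "pathfinish p \<in> A" using that pathstart_in_path_image pathfinish_in_path_image by blast+
    then show "loopin A a (conj p)"
      using that cA c unfolding loopin_def conj_def by (simp add: path_image_join)
  qed
  \<comment> \<open>Up to homotopy every path in \<open>E\<close> runs through \<open>e0\<close>, so
    only paths ending at \<open>e0\<close> need an argument of their own.\<close>
  have toe0: "gen ?M a L (conj s)" if s: "path s" "path_image s \<subseteq> E" "pathstart s = P" "pathfinish s = e0" for s P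
  proof (cases "P \<in> A")
    case True
    then have "P \<in> A \<inter> E" using s pathstart_in_path_image by blast
    then obtain d q d' where d: "path d" "path_image d \<subseteq> A" "pathstart d = a" "pathfinish d = P"
        "path q" "path_image q \<subseteq> E" "pathstart q = P" "pathfinish q = e0"
        "path d'" "path_image d' \<subseteq> A" "pathstart d' = a" "pathfinish d' = e0"
        and g: "gen ?M a L (d +++ (q +++ reversepath d'))" using bridge by blast
    have x: "gen ?M a L (c P +++ reversepath d)" "gen ?M a L (d' +++ reversepath (c e0))"
      by (rule LA, use True e0 d c[of P] c[of e0] cA[of P] cA[of e0] in \<open>simp add: loopin_def path_image_join\<close>)+
    have "gen ?M a L ((c P +++ reversepath d) +++ ((d +++ (q +++ reversepath d')) +++ (d' +++ reversepath (c e0))))"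
      by (intro gen_join x g)
    moreover have "homotopic_paths ?M ((c P +++ reversepath d) +++ ((d +++ (q +++ reversepath d')) +++ (d' +++ reversepath (c e0)))) (conj q)"
    proof -
      have dM: "rep ?M d a [d] P" "rep ?M (reversepath d) P [reversepath d] a" "rep ?M q P [q] e0"
        "rep ?M d' a [d'] e0" "rep ?M (reversepath d') e0 [reversepath d'] a"
        using d by (auto intro!: rep_single)
      have PM: "P \<in> ?M" "e0 \<in> ?M" using True e0 by auto
      have "rep ?M ((c P +++ reversepath d) +++ ((d +++ (q +++ reversepath d')) +++ (d' +++ reversepath (c e0)))) a
          (([c P] @ [reversepath d]) @ (([d] @ ([q] @ [reversepath d'])) @ ([d'] @ [reversepath (c e0)]))) a"
        by (intro rep_join[OF rep_join[OF r1(1)[OF PM(1)] dM(2)] rep_join[OF rep_join[OF dM(1) rep_join[OF dM(3,5)]] rep_join[OF dM(4) r1(2)[OF PM(2)]]]])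
      then have "rep ?M ((c P +++ reversepath d) +++ ((d +++ (q +++ reversepath d')) +++ (d' +++ reversepath (c e0)))) a
          ([c P] @ reversepath d # d # [q, reversepath d', d', reversepath (c e0)]) a" by simp
      then have "rep ?M ((c P +++ reversepath d) +++ ((d +++ (q +++ reversepath d')) +++ (d' +++ reversepath (c e0)))) a
          ([c P] @ [q, reversepath d', d', reversepath (c e0)]) a" by (rule rep_cancel) simp
      then have "rep ?M ((c P +++ reversepath d) +++ ((d +++ (q +++ reversepath d')) +++ (d' +++ reversepath (c e0)))) a
          ([c P, q] @ reversepath d' # d' # [reversepath (c e0)]) a" by simp
      then have "rep ?M ((c P +++ reversepath d) +++ ((d +++ (q +++ reversepath d')) +++ (d' +++ reversepath (c e0)))) a
          ([c P, q] @ [reversepath (c e0)]) a" by (rule rep_cancel) simp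
      moreover have "rep ?M (conj q) a ([c P] @ [q] @ [reversepath (c e0)]) a"
        using rconj[of q] d by auto
      ultimately show ?thesis by (auto intro: rep_eq)
    qed
    ultimately have "gen ?M a L (conj q)" by (rule gen_hom)
    moreover have "homotopic_paths ?M (conj q) (conj s)"
      using s d by (intro conj_hom homotopic_paths_subset[OF scE']) auto
    ultimately show ?thesis by (rule gen_hom)
  next
    case False
    have PM: "P \<in> ?M" using s pathstart_in_path_image by blast
    obtain r where r: "path r" "path_image r \<subseteq> E" "pathstart r = e0" "pathfinish r = P" "c P = c0 +++ r"
      using cE[OF PM False] by blast
    have g0: "gen ?M a L (c0 +++ reversepath (c e0))"
      by (rule LA) (use e0 c0 c[of e0] cA[of e0] in \<open>simp add: loopin_def path_image_join\<close>)
    have "homotopic_paths ?M (conj (reversepath r)) (c0 +++ reversepath (c e0))"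
    proof -
      have rr: "rep ?M c0 a [c0] e0" "rep ?M r e0 [r] P" "rep ?M (reversepath r) P [reversepath r] e0"
         "rep ?M (reversepath (c e0)) e0 [reversepath (c e0)] a"
        using r c0 c[of e0] e0 by (auto intro!: rep_single)
      have "rep ?M (conj (reversepath r)) a (([c0] @ [r]) @ ([reversepath r] @ [reversepath (c e0)])) a"
        unfolding conj_def using rep_join[OF rep_join[OF rr(1,2)] rep_join[OF rr(3,4)]] r by simp
      then have "rep ?M (conj (reversepath r)) a ([c0] @ r # reversepath r # [reversepath (c e0)]) a" by simp
      then have "rep ?M (conj (reversepath r)) a ([c0] @ [reversepath (c e0)]) a" by (rule rep_cancel) simp
      with rep_join[OF rr(1,4)] show ?thesis by (auto intro: rep_eq)
    qed
    then have "gen ?M a L (conj (reversepath r))" using g0 by (blast intro: gen_hom homotopic_paths_sym)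
    moreover have "homotopic_paths ?M (conj (reversepath r)) (conj s)"
      using s r by (intro conj_hom homotopic_paths_subset[OF scE']) auto
    ultimately show ?thesis by (rule gen_hom)
  qed
  have revconj: "gen ?M a L (conj (reversepath s))" if "gen ?M a L (conj s)" "path s" "path_image s \<subseteq> ?M" for s
  proof -
    have sM: "pathstart s \<in> ?M" "pathfinish s \<in> ?M" using endM that by auto
    have rs: "rep ?M (reversepath s) (pathfinish s) [reversepath s] (pathstart s)"
      using that by (auto intro!: rep_single)
    have e: "reversepath (conj s) = (c (pathfinish s) +++ reversepath s) +++ reversepath (c (pathstart s))"
      unfolding conj_def using c sM by (simp add: reversepath_joinpaths)
    have "rep ?M (reversepath (conj s)) a (([c (pathfinish s)] @ [reversepath s]) @ [reversepath (c (pathstart s))]) a"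
      unfolding e by (rule rep_join[OF rep_join[OF r1(1)[OF sM(2)] rs] r1(2)[OF sM(1)]])
    moreover have "rep ?M (conj (reversepath s)) a ([c (pathfinish s)] @ [reversepath s] @ [reversepath (c (pathstart s))]) a"
      using rconj[of "reversepath s"] that by simp
    ultimately have "homotopic_paths ?M (reversepath (conj s)) (conj (reversepath s))" by (auto intro: rep_eq)
    then show ?thesis using that(1) by (blast intro: gen_hom gen_rev)
  qed
  have conjE: "gen ?M a L (conj q)" if q: "path q" "path_image q \<subseteq> E" for q
  proof -
    have "pathstart q \<in> E" "pathfinish q \<in> E" using q pathstart_in_path_image pathfinish_in_path_image by blast+
    then obtain s t where s: "path s" "path_image s \<subseteq> E" "pathstart s = pathstart q" "pathfinish s = e0"
      and t: "path t" "path_image t \<subseteq> E" "pathstart t = pathfinish q" "pathfinish t = e0"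
      using pcE e0 unfolding path_connected_def by (metis IntD2)
    have "gen ?M a L (conj s +++ conj (reversepath t))"
      using toe0[OF s] toe0[OF t] t by (intro gen_join revconj) auto
    moreover have "homotopic_paths ?M (conj s +++ conj (reversepath t)) (conj (s +++ reversepath t))"
      by (rule conj_join) (use s t in auto)
    moreover have "homotopic_paths ?M (conj (s +++ reversepath t)) (conj q)"
      using s t q by (intro conj_hom homotopic_paths_subset[OF scE']) (auto simp: path_image_join)
    ultimately show ?thesis by (blast intro: gen_hom)
  qed
  have "gen ?M a L (conj p)"
  proof (rule path_cover_induct[OF op, of p "\<lambda>p. gen ?M a L (conj p)"])
    show "path p" "path_image p \<subseteq> A \<union> E" using p by (auto simp: loopin_def)
    show "gen ?M a L (conj q)" if "path q" "path_image q \<subseteq> A \<or> path_image q \<subseteq> E" for q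
      using that conjA conjE by blast
    show "gen ?M a L (conj (q +++ r))" if "gen ?M a L (conj q)" "gen ?M a L (conj r)" "path q" "path r"
      "path_image q \<subseteq> A \<union> E" "path_image r \<subseteq> A \<union> E" "pathfinish q = pathstart r" for q r
      using gen_hom[OF gen_join[OF that(1,2)] conj_join] that by blast
    show "gen ?M a L (conj r)" if "gen ?M a L (conj q)" "homotopic_paths (A \<union> E) q r" for q r
      using gen_hom[OF that(1) conj_hom[OF that(2)]] .
  qed
  moreover have "homotopic_paths ?M (conj p) p"
  proof -
    have e: "pathstart p = a" "pathfinish p = a" "path p" "path_image p \<subseteq> ?M" using p by (auto simp: loopin_def)
    have "rep ?M (conj p) a ([] @ [p] @ []) a"
      unfolding e conj_def ca reversepath_linepath
      by (rule rep_join[OF rep_nil rep_join[OF rep_single rep_nil]]) (use a e in auto)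
    then show ?thesis using e by (intro rep_eq[OF _ rep_single]) auto
  qed
  ultimately show ?thesis by (rule gen_hom)
qed

text \<open>Leaving \<open>A\<close> through one entrance of the convex piece \<open>E\<close> and
  returning through the other gives one extra loop \<open>new\<close>; convexity of \<open>E\<close>
  allows no further ones. It is free because the potential on \<open>E2\<close> may be shifted by
  any constant relative to the one on \<open>E1\<close>.\<close>

lemma freely_generated_wall:
  fixes A E :: "'a::real_normed_vector set"
  assumes fr: "freely_generated A a" and op: "open A" "open E" and E: "convex E"
    and E12: "A \<inter> E = E1 \<union> E2" "open E1" "open E2" "convex E1" "convex E2" "E1 \<inter> E2 = {}" "E1 \<noteq> {}" "E2 \<noteq> {}"
  shows "freely_generated (A \<union> E) a"
proof -
  let ?M = "A \<union> E"
  obtain k x where pc: "path_connected A" "a \<in> A" and x: "\<forall>i<k. loopin A a (x i)"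
    and g: "\<forall>p. loopin A a p \<longrightarrow> gen A a (x ` {..<k}) p"
    and u: "\<forall>g :: nat \<Rightarrow> word_perm. \<exists>f. loop_hom A a f \<and> (\<forall>i<k. f (x i) = g i)"
    using fr unfolding freely_generated_def by blast
  obtain b1 b2 where b: "b1 \<in> E1" "b2 \<in> E2" using E12 by blast
  have bA: "b1 \<in> A" "b1 \<in> E" "b2 \<in> A" "b2 \<in> E" using b E12 by blast+
  have sub: "E1 \<subseteq> A" "E1 \<subseteq> E" "E2 \<subseteq> A" "E2 \<subseteq> E" using E12 by blast+
  obtain c1 where c1: "path c1" "path_image c1 \<subseteq> A" "pathstart c1 = a" "pathfinish c1 = b1"
    using pc bA unfolding path_connected_def by blast
  obtain c2 where c2: "path c2" "path_image c2 \<subseteq> A" "pathstart c2 = a" "pathfinish c2 = b2"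
    using pc bA unfolding path_connected_def by blast
  define new where "new = c1 +++ (linepath b1 b2 +++ reversepath c2)"
  define y where "y = x(k := new)"
  have lE: "path_image (linepath P Q) \<subseteq> S" if "P \<in> S" "Q \<in> S" "convex S" for P Q and S :: "'a set"
    using that by (simp add: closed_segment_subset)
  have new: "loopin ?M a new"
    unfolding loopin_def new_def using c1 c2 lE[OF bA(2,4) E] by (auto simp: path_image_join)
  have y: "loopin ?M a (y i)" if "i < Suc k" for i
    using that new x loopin_mono[of A a "x i" ?M] by (cases "i = k") (auto simp: y_def)
  have pcM: "path_connected ?M"
    using path_connected_Un[OF pc(1) convex_imp_path_connected[OF E]] bA by blast
  have gen_new: "gen ?M a (y ` {..<Suc k}) new"
    using new by (intro gen_base) (auto simp: y_def)
  have LA: "gen ?M a (y ` {..<Suc k}) p" if "loopin A a p" for p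
  proof -
    have "gen A a (x ` {..<k}) p" using g that by blast
    then show ?thesis by (rule gen_mono) (auto simp: y_def)
  qed
  have G: "gen ?M a (y ` {..<Suc k}) p" if "loopin ?M a p" for p
  proof (rule gen_vk[OF op pc convex_imp_simply_connected[OF E] _ LA _ that])
    show "b1 \<in> A \<inter> E" using bA by blast
    fix P assume "P \<in> A \<inter> E"
    then consider "P \<in> E1" | "P \<in> E2" using E12 by blast
    then show "\<exists>c q c'. path c \<and> path_image c \<subseteq> A \<and> pathstart c = a \<and> pathfinish c = P \<and>
        path q \<and> path_image q \<subseteq> E \<and> pathstart q = P \<and> pathfinish q = b1 \<and>
        path c' \<and> path_image c' \<subseteq> A \<and> pathstart c' = a \<and> pathfinish c' = b1 \<and>
        gen ?M a (y ` {..<Suc k}) (c +++ (q +++ reversepath c'))"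
    proof cases
      case 1
      obtain c where c: "path c" "path_image c \<subseteq> A" "pathstart c = a" "pathfinish c = P"
        using pc 1 sub unfolding path_connected_def by blast
      have l: "path_image (linepath P b1) \<subseteq> E1" using lE 1 b E12 by blast
      have "gen ?M a (y ` {..<Suc k}) (c +++ (linepath P b1 +++ reversepath c1))"
        using c c1 l sub by (intro LA) (auto simp: loopin_def path_image_join)
      then show ?thesis using c c1 l sub
        by (intro exI[of _ c] exI[of _ "linepath P b1"] exI[of _ c1]) auto
    next
      case 2
      have l: "path_image (linepath P b2) \<subseteq> E2" "path_image (linepath b2 P) \<subseteq> E2" using lE 2 b E12 by blast+
      have l': "path_image (linepath b2 b1) \<subseteq> E" using lE bA E by blast
      let ?p = "(c2 +++ linepath b2 P) +++ ((linepath P b2 +++ linepath b2 b1) +++ reversepath c1)"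
      have R: "rep ?M c2 a [c2] b2" "rep ?M (linepath b2 P) b2 [linepath b2 P] P" "rep ?M (linepath P b2) P [linepath P b2] b2"
        "rep ?M (linepath b2 b1) b2 [linepath b2 b1] b1" "rep ?M (reversepath c1) b1 [reversepath c1] a"
        using c1 c2 l l' sub by (auto intro!: rep_single)
      have "rep ?M ?p a (([c2] @ [linepath b2 P]) @ (([linepath P b2] @ [linepath b2 b1]) @ [reversepath c1])) a"
        by (intro rep_join[OF rep_join[OF R(1,2)] rep_join[OF rep_join[OF R(3,4)] R(5)]])
      then have "rep ?M ?p a ([c2] @ linepath b2 P # linepath P b2 # [linepath b2 b1, reversepath c1]) a" by simp
      then have "rep ?M ?p a ([c2] @ [linepath b2 b1, reversepath c1]) a" by (rule rep_cancel) simp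
      moreover have "rep ?M (reversepath new) a (([c2] @ [linepath b2 b1]) @ [reversepath c1]) a"
        using rep_join[OF rep_join[OF R(1,4)] R(5)] c1 c2 by (simp add: new_def reversepath_joinpaths)
      ultimately have "homotopic_paths ?M (reversepath new) ?p" by (auto intro: rep_eq)
      then have "gen ?M a (y ` {..<Suc k}) ?p" using gen_new by (blast intro: gen_hom gen_rev)
      then show ?thesis using c1 c2 l l' sub
        by (intro exI[of _ "c2 +++ linepath b2 P"] exI[of _ "linepath P b2 +++ linepath b2 b1"] exI[of _ c1])
          (auto simp: path_image_join)
    qed
  qed
  have U: "\<exists>f. loop_hom ?M a f \<and> (\<forall>i<Suc k. f (y i) = h i)" for h :: "nat \<Rightarrow> word_perm"
  proof -
    obtain f where f: "loop_hom A a f" "\<forall>i<k. f (x i) = h i" using u by blast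
    obtain F where F: "path_functor A F" and Ff: "\<And>p. loopin A a p \<Longrightarrow> F p = f p"
      using loop_hom_functor[OF pc f(1)] by metis
    \<comment> \<open>Solves \<open>F c1 + (\<theta> - F c2) = h k\<close>, whose left side is the
      value of the extension on \<open>new\<close>.\<close>
    define \<theta> where "\<theta> = - F c1 + h k + F c2"
    define s where "s P = (if P \<in> E1 then F (linepath b1 P) else \<theta> + F (linepath b2 P))" for P
    have side: "F p = - F (linepath b (pathstart p)) + F (linepath b (pathfinish p))"
      if p: "path p" "path_image p \<subseteq> S" and S: "convex S" "S \<subseteq> A" "b \<in> S" for p b S
    proof -
      have e: "pathstart p \<in> S" "pathfinish p \<in> S" using p pathstart_in_path_image pathfinish_in_path_image by blast+
      have l: "path_image (linepath b (pathstart p)) \<subseteq> S" "path_image (linepath b (pathfinish p)) \<subseteq> S" using lE e S by blast+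
      have "homotopic_paths S (linepath b (pathstart p) +++ p) (linepath b (pathfinish p))"
        by (rule homotopic_paths_convex) (use S p l in \<open>auto simp: path_image_join\<close>)
      then have "F (linepath b (pathstart p) +++ p) = F (linepath b (pathfinish p))"
        using path_functor_homotopic[OF path_functor_mono[OF F S(2)]] by blast
      moreover have "F (linepath b (pathstart p) +++ p) = F (linepath b (pathstart p)) + F p"
        by (rule path_functor_join[OF F]) (use p l S in auto)
      ultimately show ?thesis by (metis add.assoc add_0 left_minus)
    qed
    have sF: "F p = - s (pathstart p) + s (pathfinish p)" if p: "path p" "path_image p \<subseteq> A \<inter> E" for p
    proof -
      have e: "pathstart p \<in> path_image p" "pathfinish p \<in> path_image p" by auto
      \<comment> \<open>A path in the overlap stays in one of the two pieces, so it does not see the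
        jump of \<open>s\<close> between them.\<close>
      have "connected (path_image p)" using p by (simp add: connected_path_image)
      then have "E1 \<inter> path_image p = {} \<or> E2 \<inter> path_image p = {}"
        by (rule connectedD[OF _ E12(2,3)]) (use p E12 in auto)
      then consider "path_image p \<subseteq> E1" | "path_image p \<subseteq> E2" using p E12 by blast
      then show ?thesis
      proof cases
        case 1
        then show ?thesis using side[OF p(1) 1 E12(4) sub(1) b(1)] e unfolding s_def by auto
      next
        case 2
        then have "pathstart p \<notin> E1" "pathfinish p \<notin> E1" using e E12 by blast+
        then show ?thesis using side[OF p(1) 2 E12(5) sub(3) b(2)]
          unfolding s_def by (simp only: if_False minus_add add.assoc minus_add_cancel)
      qed
    qed
    obtain H where H: "path_functor ?M H" "\<And>p. path p \<Longrightarrow> path_image p \<subseteq> A \<Longrightarrow> H p = F p"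
      "\<And>p. path p \<Longrightarrow> path_image p \<subseteq> E \<Longrightarrow> H p = - s (pathstart p) + s (pathfinish p)"
      using path_functor_extend[OF op F sF] by blast
    have "H (y i) = h i" if "i < Suc k" for i
    proof (cases "i = k")
      case True
      have b2: "b2 \<notin> E1" using b E12 by blast
      have s: "s b1 = 0" "s b2 = \<theta>"
        unfolding s_def using b b2 path_functor_const[OF F bA(1)] path_functor_const[OF F bA(3)] by auto
      have "H new = H c1 + (H (linepath b1 b2) + H (reversepath c2))"
        unfolding new_def using c1 c2 lE[OF bA(2,4) E]
        by (subst path_functor_join[OF H(1)], auto simp: path_image_join) (subst path_functor_join[OF H(1)], auto)
      also have "\<dots> = F c1 + (\<theta> - F c2)"
        using H(2)[of c1] H(2)[of "reversepath c2"] H(3)[of "linepath b1 b2"] path_functor_reverse[OF F, of c2]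
          c1 c2 lE[OF bA(2,4) E] s by simp
      also have "\<dots> = h k" unfolding \<theta>_def by (simp only: add_diff_cancel add_minus_cancel)
      finally show ?thesis using True by (simp add: y_def)
    next
      case False
      then have i: "i < k" using that by simp
      then have "loopin A a (x i)" using x by blast
      then show ?thesis using H(2)[of "x i"] Ff f(2) i by (simp add: y_def loopin_def)
    qed
    then show ?thesis using functor_loop_hom[OF H(1)] by blast
  qed
  show ?thesis unfolding freely_generated_def
    using pcM pc(2) y G U by (intro conjI exI[of _ "Suc k"] exI[of _ y]) auto
qed

text \<open>Loops of the overlap are null-homotopic in \<open>I\<close>, hence in \<open>A\<close>,
  so gluing in \<open>E\<close> imposes no relation; and it creates no generator because the overlap
  is connected. Asking for \<open>I\<close> rather than for a simply connected overlap is essential: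
  at the top vertex the overlap is a punctured plane times an interval.\<close>

lemma freely_generated_cap:
  fixes A E :: "'a::real_normed_vector set"
  assumes fr: "freely_generated A a" and op: "open A" "open E" and E: "simply_connected E"
    and AE: "path_connected (A \<inter> E)" "A \<inter> E \<noteq> {}" and I: "A \<inter> E \<subseteq> I" "I \<subseteq> A" "simply_connected I"
  shows "freely_generated (A \<union> E) a"
proof -
  let ?M = "A \<union> E"
  obtain k x where pc: "path_connected A" "a \<in> A" and x: "\<forall>i<k. loopin A a (x i)"
    and g: "\<forall>p. loopin A a p \<longrightarrow> gen A a (x ` {..<k}) p"
    and u: "\<forall>g :: nat \<Rightarrow> word_perm. \<exists>f. loop_hom A a f \<and> (\<forall>i<k. f (x i) = g i)"
    using fr unfolding freely_generated_def by blast
  obtain e0 where e0: "e0 \<in> A" "e0 \<in> E" using AE by blast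
  have pcM: "path_connected ?M"
    using path_connected_Un[OF pc(1) simply_connected_imp_path_connected[OF E]] e0 by blast
  have x': "loopin ?M a (x i)" if "i < k" for i using x loopin_mono[of A a "x i" ?M] that by blast
  have LA: "gen ?M a (x ` {..<k}) p" if "loopin A a p" for p
    using g that by (blast intro: gen_mono)
  have G: "gen ?M a (x ` {..<k}) p" if "loopin ?M a p" for p
  proof (rule gen_vk[OF op pc E _ LA _ that])
    show "e0 \<in> A \<inter> E" using e0 by blast
    fix P assume P: "P \<in> A \<inter> E"
    obtain c where c: "path c" "path_image c \<subseteq> A" "pathstart c = a" "pathfinish c = P"
      using pc P unfolding path_connected_def by blast
    obtain c' where c': "path c'" "path_image c' \<subseteq> A" "pathstart c' = a" "pathfinish c' = e0"
      using pc e0 unfolding path_connected_def by blast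
    obtain q where q: "path q" "path_image q \<subseteq> A \<inter> E" "pathstart q = P" "pathfinish q = e0"
      using AE P e0 unfolding path_connected_def by blast
    have "gen ?M a (x ` {..<k}) (c +++ (q +++ reversepath c'))"
      using c c' q by (intro LA) (auto simp: loopin_def path_image_join)
    then show "\<exists>c q c'. path c \<and> path_image c \<subseteq> A \<and> pathstart c = a \<and> pathfinish c = P \<and>
        path q \<and> path_image q \<subseteq> E \<and> pathstart q = P \<and> pathfinish q = e0 \<and>
        path c' \<and> path_image c' \<subseteq> A \<and> pathstart c' = a \<and> pathfinish c' = e0 \<and>
        gen ?M a (x ` {..<k}) (c +++ (q +++ reversepath c'))"
      using c c' q by (intro exI[of _ c] exI[of _ q] exI[of _ c']) auto
  qed
  have U: "\<exists>f. loop_hom ?M a f \<and> (\<forall>i<k. f (x i) = h i)" for h :: "nat \<Rightarrow> word_perm"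
  proof -
    obtain f where f: "loop_hom A a f" "\<forall>i<k. f (x i) = h i" using u by blast
    obtain F where F: "path_functor A F" and Ff: "\<And>p. loopin A a p \<Longrightarrow> F p = f p"
      using loop_hom_functor[OF pc f(1)] by metis
    have eI: "e0 \<in> I" using e0 I by blast
    have "\<exists>c. path c \<and> path_image c \<subseteq> I \<and> pathstart c = e0 \<and> pathfinish c = P" if "P \<in> I" for P
      using simply_connected_imp_path_connected[OF I(3)] eI that unfolding path_connected_def by blast
    then obtain c where c: "\<And>P. P \<in> I \<Longrightarrow> path (c P) \<and> path_image (c P) \<subseteq> I \<and> pathstart (c P) = e0 \<and> pathfinish (c P) = P"
      by metis
    \<comment> \<open>Paths in \<open>I\<close> with the same ends are homotopic in
      \<open>I\<close>, so \<open>F\<close> has a potential there.\<close>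
    define s where "s P = F (c P)" for P
    have sF: "F p = - s (pathstart p) + s (pathfinish p)" if p: "path p" "path_image p \<subseteq> A \<inter> E" for p
    proof -
      have pI: "path_image p \<subseteq> I" using p I by blast
      have e: "pathstart p \<in> I" "pathfinish p \<in> I" using pI pathstart_in_path_image pathfinish_in_path_image by blast+
      have "homotopic_paths I (c (pathstart p) +++ p) (c (pathfinish p))"
        using I(3) p pI c[OF e(1)] c[OF e(2)] unfolding simply_connected_eq_homotopic_paths
        by (auto simp: path_image_join)
      then have "F (c (pathstart p) +++ p) = F (c (pathfinish p))"
        using path_functor_homotopic[OF path_functor_mono[OF F I(2)]] by blast
      moreover have "F (c (pathstart p) +++ p) = F (c (pathstart p)) + F p"
        by (rule path_functor_join[OF F]) (use p pI c[OF e(1)] I in auto)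
      ultimately show ?thesis unfolding s_def by (metis add.assoc add_0 left_minus)
    qed
    obtain H where H: "path_functor ?M H" "\<And>p. path p \<Longrightarrow> path_image p \<subseteq> A \<Longrightarrow> H p = F p"
      using path_functor_extend[OF op F sF] by blast
    have "H (x i) = h i" if "i < k" for i
      using H(2)[of "x i"] Ff[of "x i"] x f(2) that by (simp add: loopin_def)
    then show ?thesis using functor_loop_hom[OF H(1)] by blast
  qed
  show ?thesis unfolding freely_generated_def
    using pcM pc(2) x' G U by (intro conjI exI[of _ k] exI[of _ x]) auto
qed

lemma freely_generated_simply_connected:
  fixes M :: "'a::real_normed_vector set"
  assumes "simply_connected M" "a \<in> M"
  shows "freely_generated M a"
  unfolding freely_generated_def
proof (intro conjI exI[of _ "0::nat"] exI[of _ "\<lambda>_. linepath a a"])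
  show "path_connected M" "a \<in> M" using assms simply_connected_imp_path_connected by auto
  show "\<forall>p. loopin M a p \<longrightarrow> gen M a ((\<lambda>_. linepath a a) ` {..<0::nat}) p"
  proof (intro allI impI)
    fix p assume "loopin M a p"
    then have "homotopic_paths M (linepath a a) p"
      using assms unfolding simply_connected_eq_homotopic_paths loopin_def by auto
    then show "gen M a ((\<lambda>_. linepath a a) ` {..<0::nat}) p"
      using gen_const[OF assms(2)] gen_hom by blast
  qed
  show "\<forall>g :: nat \<Rightarrow> word_perm. \<exists>f. loop_hom M a f \<and> (\<forall>i<0. f (linepath a a) = g i)"
    by (auto intro!: exI[of _ "\<lambda>_. 0"] simp: loop_hom_def)
qed auto

lemma freely_generated_base:
  fixes M :: "'a::real_normed_vector set"
  assumes "freely_generated M a" "b \<in> M"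
  shows "freely_generated M b"
proof -
  obtain k x where pc: "path_connected M" "a \<in> M" and x: "\<forall>i<k. loopin M a (x i)"
    and g: "\<forall>p. loopin M a p \<longrightarrow> gen M a (x ` {..<k}) p"
    and u: "\<forall>g :: nat \<Rightarrow> word_perm. \<exists>f. loop_hom M a f \<and> (\<forall>i<k. f (x i) = g i)"
    using assms(1) unfolding freely_generated_def by blast
  obtain c where c: "path c" "path_image c \<subseteq> M" "pathstart c = b" "pathfinish c = a"
    using pc assms(2) unfolding path_connected_def by blast
  define conj where "conj p = c +++ (p +++ reversepath c)" for p
  have rc: "rep M c b [c] a" "rep M (reversepath c) a [reversepath c] b" using c by (auto intro!: rep_single)
  have rp: "rep M p a [p] a" if "loopin M a p" for p using that by (auto intro!: rep_single simp: loopin_def)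
  have rconj: "rep M (conj p) b ([c] @ [p] @ [reversepath c]) b" if "loopin M a p" for p
    unfolding conj_def by (rule rep_join[OF rc(1) rep_join[OF rp[OF that] rc(2)]])
  have lconj: "loopin M b (conj p)" if "loopin M a p" for p
    using rep_ends[OF rconj[OF that]] by (simp add: loopin_def)
  have C: "gen M b ((conj \<circ> x) ` {..<k}) (conj p)" if "gen M a (x ` {..<k}) p" for p
    using that
  proof (induction rule: gen.induct)
    case (gen_base p)
    then show ?case using lconj by (intro gen.gen_base) auto
  next
    case gen_const
    have "rep M (conj (linepath a a)) b ([c] @ [] @ [reversepath c]) b"
      unfolding conj_def by (rule rep_join[OF rc(1) rep_join[OF rep_nil[OF pc(2)] rc(2)]])
    then have "rep M (conj (linepath a a)) b ([] @ c # reversepath c # []) b" by simp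
    then have "rep M (conj (linepath a a)) b ([] @ []) b" by (rule rep_cancel) simp
    then have "homotopic_paths M (linepath b b) (conj (linepath a a))"
      using rep_nil[OF assms(2)] by (auto intro: rep_eq)
    then show ?case by (rule gen.gen_hom[OF gen.gen_const[OF assms(2)]])
  next
    case (gen_rev p)
    have p: "loopin M a p" using gen_loop[OF gen_rev(1)] .
    have pr: "loopin M a (reversepath p)" using p by (simp add: loopin_def)
    have e: "reversepath (conj p) = (c +++ reversepath p) +++ reversepath c"
      unfolding conj_def using c p by (simp add: reversepath_joinpaths loopin_def)
    have "rep M (reversepath (conj p)) b (([c] @ [reversepath p]) @ [reversepath c]) b"
      unfolding e by (rule rep_join[OF rep_join[OF rc(1) rp[OF pr]] rc(2)])
    then have "homotopic_paths M (reversepath (conj p)) (conj (reversepath p))"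
      using rconj[OF pr] by (auto intro: rep_eq)
    then show ?case using gen_rev by (blast intro: gen.gen_hom gen.gen_rev)
  next
    case (gen_join p q)
    have pq: "loopin M a p" "loopin M a q" using gen_loop gen_join by blast+
    have "rep M (conj p +++ conj q) b ([c, p] @ reversepath c # c # [q, reversepath c]) b"
      using rep_join[OF rconj[OF pq(1)] rconj[OF pq(2)]] by simp
    then have "rep M (conj p +++ conj q) b ([c, p] @ [q, reversepath c]) b" by (rule rep_cancel) simp
    moreover have "rep M (conj (p +++ q)) b ([c] @ ([p] @ [q]) @ [reversepath c]) b"
      unfolding conj_def by (rule rep_join[OF rc(1) rep_join[OF rep_join[OF rp[OF pq(1)] rp[OF pq(2)]] rc(2)]])
    ultimately have "homotopic_paths M (conj p +++ conj q) (conj (p +++ q))" by (auto intro: rep_eq)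
    then show ?case using gen_join by (blast intro: gen.gen_hom gen.gen_join)
  next
    case (gen_hom p q)
    have "homotopic_paths M (conj p) (conj q)"
      using gen_hom(2) gen_loop[OF gen_hom(1)] c unfolding conj_def
      by (auto intro!: homotopic_paths_join simp: loopin_def dest: homotopic_paths_imp_pathfinish)
    then show ?case using gen_hom by (blast intro: gen.gen_hom)
  qed
  have G: "gen M b ((conj \<circ> x) ` {..<k}) p" if p: "loopin M b p" for p
  proof -
    let ?q = "reversepath c +++ (p +++ c)"
    have rb: "rep M p b [p] b" using p by (auto intro!: rep_single simp: loopin_def)
    have rq: "rep M ?q a ([reversepath c] @ [p] @ [c]) a"
      by (rule rep_join[OF rc(2) rep_join[OF rb rc(1)]])
    have q: "loopin M a ?q" using rep_ends[OF rq] by (simp add: loopin_def)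
    have "rep M (conj ?q) b ([c] @ ([reversepath c] @ [p] @ [c]) @ [reversepath c]) b"
      unfolding conj_def by (rule rep_join[OF rc(1) rep_join[OF rq rc(2)]])
    then have "rep M (conj ?q) b ([] @ c # reversepath c # [p, c, reversepath c]) b" by simp
    then have "rep M (conj ?q) b ([] @ [p, c, reversepath c]) b" by (rule rep_cancel) simp
    then have "rep M (conj ?q) b ([p] @ c # reversepath c # []) b" by simp
    then have "rep M (conj ?q) b ([p] @ []) b" by (rule rep_cancel) simp
    then have "homotopic_paths M (conj ?q) p" using rb by (auto intro: rep_eq)
    then show ?thesis using C g q by (blast intro: gen_hom)
  qed
  have U: "\<exists>f. loop_hom M b f \<and> (\<forall>i<k. f ((conj \<circ> x) i) = h i)" for h :: "nat \<Rightarrow> word_perm"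
  proof -
    obtain f where f: "loop_hom M a f" "\<forall>i<k. f (x i) = h i" using u by blast
    obtain F where F: "path_functor M F" and Ff: "\<And>p. loopin M a p \<Longrightarrow> F p = f p"
      using loop_hom_functor[OF pc f(1)] by metis
    define H where "H p = - F c + F p + F c" for p
    have "loop_hom M b H" unfolding loop_hom_def
    proof (intro conjI allI impI)
      show "H p = H q" if "loopin M b p \<and> homotopic_paths M p q" for p q
        using path_functor_homotopic[OF F] that by (simp add: H_def)
      show "H (p +++ q) = H p + H q" if "loopin M b p \<and> loopin M b q" for p q
      proof -
        have "F (p +++ q) = F p + F q"
          by (rule path_functor_join[OF F]) (use that in \<open>auto simp: loopin_def\<close>)
        then show ?thesis by (simp only: H_def add.assoc add_minus_cancel)
      qed
    qed
    moreover have "H ((conj \<circ> x) i) = h i" if i: "i < k" for i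
    proof -
      have l: "loopin M a (x i)" using x i by blast
      have "F (conj (x i)) = F c + (F (x i) + - F c)"
        unfolding conj_def using c l
        by (simp add: path_functor_join[OF F] path_functor_reverse[OF F] loopin_def path_image_join)
      then show ?thesis using Ff[OF l] f(2) i by (simp add: H_def add.assoc)
    qed
    ultimately show ?thesis by blast
  qed
  show ?thesis unfolding freely_generated_def
    using pc(1) assms(2) lconj x G U by (intro conjI exI[of _ k] exI[of _ "conj \<circ> x"]) auto
qed

section \<open>Freeness of the fundamental group\<close>

lemma path_class_eq_iff: "path p \<Longrightarrow> path_image p \<subseteq> M \<Longrightarrow> path_class M p = path_class M q \<longleftrightarrow> homotopic_paths M p q"
  unfolding path_class_def
  by (metis (no_types, lifting) homotopic_paths_refl homotopic_paths_sym homotopic_paths_trans mem_Collect_eq Collect_cong)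

context
  fixes M :: "'a::real_normed_vector set" and a :: 'a
  assumes aM: "a \<in> M"
begin

lemma carrier_pi1: "carrier (fundamental_group M a) = {path_class M p | p. loopin M a p}"
  by (simp add: fundamental_group_def loopin_def)

lemma path_class_in [simp]: "loopin M a p \<Longrightarrow> path_class M p \<in> carrier (fundamental_group M a)"
  unfolding carrier_pi1 by blast

lemma path_class_eq: "loopin M a p \<Longrightarrow> path_class M p = path_class M q \<longleftrightarrow> homotopic_paths M p q"
  by (rule path_class_eq_iff) (auto simp: loopin_def)

lemma mult_pi1:
  assumes p: "loopin M a p" and q: "loopin M a q"
  shows "path_class M p \<otimes>\<^bsub>fundamental_group M a\<^esub> path_class M q = path_class M (p +++ q)"
proof -
  have some: "homotopic_paths M r (SOME s. s \<in> path_class M r)" if "loopin M a r" for r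
  proof -
    have "r \<in> path_class M r" using that by (simp add: path_class_def loopin_def)
    then have "(SOME s. s \<in> path_class M r) \<in> path_class M r" by (rule someI[where P="\<lambda>s. s \<in> path_class M r"])
    then show ?thesis by (simp add: path_class_def)
  qed
  have "homotopic_paths M (p +++ q) ((SOME s. s \<in> path_class M p) +++ (SOME s. s \<in> path_class M q))"
    using p q by (intro homotopic_paths_join some) (auto simp: loopin_def)
  then have "path_class M (p +++ q) = path_class M ((SOME s. s \<in> path_class M p) +++ (SOME s. s \<in> path_class M q))"
    using path_class_eq[OF loopin_join[OF p q]] by blast
  then show ?thesis by (simp add: fundamental_group_def)
qed

lemma loopin_const: "loopin M a (linepath a a)"
  using aM by (simp add: loopin_def)

lemma one_pi1: "\<one>\<^bsub>fundamental_group M a\<^esub> = path_class M (linepath a a)"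
  by (simp add: fundamental_group_def linepath_refl)

lemma loopin_rev: "loopin M a p \<Longrightarrow> loopin M a (reversepath p)"
  by (simp add: loopin_def)

lemma group_pi1: "group (fundamental_group M a)"
proof (rule groupI)
  let ?G = "fundamental_group M a"
  show "x \<otimes>\<^bsub>?G\<^esub> y \<in> carrier ?G" if "x \<in> carrier ?G" "y \<in> carrier ?G" for x y
    using that mult_pi1 loopin_join unfolding carrier_pi1 by fastforce
  show "\<one>\<^bsub>?G\<^esub> \<in> carrier ?G" unfolding one_pi1 using loopin_const by simp
  fix x assume "x \<in> carrier ?G"
  then obtain p where p: "loopin M a p" "x = path_class M p" unfolding carrier_pi1 by blast
  show "\<one>\<^bsub>?G\<^esub> \<otimes>\<^bsub>?G\<^esub> x = x"
    unfolding one_pi1 p(2) mult_pi1[OF loopin_const p(1)] path_class_eq[OF loopin_join[OF loopin_const p(1)]]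
    using p(1) by (intro homotopic_paths_lid') (auto simp: loopin_def)
  have "path_class M (reversepath p) \<otimes>\<^bsub>?G\<^esub> x = \<one>\<^bsub>?G\<^esub>"
    unfolding one_pi1 p(2) mult_pi1[OF loopin_rev[OF p(1)] p(1)] path_class_eq[OF loopin_join[OF loopin_rev[OF p(1)] p(1)]]
    using p(1) homotopic_paths_linv[of p M] by (auto simp: loopin_def)
  then show "\<exists>y\<in>carrier ?G. y \<otimes>\<^bsub>?G\<^esub> x = \<one>\<^bsub>?G\<^esub>" using loopin_rev[OF p(1)] path_class_in by blast
next
  let ?G = "fundamental_group M a"
  fix x y z assume "x \<in> carrier ?G" "y \<in> carrier ?G" "z \<in> carrier ?G"
  then obtain p q r where p: "loopin M a p" "x = path_class M p" and q: "loopin M a q" "y = path_class M q"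
    and r: "loopin M a r" "z = path_class M r" unfolding carrier_pi1 by blast
  have "homotopic_paths M ((p +++ q) +++ r) (p +++ (q +++ r))"
    by (rule homotopic_paths_sym[OF homotopic_paths_assoc]) (use p q r in \<open>auto simp: loopin_def\<close>)
  then show "(x \<otimes>\<^bsub>?G\<^esub> y) \<otimes>\<^bsub>?G\<^esub> z = x \<otimes>\<^bsub>?G\<^esub> (y \<otimes>\<^bsub>?G\<^esub> z)"
    using p q r by (simp add: mult_pi1 loopin_join path_class_eq)
qed

lemma inv_pi1:
  assumes p: "loopin M a p"
  shows "inv\<^bsub>fundamental_group M a\<^esub> path_class M p = path_class M (reversepath p)"
proof (rule group.inv_equality[OF group_pi1])
  show "path_class M (reversepath p) \<otimes>\<^bsub>fundamental_group M a\<^esub> path_class M p = \<one>\<^bsub>fundamental_group M a\<^esub>"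
    unfolding one_pi1 mult_pi1[OF loopin_rev[OF p] p] path_class_eq[OF loopin_join[OF loopin_rev[OF p] p]]
    using p homotopic_paths_linv[of p M] by (auto simp: loopin_def)
qed (use p loopin_rev in auto)

lemma loop_hom_const:
  fixes f :: "(real \<Rightarrow> 'a) \<Rightarrow> 'h::group_add"
  assumes "loop_hom M a f"
  shows "f (linepath a a) = 0"
proof -
  have "f (linepath a a +++ linepath a a) = f (linepath a a)"
    using assms loopin_join[OF loopin_const loopin_const] homotopic_paths_rid'[of "linepath a a" M a] loopin_const
    unfolding loop_hom_def by (auto simp: loopin_def)
  moreover have "f (linepath a a +++ linepath a a) = f (linepath a a) + f (linepath a a)"
    using assms loopin_const unfolding loop_hom_def by blast
  ultimately show ?thesis using add_left_cancel[of "f (linepath a a)" "f (linepath a a)" 0] by simp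
qed

lemma loop_hom_rev:
  fixes f :: "(real \<Rightarrow> 'a) \<Rightarrow> 'h::group_add"
  assumes f: "loop_hom M a f" and p: "loopin M a p"
  shows "f (reversepath p) = - f p"
proof -
  have "homotopic_paths M (p +++ reversepath p) (linepath a a)"
    using homotopic_paths_rinv[of p M] p by (auto simp: loopin_def)
  then have "f (p +++ reversepath p) = 0"
    using f loop_hom_const[OF f] loopin_join[OF p loopin_rev[OF p]] unfolding loop_hom_def by metis
  moreover have "f (p +++ reversepath p) = f p + f (reversepath p)"
    using f p loopin_rev unfolding loop_hom_def by blast
  ultimately show ?thesis by (metis minus_unique)
qed

lemma reduced_word_map:
  assumes "reduced_word w" "inj_on h (snd ` set w)"
  shows "reduced_word (map (\<lambda>(b, x). (b, h x)) w)"
  using assms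
proof (induction w rule: reduced_word.induct)
  case (1 b x c y w)
  then show ?case by (auto simp: inj_on_def)
qed auto

text \<open>The homomorphism that sends the generators to letter permutations is evaluated on a
  reduced word and applied to the empty word. It returns the word itself, whereas the trivial class
  would return the empty word.\<close>

lemma is_free_group_pi1:
  assumes fr: "freely_generated M a"
  shows "is_free_group (fundamental_group M a)"
proof -
  let ?G = "fundamental_group M a"
  obtain k x where x: "\<forall>i<k. loopin M a (x i)"
    and g: "\<forall>p. loopin M a p \<longrightarrow> gen M a (x ` {..<k}) p"
    and u: "\<forall>g :: nat \<Rightarrow> word_perm. \<exists>f. loop_hom M a f \<and> (\<forall>i<k. f (x i) = g i)"
    using fr unfolding freely_generated_def by blast
  obtain f where f: "loop_hom M a f" "\<forall>i<k. f (x i) = letter_perm i" using u by blast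
  define X where "X = (\<lambda>i. path_class M (x i)) ` {..<k}"
  have X: "X \<subseteq> carrier ?G" using x by (auto simp: X_def)
  have "path_class M p \<in> generate ?G X" if "gen M a (x ` {..<k}) p" for p
    using that
  proof (induction rule: gen.induct)
    case (gen_base p)
    then show ?case by (intro generate.incl) (auto simp: X_def)
  next
    case gen_const
    then show ?case using generate.one[of ?G X] by (simp add: one_pi1)
  next
    case (gen_rev p)
    then show ?case
      using group.generate_m_inv_closed[OF group_pi1 X] inv_pi1[OF gen_loop[OF gen_rev(1)]] by fastforce
  next
    case (gen_join p q)
    then show ?case
      using generate.eng[of _ ?G X] mult_pi1[OF gen_loop[OF gen_join(1)] gen_loop[OF gen_join(2)]] by metis
  next
    case (gen_hom p q)
    then show ?case using path_class_eq[OF gen_loop[OF gen_hom(1)]] by metis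
  qed
  then have gen: "generate ?G X = carrier ?G"
    using g group.generate_incl[OF group_pi1 X] unfolding carrier_pi1 by blast
  \<comment> \<open>Letters are homotopy classes here but indices in \<open>word_perm\<close>. A
    class is recovered from its index, so \<open>idx\<close> is injective on \<open>X\<close> and
    keeps words reduced.\<close>
  define idx where "idx c = (SOME i. i < k \<and> c = path_class M (x i))" for c
  have idx: "idx c < k \<and> c = path_class M (x (idx c))" if "c \<in> X" for c
    unfolding idx_def by (rule someI_ex) (use that in \<open>auto simp: X_def\<close>)
  have word: "\<exists>p. loopin M a p \<and> eval_word ?G w = path_class M p \<and>
      f p = sum_list (map (\<lambda>(b, i). signed b (letter_perm i)) (map (\<lambda>(b, c). (b, idx c)) w))"
    if "snd ` set w \<subseteq> X" for w
    using that
  proof (induction w)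
    case Nil
    then show ?case using loopin_const loop_hom_const[OF f(1)] by (auto simp: one_pi1 intro!: exI[of _ "linepath a a"])
  next
    case (Cons l w)
    obtain b c where l: "l = (b, c)" by (cases l)
    have c: "c \<in> X" using Cons.prems l by simp
    obtain p where p: "loopin M a p" "eval_word ?G w = path_class M p"
       "f p = sum_list (map (\<lambda>(b, i). signed b (letter_perm i)) (map (\<lambda>(b, c). (b, idx c)) w))"
      using Cons by auto
    define q where "q = (if b then x (idx c) else reversepath (x (idx c)))"
    have xi: "loopin M a (x (idx c))" using x idx[OF c] by blast
    have q: "loopin M a q" using xi loopin_rev by (simp add: q_def)
    have cq: "(if b then c else inv\<^bsub>?G\<^esub> c) = path_class M q"
      using idx[OF c] inv_pi1[OF xi] by (auto simp: q_def)
    have fq: "f q = signed b (letter_perm (idx c))"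
      using f(2) idx[OF c] loop_hom_rev[OF f(1) xi] by (simp add: q_def signed_def)
    have "f (q +++ p) = f q + f p" using f(1) q p(1) unfolding loop_hom_def by blast
    then show ?case
      using l cq fq p mult_pi1[OF q p(1)] loopin_join[OF q p(1)]
      by (intro exI[of _ "q +++ p"]) simp
  qed
  have "eval_word ?G w \<noteq> \<one>\<^bsub>?G\<^esub>" if w: "w \<noteq> []" "snd ` set w \<subseteq> X" "reduced_word w" for w
  proof
    assume one: "eval_word ?G w = \<one>\<^bsub>?G\<^esub>"
    let ?v = "map (\<lambda>(b, c). (b, idx c)) w"
    obtain p where p: "loopin M a p" "eval_word ?G w = path_class M p"
      "f p = sum_list (map (\<lambda>(b, i). signed b (letter_perm i)) ?v)" using word[OF w(2)] by blast
    have "homotopic_paths M p (linepath a a)" using one p path_class_eq unfolding one_pi1 by metis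
    then have "f p = 0" using f(1) p(1) loop_hom_const[OF f(1)] unfolding loop_hom_def by metis
    moreover have "inj_on idx (snd ` set w)" by (rule inj_onI) (metis idx subsetD w(2))
    then have "reduced_word ?v" by (rule reduced_word_map[OF w(3)])
    ultimately have "bij_fun (0 :: word_perm) [] = ?v" using word_perm_Nil p(3) by metis
    then show False using w(1) by (simp add: zero_bijection.rep_eq)
  qed
  then show ?thesis unfolding is_free_group_def using group_pi1 X gen by blast
qed

end

text \<open>Serves the linear change of coordinates that turns a chosen direction into the
  height.\<close>

lemma freely_generated_homeomorphic:
  fixes T :: "'a::real_normed_vector \<Rightarrow> 'b::real_normed_vector"
  assumes fr: "freely_generated (T ` M) (T a)" and a: "a \<in> M"
    and T: "continuous_on M T" and S: "continuous_on (T ` M) S" "\<And>x. x \<in> M \<Longrightarrow> S (T x) = x"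
  shows "freely_generated M a"
proof -
  let ?N = "T ` M"
  obtain k x where pc: "path_connected ?N" and x: "\<forall>i<k. loopin ?N (T a) (x i)"
    and g: "\<forall>p. loopin ?N (T a) p \<longrightarrow> gen ?N (T a) (x ` {..<k}) p"
    and u: "\<forall>g :: nat \<Rightarrow> word_perm. \<exists>f. loop_hom ?N (T a) f \<and> (\<forall>i<k. f (x i) = g i)"
    using fr unfolding freely_generated_def by blast
  have SN: "S ` ?N = M" using S(2) by force
  have lS: "loopin M a (S \<circ> p)" if p: "loopin ?N (T a) p" for p
    unfolding loopin_def
  proof (intro conjI)
    show "path (S \<circ> p)"
      using p by (intro path_continuous_image continuous_on_subset[OF S(1)]) (auto simp: loopin_def)
    show "path_image (S \<circ> p) \<subseteq> M"
      using p image_mono[of "path_image p" ?N S] SN by (simp add: path_image_compose loopin_def)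
  qed (use p S(2)[OF a] in \<open>auto simp: loopin_def pathstart_compose pathfinish_compose\<close>)
  have lT: "loopin ?N (T a) (T \<circ> p)" if "loopin M a p" for p
    using that
    by (auto simp: loopin_def path_image_compose pathstart_compose pathfinish_compose intro!: path_continuous_image continuous_on_subset[OF T])
  have hS: "homotopic_paths M (S \<circ> p) (S \<circ> q)" if "homotopic_paths ?N p q" for p q
    by (rule homotopic_paths_continuous_image[OF that S(1)]) (use SN in auto)
  have hT: "homotopic_paths ?N (T \<circ> p) (T \<circ> q)" if "homotopic_paths M p q" for p q
    by (rule homotopic_paths_continuous_image[OF that T]) auto
  have G: "gen M a ((\<lambda>i. S \<circ> x i) ` {..<k}) (S \<circ> p)" if "gen ?N (T a) (x ` {..<k}) p" for p
    using that
  proof (induction rule: gen.induct)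
    case (gen_base p)
    then have "S \<circ> p \<in> (\<lambda>i. S \<circ> x i) ` {..<k}" by blast
    then show ?case using lS[OF gen_base(2)] by (rule gen.gen_base)
  next
    case gen_const
    have "S \<circ> linepath (T a) (T a) = linepath a a" using S(2)[OF a] by (auto simp: linepath_refl)
    then show ?case using gen.gen_const[OF a] by metis
  next
    case (gen_rev p)
    then show ?case using gen.gen_rev by (fastforce simp: reversepath_o[symmetric] reversepath_def comp_def)
  next
    case (gen_join p q)
    then show ?case using gen.gen_join by (metis path_compose_join)
  next
    case (gen_hom p q)
    then show ?case using gen.gen_hom hS by blast
  qed
  have ST: "homotopic_paths M p (S \<circ> (T \<circ> p))" if p: "loopin M a p" for p
  proof (rule homotopic_paths_eq)
    fix t :: real assume "t \<in> {0..1}"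
    then have "p t \<in> M" using p by (auto simp: loopin_def path_image_def)
    then show "p t = (S \<circ> (T \<circ> p)) t" using S(2) by auto
  qed (use p in \<open>auto simp: loopin_def\<close>)
  have TS: "homotopic_paths ?N p (T \<circ> (S \<circ> p))" if "loopin ?N (T a) p" for p
  proof (rule homotopic_paths_eq)
    fix t :: real assume "t \<in> {0..1}"
    then have "p t \<in> ?N" using that by (auto simp: loopin_def path_image_def)
    then show "p t = (T \<circ> (S \<circ> p)) t" using S(2) by auto
  qed (use that in \<open>auto simp: loopin_def\<close>)
  have gM: "gen M a ((\<lambda>i. S \<circ> x i) ` {..<k}) p" if p: "loopin M a p" for p
    using G g lT[OF p] ST[OF p] by (blast intro: gen_hom homotopic_paths_sym)
  have U: "\<exists>f. loop_hom M a f \<and> (\<forall>i<k. f (S \<circ> x i) = h i)" for h :: "nat \<Rightarrow> word_perm"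
  proof -
    obtain f where f: "loop_hom ?N (T a) f" "\<forall>i<k. f (x i) = h i" using u by blast
    have "loop_hom M a (\<lambda>p. f (T \<circ> p))"
      unfolding loop_hom_def
    proof (intro conjI allI impI)
      show "f (T \<circ> p) = f (T \<circ> q)" if "loopin M a p \<and> homotopic_paths M p q" for p q
        using f(1) lT[of p] hT[of p q] that unfolding loop_hom_def by blast
      show "f (T \<circ> (p +++ q)) = f (T \<circ> p) + f (T \<circ> q)" if "loopin M a p \<and> loopin M a q" for p q
        using f(1) lT that unfolding loop_hom_def path_compose_join by blast
    qed
    moreover have "f (T \<circ> (S \<circ> x i)) = h i" if "i < k" for i
      using f TS[of "x i"] x that unfolding loop_hom_def by metis
    ultimately show ?thesis by blast
  qed
  have "path_connected M" using path_connected_continuous_image[OF S(1) pc] SN by simp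
  then show ?thesis unfolding freely_generated_def
    using a lS x gM U by (intro conjI exI[of _ k] exI[of _ "\<lambda>i. S \<circ> x i"]) auto
qed

section \<open>Strands\<close>

text \<open>Two deformations in succession; the second need only be defined on \<open>B'\<close>,
  where the first one ends. In the sweep the first moves points horizontally and the second
  vertically.\<close>

lemma pi1_eq_deform2:
  fixes A B B' :: "'a::real_normed_vector set" and F G :: "real \<Rightarrow> 'a \<Rightarrow> 'a"
  assumes AB: "A \<subseteq> B'" "B' \<subseteq> B" "a \<in> A"
    and F: "continuous_on ({0..1} \<times> B) (\<lambda>y. F (fst y) (snd y))" "\<And>x. F 0 x = x"
      "\<And>s x. s \<in> {0..1} \<Longrightarrow> x \<in> B \<Longrightarrow> F s x \<in> B" "\<And>s x. s \<in> {0..1} \<Longrightarrow> x \<in> A \<Longrightarrow> F s x \<in> A"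
      "\<And>s. s \<in> {0..1} \<Longrightarrow> F s a = a" "\<And>x. x \<in> B \<Longrightarrow> F 1 x \<in> B'"
    and G: "continuous_on ({0..1} \<times> B') (\<lambda>y. G (fst y) (snd y))" "\<And>x. G 0 x = x"
      "\<And>s x. s \<in> {0..1} \<Longrightarrow> x \<in> B' \<Longrightarrow> G s x \<in> B" "\<And>s x. s \<in> {0..1} \<Longrightarrow> x \<in> A \<Longrightarrow> G s x \<in> A"
      "\<And>s. s \<in> {0..1} \<Longrightarrow> G s a = a" "\<And>x. x \<in> B' \<Longrightarrow> G 1 x \<in> A"
  shows "pi1_eq A B a" and "path_connected B \<Longrightarrow> path_connected A"
proof -
  let ?P = "\<lambda>h. h ` A \<subseteq> A \<and> h a = a"
  have h1: "homotopic_with_canon ?P B B id (F 1)"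
    unfolding homotopic_with_def
  proof (intro exI[of _ "\<lambda>y. F (fst y) (snd y)"] conjI allI ballI)
    show "continuous_map (prod_topology (top_of_set {0..1}) (top_of_set B)) (top_of_set B) (\<lambda>y. F (fst y) (snd y))"
      using F(1,3) by (auto simp: image_subset_iff)
  qed (use F in auto)
  have "continuous_on ({0..1} \<times> B) (\<lambda>y. G (fst y) (F 1 (snd y)))"
  proof (rule continuous_on_compose2[OF G(1), where f="\<lambda>y. (fst y, F 1 (snd y))", simplified])
    have "continuous_on ({0..1::real} \<times> B) (\<lambda>y. F 1 (snd y))"
    proof (rule continuous_on_compose2[OF F(1), where f="\<lambda>y. (1, snd y)", simplified])
      show "continuous_on ({0..1::real} \<times> B) (\<lambda>x. (1::real, snd x))"
        by (intro continuous_intros)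
    qed auto
    then show "continuous_on ({0..1::real} \<times> B) (\<lambda>y. (fst y, F 1 (snd y)))"
      by (intro continuous_on_Pair continuous_on_fst continuous_on_id)
    show "(\<lambda>y. (fst y, F 1 (snd y))) ` ({0..1} \<times> B) \<subseteq> {0..1} \<times> B'" using F(6) by auto
  qed
  then have cG: "continuous_map (prod_topology (top_of_set {0..1}) (top_of_set B)) (top_of_set B) (\<lambda>y. G (fst y) (F 1 (snd y)))"
    using G(3) F(6) by (auto simp: image_subset_iff)
  have h2: "homotopic_with_canon ?P B B (F 1) (\<lambda>x. G 1 (F 1 x))"
    unfolding homotopic_with_def
  proof (intro exI[of _ "\<lambda>y. G (fst y) (F 1 (snd y))"] conjI allI ballI cG)
    fix s :: real assume s: "s \<in> {0..1}"
    show "(\<lambda>x. G (fst (s, x)) (F 1 (snd (s, x)))) ` A \<subseteq> A" using F(4)[of 1] G(4)[OF s] by auto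
    show "G (fst (s, a)) (F 1 (snd (s, a))) = a" using F(5)[of 1] G(5)[OF s] by simp
  qed (use G in auto)
  have "homotopic_with_canon ?P B B id (\<lambda>x. G 1 (F 1 x))"
    using homotopic_with_trans[OF h1 h2] .
  moreover have "(\<lambda>x. G 1 (F 1 x)) ` B \<subseteq> A" using F(6) G(6) by auto
  ultimately show "pi1_eq A B a" "path_connected B \<Longrightarrow> path_connected A"
    using pi1_eq_deform[of A a B "\<lambda>x. G 1 (F 1 x)"] AB by blast+
qed

definition affine_fun :: "('a::real_vector \<Rightarrow> real) \<Rightarrow> bool" where
  "affine_fun f \<longleftrightarrow> (\<forall>x y u. f ((1 - u) *\<^sub>R x + u *\<^sub>R y) = (1 - u) * f x + u * f y)"

lemma affine_fun_diff: "affine_fun f \<Longrightarrow> affine_fun h \<Longrightarrow> affine_fun (\<lambda>x. f x - h x)"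
  by (simp add: affine_fun_def algebra_simps)

lemma affine_fun_scale:
  assumes "affine_fun f"
  shows "affine_fun (\<lambda>x. c * f x)"
  unfolding affine_fun_def
proof (intro allI)
  fix x y u
  have "f ((1 - u) *\<^sub>R x + u *\<^sub>R y) = (1 - u) * f x + u * f y" using assms by (simp only: affine_fun_def)
  then show "c * f ((1 - u) *\<^sub>R x + u *\<^sub>R y) = (1 - u) * (c * f x) + u * (c * f y)"
    by (simp only: distrib_left mult.left_commute)
qed

lemma affine_fun_const: "affine_fun (\<lambda>x. c)"
  by (simp add: affine_fun_def algebra_simps)

lemma convex_affine_pos:
  assumes "affine_fun f"
  shows "convex {x. 0 < f x}"
  unfolding convex_alt
proof (intro ballI allI impI)
  fix x y and u :: real
  assume xy: "x \<in> {x. 0 < f x}" "y \<in> {x. 0 < f x}" and u: "0 \<le> u \<and> u \<le> 1"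
  have "0 < (1 - u) * f x + u * f y"
  proof (cases "u = 0")
    case False
    then have "0 < u * f y" using xy u by simp
    moreover have "0 \<le> (1 - u) * f x" using xy u by simp
    ultimately show ?thesis by linarith
  qed (use xy in simp)
  then show "(1 - u) *\<^sub>R x + u *\<^sub>R y \<in> {x. 0 < f x}" using assms by (simp add: affine_fun_def)
qed

lemma convex_affine_less:
  "affine_fun f \<Longrightarrow> affine_fun h \<Longrightarrow> convex {x. f x < h x}"
  using convex_affine_pos[OF affine_fun_diff[of h f]] by simp

lemma convex_affine_abs_less:
  assumes "affine_fun f" "affine_fun h"
  shows "convex {x. \<bar>f x\<bar> < h x}"
proof -
  have "{x. \<bar>f x\<bar> < h x} = {x. f x < h x} \<inter> {x. (-1) * f x < h x}" by auto
  then show ?thesis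
    using convex_affine_less[OF assms] convex_affine_less[OF affine_fun_scale[OF assms(1)] assms(2)] convex_Int by metis
qed

text \<open>Edges are parametrised by height, with the horizontal position in the complex plane so
  that directions can be divided by one another. \<open>up\<close> excludes local maxima below
  \<open>T\<close>, and \<open>top\<close> leaves a single point at height \<open>T\<close>.\<close>

locale strands =
  fixes S :: "'e set" and ln :: "'e \<Rightarrow> real \<Rightarrow> complex" and lo hi :: "'e \<Rightarrow> real" and vel :: "'e \<Rightarrow> complex"
    and T :: real and X :: complex
  assumes fin: "finite S" and ne: "S \<noteq> {}"
    and lohi: "e \<in> S \<Longrightarrow> lo e < hi e"
    and affine: "ln e z = ln e w + (z - w) *\<^sub>R vel e"
    and disj: "e \<in> S \<Longrightarrow> e' \<in> S \<Longrightarrow> e \<noteq> e' \<Longrightarrow> lo e \<le> z \<Longrightarrow> z \<le> hi e \<Longrightarrow> lo e' \<le> z \<Longrightarrow> z \<le> hi e' \<Longrightarrow>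
        ln e z = ln e' z \<Longrightarrow> (z = lo e \<or> z = hi e) \<and> (z = lo e' \<or> z = hi e')"
    and up: "e \<in> S \<Longrightarrow> hi e < T \<Longrightarrow> \<exists>e'\<in>S. lo e' = hi e \<and> ln e' (hi e) = ln e (hi e)"
    and hiT: "e \<in> S \<Longrightarrow> hi e \<le> T" and top: "e \<in> S \<Longrightarrow> hi e = T \<Longrightarrow> ln e T = X"
begin

definition K :: "(complex \<times> real) set" where
  "K = {(ln e z, z) | e z. e \<in> S \<and> lo e \<le> z \<and> z \<le> hi e}"

definition M :: "real \<Rightarrow> (complex \<times> real) set" where
  "M t = {p. snd p < t} - K"

lemma continuous_ln [continuous_intros]: "continuous_on A f \<Longrightarrow> continuous_on A (\<lambda>x. ln e (f x))"
proof -
  assume f: "continuous_on A f"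
  have "ln e (f x) = ln e 0 + f x *\<^sub>R vel e" for x using affine[of e "f x" 0] by simp
  then show ?thesis using f by (simp add: continuous_intros)
qed

lemma compact_K: "compact K"
proof -
  have "K = (\<Union>e\<in>S. (\<lambda>z. (ln e z, z)) ` {lo e..hi e})"
    unfolding K_def by auto
  then show ?thesis
    using fin by (auto intro!: compact_UN compact_continuous_image continuous_intros)
qed

lemma closed_K: "closed K" by (rule compact_imp_closed[OF compact_K])

lemma open_lower: "open {p :: complex \<times> real. snd p < t}"
  by (intro open_Collect_less continuous_intros)

lemma open_M: "open (M t)"
  unfolding M_def by (intro open_Diff open_lower closed_K)

text \<open>The summand 1 keeps \<open>C\<close> positive when all strands are vertical.\<close>

definition C :: real where "C = 1 + Max ((\<lambda>e. norm (vel e)) ` S)"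

lemma vel_C: "e \<in> S \<Longrightarrow> norm (vel e) \<le> C - 1"
  unfolding C_def using fin by simp

lemma C_ge1: "1 \<le> C"
proof -
  obtain e where "e \<in> S" using ne by blast
  from vel_C[OF this] norm_ge_zero[of "vel e"] show ?thesis by linarith
qed

lemma ln_lipschitz: "e \<in> S \<Longrightarrow> dist (ln e z) (ln e w) \<le> C * \<bar>z - w\<bar>"
proof -
  assume e: "e \<in> S"
  have "dist (ln e z) (ln e w) = \<bar>z - w\<bar> * norm (vel e)"
    by (subst affine[of e z w]) (simp add: dist_norm)
  also have "\<dots> \<le> \<bar>z - w\<bar> * C" using vel_C[OF e] by (intro mult_left_mono) auto
  finally show ?thesis by (simp add: mult.commute)
qed

definition U :: "real \<Rightarrow> 'e set" where "U \<tau> = {e \<in> S. lo e \<le> \<tau> \<and> \<tau> < hi e}"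

definition pts :: "real \<Rightarrow> complex set" where "pts \<tau> = (\<lambda>e. ln e \<tau>) ` U \<tau>"

text \<open>Picks one strand leaving \<open>P\<close> upwards, the spine of the fan at
  \<open>P\<close>.\<close>

definition sel :: "real \<Rightarrow> complex \<Rightarrow> 'e" where "sel \<tau> P = (SOME e. e \<in> U \<tau> \<and> ln e \<tau> = P)"

lemma sel: "P \<in> pts \<tau> \<Longrightarrow> sel \<tau> P \<in> U \<tau> \<and> ln (sel \<tau> P) \<tau> = P"
  unfolding sel_def by (rule someI_ex) (auto simp: pts_def)

lemma finite_pts: "finite (pts \<tau>)" using fin by (simp add: pts_def U_def)

lemma U_sub: "U \<tau> \<subseteq> S" by (auto simp: U_def)

text \<open>Among the strands that start no higher than \<open>\<tau>\<close>, one with the highest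
  end must end above \<open>\<tau>\<close>: otherwise \<open>up\<close> continues it by a strand of
  the same kind that ends still higher.\<close>

lemma U_nonempty:
  assumes "e \<in> S" "lo e \<le> \<tau>" "\<tau> < T"
  shows "U \<tau> \<noteq> {}"
proof -
  let ?A = "{e \<in> S. lo e \<le> \<tau>}"
  have "finite (hi ` ?A)" "hi ` ?A \<noteq> {}" using fin assms by auto
  then have "Max (hi ` ?A) \<in> hi ` ?A" by (rule Max_in)
  then obtain f where f: "f \<in> ?A" "hi f = Max (hi ` ?A)" by auto
  have "\<tau> < hi f"
  proof (rule ccontr)
    assume n: "\<not> \<tau> < hi f"
    then obtain e' where e': "e' \<in> S" "lo e' = hi f" using up[of f] f assms by auto
    then have "e' \<in> ?A" using n by auto
    then have "hi e' \<le> hi f" unfolding f(2) using fin by simp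
    then show False using lohi[OF e'(1)] e' by simp
  qed
  then show ?thesis using f by (auto simp: U_def)
qed

lemma isolated_level:
  obtains \<delta> where "0 < \<delta>" "\<delta> \<le> 1" "\<And>e. e \<in> S \<Longrightarrow> lo e \<le> \<tau> - \<delta> \<or> lo e = \<tau> \<or> \<tau> + \<delta> \<le> lo e"
    "\<And>e. e \<in> S \<Longrightarrow> hi e \<le> \<tau> - \<delta> \<or> hi e = \<tau> \<or> \<tau> + \<delta> \<le> hi e"
proof -
  let ?D = "insert 1 ((\<lambda>r. \<bar>r - \<tau>\<bar>) ` ((lo ` S \<union> hi ` S) - {\<tau>}))"
  have f: "finite ?D" using fin by simp
  define \<delta> where "\<delta> = Min ?D"
  have "\<delta> \<in> ?D" unfolding \<delta>_def by (rule Min_in[OF f]) simp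
  then have pos: "0 < \<delta>" by auto
  have le: "\<delta> \<le> x" if "x \<in> ?D" for x unfolding \<delta>_def using Min_le[OF f that] .
  have r: "r \<le> \<tau> - \<delta> \<or> r = \<tau> \<or> \<tau> + \<delta> \<le> r" if "r \<in> lo ` S \<union> hi ` S" for r
  proof (cases "r = \<tau>")
    case False
    then have "\<bar>r - \<tau>\<bar> \<in> ?D" using that by blast
    then have "\<delta> \<le> \<bar>r - \<tau>\<bar>" by (rule le)
    then show ?thesis by linarith
  qed simp
  show ?thesis by (rule that[OF pos le[of 1]]) (use r in auto)
qed

text \<open>Triangular sectors between each strand of \<open>B\<close> and the spine through its
  point at height \<open>\<tau>\<close>. Once all of them are deleted, the horizontal slices of the
  deleted set near a point are star-shaped about the spine, so no loop can pass between strands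
  leaving the same point.\<close>

definition fan :: "real \<Rightarrow> real \<Rightarrow> 'e set \<Rightarrow> (complex \<times> real) set" where
  "fan \<tau> t B = {p. \<tau> < snd p \<and> snd p < t \<and>
     (\<exists>e\<in>B. fst p \<in> closed_segment (ln (sel \<tau> (ln e \<tau>)) (snd p)) (ln e (snd p)))}"

text \<open>\<open>\<delta>\<close> isolates \<open>\<tau>\<close> from the other heights at which
  strands start or end. The factor 12 keeps the balls of radius \<open>6 * C * \<eta>\<close> about
  the points of the level disjoint; here 6 is the push radius 5 plus 1 for the drift of the
  spine.\<close>

definition good :: "real \<Rightarrow> real \<Rightarrow> real \<Rightarrow> bool" where
  "good \<tau> \<delta> \<eta> \<longleftrightarrow> 0 < \<delta> \<and> \<delta> \<le> 1 \<and> 0 < \<eta> \<and> \<eta> < \<delta> / 2 \<and>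
     (\<forall>e\<in>S. lo e \<le> \<tau> - \<delta> \<or> lo e = \<tau> \<or> \<tau> + \<delta> \<le> lo e) \<and>
     (\<forall>e\<in>S. hi e \<le> \<tau> - \<delta> \<or> hi e = \<tau> \<or> \<tau> + \<delta> \<le> hi e) \<and>
     (\<forall>P\<in>pts \<tau>. \<forall>P'\<in>pts \<tau>. P \<noteq> P' \<longrightarrow> 12 * C * \<eta> < dist P P')"

lemma ex_good: obtains \<delta> \<eta> where "good \<tau> \<delta> \<eta>"
proof -
  obtain \<delta> where \<delta>: "0 < \<delta>" "\<delta> \<le> 1" "\<And>e. e \<in> S \<Longrightarrow> lo e \<le> \<tau> - \<delta> \<or> lo e = \<tau> \<or> \<tau> + \<delta> \<le> lo e"
    "\<And>e. e \<in> S \<Longrightarrow> hi e \<le> \<tau> - \<delta> \<or> hi e = \<tau> \<or> \<tau> + \<delta> \<le> hi e" by (rule isolated_level[of \<tau>]) blast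
  let ?D = "insert 1 ((\<lambda>(P, P'). dist P P') ` ((pts \<tau> \<times> pts \<tau>) - Id))"
  have f: "finite ?D" using finite_pts by simp
  define \<sigma> where "\<sigma> = Min ?D"
  have "\<sigma> \<in> ?D" unfolding \<sigma>_def by (rule Min_in[OF f]) simp
  then have \<sigma>: "0 < \<sigma>" by auto
  have le: "\<sigma> \<le> dist P P'" if "P \<in> pts \<tau>" "P' \<in> pts \<tau>" "P \<noteq> P'" for P P'
    unfolding \<sigma>_def by (rule Min_le[OF f]) (use that in force)
  define \<eta> where "\<eta> = min (\<delta> / 4) (\<sigma> / (24 * C))"
  have C: "0 < C" using C_ge1 by simp
  have "12 * C * \<eta> \<le> 12 * C * (\<sigma> / (24 * C))" unfolding \<eta>_def using C by (intro mult_left_mono) auto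
  also have "\<dots> < \<sigma>" using C \<sigma> by simp
  finally have "12 * C * \<eta> < \<sigma>" .
  moreover have "0 < \<eta>" "\<eta> < \<delta> / 2" unfolding \<eta>_def using \<delta> \<sigma> C by auto
  ultimately have "good \<tau> \<delta> \<eta>" unfolding good_def using \<delta> le by fastforce
  then show ?thesis by (rule that)
qed

section \<open>A thin slab above one level\<close>

context
  fixes \<tau> \<delta> \<eta> t :: real
  assumes gd: "good \<tau> \<delta> \<eta>" and t: "\<tau> < t" "t \<le> \<tau> + \<eta>" and \<tau>T: "\<tau> < T"
begin

lemma C0: "0 < C" using C_ge1 by simp

lemma \<eta>0: "0 < \<eta>" "0 < \<delta>" "\<delta> \<le> 1" "\<eta> < \<delta> / 2" using gd by (auto simp: good_def)

lemma hi_good: "e \<in> S \<Longrightarrow> hi e \<le> \<tau> - \<delta> \<or> hi e = \<tau> \<or> \<tau> + \<delta> \<le> hi e"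
  using gd by (simp add: good_def)

text \<open>A strand ending at height \<open>\<tau>\<close> is continued by \<open>up\<close>, so
  its end point is one of \<open>pts \<tau>\<close>; for the strands that pass through the level
  this is immediate. The distance is the Lipschitz bound.\<close>

lemma K_below:
  assumes "(x, z) \<in> K" "\<tau> - \<delta> < z" "z < \<tau>"
  obtains P where "P \<in> pts \<tau>" "dist x P \<le> C * (\<tau> - z)"
proof -
  obtain e where e: "e \<in> S" "lo e \<le> z" "z \<le> hi e" "x = ln e z" using assms(1) by (auto simp: K_def)
  have hi: "\<tau> \<le> hi e" and lo: "lo e < \<tau>" using gd e assms(2,3) \<eta>0 unfolding good_def by fastforce+
  have "ln e \<tau> \<in> pts \<tau>"
  proof (cases "hi e = \<tau>")
    case True
    then obtain e' where e': "e' \<in> S" "lo e' = \<tau>" "ln e' \<tau> = ln e \<tau>" using up[OF e(1)] \<tau>T by auto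
    then have "e' \<in> U \<tau>" using lohi[OF e'(1)] by (simp add: U_def)
    then show ?thesis using e'(3) by (auto simp: pts_def intro!: image_eqI[of _ _ e'])
  next
    case False
    then have "e \<in> U \<tau>" using hi lo e by (simp add: U_def)
    then show ?thesis by (simp add: pts_def)
  qed
  moreover have "dist x (ln e \<tau>) \<le> C * (\<tau> - z)" using ln_lipschitz[OF e(1), of z \<tau>] assms e by simp
  ultimately show ?thesis by (rule that)
qed

lemma K_at: "(x, \<tau>) \<in> K \<longleftrightarrow> x \<in> pts \<tau>"
proof
  assume "(x, \<tau>) \<in> K"
  then obtain e where e: "e \<in> S" "lo e \<le> \<tau>" "\<tau> \<le> hi e" "x = ln e \<tau>" by (auto simp: K_def)
  show "x \<in> pts \<tau>"
  proof (cases "hi e = \<tau>")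
    case True
    then obtain e' where e': "e' \<in> S" "lo e' = \<tau>" "ln e' \<tau> = ln e \<tau>" using up[OF e(1)] \<tau>T by auto
    then have "e' \<in> U \<tau>" using lohi[OF e'(1)] by (simp add: U_def)
    then show ?thesis using e'(3) e(4) by (auto simp: pts_def intro!: image_eqI[of _ _ e'])
  next
    case False
    then have "e \<in> U \<tau>" using e by (simp add: U_def)
    then show ?thesis using e by (simp add: pts_def)
  qed
next
  assume "x \<in> pts \<tau>"
  then show "(x, \<tau>) \<in> K" by (auto simp: pts_def U_def K_def)
qed

lemma K_above:
  assumes "\<tau> < z" "z < t"
  shows "(x, z) \<in> K \<longleftrightarrow> (\<exists>e\<in>U \<tau>. x = ln e z)"
proof
  assume "(x, z) \<in> K"
  then obtain e where e: "e \<in> S" "lo e \<le> z" "z \<le> hi e" "x = ln e z" by (auto simp: K_def)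
  have "lo e \<le> \<tau>" "\<tau> < hi e" using gd e assms t \<eta>0 unfolding good_def by fastforce+
  then show "\<exists>e\<in>U \<tau>. x = ln e z" using e by (auto simp: U_def)
next
  assume "\<exists>e\<in>U \<tau>. x = ln e z"
  then obtain e where e: "e \<in> S" "lo e \<le> \<tau>" "\<tau> < hi e" "x = ln e z" by (auto simp: U_def)
  have "\<tau> + \<delta> \<le> hi e" using gd e \<eta>0 unfolding good_def by fastforce
  then show "(x, z) \<in> K" using e assms t \<eta>0 unfolding K_def by fastforce
qed

abbreviation g :: "complex \<Rightarrow> real \<Rightarrow> complex" where "g P z \<equiv> ln (sel \<tau> P) z"

lemma g_near: "P \<in> pts \<tau> \<Longrightarrow> \<tau> \<le> z \<Longrightarrow> dist (g P z) P \<le> C * (z - \<tau>)"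
  using ln_lipschitz[of "sel \<tau> P" z \<tau>] sel[of P \<tau>] U_sub by auto

lemma seg_near:
  assumes "e \<in> U \<tau>" "\<tau> \<le> z" "x \<in> closed_segment (g (ln e \<tau>) z) (ln e z)"
  shows "dist x (ln e \<tau>) \<le> C * (z - \<tau>)"
proof -
  have P: "ln e \<tau> \<in> pts \<tau>" using assms by (simp add: pts_def)
  have "dist (ln e z) (ln e \<tau>) \<le> C * (z - \<tau>)" using ln_lipschitz[of e z \<tau>] assms U_sub by auto
  then have "closed_segment (g (ln e \<tau>) z) (ln e z) \<subseteq> cball (ln e \<tau>) (C * (z - \<tau>))"
    using g_near[OF P assms(2)] by (intro closed_segment_subset) (auto simp: dist_commute)
  then show ?thesis using assms(3) by (auto simp: dist_commute)
qed

lemma sep: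
  assumes "P \<in> pts \<tau>" "P' \<in> pts \<tau>" "dist x P \<le> 6 * C * (z - \<tau>)" "dist x P' \<le> 6 * C * (z - \<tau>)" "z < t"
  shows "P = P'"
proof (rule ccontr)
  assume ne: "P \<noteq> P'"
  have "dist P P' \<le> dist x P + dist x P'" by (metis dist_commute dist_triangle)
  also have "\<dots> \<le> 12 * C * (z - \<tau>)" using assms by simp
  also have "\<dots> \<le> 12 * C * \<eta>" using assms t C0 by (intro mult_left_mono) auto
  finally show False using gd assms ne unfolding good_def by fastforce
qed

definition N :: "'e set \<Rightarrow> (complex \<times> real) set" where
  "N B = M t - fan \<tau> t B"

text \<open>Moves a point horizontally and radially away from a nearby spine, to distance
  \<open>5 * C * (z - \<tau>)\<close>. The sum makes continuity visible; by \<open>push_one\<close>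
  a point close to one spine is affected by that spine alone.\<close>

definition push :: "complex \<times> real \<Rightarrow> complex" where
  "push p = (\<Sum>P\<in>pts \<tau>. max 0 (5 * C * max 0 (snd p - \<tau>) - norm (fst p - g P (snd p))) *\<^sub>R sgn (fst p - g P (snd p)))"

lemma push_low: "z \<le> \<tau> \<Longrightarrow> push (x, z) = 0"
  unfolding push_def by (intro sum.neutral) auto

lemma push_none:
  assumes "\<And>P. P \<in> pts \<tau> \<Longrightarrow> 5 * C * max 0 (z - \<tau>) \<le> norm (x - g P z)"
  shows "push (x, z) = 0"
  unfolding push_def by (intro sum.neutral ballI) (simp add: max_absorb1 assms)

lemma push_one:
  assumes P: "P \<in> pts \<tau>" and z: "\<tau> < z" "z < t" and near: "norm (x - g P z) < 5 * C * (z - \<tau>)"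
  shows "push (x, z) = (5 * C * (z - \<tau>) - norm (x - g P z)) *\<^sub>R sgn (x - g P z)"
proof -
  have "push (x, z) = (\<Sum>Q\<in>pts \<tau>. if Q = P then (5 * C * (z - \<tau>) - norm (x - g P z)) *\<^sub>R sgn (x - g P z) else 0)"
    unfolding push_def
  proof (intro sum.cong refl)
    fix Q assume Q: "Q \<in> pts \<tau>"
    show "max 0 (5 * C * max 0 (snd (x, z) - \<tau>) - norm (fst (x, z) - g Q (snd (x, z)))) *\<^sub>R sgn (fst (x, z) - g Q (snd (x, z)))
      = (if Q = P then (5 * C * (z - \<tau>) - norm (x - g P z)) *\<^sub>R sgn (x - g P z) else 0)"
    proof (cases "Q = P")
      case False
      have "5 * C * (z - \<tau>) \<le> norm (x - g Q z)"
      proof (rule ccontr)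
        assume "\<not> ?thesis"
        then have "dist x Q \<le> 6 * C * (z - \<tau>)" "dist x P \<le> 6 * C * (z - \<tau>)"
          using g_near[OF Q, of z] g_near[OF P, of z] z near dist_triangle[of x Q "g Q z"] dist_triangle[of x P "g P z"]
          by (auto simp: dist_norm)
        then show False using sep[OF Q P] z False by blast
      qed
      then show ?thesis using False z by (simp add: max_def)
    qed (use z near in \<open>simp add: max_def\<close>)
  qed
  also have "\<dots> = (5 * C * (z - \<tau>) - norm (x - g P z)) *\<^sub>R sgn (x - g P z)"
    using P finite_pts by simp
  finally show ?thesis .
qed

lemma N_above:
  assumes "\<tau> < z" "z < t"
  shows "(x, z) \<in> N (U \<tau>) \<longleftrightarrow> (\<forall>e\<in>U \<tau>. x \<notin> closed_segment (g (ln e \<tau>) z) (ln e z))"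
  using assms K_above[OF assms] unfolding N_def M_def fan_def by auto

lemma N_low: "z \<le> \<tau> \<Longrightarrow> (x, z) \<in> N B \<longleftrightarrow> (x, z) \<notin> K"
  using t unfolding N_def M_def fan_def by auto

lemma N_lt: "(x, z) \<in> N B \<Longrightarrow> z < t" unfolding N_def M_def by auto

lemma N_ne_g:
  assumes "(x, z) \<in> N (U \<tau>)" "P \<in> pts \<tau>" "\<tau> \<le> z"
  shows "x \<noteq> g P z"
proof (cases "z = \<tau>")
  case True
  then show ?thesis using assms sel[OF assms(2)] N_low[of z x] K_at by auto
next
  case False
  then have z: "\<tau> < z" "z < t" using assms N_lt by auto
  have "sel \<tau> P \<in> U \<tau>" "ln (sel \<tau> P) \<tau> = P" using sel[OF assms(2)] by auto
  then have "x \<notin> closed_segment (g P z) (g P z)" using N_above[OF z] assms(1) by auto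
  then show ?thesis by auto
qed

text \<open>\<open>sgn\<close> is discontinuous only on the spines, and these are missing from
  \<open>N (U \<tau>)\<close>. The part below the level is treated apart: the affine extension of a
  spine may run through the space there, but the factor in front of \<open>sgn\<close> is
  zero.\<close>

lemma continuous_push: "continuous_on (N (U \<tau>)) push"
proof -
  let ?A = "N (U \<tau>) \<inter> {p. snd p \<le> \<tau>}" and ?B = "N (U \<tau>) \<inter> {p. \<tau> \<le> snd p}"
  have AB: "N (U \<tau>) = ?A \<union> ?B" by auto
  have "closed {p :: complex \<times> real. snd p \<le> \<tau>}" "closed {p :: complex \<times> real. \<tau> \<le> snd p}"
    by (intro closed_Collect_le continuous_intros)+
  then have cl: "closedin (top_of_set (?A \<union> ?B)) ?A" "closedin (top_of_set (?A \<union> ?B)) ?B"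
    unfolding AB[symmetric] by (auto intro: closedin_closed_Int)
  have "continuous_on ?A push"
  proof (rule continuous_on_eq[OF continuous_on_const[of _ 0]])
    fix p assume "p \<in> ?A" then show "0 = push p" using push_low[of "snd p" "fst p"] by simp
  qed
  moreover have "continuous_on ?B push"
    unfolding push_def
  proof (intro continuous_intros)
    fix P assume P: "P \<in> pts \<tau>"
    show "\<forall>p\<in>?B. fst p - g P (snd p) \<noteq> 0" using N_ne_g[OF _ P] by (auto simp: prod_eq_iff)
  qed
  ultimately show ?thesis using continuous_on_Un_local[OF cl] AB by metis
qed

text \<open>Horizontal slices of a sector are segments starting at the spine. A radial motion away
  from the spine cannot enter such a segment, because its starting point would already lie on it.
  Fans at other points are out of reach by \<open>sep\<close>.\<close>

lemma push_step:
  assumes p: "(x, z) \<in> N (U \<tau>)" and s: "s \<in> {0..1}"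
  shows "(x + s *\<^sub>R push (x, z), z) \<in> N (U \<tau>)"
    and "\<tau> < z \<Longrightarrow> P \<in> pts \<tau> \<Longrightarrow> 4 * C * (z - \<tau>) \<le> dist (x + push (x, z)) P"
proof -
  note C = C0
  have main: "(x + s *\<^sub>R push (x, z), z) \<in> N (U \<tau>) \<and>
     (P \<in> pts \<tau> \<longrightarrow> 4 * C * (z - \<tau>) \<le> dist (x + push (x, z)) P)" if z: "\<tau> < z" for P
  proof (cases "\<exists>Q\<in>pts \<tau>. norm (x - g Q z) < 5 * C * (z - \<tau>)")
    case False
    then have ge: "5 * C * (z - \<tau>) \<le> norm (x - g Q z)" if "Q \<in> pts \<tau>" for Q using that by force
    then have "push (x, z) = 0" using z by (intro push_none) simp
    moreover have "4 * C * (z - \<tau>) \<le> dist x P" if "P \<in> pts \<tau>"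
      using ge[OF that] g_near[OF that, of z] z dist_triangle[of x "g P z" P] dist_commute[of P "g P z"]
      by (auto simp: dist_norm)
    ultimately show ?thesis using p by simp
  next
    case True
    then obtain Q where Q: "Q \<in> pts \<tau>" and near: "norm (x - g Q z) < 5 * C * (z - \<tau>)" by blast
    have zt: "z < t" using N_lt p by blast
    define r k where "r = norm (x - g Q z)" and "k = 5 * C * (z - \<tau>)"
    have r: "0 < r" "r < k" using N_ne_g[OF p Q] z near by (auto simp: r_def k_def)
    have pe: "push (x, z) = ((k - r) / r) *\<^sub>R (x - g Q z)"
      using push_one[OF Q z zt near] by (simp add: sgn_div_norm r_def k_def divide_inverse)
    define l where "l s = 1 + s * ((k - r) / r)" for s
    have x': "x + s *\<^sub>R push (x, z) = g Q z + l s *\<^sub>R (x - g Q z)" for s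
      unfolding pe l_def by (simp add: algebra_simps)
    have l1: "1 \<le> l s" if "s \<in> {0..1}" for s using r that by (simp add: l_def)
    have nr: "norm (x + s *\<^sub>R push (x, z) - g Q z) = r + s * (k - r)" if "s \<in> {0..1}" for s
    proof -
      have "norm (x + s *\<^sub>R push (x, z) - g Q z) = l s * r"
        unfolding x' using l1[OF that] by (simp add: r_def)
      also have "\<dots> = r + s * (k - r)" using r by (simp add: l_def field_simps)
      finally show ?thesis .
    qed
    have nk: "dist (x + s *\<^sub>R push (x, z)) Q \<le> 6 * C * (z - \<tau>)" if s: "s \<in> {0..1}" for s
    proof -
      have "s * (k - r) \<le> 1 * (k - r)" by (rule mult_right_mono) (use s r in auto)
      then have "dist (x + s *\<^sub>R push (x, z)) (g Q z) \<le> k" using nr[OF s] by (simp add: dist_norm)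
      then show ?thesis using g_near[OF Q, of z] z dist_triangle[of "x + s *\<^sub>R push (x, z)" Q "g Q z"]
        by (simp add: k_def)
    qed
    have inN: "(x + s *\<^sub>R push (x, z), z) \<in> N (U \<tau>)"
      unfolding N_above[OF z zt]
    proof (intro ballI notI)
      fix e assume e: "e \<in> U \<tau>" and seg: "x + s *\<^sub>R push (x, z) \<in> closed_segment (g (ln e \<tau>) z) (ln e z)"
      have eP: "ln e \<tau> \<in> pts \<tau>" using e by (simp add: pts_def)
      have "dist (x + s *\<^sub>R push (x, z)) (ln e \<tau>) \<le> C * (z - \<tau>)" using seg_near[OF e _ seg] z by simp
      also have "\<dots> \<le> 6 * C * (z - \<tau>)" using z C by simp
      finally have eq: "ln e \<tau> = Q" using sep[OF eP Q _ nk[OF s] zt] by blast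
      obtain u where u: "0 \<le> u" "u \<le> 1" "g Q z + l s *\<^sub>R (x - g Q z) = (1 - u) *\<^sub>R g Q z + u *\<^sub>R ln e z"
        using seg unfolding eq x' closed_segment_def by auto
      have "l s *\<^sub>R (x - g Q z) = u *\<^sub>R (ln e z - g Q z)" using u(3) by (simp add: algebra_simps)
      then have "(1 / l s) *\<^sub>R (l s *\<^sub>R (x - g Q z)) = (1 / l s) *\<^sub>R (u *\<^sub>R (ln e z - g Q z))" by simp
      then have "x - g Q z = (u / l s) *\<^sub>R (ln e z - g Q z)" using l1[OF s] by simp
      then have "x = (1 - u / l s) *\<^sub>R g Q z + (u / l s) *\<^sub>R ln e z" by (simp add: algebra_simps)
      moreover have "0 \<le> u / l s" "u / l s \<le> 1" using u l1[OF s] by auto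
      ultimately have "x \<in> closed_segment (g (ln e \<tau>) z) (ln e z)"
        unfolding eq closed_segment_def by blast
      then show False using p e N_above[OF z zt] by blast
    qed
    have "4 * C * (z - \<tau>) \<le> dist (x + push (x, z)) P" if P: "P \<in> pts \<tau>"
    proof (cases "P = Q")
      case True
      have "dist (x + push (x, z)) (g Q z) = k" using nr[of 1] by (simp add: dist_norm)
      then show ?thesis using g_near[OF Q, of z] z True dist_triangle[of "x + push (x, z)" "g Q z" Q] dist_commute[of Q "g Q z"]
        by (simp add: k_def)
    next
      case False
      have "\<not> dist (x + push (x, z)) P \<le> 6 * C * (z - \<tau>)"
        using sep[OF P Q _ nk[of 1] zt] False by auto
      moreover have "0 \<le> C * (z - \<tau>)" using C z by simp
      ultimately show ?thesis by linarith
    qed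
    then show ?thesis using inN by blast
  qed
  show "(x + s *\<^sub>R push (x, z), z) \<in> N (U \<tau>)"
  proof (cases "\<tau> < z")
    case False then show ?thesis using p push_low[of z x] by simp
  qed (use main in blast)
  show "\<tau> < z \<Longrightarrow> P \<in> pts \<tau> \<Longrightarrow> 4 * C * (z - \<tau>) \<le> dist (x + push (x, z)) P" using main by blast
qed

text \<open>A depth within which the column below \<open>x\<close> is free of \<open>K\<close>: just
  below the level, \<open>K_below\<close> puts \<open>K\<close> within
  \<open>C * (\<tau> - z)\<close> of a point of \<open>pts \<tau>\<close>. The 2 in the denominator
  leaves a margin.\<close>

definition drop_by :: "complex \<Rightarrow> real" where
  "drop_by x = min (\<delta> / 2) (infdist x (pts \<tau>) / (2 * C))"

text \<open>At time 1 a height above \<open>\<tau> - drop_by x\<close> is averaged with that height,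
  and a lower one is kept. Averaging never descends beyond the safe depth and fits continuously with
  the identity below it.\<close>

definition drop :: "real \<Rightarrow> complex \<times> real \<Rightarrow> complex \<times> real" where
  "drop s p = (fst p, (1 - s) * snd p + s * min (snd p) ((snd p + \<tau> - drop_by (fst p)) / 2))"

text \<open>The region reached by \<open>push\<close>: above the level its points are far enough
  from the fans for a vertical descent.\<close>

definition N' :: "(complex \<times> real) set" where
  "N' = {p \<in> N (U \<tau>). snd p \<le> \<tau> \<or> 4 * C * (snd p - \<tau>) \<le> infdist (fst p) (pts \<tau>)}"

lemma infdist_pts_pos:
  assumes "(x, \<tau>) \<notin> K" "pts \<tau> \<noteq> {}"
  shows "0 < infdist x (pts \<tau>)"
  using assms in_closed_iff_infdist_zero[OF finite_imp_closed[OF finite_pts] assms(2), of x] K_at infdist_nonneg[of x "pts \<tau>"]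
  by (auto simp: less_le)

lemma drop_N:
  assumes p: "(x, z) \<in> N'" and s: "s \<in> {0..1}" and ne: "pts \<tau> \<noteq> {}"
  shows "drop s (x, z) \<in> N (U \<tau>)"
proof -
  note C = C0
  let ?d = "infdist x (pts \<tau>)" and ?h = "drop_by x"
  define w where "w = min z ((z + \<tau> - ?h) / 2)"
  define y where "y = (1 - s) * z + s * w"
  have N: "(x, z) \<in> N (U \<tau>)" and alt: "z \<le> \<tau> \<or> 4 * C * (z - \<tau>) \<le> ?d" using p by (auto simp: N'_def)
  have zt: "z < t" using N_lt N by blast
  have "w \<le> z" by (simp add: w_def)
  have "s * w \<le> s * z" using \<open>w \<le> z\<close> s by (intro mult_left_mono) auto
  then have yz: "y \<le> z" by (simp add: y_def algebra_simps)
  have "(1 - s) * w \<le> (1 - s) * z" using \<open>w \<le> z\<close> s by (intro mult_left_mono) auto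
  then have wy: "w \<le> y" by (simp add: y_def algebra_simps)
  have "(x, y) \<in> N (U \<tau>)"
  proof (cases "z \<le> \<tau> - ?h")
    case True
    then have "w = z" by (simp add: w_def)
    then show ?thesis using N yz wy by simp
  next
    case False
    then have wl: "\<tau> - ?h < w" by (simp add: w_def)
    have h: "?h \<le> \<delta> / 2" "C * ?h \<le> ?d / 2"
    proof -
      show "?h \<le> \<delta> / 2" by (simp add: drop_by_def)
      have "C * ?h \<le> C * (?d / (2 * C))" using C by (intro mult_left_mono) (auto simp: drop_by_def)
      then show "C * ?h \<le> ?d / 2" using C by simp
    qed
    consider "\<tau> < y" | "y = \<tau>" | "y < \<tau>" by linarith
    then show ?thesis
    proof cases
      case 1
      have yt: "y < t" using yz zt by simp
      show ?thesis unfolding N_above[OF 1 yt]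
      proof (intro ballI notI)
        fix e assume e: "e \<in> U \<tau>" "x \<in> closed_segment (g (ln e \<tau>) y) (ln e y)"
        have "?d \<le> dist x (ln e \<tau>)" using e by (intro infdist_le) (simp add: pts_def)
        also have "\<dots> \<le> C * (y - \<tau>)" using seg_near e 1 by simp
        also have "\<dots> \<le> C * (z - \<tau>)" using yz C by simp
        finally have "?d \<le> C * (z - \<tau>)" .
        moreover have "4 * (C * (z - \<tau>)) \<le> ?d" using alt 1 yz by (simp add: mult.assoc)
        moreover have "0 < C * (z - \<tau>)" using C 1 yz by simp
        ultimately show False by linarith
      qed
    next
      case 2
      have "(x, \<tau>) \<notin> K"
      proof (cases "z = \<tau>")
        case True then show ?thesis using N N_low[of z x] by simp
      next
        case False
        then have "0 < C * (z - \<tau>)" using C 2 yz by simp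
        moreover have "4 * (C * (z - \<tau>)) \<le> ?d" using alt False 2 yz by simp
        ultimately have "0 < ?d" by linarith
        then show ?thesis using K_at infdist_zero by force
      qed
      then show ?thesis using 2 N_low[of y x] by simp
    next
      case 3
      have "(x, y) \<notin> K"
      proof
        assume K: "(x, y) \<in> K"
        have "\<tau> - \<delta> < y" using h wl wy \<eta>0 by linarith
        then obtain P where P: "P \<in> pts \<tau>" "dist x P \<le> C * (\<tau> - y)" by (rule K_below[OF K _ 3])
        have "?d \<le> dist x P" by (rule infdist_le[OF P(1)])
        also have "\<dots> \<le> C * (\<tau> - y)" by (rule P(2))
        also have "\<dots> < C * ?h" using wl wy C by (intro mult_strict_left_mono) linarith+
        also have "\<dots> \<le> ?d / 2" by (rule h(2))
        finally show False using infdist_nonneg[of x "pts \<tau>"] by linarith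
      qed
      then show ?thesis using 3 N_low[of y x] by simp
    qed
  qed
  then show ?thesis by (simp add: drop_def y_def w_def)
qed

lemma drop_final:
  assumes p: "(x, z) \<in> N'" and ne: "pts \<tau> \<noteq> {}"
  shows "drop 1 (x, z) \<in> M \<tau>"
proof -
  note C = C0
  let ?d = "infdist x (pts \<tau>)" and ?h = "drop_by x"
  have N: "(x, z) \<in> N (U \<tau>)" and alt: "z \<le> \<tau> \<or> 4 * C * (z - \<tau>) \<le> ?d" using p by (auto simp: N'_def)
  have zt: "z < t" using N_lt N by blast
  have lt: "min z ((z + \<tau> - ?h) / 2) < \<tau>"
  proof -
    consider "z < \<tau>" | "z = \<tau>" | "\<tau> < z" by linarith
    then show ?thesis
    proof cases
      case 2
      then have "0 < ?d" using N N_low[of z x] infdist_pts_pos ne by simp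
      then have "0 < ?h" using \<eta>0 C by (simp add: drop_by_def)
      then show ?thesis using 2 by simp
    next
      case 3
      have pos: "0 < C * (z - \<tau>)" using 3 C by simp
      have "2 * C * (z - \<tau>) < ?d" using alt 3 pos by simp
      then have "z - \<tau> < ?d / (2 * C)" using C by (simp add: field_simps)
      moreover have "z - \<tau> < \<delta> / 2" using zt t \<eta>0 by linarith
      ultimately have "z - \<tau> < ?h" by (simp add: drop_by_def)
      then have "(z + \<tau> - ?h) / 2 < \<tau>" by simp
      then show ?thesis by (simp add: min_less_iff_disj)
    qed simp
  qed
  have "drop 1 (x, z) \<in> N (U \<tau>)" by (rule drop_N[OF p _ ne]) simp
  then show ?thesis using lt by (auto simp: drop_def N_def M_def)
qed

text \<open>With the whole fans deleted, the slab adds nothing to the part below: points are pushed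
  away from the fans and then dropped below the level. Both motions fix the base point because it
  lies at least \<open>\<delta>\<close> below the level.\<close>

lemma pi1_eq_step:
  assumes a: "a \<notin> K" "snd a \<le> \<tau> - \<delta>" and ne: "pts \<tau> \<noteq> {}"
  shows "pi1_eq (M \<tau>) (N (U \<tau>)) a"
proof (rule pi1_eq_deform2(1)[where F="\<lambda>s p. (fst p + s *\<^sub>R push p, snd p)" and G=drop and B'=N'])
  have dlow: "drop s p \<in> M \<tau>" if "s \<in> {0..1}" "p \<in> M \<tau>" for s p
  proof -
    obtain x z where p: "p = (x, z)" by (cases p)
    have z: "z < \<tau>" "(x, z) \<notin> K" using that p by (auto simp: M_def)
    then have N': "(x, z) \<in> N'" using N_low by (simp add: N'_def)
    have "drop s (x, z) \<in> N (U \<tau>)" by (rule drop_N[OF N' that(1) ne])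
    moreover have "snd (drop s (x, z)) < \<tau>"
    proof -
      have "s * min z ((z + \<tau> - drop_by x) / 2) \<le> s * z" using that(1) by (intro mult_left_mono) auto
      then have "(1 - s) * z + s * min z ((z + \<tau> - drop_by x) / 2) \<le> z" by (simp add: algebra_simps)
      then show ?thesis using z by (simp add: drop_def)
    qed
    ultimately show ?thesis using p by (simp add: N_def M_def)
  qed
  show sub: "M \<tau> \<subseteq> N'" unfolding N'_def using N_low t by (auto simp: M_def)
  show "N' \<subseteq> N (U \<tau>)" by (auto simp: N'_def)
  show "a \<in> M \<tau>" using a \<eta>0 by (auto simp: M_def)
  have "continuous_on ({0..1} \<times> N (U \<tau>)) (\<lambda>y. push (snd y))"
    by (rule continuous_on_compose2[OF continuous_push continuous_on_snd[OF continuous_on_id]]) auto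
  then show "continuous_on ({0..1} \<times> N (U \<tau>)) (\<lambda>y. (fst (snd y) + fst y *\<^sub>R push (snd y), snd (snd y)))"
    by (intro continuous_intros)
  show "continuous_on ({0..1} \<times> N') (\<lambda>y. drop (fst y) (snd y))"
    unfolding drop_def drop_by_def using C0 by (intro continuous_intros) auto
  show "(fst p + s *\<^sub>R push p, snd p) \<in> N (U \<tau>)" if "s \<in> {0..1}" "p \<in> N (U \<tau>)" for s p
    using push_step(1)[of "fst p" "snd p" s] that by simp
  show "(fst p + s *\<^sub>R push p, snd p) \<in> M \<tau>" if "s \<in> {0..1}" "p \<in> M \<tau>" for s p
    using push_low[of "snd p" "fst p"] that by (simp add: M_def)
  show "(fst a + s *\<^sub>R push a, snd a) = a" for s
    using push_low[of "snd a" "fst a"] a \<eta>0 by simp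
  show "(fst p + 1 *\<^sub>R push p, snd p) \<in> N'" if "p \<in> N (U \<tau>)" for p
  proof -
    have "4 * C * (snd p - \<tau>) \<le> infdist (fst p + push p) (pts \<tau>)" if "\<tau> < snd p"
      unfolding infdist_notempty[OF ne]
      using push_step(2)[of "fst p" "snd p" 1] \<open>p \<in> N (U \<tau>)\<close> that ne by (intro cINF_greatest) auto
    then show ?thesis using push_step(1)[of "fst p" "snd p" 1] that
      by (cases "\<tau> < snd p") (auto simp: N'_def)
  qed
  show "drop s p \<in> N (U \<tau>)" if "s \<in> {0..1}" "p \<in> N'" for s p
    using drop_N[of "fst p" "snd p" s] that ne by simp
  show "drop s p \<in> M \<tau>" if "s \<in> {0..1}" "p \<in> M \<tau>" for s p using dlow that by blast
  show "drop 1 p \<in> M \<tau>" if "p \<in> N'" for p using drop_final[of "fst p" "snd p"] that ne by simp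
  show "drop s a = a" for s
  proof -
    have "drop_by (fst a) \<le> \<delta> / 2" by (simp add: drop_by_def)
    then have "min (snd a) ((snd a + \<tau> - drop_by (fst a)) / 2) = snd a" using a \<eta>0 by simp
    then show ?thesis by (simp add: drop_def algebra_simps prod_eq_iff)
  qed
qed (auto simp: drop_def prod_eq_iff)

section \<open>Restoring the sectors of a fan\<close>

definition rel_vel :: "'e \<Rightarrow> complex" where
  "rel_vel f = vel f - vel (sel \<tau> (ln f \<tau>))"

lemma ln_rel: "f \<in> U \<tau> \<Longrightarrow> ln f z = g (ln f \<tau>) z + (z - \<tau>) *\<^sub>R rel_vel f"
proof -
  assume f: "f \<in> U \<tau>"
  have "ln (sel \<tau> (ln f \<tau>)) \<tau> = ln f \<tau>" using sel[of "ln f \<tau>" \<tau>] f by (simp add: pts_def)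
  then show ?thesis
    using affine[of f z \<tau>] affine[of "sel \<tau> (ln f \<tau>)" z \<tau>] by (simp add: rel_vel_def algebra_simps)
qed

text \<open>Strands leaving one point with the same slope run together until one of them ends, which
  contradicts \<open>disj\<close> at an interior height.\<close>

lemma rel_vel_inj:
  assumes "f \<in> U \<tau>" "f' \<in> U \<tau>" "ln f \<tau> = ln f' \<tau>" "rel_vel f = rel_vel f'"
  shows "f = f'"
proof (rule ccontr)
  assume ne: "f \<noteq> f'"
  define z where "z = (\<tau> + t) / 2"
  have z: "\<tau> < z" "z < \<tau> + \<delta>" using t \<eta>0 by (auto simp: z_def)
  have S: "f \<in> S" "f' \<in> S" "lo f \<le> \<tau>" "lo f' \<le> \<tau>" "\<tau> < hi f" "\<tau> < hi f'" using assms by (auto simp: U_def)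
  have "\<tau> + \<delta> \<le> hi f" "\<tau> + \<delta> \<le> hi f'" using S hi_good[of f] hi_good[of f'] \<eta>0 by auto
  moreover have "ln f z = ln f' z"
    using ln_rel[OF assms(1), of z] unfolding assms(3,4) ln_rel[OF assms(2), of z, symmetric] .
  ultimately show False using disj[OF S(1,2) ne, of z] z S by linarith
qed

text \<open>Closing the slab to \<open>{\<tau>..t}\<close> changes nothing: the added points at
  height \<open>\<tau>\<close> lie in \<open>K\<close>, and those at height \<open>t\<close> are
  outside \<open>M t\<close>. The deleted set is then compact, which makes \<open>N B\<close>
  open.\<close>

lemma closed_fan:
  assumes "B \<subseteq> U \<tau>"
  shows "N B = M t - (\<Union>e\<in>B. (\<lambda>(z, u). ((1 - u) *\<^sub>R g (ln e \<tau>) z + u *\<^sub>R ln e z, z)) ` ({\<tau>..t} \<times> {0..1}))"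
    (is "_ = M t - ?F")
proof -
  have "p \<in> fan \<tau> t B \<longleftrightarrow> p \<in> ?F" if p: "p \<in> M t" for p
  proof
    assume "p \<in> fan \<tau> t B"
    then obtain e where e: "\<tau> < snd p" "snd p < t" "e \<in> B" "fst p \<in> closed_segment (g (ln e \<tau>) (snd p)) (ln e (snd p))"
      by (auto simp: fan_def)
    then obtain u where "0 \<le> u" "u \<le> 1" "fst p = (1 - u) *\<^sub>R g (ln e \<tau>) (snd p) + u *\<^sub>R ln e (snd p)"
      unfolding closed_segment_def by blast
    then show "p \<in> ?F" using e by (intro UN_I[OF e(3)] image_eqI[of _ _ "(snd p, u)"]) (auto simp: prod_eq_iff)
  next
    assume "p \<in> ?F"
    then obtain e u where e: "e \<in> B" "\<tau> \<le> snd p" "snd p \<le> t" "0 \<le> u" "u \<le> 1"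
       and fp: "fst p = (1 - u) *\<^sub>R g (ln e \<tau>) (snd p) + u *\<^sub>R ln e (snd p)" by auto
    have eU: "ln e \<tau> \<in> pts \<tau>" using e assms by (auto simp: pts_def)
    have "snd p \<noteq> \<tau>"
    proof
      assume z: "snd p = \<tau>"
      then have "fst p = ln e \<tau>" using fp sel[OF eU] by (simp add: scaleR_left.add[symmetric] algebra_simps)
      then have "p \<in> K" using K_at[of "fst p"] eU z by (metis prod.collapse)
      then show False using p by (simp add: M_def)
    qed
    then show "p \<in> fan \<tau> t B" using e fp p unfolding fan_def M_def closed_segment_def by auto
  qed
  then show ?thesis unfolding N_def by blast
qed

lemma open_N: "B \<subseteq> U \<tau> \<Longrightarrow> open (N B)"
proof -
  assume B: "B \<subseteq> U \<tau>"
  have "finite B" using B U_sub fin by (meson finite_subset)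
  then have "closed (\<Union>e\<in>B. (\<lambda>(z, u). ((1 - u) *\<^sub>R g (ln e \<tau>) z + u *\<^sub>R ln e z, z)) ` ({\<tau>..t} \<times> {0..1}))"
    by (intro closed_UN ballI compact_imp_closed compact_continuous_image compact_Times compact_Icc)
      (auto simp: case_prod_unfold intro!: continuous_intros)
  then show ?thesis unfolding closed_fan[OF B] by (intro open_Diff open_M)
qed

lemma N_above_gen:
  assumes "\<tau> < z" "z < t"
  shows "(x, z) \<in> N B \<longleftrightarrow> (\<forall>f\<in>U \<tau>. x \<noteq> ln f z) \<and> (\<forall>f\<in>B. x \<notin> closed_segment (g (ln f \<tau>) z) (ln f z))"
  using assms K_above[OF assms] unfolding N_def M_def fan_def by auto

text \<open>Restoring the sector of \<open>e\<close> opens a convex lens, cut by that sector into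
  two convex halves, and \<open>freely_generated_wall\<close> applies. Strands are taken by
  decreasing speed relative to the spine because several of them may move away from it in the same
  direction: the sector of the fastest contains the others, and only its part beyond the next strand
  is restored.\<close>

lemma wall_step:
  assumes B: "B \<subseteq> U \<tau>" "e \<in> B" and inner: "\<And>f. f \<in> B \<Longrightarrow> norm (rel_vel f) \<le> norm (rel_vel e)"
    and outer: "\<And>f. f \<in> U \<tau> - B \<Longrightarrow> norm (rel_vel e) \<le> norm (rel_vel f)"
    and fr: "freely_generated (N B) a"
  shows "freely_generated (N (B - {e})) a"
proof (cases "rel_vel e = 0")
  \<comment> \<open>Then \<open>e\<close> runs along the spine and its sector is just the strand,
    which is missing anyway.\<close>
  case True
  have eU: "e \<in> U \<tau>" using B by blast
  have "p \<in> N B \<longleftrightarrow> p \<in> N (B - {e})" for p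
  proof (cases "\<tau> < snd p \<and> snd p < t")
    case True
    have "ln e (snd p) = g (ln e \<tau>) (snd p)" using ln_rel[OF eU, of "snd p"] \<open>rel_vel e = 0\<close> by simp
    then have k: "fst p \<notin> closed_segment (g (ln e \<tau>) (snd p)) (ln e (snd p))" if "fst p \<noteq> ln e (snd p)"
      using that by simp
    show ?thesis
      using N_above_gen[of "snd p" "fst p" B] N_above_gen[of "snd p" "fst p" "B - {e}"] True eU k
      by (simp only: prod.collapse) blast
  next
    case False
    then show ?thesis by (auto simp: N_def fan_def)
  qed
  then show ?thesis using fr by (metis subsetI subset_antisym)
next
  case False
  note w0 = False
  define w P where "w = rel_vel e" and "P = ln e \<tau>"
  have eU: "e \<in> U \<tau>" using B by blast
  have P: "P \<in> pts \<tau>" using eU by (simp add: P_def pts_def)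
  have Cw: "norm w \<le> 2 * C"
  proof -
    have "sel \<tau> P \<in> S" using sel[OF P] U_sub by blast
    then have "norm w \<le> (C - 1) + (C - 1)"
      unfolding w_def rel_vel_def using vel_C[of e] vel_C[of "sel \<tau> P"] eU U_sub
      by (intro order_trans[OF norm_triangle_ineq4] add_mono) (auto simp: P_def)
    then show ?thesis by simp
  qed
  \<comment> \<open>This coordinate puts the spine at 0 and \<open>e\<close> at the real number
    \<open>z - \<tau>\<close>; a strand \<open>f\<close> through \<open>P\<close> becomes the ray
    \<open>(z - \<tau>) *\<^sub>R \<zeta> f\<close>.\<close>
  define \<Phi> :: "complex \<times> real \<Rightarrow> complex" where "\<Phi> p = (fst p - g P (snd p)) / w" for p
  have x_eq: "x = g P z + \<Phi> (x, z) * w" for x z using w0 by (simp add: \<Phi>_def w_def)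
  define VP where "VP = {f \<in> U \<tau>. ln f \<tau> = P}"
  define \<zeta> where "\<zeta> f = rel_vel f / w" for f
  have ln_\<zeta>: "ln f z = g P z + ((z - \<tau>) *\<^sub>R \<zeta> f) * w" if "f \<in> VP" for f z
    using ln_rel[of f z] that w0 by (simp add: VP_def \<zeta>_def w_def)
  have fVP: "finite VP" using U_sub fin by (auto simp: VP_def intro: finite_subset)
  \<comment> \<open>\<open>l\<close> is the position of the last strand before \<open>e\<close> in
    the same direction, or 0 for the spine. Up to \<open>l\<close> the sector of \<open>e\<close>
    stays covered.\<close>
  define \<Lambda> where "\<Lambda> = insert 0 (Re ` \<zeta> ` {f \<in> VP. Im (\<zeta> f) = 0 \<and> 0 \<le> Re (\<zeta> f) \<and> Re (\<zeta> f) < 1})"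
  have f\<Lambda>: "finite \<Lambda>" using fVP by (simp add: \<Lambda>_def)
  define l where "l = Max \<Lambda>"
  have l\<Lambda>: "l \<in> \<Lambda>" unfolding l_def by (rule Max_in[OF f\<Lambda>]) (simp add: \<Lambda>_def)
  have l01: "0 \<le> l" "l < 1" using l\<Lambda> by (auto simp: \<Lambda>_def)
  have le_l: "Re (\<zeta> f) \<le> l" if "f \<in> VP" "Im (\<zeta> f) = 0" "0 \<le> Re (\<zeta> f)" "Re (\<zeta> f) < 1" for f
    unfolding l_def by (rule Max_ge[OF f\<Lambda>]) (use that in \<open>auto simp: \<Lambda>_def\<close>)
  \<comment> \<open>\<open>\<epsilon>\<close> is the opening of the lens, so small that rays with a
    velocity off the real axis miss it.\<close>
  define D where "D = insert 1 ((\<lambda>f. \<bar>Im (\<zeta> f)\<bar> / (\<bar>Re (\<zeta> f)\<bar> + 1)) ` {f \<in> VP. Im (\<zeta> f) \<noteq> 0})"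
  have fD: "finite D" using fVP by (simp add: D_def)
  define \<epsilon> where "\<epsilon> = Min D"
  have "\<epsilon> \<in> D" unfolding \<epsilon>_def by (rule Min_in[OF fD]) (simp add: D_def)
  then have \<epsilon>0: "0 < \<epsilon>" by (auto simp: D_def intro!: divide_pos_pos)
  have \<epsilon>1: "\<epsilon> \<le> 1" unfolding \<epsilon>_def by (rule Min_le[OF fD]) (simp add: D_def)
  have \<epsilon>_le: "\<epsilon> * (\<bar>Re (\<zeta> f)\<bar> + 1) \<le> \<bar>Im (\<zeta> f)\<bar>" if "f \<in> VP" "Im (\<zeta> f) \<noteq> 0" for f
  proof -
    have "\<epsilon> \<le> \<bar>Im (\<zeta> f)\<bar> / (\<bar>Re (\<zeta> f)\<bar> + 1)"
      unfolding \<epsilon>_def by (rule Min_le[OF fD]) (use that in \<open>auto simp: D_def\<close>)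
    then show ?thesis by (simp add: pos_le_divide_eq add_nonneg_pos)
  qed
  define Z :: "complex \<times> real \<Rightarrow> real" where "Z p = snd p - \<tau>" for p
  \<comment> \<open>A double wedge about the open interval from \<open>l * Z p\<close> to
    \<open>Z p\<close> on the real axis. Apart from the cut at height \<open>t\<close> its
    conditions are homogeneous, so it is a cone with apex at \<open>P\<close>; all of them are
    affine, hence convex.\<close>
  define L where "L = {p. l * Z p < Re (\<Phi> p)} \<inter> {p. Re (\<Phi> p) < Z p} \<inter> {p. \<bar>Im (\<Phi> p)\<bar> < \<epsilon> * (Re (\<Phi> p) - l * Z p)} \<inter>
    {p. \<bar>Im (\<Phi> p)\<bar> < \<epsilon> * (Z p - Re (\<Phi> p))} \<inter> {p. Z p < t - \<tau>}"
  define H1 H2 where "H1 = {p. 0 < Im (\<Phi> p)}" and "H2 = {p. Im (\<Phi> p) < 0}"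
  have \<Phi>_cont: "continuous_on UNIV \<Phi>" unfolding \<Phi>_def using w0 by (intro continuous_intros) (simp add: w_def)
  have \<Phi>_affine: "\<Phi> ((1 - u) *\<^sub>R x + u *\<^sub>R y) = (1 - u) *\<^sub>R \<Phi> x + u *\<^sub>R \<Phi> y" for x y u
  proof -
    have gP: "g P z = P + (z - \<tau>) *\<^sub>R vel (sel \<tau> P)" for z using affine[of "sel \<tau> P" z \<tau>] sel[OF P] by simp
    have num: "fst ((1 - u) *\<^sub>R x + u *\<^sub>R y) - g P (snd ((1 - u) *\<^sub>R x + u *\<^sub>R y))
       = (1 - u) *\<^sub>R (fst x - g P (snd x)) + u *\<^sub>R (fst y - g P (snd y))"
      unfolding gP by (simp add: algebra_simps)
    show ?thesis unfolding \<Phi>_def num by (simp add: add_divide_distrib scaleR_conv_of_real)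
  qed
  have aff: "affine_fun (\<lambda>p. Re (\<Phi> p))" "affine_fun (\<lambda>p. Im (\<Phi> p))" "affine_fun Z"
    unfolding affine_fun_def \<Phi>_affine Z_def by (auto simp: algebra_simps)
  note affs = affine_fun_diff affine_fun_scale affine_fun_const aff
  have openL: "open L" unfolding L_def Z_def
    by (intro open_Int open_Collect_less continuous_intros continuous_on_subset[OF \<Phi>_cont] subset_UNIV)
  have openH: "open H1" "open H2" unfolding H1_def H2_def
    by (intro open_Collect_less continuous_intros continuous_on_subset[OF \<Phi>_cont] subset_UNIV)+
  have convL: "convex L" unfolding L_def
    by (intro convex_Int convex_affine_less convex_affine_abs_less affs)
  have convH: "convex H1" "convex H2" unfolding H1_def H2_def
    by (intro convex_affine_less affs)+
  have LZ: "0 < Z p" "Z p < t - \<tau>" "\<tau> < snd p" "snd p < t" if "p \<in> L" for p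
  proof -
    have "l * Z p < Z p" using that by (auto simp: L_def)
    then have "0 < (1 - l) * Z p" by (simp add: algebra_simps)
    then show "0 < Z p" using l01 by (simp add: zero_less_mult_iff)
    then show "\<tau> < snd p" by (simp add: Z_def)
    show "Z p < t - \<tau>" using that by (auto simp: L_def)
    then show "snd p < t" by (simp add: Z_def)
  qed
  \<comment> \<open>any strand of the fan, or any other sector, meeting the lens would have to emanate from the same point\<close>
  have L_P: "f \<in> VP" if p: "(x, z) \<in> L" and f: "f \<in> U \<tau>" "x \<in> closed_segment (g (ln f \<tau>) z) (ln f z)" for x z f
  proof -
    have z: "\<tau> < z" "z < t" using LZ[OF p] by auto
    have X: "\<bar>Re (\<Phi> (x, z))\<bar> \<le> z - \<tau>" "\<bar>Im (\<Phi> (x, z))\<bar> \<le> z - \<tau>"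
    proof -
      have b: "l * (z - \<tau>) < Re (\<Phi> (x, z))" "Re (\<Phi> (x, z)) < z - \<tau>"
        "\<bar>Im (\<Phi> (x, z))\<bar> < \<epsilon> * (z - \<tau> - Re (\<Phi> (x, z)))" using p by (auto simp: L_def Z_def)
      have r0: "0 \<le> l * (z - \<tau>)" using l01 z by simp
      have Re0: "0 < Re (\<Phi> (x, z))" by (rule le_less_trans[OF r0 b(1)])
      show "\<bar>Re (\<Phi> (x, z))\<bar> \<le> z - \<tau>" using b(2) Re0 by linarith
      have "\<epsilon> * (z - \<tau> - Re (\<Phi> (x, z))) \<le> 1 * (z - \<tau> - Re (\<Phi> (x, z)))"
        using \<epsilon>1 b by (intro mult_right_mono) auto
      then have "\<bar>Im (\<Phi> (x, z))\<bar> < 1 * (z - \<tau> - Re (\<Phi> (x, z)))" by (rule less_le_trans[OF b(3)])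
      then have "\<bar>Im (\<Phi> (x, z))\<bar> < z - \<tau> - Re (\<Phi> (x, z))" by simp
      then show "\<bar>Im (\<Phi> (x, z))\<bar> \<le> z - \<tau>" using Re0 by linarith
    qed
    have "norm (x - g P z) = norm (\<Phi> (x, z)) * norm w" using x_eq[of x z] by (metis add_diff_cancel_left' norm_mult)
    also have "\<dots> \<le> (2 * (z - \<tau>)) * (2 * C)"
      using X cmod_le[of "\<Phi> (x, z)"] Cw z by (intro mult_mono) auto
    also have "\<dots> = 4 * (C * (z - \<tau>))" by (simp add: algebra_simps)
    finally have q: "dist x (g P z) \<le> 4 * (C * (z - \<tau>))" by (simp only: dist_norm)
    have m0: "0 \<le> C * (z - \<tau>)" using C0 z by simp
    have m6: "6 * C * (z - \<tau>) = 6 * (C * (z - \<tau>))" by simp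
    have "dist (g P z) P \<le> C * (z - \<tau>)" using g_near[OF P, of z] z by simp
    then have d1: "dist x P \<le> 6 * C * (z - \<tau>)"
      unfolding m6 using q m0 dist_triangle[of x P "g P z"] by linarith
    have "dist x (ln f \<tau>) \<le> C * (z - \<tau>)" using seg_near[OF f(1) _ f(2)] z by simp
    then have d2: "dist x (ln f \<tau>) \<le> 6 * C * (z - \<tau>)" unfolding m6 using m0 by linarith
    show ?thesis using sep[OF P _ d1 d2 z(2)] f(1) by (auto simp: VP_def pts_def)
  qed
  have lens_ray: "Im (\<zeta> f) = 0 \<and> l < s * Re (\<zeta> f) \<and> s * Re (\<zeta> f) < 1"
    if p: "(x, z) \<in> L" and f: "f \<in> VP" and s: "0 \<le> s" and x: "\<Phi> (x, z) = ((z - \<tau>) * s) *\<^sub>R \<zeta> f" for x z f s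
  proof -
    have z: "0 < z - \<tau>" using LZ[OF p] by auto
    have b: "l * (z - \<tau>) < (z - \<tau>) * s * Re (\<zeta> f)" "(z - \<tau>) * s * Re (\<zeta> f) < z - \<tau>"
        "\<bar>(z - \<tau>) * s * Im (\<zeta> f)\<bar> < \<epsilon> * ((z - \<tau>) * s * Re (\<zeta> f) - l * (z - \<tau>))" using p x by (auto simp: L_def Z_def)
    have b': "(z - \<tau>) * l < (z - \<tau>) * (s * Re (\<zeta> f))" "(z - \<tau>) * (s * Re (\<zeta> f)) < (z - \<tau>) * 1"
      using b(1,2) by (simp_all only: mult.assoc mult.commute mult.left_commute mult_1_right mult_1)
    then have c: "l < s * Re (\<zeta> f)" "s * Re (\<zeta> f) < 1" using z by (simp_all only: mult_less_cancel_left_pos)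
    have "Im (\<zeta> f) = 0"
    proof (rule ccontr)
      assume n: "Im (\<zeta> f) \<noteq> 0"
      have s0: "0 < s" using c(1) l01(1) s by (cases "s = 0") auto
      have zs: "0 < (z - \<tau>) * s" using z s0 by simp
      have "(z - \<tau>) * s * \<bar>Im (\<zeta> f)\<bar> = \<bar>(z - \<tau>) * s * Im (\<zeta> f)\<bar>" using z s0 by (simp add: abs_mult)
      also have "\<dots> < \<epsilon> * ((z - \<tau>) * s * Re (\<zeta> f) - l * (z - \<tau>))" by (rule b(3))
      also have "\<dots> \<le> \<epsilon> * ((z - \<tau>) * s * (\<bar>Re (\<zeta> f)\<bar> + 1))"
      proof (rule mult_left_mono)
        have "(z - \<tau>) * s * Re (\<zeta> f) \<le> (z - \<tau>) * s * (\<bar>Re (\<zeta> f)\<bar> + 1)" using zs by (intro mult_left_mono) auto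
        moreover have "0 \<le> l * (z - \<tau>)" using l01 z by simp
        ultimately show "(z - \<tau>) * s * Re (\<zeta> f) - l * (z - \<tau>) \<le> (z - \<tau>) * s * (\<bar>Re (\<zeta> f)\<bar> + 1)" by linarith
      qed (use \<epsilon>0 in simp)
      also have "\<dots> = (z - \<tau>) * s * (\<epsilon> * (\<bar>Re (\<zeta> f)\<bar> + 1))" by (simp add: mult.left_commute mult.assoc)
      also have "\<dots> \<le> (z - \<tau>) * s * \<bar>Im (\<zeta> f)\<bar>" using zs \<epsilon>_le[OF f n] by (intro mult_left_mono) auto
      finally show False by simp
    qed
    then show ?thesis using c by blast
  qed
  have norm_\<zeta>: "norm (\<zeta> f) = norm (rel_vel f) / norm w" for f by (simp add: \<zeta>_def norm_divide)
  have w_pos: "0 < norm w" using w0 by (simp add: w_def)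
  have eVP: "e \<in> VP" using eU by (simp add: VP_def P_def)
  have \<zeta>_ne: "\<zeta> f \<noteq> 1" if "f \<in> VP" "f \<noteq> e" for f
    using rel_vel_inj[of f e] that eVP w0 by (auto simp: \<zeta>_def w_def VP_def)
  have real_norm: "\<bar>Re y\<bar> = norm y" if "Im y = 0" for y using that by (simp add: cmod_eq_Re)
  have inner\<zeta>: "Re (\<zeta> f) < 1" if f: "f \<in> B" "f \<in> VP" "f \<noteq> e" "Im (\<zeta> f) = 0" for f
  proof -
    have "norm (\<zeta> f) \<le> 1" using inner[OF f(1)] w_pos by (simp add: norm_\<zeta> w_def[symmetric])
    then have "Re (\<zeta> f) \<le> 1" using real_norm[OF f(4)] by linarith
    moreover have "Re (\<zeta> f) \<noteq> 1" using \<zeta>_ne[OF f(2,3)] f(4) by (auto simp: complex_eq_iff)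
    ultimately show ?thesis by simp
  qed
  have seg_\<Phi>: "\<exists>s. 0 \<le> s \<and> s \<le> 1 \<and> \<Phi> (x, z) = ((z - \<tau>) * s) *\<^sub>R \<zeta> f"
    if f: "f \<in> VP" and seg: "x \<in> closed_segment (g (ln f \<tau>) z) (ln f z)" for x z f
  proof -
    obtain s where s: "0 \<le> s" "s \<le> 1" "x = (1 - s) *\<^sub>R g P z + s *\<^sub>R ln f z"
      using seg f unfolding closed_segment_def VP_def by blast
    have "x = g P z + (((z - \<tau>) * s) *\<^sub>R \<zeta> f) * w"
      unfolding s(3) ln_\<zeta>[OF f] by (simp add: algebra_simps)
    then have "\<Phi> (x, z) = ((z - \<tau>) * s) *\<^sub>R \<zeta> f" using w0 by (simp add: \<Phi>_def w_def scaleR_conv_of_real)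
    then show ?thesis using s by blast
  qed
  have noK: "x \<noteq> ln f z" if p: "(x, z) \<in> L" and f: "f \<in> U \<tau>" for x z f
  proof
    assume x: "x = ln f z"
    have fV: "f \<in> VP" by (rule L_P[OF p f]) (simp add: x)
    have e1: "\<Phi> (x, z) = ((z - \<tau>) * 1) *\<^sub>R \<zeta> f" using ln_\<zeta>[OF fV, of z] x w0 by (simp add: \<Phi>_def w_def scaleR_conv_of_real)
    have r: "Im (\<zeta> f) = 0" "l < Re (\<zeta> f)" "Re (\<zeta> f) < 1" using lens_ray[OF p fV _ e1] by auto
    then show False using le_l[OF fV] l01 by fastforce
  qed
  have noSec: "x \<notin> closed_segment (g (ln f \<tau>) z) (ln f z)" if p: "(x, z) \<in> L" and f: "f \<in> B" "f \<noteq> e" for x z f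
  proof
    assume x: "x \<in> closed_segment (g (ln f \<tau>) z) (ln f z)"
    have fU: "f \<in> U \<tau>" using f B by blast
    have fV: "f \<in> VP" by (rule L_P[OF p fU x])
    obtain s where s: "0 \<le> s" "s \<le> 1" "\<Phi> (x, z) = ((z - \<tau>) * s) *\<^sub>R \<zeta> f" using seg_\<Phi>[OF fV x] by blast
    have r: "Im (\<zeta> f) = 0" "l < s * Re (\<zeta> f)" using lens_ray[OF p fV s(1,3)] by auto
    have r0: "0 \<le> Re (\<zeta> f)"
    proof (rule ccontr)
      assume "\<not> 0 \<le> Re (\<zeta> f)"
      then have "s * Re (\<zeta> f) \<le> 0" using s(1) by (simp add: mult_nonneg_nonpos)
      then show False using r(2) l01 by linarith
    qed
    have "Re (\<zeta> f) \<le> l" by (rule le_l[OF fV r(1) r0 inner\<zeta>[OF f(1) fV f(2) r(1)]])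
    moreover have "s * Re (\<zeta> f) \<le> 1 * Re (\<zeta> f)" using s r0 by (intro mult_right_mono) auto
    ultimately show False using r(2) by simp
  qed
  have Be: "B - {e} \<subseteq> U \<tau>" using B by blast
  have LN: "L \<subseteq> N (B - {e})"
  proof
    fix p assume p: "p \<in> L"
    obtain x z where xz: "p = (x, z)" by (cases p)
    have z: "\<tau> < z" "z < t" using LZ[OF p] xz by auto
    show "p \<in> N (B - {e})" unfolding xz N_above_gen[OF z]
      using noK noSec p xz by blast
  qed
  have \<zeta>e: "\<zeta> e = 1" using w0 by (simp add: \<zeta>_def w_def)
  \<comment> \<open>Within the lens the sector of \<open>e\<close> is the zero set of
    \<open>Im\<close>, and nothing else is missing from \<open>N B\<close>.\<close>
  have LNB: "N B \<inter> L = (L \<inter> H1) \<union> (L \<inter> H2)"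
  proof (rule Set.set_eqI)
    fix p :: "complex \<times> real"
    obtain x z where xz: "p = (x, z)" by (cases p)
    show "p \<in> N B \<inter> L \<longleftrightarrow> p \<in> (L \<inter> H1) \<union> (L \<inter> H2)"
    proof (cases "p \<in> L")
      case True
      have z: "\<tau> < z" "z < t" using LZ[OF True] xz by auto
      have "p \<in> N B \<longleftrightarrow> x \<notin> closed_segment (g (ln e \<tau>) z) (ln e z)"
        unfolding xz N_above_gen[OF z] using noK noSec True xz B by blast
      also have "\<dots> \<longleftrightarrow> Im (\<Phi> p) \<noteq> 0"
      proof -
        have "Im (\<Phi> p) = 0" if "x \<in> closed_segment (g (ln e \<tau>) z) (ln e z)"
          using seg_\<Phi>[OF eVP that] \<zeta>e xz by auto
        moreover have "x \<in> closed_segment (g (ln e \<tau>) z) (ln e z)" if "Im (\<Phi> p) = 0"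
        proof -
          define s where "s = Re (\<Phi> p) / (z - \<tau>)"
          have b: "l * (z - \<tau>) < Re (\<Phi> p)" "Re (\<Phi> p) < z - \<tau>" using True xz by (auto simp: L_def Z_def)
          moreover have "0 \<le> l * (z - \<tau>)" using l01 z by simp
          ultimately have s: "0 \<le> s" "s \<le> 1" using z by (auto simp: s_def)
          have "\<Phi> p = of_real ((z - \<tau>) * s)" using that z by (simp add: s_def complex_eq_iff)
          then have "x = g P z + of_real ((z - \<tau>) * s) * w" using x_eq[of x z] xz by simp
          also have "\<dots> = (1 - s) *\<^sub>R g P z + s *\<^sub>R ln e z"
            unfolding ln_\<zeta>[OF eVP] \<zeta>e by (simp add: algebra_simps scaleR_conv_of_real)
          finally show ?thesis using s unfolding closed_segment_def P_def by blast
        qed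
        ultimately show ?thesis by blast
      qed
      finally show ?thesis using True by (auto simp: H1_def H2_def)
    qed auto
  qed
  \<comment> \<open>Only the open outer part of the sector has to be found in the lens. Its end on
    \<open>e\<close> lies in \<open>K\<close>; its part up to \<open>l\<close> is the spine or lies
    in the sector of a strictly slower strand, which belongs to \<open>B\<close> by
    \<open>outer\<close>.\<close>
  have cover: "N B \<union> L = N (B - {e})"
  proof
    have "N B \<subseteq> N (B - {e})" by (auto simp: N_def fan_def)
    then show "N B \<union> L \<subseteq> N (B - {e})" using LN by blast
    show "N (B - {e}) \<subseteq> N B \<union> L"
    proof
      fix p assume p: "p \<in> N (B - {e})"
      obtain x z where xz: "p = (x, z)" by (cases p)
      show "p \<in> N B \<union> L"
      proof (cases "\<tau> < z \<and> z < t \<and> x \<in> closed_segment (g (ln e \<tau>) z) (ln e z)")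
        case False
        then have "p \<in> N B" using p xz unfolding N_def fan_def by auto
        then show ?thesis by blast
      next
        case True
        then have z: "\<tau> < z" "z < t" and seg: "x \<in> closed_segment (g (ln e \<tau>) z) (ln e z)" by auto
        have nK: "\<And>f. f \<in> U \<tau> \<Longrightarrow> x \<noteq> ln f z" and nS: "\<And>f. f \<in> B - {e} \<Longrightarrow> x \<notin> closed_segment (g (ln f \<tau>) z) (ln f z)"
          using p unfolding xz N_above_gen[OF z] by auto
        obtain s where s: "0 \<le> s" "s \<le> 1" "\<Phi> (x, z) = ((z - \<tau>) * s) *\<^sub>R \<zeta> e" using seg_\<Phi>[OF eVP seg] by blast
        have \<Phi>s: "\<Phi> p = of_real ((z - \<tau>) * s)" using s(3) \<zeta>e xz by (simp add: scaleR_conv_of_real)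
        have xs: "x = g P z + of_real ((z - \<tau>) * s) * w" using x_eq[of x z] \<Phi>s xz by simp
        have "s \<noteq> 1"
        proof
          assume "s = 1"
          then have "x = ln e z" using xs ln_\<zeta>[OF eVP, of z] \<zeta>e by (simp add: scaleR_conv_of_real)
          then show False using nK[OF eU] by blast
        qed
        moreover have "l < s"
        proof (rule ccontr)
          assume sl: "\<not> l < s"
          have "s \<noteq> 0"
          proof
            assume "s = 0"
            then have "x = ln (sel \<tau> P) z" using xs by simp
            then show False using nK sel[OF P] by blast
          qed
          then have "l \<noteq> 0" using sl s(1) by auto
          then obtain f where f: "f \<in> VP" "Im (\<zeta> f) = 0" "Re (\<zeta> f) = l" using l\<Lambda> by (auto simp: \<Lambda>_def)
          have "norm (\<zeta> f) < 1" using real_norm[OF f(2)] f(3) l01 by simp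
          then have "norm (rel_vel f) < norm (rel_vel e)" using w_pos by (simp add: norm_\<zeta> w_def)
          then have fB: "f \<in> B" using outer[of f] f(1) by (auto simp: VP_def not_less[symmetric])
          have "f \<noteq> e" using \<zeta>e f(3) l01 by auto
          have l0: "0 < l" using l01 \<open>l \<noteq> 0\<close> by simp
          have \<zeta>f: "\<zeta> f = of_real l" using f by (simp add: complex_eq_iff)
          define u where "u = s / l"
          have u: "0 \<le> u" "u \<le> 1" using s(1) sl l0 by (auto simp: u_def)
          have "(1 - u) *\<^sub>R g P z + u *\<^sub>R ln f z = g P z + of_real (u * ((z - \<tau>) * l)) * w"
            unfolding ln_\<zeta>[OF f(1)] \<zeta>f by (simp add: algebra_simps scaleR_conv_of_real)
          also have "u * ((z - \<tau>) * l) = (z - \<tau>) * s" using l0 by (simp add: u_def)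
          finally have "x = (1 - u) *\<^sub>R g P z + u *\<^sub>R ln f z" using xs by simp
          then have "x \<in> closed_segment (g (ln f \<tau>) z) (ln f z)"
            using u f(1) unfolding closed_segment_def VP_def by blast
          then show False using nS fB \<open>f \<noteq> e\<close> by blast
        qed
        ultimately have s1: "s < 1" and ls: "l < s" using s by auto
        have "Re (\<Phi> p) = (z - \<tau>) * s" "Im (\<Phi> p) = 0" "Z p = z - \<tau>" using \<Phi>s xz by (auto simp: Z_def)
        moreover have "l * (z - \<tau>) < (z - \<tau>) * s" "(z - \<tau>) * s < z - \<tau>" using z s1 ls by (auto simp: mult.commute)
        ultimately have "p \<in> L" using \<epsilon>0 z by (simp add: L_def)
        then show ?thesis by blast
      qed
    qed
  qed
  \<comment> \<open>A point in either half: at half the height of the slab, with \<open>Re\<close>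
    in the middle of its interval and \<open>Im\<close> at half its bound.\<close>
  have wit: "\<exists>p. p \<in> L \<and> Im (\<Phi> p) = \<sigma> * (\<epsilon> * (1 - l) * (t - \<tau>) / 8)" if "\<bar>\<sigma>\<bar> = 1" for \<sigma>
  proof -
    define d where "d = t - \<tau>"
    have d: "0 < d" using t by (simp add: d_def)
    define z where "z = \<tau> + d / 2"
    define y where "y = Complex ((l + 1) / 2 * (d / 2)) (\<sigma> * (\<epsilon> * (1 - l) * d / 8))"
    define p where "p = (g P z + y * w, z)"
    have \<Phi>p: "\<Phi> p = y" using w0 by (simp add: p_def \<Phi>_def w_def)
    have Zp: "Z p = d / 2" by (simp add: p_def Z_def z_def)
    have pos: "0 < (1 - l) * d" using l01 d by simp
    have ab: "\<bar>\<sigma> * (\<epsilon> * (1 - l) * d / 8)\<bar> = \<epsilon> * ((1 - l) * d / 8)"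
      using that \<epsilon>0 l01 d by (simp add: abs_mult)
    have e1: "(l + 1) / 2 * (d / 2) - l * (d / 2) = (1 - l) * d / 4" "d / 2 - (l + 1) / 2 * (d / 2) = (1 - l) * d / 4"
      by (simp_all add: field_simps)
    have lt: "\<epsilon> * ((1 - l) * d / 8) < \<epsilon> * ((1 - l) * d / 4)"
      by (rule mult_strict_left_mono[OF _ \<epsilon>0]) (use pos in linarith)
    have pos4: "0 < (1 - l) * d / 4" using pos by linarith
    have i: "l * (d / 2) < (l + 1) / 2 * (d / 2)" "(l + 1) / 2 * (d / 2) < d / 2"
    proof -
      show "l * (d / 2) < (l + 1) / 2 * (d / 2)" using pos4 unfolding e1(1)[symmetric] by (simp only: diff_gt_0_iff_gt)
      show "(l + 1) / 2 * (d / 2) < d / 2" using pos4 unfolding e1(2)[symmetric] by (simp only: diff_gt_0_iff_gt)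
    qed
    have "p \<in> L" unfolding L_def
    proof (intro IntI CollectI)
      show "l * Z p < Re (\<Phi> p)" "Re (\<Phi> p) < Z p" using i by (simp_all add: \<Phi>p Zp y_def)
      show "\<bar>Im (\<Phi> p)\<bar> < \<epsilon> * (Re (\<Phi> p) - l * Z p)" "\<bar>Im (\<Phi> p)\<bar> < \<epsilon> * (Z p - Re (\<Phi> p))"
        using lt unfolding \<Phi>p Zp y_def complex.sel ab e1 by simp_all
      show "Z p < t - \<tau>" using d by (simp add: Zp d_def[symmetric])
    qed
    then show ?thesis using \<Phi>p by (intro exI[of _ p]) (simp add: y_def d_def)
  qed
  have posq: "0 < \<epsilon> * (1 - l) * (t - \<tau>) / 8" using \<epsilon>0 l01 t by simp
  have ne1: "L \<inter> H1 \<noteq> {}" using wit[of 1] posq by (auto simp: H1_def)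
  have ne2: "L \<inter> H2 \<noteq> {}" using wit[of "-1"] posq by (fastforce simp: H2_def)
  have "freely_generated (N B \<union> L) a"
    by (rule freely_generated_wall[OF fr open_N[OF B(1)] openL convL LNB])
      (use openL openH convL convH ne1 ne2 in \<open>auto simp: H1_def H2_def intro: convex_Int\<close>)
  then show ?thesis unfolding cover .
qed

text \<open>The hypothesis on speeds says that the strands already freed are the faster ones; it
  survives the removal of a fastest strand from \<open>B\<close>.\<close>

lemma walls:
  assumes "B \<subseteq> U \<tau>" "\<And>f f'. f \<in> U \<tau> - B \<Longrightarrow> f' \<in> B \<Longrightarrow> norm (rel_vel f') \<le> norm (rel_vel f)"
    and "freely_generated (N B) a"
  shows "freely_generated (M t) a"
proof -
  have "finite B" using assms(1) U_sub fin by (meson finite_subset)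
  then show ?thesis using assms
  proof (induction "card B" arbitrary: B)
    case 0
    then show ?case by (simp add: N_def fan_def)
  next
    case (Suc n)
    have ne: "B \<noteq> {}" using Suc.hyps(2) by auto
    have "Max ((\<lambda>f. norm (rel_vel f)) ` B) \<in> (\<lambda>f. norm (rel_vel f)) ` B" using Suc.prems ne by (intro Max_in) auto
    then obtain e where e: "e \<in> B" "norm (rel_vel e) = Max ((\<lambda>f. norm (rel_vel f)) ` B)" by auto
    have mx: "norm (rel_vel f) \<le> norm (rel_vel e)" if "f \<in> B" for f using e(2) Suc.prems(1) that by simp
    have "freely_generated (N (B - {e})) a"
      using Suc.prems(2-4) e(1) mx by (intro wall_step) auto
    then show ?case
      using Suc.prems Suc.hyps(2) e(1) mx
      by (intro Suc.hyps(1)[of "B - {e}"]) auto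
  qed
qed

end

end

section \<open>Sweeping by height\<close>

text \<open>The supremum of the good initial segments is itself good by \<open>left\<close>, and by
  \<open>right\<close> it cannot lie before \<open>b\<close>. This spares an enumeration of the
  vertex heights.\<close>

lemma real_induct:
  fixes a b :: real
  assumes ab: "a \<le> b" and base: "P a"
    and right: "\<And>x. a \<le> x \<Longrightarrow> x < b \<Longrightarrow> (\<And>y. a \<le> y \<Longrightarrow> y \<le> x \<Longrightarrow> P y) \<Longrightarrow> \<exists>e>0. \<forall>y. x < y \<and> y \<le> x + e \<longrightarrow> P y"
    and left: "\<And>x. a < x \<Longrightarrow> x \<le> b \<Longrightarrow> (\<And>y. a \<le> y \<Longrightarrow> y < x \<Longrightarrow> P y) \<Longrightarrow> P x"
  shows "P b"
proof -
  define Q where "Q = {x. a \<le> x \<and> x \<le> b \<and> (\<forall>y. a \<le> y \<and> y \<le> x \<longrightarrow> P y)}"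
  have aQ: "a \<in> Q" using ab base by (auto simp: Q_def)
  have bdd: "bdd_above Q" by (auto simp: Q_def intro: bdd_aboveI[of _ b])
  define c where "c = Sup Q"
  have ac: "a \<le> c" unfolding c_def by (rule cSup_upper[OF aQ bdd])
  have cb: "c \<le> b" unfolding c_def using aQ by (intro cSup_least) (auto simp: Q_def)
  have below: "P y" if y: "a \<le> y" "y < c" for y
  proof -
    have "Q \<noteq> {}" using aQ by blast
    then obtain x where "x \<in> Q" "y < x" using less_cSupD[OF _ y(2)[unfolded c_def]] by blast
    then show ?thesis using y by (auto simp: Q_def)
  qed
  have Pc: "P c" using below left[of c] ac cb base by (cases "a = c") auto
  then have all: "P y" if "a \<le> y" "y \<le> c" for y using below that by (cases "y = c") auto
  show ?thesis
  proof (cases "c = b")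
    case False
    then obtain e where e: "e > 0" "\<And>y. c < y \<Longrightarrow> y \<le> c + e \<Longrightarrow> P y" using right[of c] all ac cb by force
    have "P y" if "a \<le> y" "y \<le> min (c + e) b" for y using all e(2) that by (cases "y \<le> c") auto
    then have "min (c + e) b \<in> Q" using ac cb e(1) ab by (auto simp: Q_def)
    then have "min (c + e) b \<le> c" unfolding c_def by (rule cSup_upper[OF _ bdd])
    then show ?thesis using False cb e(1) by auto
  qed (use Pc in simp)
qed

lemma simply_connected_deform:
  fixes A :: "'a::real_normed_vector set" and F :: "real \<Rightarrow> 'a \<Rightarrow> 'a"
  assumes F: "continuous_on ({0..1} \<times> A) (\<lambda>y. F (fst y) (snd y))" "\<And>x. F 0 x = x"
      "\<And>s x. s \<in> {0..1} \<Longrightarrow> x \<in> A \<Longrightarrow> F s x \<in> A"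
    and Cv: "convex Cv" "Cv \<subseteq> A" "\<And>x. x \<in> A \<Longrightarrow> F 1 x \<in> Cv" and c: "c \<in> Cv"
  shows "simply_connected A"
proof -
  have "homotopic_with_canon (\<lambda>_. True) A A id (F 1)"
    unfolding homotopic_with_def
  proof (intro exI[of _ "\<lambda>y. F (fst y) (snd y)"] conjI allI ballI)
    show "continuous_map (prod_topology (top_of_set {0..1}) (top_of_set A)) (top_of_set A) (\<lambda>y. F (fst y) (snd y))"
      using F(1,3) by (auto simp: image_subset_iff)
  qed (use F in auto)
  moreover have "homotopic_with_canon (\<lambda>_. True) A A (F 1) (\<lambda>_. c)"
  proof (rule homotopic_with_linear)
    show "continuous_on A (F 1)"
    proof (rule continuous_on_compose2[OF F(1), where f="\<lambda>y. (1, y)", simplified])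
      show "continuous_on A (\<lambda>y. (1::real, y))" by (intro continuous_intros)
    qed auto
    show "closed_segment (F 1 x) c \<subseteq> A" if "x \<in> A" for x
      using closed_segment_subset[OF Cv(3)[OF that] c Cv(1)] Cv(2) by blast
  qed auto
  ultimately have "contractible A"
    unfolding contractible_def using homotopic_with_trans by blast
  then show ?thesis by (rule contractible_imp_simply_connected)
qed

context strands
begin

text \<open>If no strand starts at the level, only one passes through each of its points, so every
  sector degenerates to its strand.\<close>

lemma N_no_vertex:
  assumes gd: "good \<tau> \<delta> \<eta>" and t: "\<tau> < t" "t \<le> \<tau> + \<eta>" and \<tau>T: "\<tau> < T" and nov: "\<tau> \<notin> lo ` S"
  shows "N \<tau> t (U \<tau>) = M t"
proof -
  have inj: "sel \<tau> (ln e \<tau>) = e" if e: "e \<in> U \<tau>" for e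
  proof (rule ccontr)
    let ?f = "sel \<tau> (ln e \<tau>)"
    assume ne: "?f \<noteq> e"
    have "ln e \<tau> \<in> pts \<tau>" using e by (simp add: pts_def)
    then have f: "?f \<in> U \<tau>" "ln ?f \<tau> = ln e \<tau>" using sel by blast+
    have "\<tau> = lo e \<or> \<tau> = hi e"
      using disj[of ?f e \<tau>] ne f e by (auto simp: U_def)
    then show False using e nov by (auto simp: U_def)
  qed
  have "fan \<tau> t (U \<tau>) \<inter> M t = {}"
  proof (rule ccontr)
    assume "fan \<tau> t (U \<tau>) \<inter> M t \<noteq> {}"
    then obtain p where p: "p \<in> fan \<tau> t (U \<tau>)" "p \<in> M t" by blast
    then obtain e where e: "\<tau> < snd p" "snd p < t" "e \<in> U \<tau>" "fst p \<in> closed_segment (ln (sel \<tau> (ln e \<tau>)) (snd p)) (ln e (snd p))"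
      by (auto simp: fan_def)
    then have "fst p = ln e (snd p)" by (simp add: inj)
    then have "(fst p, snd p) \<in> K" using K_above[OF gd t \<tau>T e(1,2), of "fst p"] e(3) by blast
    then have "p \<in> K" by simp
    then show False using p(2) by (simp add: M_def)
  qed
  then have "M t - fan \<tau> t (U \<tau>) = M t" by (simp only: Diff_triv Int_commute)
  then show ?thesis by (simp only: N_def[OF gd t \<tau>T])
qed

text \<open>The distance 1 between the base point and all strands matches the bound
  \<open>\<delta> \<le> 1\<close> in \<open>good\<close>, so every deformation of the sweep fixes
  the base point.\<close>

context
  fixes a :: "complex \<times> real"
  assumes a: "\<And>e. e \<in> S \<Longrightarrow> snd a + 1 \<le> lo e"
begin

definition bottom :: real where "bottom = Min (lo ` S)"

lemma bottom_le: "e \<in> S \<Longrightarrow> bottom \<le> lo e"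
  unfolding bottom_def using fin by simp

lemma bottom_attained: obtains e where "e \<in> S" "lo e = bottom"
proof -
  have "bottom \<in> lo ` S" unfolding bottom_def using fin ne by (intro Min_in) auto
  then obtain e where e: "bottom = lo e" "e \<in> S" by (rule imageE)
  show ?thesis by (rule that[OF e(2) e(1)[symmetric]])
qed

lemma a_bottom: "snd a + 1 \<le> bottom"
  using a bottom_attained by metis

lemma a_K: "a \<notin> K"
proof
  assume "a \<in> K"
  then obtain e where "e \<in> S" "lo e \<le> snd a" unfolding K_def by auto
  then show False using a[of e] by simp
qed

lemma a_M: "bottom \<le> t \<Longrightarrow> a \<in> M t"
  using a_K a_bottom by (simp add: M_def)

lemma pts_ne: "bottom \<le> \<tau> \<Longrightarrow> \<tau> < T \<Longrightarrow> pts \<tau> \<noteq> {}"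
  unfolding pts_def using U_nonempty by (metis bottom_attained image_is_empty)

text \<open>One \<open>\<eta>\<close> serves all upper heights \<open>t\<close> at once, which is
  the form that real induction asks for.\<close>

lemma fan_step:
  assumes "bottom \<le> \<tau>" "\<tau> < T"
  shows "\<exists>\<eta>>0. \<forall>t. \<tau> < t \<and> t \<le> \<tau> + \<eta> \<longrightarrow> pi1_eq (M \<tau>) (N \<tau> t (U \<tau>)) a \<and>
    (freely_generated (N \<tau> t (U \<tau>)) a \<longrightarrow> freely_generated (M t) a) \<and> (\<tau> \<notin> lo ` S \<longrightarrow> N \<tau> t (U \<tau>) = M t)"
proof -
  obtain \<delta> \<eta> where gd: "good \<tau> \<delta> \<eta>" by (rule ex_good)
  have d: "0 < \<eta>" "\<delta> \<le> 1" using gd by (auto simp: good_def)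
  have sa: "snd a \<le> \<tau> - \<delta>" using a_bottom assms d by linarith
  show ?thesis
  proof (intro exI[of _ \<eta>] conjI allI impI d(1))
    fix t assume "\<tau> < t \<and> t \<le> \<tau> + \<eta>"
    then have t: "\<tau> < t" "t \<le> \<tau> + \<eta>" by auto
    show "pi1_eq (M \<tau>) (N \<tau> t (U \<tau>)) a"
      by (rule pi1_eq_step[OF gd t assms(2) a_K sa pts_ne[OF assms]])
    show "freely_generated (M t) a" if "freely_generated (N \<tau> t (U \<tau>)) a"
      by (rule walls[OF gd t assms(2) order_refl _ that]) auto
    show "N \<tau> t (U \<tau>) = M t" if "\<tau> \<notin> lo ` S"
      by (rule N_no_vertex[OF gd t assms(2) that])
  qed
qed

lemma M_mono: "s \<le> t \<Longrightarrow> M s \<subseteq> M t" by (auto simp: M_def)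

text \<open>Just above each level the fans are degenerate, so \<open>pi1_eq_step\<close> compares
  the spaces themselves; a level approached from below is an increasing union of earlier
  spaces.\<close>

lemma pi1_eq_no_vertex:
  assumes s: "bottom \<le> s" "s \<le> t" "t \<le> T" and nov: "\<And>e. e \<in> S \<Longrightarrow> lo e < s \<or> t \<le> lo e"
  shows "pi1_eq (M s) (M t) a"
  using s(2)
proof (rule real_induct[where P="\<lambda>t. pi1_eq (M s) (M t) a"])
  show "pi1_eq (M s) (M s) a" by (rule pi1_eq_refl[OF a_M[OF s(1)]])
next
  fix x assume x: "s \<le> x" "x < t" and P: "\<And>y. s \<le> y \<Longrightarrow> y \<le> x \<Longrightarrow> pi1_eq (M s) (M y) a"
  have bx: "bottom \<le> x" "x < T" using x s by linarith+
  obtain \<eta> where \<eta>: "0 < \<eta>" "\<And>t. x < t \<Longrightarrow> t \<le> x + \<eta> \<Longrightarrow> pi1_eq (M x) (N x t (U x)) a"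
    "\<And>t. x < t \<Longrightarrow> t \<le> x + \<eta> \<Longrightarrow> freely_generated (N x t (U x)) a \<Longrightarrow> freely_generated (M t) a"
    "\<And>t. x < t \<Longrightarrow> t \<le> x + \<eta> \<Longrightarrow> x \<notin> lo ` S \<Longrightarrow> N x t (U x) = M t"
    using fan_step[OF bx] by auto
  have "x \<notin> lo ` S" using nov x by force
  then have "pi1_eq (M s) (M y) a" if "x < y" "y \<le> x + \<eta>" for y
    using pi1_eq_trans[OF P[OF x(1) order_refl]] \<eta>(2,4)[OF that] by simp
  then show "\<exists>e>0. \<forall>y. x < y \<and> y \<le> x + e \<longrightarrow> pi1_eq (M s) (M y) a" using \<eta>(1) by blast
next
  fix x assume x: "s < x" "x \<le> t" and P: "\<And>y. s \<le> y \<Longrightarrow> y < x \<Longrightarrow> pi1_eq (M s) (M y) a"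
  define q where "q n = x - (x - s) / real (Suc n)" for n
  have q: "s \<le> q n" "q n < x" for n
  proof -
    have "(x - s) / real (Suc n) \<le> (x - s) / 1" using x by (intro divide_left_mono) auto
    then show "s \<le> q n" by (simp add: q_def)
    show "q n < x" using x by (simp add: q_def)
  qed
  have inc: "incseq (\<lambda>n. M (q n))"
  proof (rule incseq_SucI)
    fix n
    have "(x - s) / real (Suc (Suc n)) \<le> (x - s) / real (Suc n)" using x by (intro divide_left_mono) auto
    then show "M (q n) \<subseteq> M (q (Suc n))" by (intro M_mono) (simp add: q_def)
  qed
  have "(\<Union>n. M (q n)) = M x"
  proof
    show "(\<Union>n. M (q n)) \<subseteq> M x" using M_mono[OF less_imp_le[OF q(2)]] by blast
    show "M x \<subseteq> (\<Union>n. M (q n))"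
    proof
      fix p assume p: "p \<in> M x"
      then have "0 < (x - snd p) / (x - s)" using x by (simp add: M_def)
      then obtain n where "1 / real (Suc n) < (x - snd p) / (x - s)" by (metis nat_approx_posE)
      then have "snd p < q n" using x by (simp add: q_def field_simps)
      then show "p \<in> (\<Union>n. M (q n))" using p by (auto simp: M_def)
    qed
  qed
  then show "pi1_eq (M s) (M x) a"
    using pi1_eq_limit[of "M s" "\<lambda>n. M (q n)" a] P q open_M inc by metis
qed

lemma freely_generated_M:
  assumes "bottom \<le> t" "t \<le> T"
  shows "freely_generated (M t) a"
  using assms(1)
proof (rule real_induct[where P="\<lambda>t. freely_generated (M t) a"])
  have "M bottom = {p. snd p < bottom}"
    unfolding M_def K_def using bottom_le by force
  moreover have "convex {p :: complex \<times> real. snd p < bottom}"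
  proof -
    have "affine_fun (\<lambda>p :: complex \<times> real. snd p)" by (simp add: affine_fun_def)
    then show ?thesis by (rule convex_affine_less[OF _ affine_fun_const])
  qed
  ultimately have "convex (M bottom)" by simp
  then show "freely_generated (M bottom) a"
    by (rule freely_generated_simply_connected[OF convex_imp_simply_connected a_M[OF order_refl]])
next
  fix x assume x: "bottom \<le> x" "x < t" and P: "\<And>y. bottom \<le> y \<Longrightarrow> y \<le> x \<Longrightarrow> freely_generated (M y) a"
  have xT: "x < T" using x assms by linarith
  have bx: "bottom \<le> x" "x < T" using x xT by linarith+
  obtain \<eta> where \<eta>: "0 < \<eta>" "\<And>t. x < t \<Longrightarrow> t \<le> x + \<eta> \<Longrightarrow> pi1_eq (M x) (N x t (U x)) a"
    "\<And>t. x < t \<Longrightarrow> t \<le> x + \<eta> \<Longrightarrow> freely_generated (N x t (U x)) a \<Longrightarrow> freely_generated (M t) a"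
    "\<And>t. x < t \<Longrightarrow> t \<le> x + \<eta> \<Longrightarrow> x \<notin> lo ` S \<Longrightarrow> N x t (U x) = M t"
    using fan_step[OF bx] by auto
  have "freely_generated (M y) a" if "x < y" "y \<le> x + \<eta>" for y
    using freely_generated_mono[OF \<eta>(2)[OF that] P[OF x(1) order_refl]] \<eta>(3)[OF that] by blast
  then show "\<exists>e>0. \<forall>y. x < y \<and> y \<le> x + e \<longrightarrow> freely_generated (M y) a" using \<eta>(1) by blast
next
  fix x assume x: "bottom < x" "x \<le> t" and P: "\<And>y. bottom \<le> y \<Longrightarrow> y < x \<Longrightarrow> freely_generated (M y) a"
  \<comment> \<open>Free generation need not survive an increasing union. The level \<open>x\<close>
    is therefore approached through an interval in which no strand starts, beginning halfway between
    the last starting height before \<open>x\<close> and \<open>x\<close>.\<close>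
  define r where "r = Max (lo ` {e \<in> S. lo e < x})"
  obtain e0 where e0: "e0 \<in> S" "lo e0 = bottom" by (rule bottom_attained)
  have f: "finite (lo ` {e \<in> S. lo e < x})" "lo ` {e \<in> S. lo e < x} \<noteq> {}" using fin e0 x by auto
  have "r \<in> lo ` {e \<in> S. lo e < x}" unfolding r_def by (rule Max_in[OF f])
  then have r: "r < x" "bottom \<le> r" using bottom_le by auto
  define s where "s = (r + x) / 2"
  have s: "r < s" "s < x" "bottom \<le> s" using r by (auto simp: s_def)
  have "lo e < s \<or> x \<le> lo e" if "e \<in> S" for e
  proof (cases "lo e < x")
    case True
    then have "lo e \<le> r" unfolding r_def using that f by (intro Max_ge) auto
    then show ?thesis using s by simp
  qed simp
  then have "pi1_eq (M s) (M x) a" using s x assms by (intro pi1_eq_no_vertex) auto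
  then show "freely_generated (M x) a" using P[OF s(3,2)] by (rule freely_generated_mono)
qed

text \<open>What is missing above \<open>M T\<close> is glued in as a cap \<open>E\<close>, the
  region above a cone with its apex at the top point. The overlap winds around the apex; inside
  \<open>I\<close> such a loop can be blown up from the apex until it lies below all strands, where
  it bounds, so \<open>freely_generated_cap\<close> applies.\<close>

theorem freely_generated_complement: "freely_generated (- K) a"
proof -
  have bT: "bottom \<le> T" using bottom_attained lohi hiT by (metis less_imp_le order_trans)
  obtain e1 where e1: "e1 \<in> S" "hi e1 = T"
  proof -
    have "Max (hi ` S) \<in> hi ` S" using fin ne by (intro Max_in) auto
    then obtain e where e: "e \<in> S" "hi e = Max (hi ` S)" by auto
    have "hi e = T"
    proof (rule ccontr)
      assume "hi e \<noteq> T"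
      then obtain e' where e': "e' \<in> S" "lo e' = hi e" using up[OF e(1)] hiT[OF e(1)] by force
      then have "hi e' \<le> hi e" unfolding e(2) using fin by simp
      then show False using lohi[OF e'(1)] e' by simp
    qed
    then show ?thesis using e that by blast
  qed
  have XK: "(X, T) \<in> K" using e1 top[OF e1] lohi[OF e1(1)] unfolding K_def by force
  \<comment> \<open>The cone is flat enough to stay above \<open>K\<close>. Strands ending at the
    top have horizontal speed at most \<open>C\<close>; the others end at least \<open>d\<close>
    below the top and stay within horizontal distance \<open>R\<close> of it.\<close>
  obtain c where c: "0 < c" "\<And>x z. (x, z) \<in> K \<Longrightarrow> c * dist x X \<le> T - z"
  proof -
    obtain R where R: "0 < R" "\<And>p. p \<in> K \<Longrightarrow> dist (fst p) X \<le> R"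
    proof -
      have "bounded ((\<lambda>p. dist (fst p) X) ` K)"
        by (intro compact_imp_bounded compact_continuous_image compact_K continuous_intros)
      then obtain R where "0 < R" "\<forall>y \<in> (\<lambda>p. dist (fst p) X) ` K. norm y \<le> R" using bounded_pos by blast
      then show ?thesis by (intro that[of R]) auto
    qed
    define D where "D = insert 1 ((\<lambda>e. T - hi e) ` {e \<in> S. hi e < T})"
    have fD: "finite D" using fin by (simp add: D_def)
    define d where "d = Min D"
    have "d \<in> D" unfolding d_def by (rule Min_in[OF fD]) (simp add: D_def)
    then have d: "0 < d" by (auto simp: D_def)
    define c where "c = min (1 / C) (d / R)"
    have C: "0 < C" using C_ge1 by simp
    show ?thesis
    proof (rule that[of c])
      show "0 < c" using d R C by (simp add: c_def)
      fix x z assume xz: "(x, z) \<in> K"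
      then obtain e where e: "e \<in> S" "z \<le> hi e" "x = ln e z" by (auto simp: K_def)
      show "c * dist x X \<le> T - z"
      proof (cases "hi e = T")
        case True
        have "dist x X \<le> C * (T - z)" using ln_lipschitz[OF e(1), of z T] top[OF e(1) True] e True by simp
        then have "1 / C * dist x X \<le> T - z" using C by (simp add: field_simps)
        moreover have "c * dist x X \<le> 1 / C * dist x X" by (intro mult_right_mono) (auto simp: c_def)
        ultimately show ?thesis by linarith
      next
        case False
        then have "T - hi e \<in> D" using hiT[OF e(1)] e by (auto simp: D_def)
        then have "d \<le> T - hi e" unfolding d_def by (rule Min_le[OF fD])
        moreover have "c * dist x X \<le> d / R * R"
          using R(2)[OF xz] R(1) d by (intro mult_mono) (auto simp: c_def)
        ultimately show ?thesis using e R(1) by simp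
      qed
    qed
  qed
  define E where "E = {p :: complex \<times> real. T - c * dist (fst p) X < snd p}"
  define I where "I = {p :: complex \<times> real. snd p < T \<and> (snd p < bottom \<or> T - c * dist (fst p) X < snd p)}"
  have cover: "M T \<union> E = - K"
  proof (rule Set.set_eqI)
    fix p :: "complex \<times> real"
    obtain x z where p: "p = (x, z)" by (cases p)
    have "p \<notin> K" if "p \<in> E" using c(2)[of x z] that p by (auto simp: E_def)
    moreover have "p \<in> M T \<union> E" if "p \<notin> K"
    proof (cases "z < T")
      case True then show ?thesis using that p by (simp add: M_def)
    next
      case False
      have "x \<noteq> X \<or> z \<noteq> T" using that XK p by auto
      then have "0 < c * dist x X \<or> T < z" using False c(1) by (cases "x = X") auto
      moreover have "0 \<le> c * dist x X" using c(1) by simp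
      ultimately show ?thesis using p False unfolding E_def by fastforce
    qed
    ultimately show "p \<in> M T \<union> E \<longleftrightarrow> p \<in> - K" by (auto simp: M_def)
  qed
  have openE: "open E" unfolding E_def by (intro open_Collect_less continuous_intros)
  have cvx: "convex {p :: complex \<times> real. f < snd p}" "convex {p :: complex \<times> real. snd p < f}" for f
  proof -
    have "affine_fun (\<lambda>p :: complex \<times> real. snd p)" by (simp add: affine_fun_def)
    then show "convex {p :: complex \<times> real. f < snd p}" "convex {p :: complex \<times> real. snd p < f}"
      by (intro convex_affine_less affine_fun_const; simp)+
  qed
  have scE: "simply_connected E"
  proof (rule simply_connected_deform[where F="\<lambda>s p. (fst p, (1 - s) * snd p + s * max (snd p) (T + 1))" and Cv="{p. T < snd p}" and c="(X, T + 1)"])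
    show "continuous_on ({0..1} \<times> E) (\<lambda>y. (fst (snd y), (1 - fst y) * snd (snd y) + fst y * max (snd (snd y)) (T + 1)))"
      by (intro continuous_intros)
    show "(fst p, (1 - s) * snd p + s * max (snd p) (T + 1)) \<in> E" if s: "s \<in> {0..1}" and p: "p \<in> E" for s p
    proof -
      have "s * snd p \<le> s * max (snd p) (T + 1)" using s by (intro mult_left_mono) auto
      then have "snd p \<le> (1 - s) * snd p + s * max (snd p) (T + 1)" by (simp add: algebra_simps)
      then show ?thesis using p by (simp add: E_def)
    qed
    show "{p. T < snd p} \<subseteq> E"
    proof
      fix p :: "complex \<times> real" assume "p \<in> {p. T < snd p}"
      moreover have "0 \<le> c * dist (fst p) X" using c(1) by simp
      ultimately show "p \<in> E" by (auto simp: E_def intro: le_less_trans)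
    qed
  qed (use cvx in auto)
  \<comment> \<open>A homothety about the apex with factor at least 1 preserves both alternatives in
    \<open>I\<close>. The final factor multiplies the depth \<open>T - snd p\<close> so as to add
    \<open>T - bottom + 1\<close> to it, which brings \<open>p\<close> below
    \<open>bottom\<close>.\<close>
  have scI: "simply_connected I"
  proof (rule simply_connected_deform[where F="\<lambda>s p. (X, T) + (1 + s * ((T - bottom + 1) / (T - snd p))) *\<^sub>R (p - (X, T))"
        and Cv="{p. snd p < bottom}" and c="(X, bottom - 1)"])
    show "continuous_on ({0..1} \<times> I) (\<lambda>y. (X, T) + (1 + fst y * ((T - bottom + 1) / (T - snd (snd y)))) *\<^sub>R (snd y - (X, T)))"
      by (intro continuous_intros) (auto simp: I_def)
    fix s p assume s: "s \<in> {0..1::real}" and p: "p \<in> I"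
    define r where "r = 1 + s * ((T - bottom + 1) / (T - snd p))"
    have zT: "snd p < T" using p by (simp add: I_def)
    have r: "1 \<le> r" using s zT bT by (simp add: r_def)
    have sn: "snd ((X, T) + r *\<^sub>R (p - (X, T))) = T - r * (T - snd p)" by (simp add: algebra_simps)
    have fs: "dist (fst ((X, T) + r *\<^sub>R (p - (X, T)))) X = r * dist (fst p) X" using r by (simp add: dist_norm)
    have ge: "T - snd p \<le> r * (T - snd p)" using r zT by simp
    have "snd ((X, T) + r *\<^sub>R (p - (X, T))) < T" unfolding sn using ge zT by linarith
    moreover have "T - r * (T - snd p) < bottom" if "snd p < bottom" using that ge by linarith
    moreover have "T - c * (r * dist (fst p) X) < T - r * (T - snd p)" if "T - c * dist (fst p) X < snd p"
    proof -
      have "r * (T - snd p) < r * (c * dist (fst p) X)" using that r by (intro mult_strict_left_mono) auto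
      then show ?thesis by (simp add: mult.left_commute)
    qed
    ultimately show "(X, T) + (1 + s * ((T - bottom + 1) / (T - snd p))) *\<^sub>R (p - (X, T)) \<in> I"
      unfolding r_def[symmetric] using p unfolding I_def mem_Collect_eq sn fs by blast
  next
    fix p assume p: "p \<in> I"
    then have zT: "0 < T - snd p" by (simp add: I_def)
    have "snd ((X, T) + r *\<^sub>R (p - (X, T))) = T - r * (T - snd p)" for r
      by (simp add: algebra_simps)
    then have "snd ((X, T) + (1 + 1 * ((T - bottom + 1) / (T - snd p))) *\<^sub>R (p - (X, T))) = T - (1 + (T - bottom + 1) / (T - snd p)) * (T - snd p)"
      by simp
    also have "\<dots> = T - ((T - snd p) + (T - bottom + 1))"
    proof -
      have "0 < d \<Longrightarrow> (1 + k / d) * d = d + k" for d k :: real by (simp add: field_simps)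
      from this[OF zT] show ?thesis by (simp only:)
    qed
    also have "\<dots> < bottom" using zT by simp
    finally show "(X, T) + (1 + 1 * ((T - bottom + 1) / (T - snd p))) *\<^sub>R (p - (X, T)) \<in> {p. snd p < bottom}" by simp
  next
    show "{p. snd p < bottom} \<subseteq> I" using bT by (auto simp: I_def)
  qed (use cvx in auto)
  have AE: "M T \<inter> E = (\<lambda>(x, u). (x, T - u * (c * dist x X))) ` ((- {X}) \<times> {0<..<1})"
  proof
    show "M T \<inter> E \<subseteq> (\<lambda>(x, u). (x, T - u * (c * dist x X))) ` ((- {X}) \<times> {0<..<1})"
    proof
      fix p assume "p \<in> M T \<inter> E"
      then obtain x z where p: "p = (x, z)" "z < T" "T - c * dist x X < z" by (cases p) (auto simp: M_def E_def)
      define u where "u = (T - z) / (c * dist x X)"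
      have pos: "0 < c * dist x X" using p by linarith
      then have "x \<noteq> X" by auto
      moreover have "0 < u" "u < 1" "T - u * (c * dist x X) = z" using p pos by (auto simp: u_def)
      ultimately show "p \<in> (\<lambda>(x, u). (x, T - u * (c * dist x X))) ` ((- {X}) \<times> {0<..<1})"
        using p by (intro image_eqI[of _ _ "(x, u)"]) auto
    qed
    show "(\<lambda>(x, u). (x, T - u * (c * dist x X))) ` ((- {X}) \<times> {0<..<1}) \<subseteq> M T \<inter> E"
    proof
      fix p assume "p \<in> (\<lambda>(x, u). (x, T - u * (c * dist x X))) ` ((- {X}) \<times> {0<..<1})"
      then obtain q where q: "q \<in> (- {X}) \<times> {0<..<1}" "p = (case q of (x, u) \<Rightarrow> (x, T - u * (c * dist x X)))"
        by (rule imageE)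
      define x u where "x = fst q" and "u = snd q"
      have p: "p = (x, T - u * (c * dist x X))" and x: "x \<notin> {X}" and u: "u \<in> {0<..<1::real}"
        using q by (auto simp: x_def u_def)
      have pos: "0 < c * dist x X" using x c(1) by simp
      have "u * (c * dist x X) < 1 * (c * dist x X)" using u pos by (intro mult_strict_right_mono) auto
      then have E: "(x, T - u * (c * dist x X)) \<in> E" by (simp add: E_def)
      then have "(x, T - u * (c * dist x X)) \<notin> K" using cover by blast
      then show "p \<in> M T \<inter> E" using E u pos p by (simp add: M_def)
    qed
  qed
  have "path_connected (M T \<inter> E)" unfolding AE
  proof (rule path_connected_continuous_image)
    show "continuous_on ((- {X}) \<times> {0<..<1}) (\<lambda>(x, u). (x, T - u * (c * dist x X)))"
      unfolding case_prod_unfold by (intro continuous_intros)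
    show "path_connected ((- {X}) \<times> {0<..<1::real})"
      by (intro path_connected_Times path_connected_punctured_universe convex_imp_path_connected) auto
  qed
  moreover have "M T \<inter> E \<noteq> {}" 
  proof -
    have "(X + 1, 1/2) \<in> (- {X}) \<times> {0<..<1::real}" by simp
    then show ?thesis unfolding AE by blast
  qed
  moreover have "M T \<inter> E \<subseteq> I" by (auto simp: M_def E_def I_def)
  moreover have "I \<subseteq> M T"
  proof
    fix p assume p: "p \<in> I"
    have "p \<notin> K"
    proof
      assume k: "p \<in> K"
      then have "bottom \<le> snd p" using bottom_le unfolding K_def by force
      moreover have "c * dist (fst p) X \<le> T - snd p" using c(2)[of "fst p" "snd p"] k by simp
      ultimately show False using p by (auto simp: I_def)
    qed
    then show "p \<in> M T" using p by (simp add: I_def M_def)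
  qed
  ultimately have "freely_generated (M T \<union> E) a"
    using freely_generated_cap[OF freely_generated_M[OF bT order_refl] open_M openE scE _ _ _ _ scI] by blast
  then show ?thesis unfolding cover .
qed

end

end

section \<open>Straight arcs and sliding over a triangle\<close>

text \<open>Oriented segments become strands through their heights; \<open>up\<close> says that
  \<open>A\<close> is the only local maximum.\<close>

lemma freely_generated_segments:
  fixes S :: "((complex \<times> real) \<times> (complex \<times> real)) set" and A :: "complex \<times> real"
  assumes fin: "finite S" and ne: "S \<noteq> {}"
    and upw: "\<And>P Q. (P, Q) \<in> S \<Longrightarrow> snd P < snd Q"
    and disj: "\<And>P Q P' Q'. (P, Q) \<in> S \<Longrightarrow> (P', Q') \<in> S \<Longrightarrow> (P, Q) \<noteq> (P', Q') \<Longrightarrow>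
        closed_segment P Q \<inter> closed_segment P' Q' \<subseteq> {P, Q} \<inter> {P', Q'}"
    and up: "\<And>P Q. (P, Q) \<in> S \<Longrightarrow> Q = A \<or> snd Q < snd A \<and> (\<exists>Q'. (Q, Q') \<in> S)"
    and a: "a \<notin> (\<Union>(P, Q)\<in>S. closed_segment P Q)"
  shows "freely_generated (- (\<Union>(P, Q)\<in>S. closed_segment P Q)) a"
proof -
  define vel where "vel e = (1 / (snd (snd e) - snd (fst e))) *\<^sub>R (fst (snd e) - fst (fst e))" for e :: "(complex \<times> real) \<times> (complex \<times> real)"
  define ln where "ln e z = fst (fst e) + (z - snd (fst e)) *\<^sub>R vel e" for e z
  define lo hi where "lo e = snd (fst e)" and "hi e = snd (snd e)" for e :: "(complex \<times> real) \<times> (complex \<times> real)"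
  have ends: "ln e (lo e) = fst (fst e)" "ln e (hi e) = fst (snd e)" if "e \<in> S" for e
  proof -
    have "snd (fst e) < snd (snd e)" using upw[of "fst e" "snd e"] that by simp
    then show "ln e (lo e) = fst (fst e)" "ln e (hi e) = fst (snd e)"
      by (simp_all add: ln_def lo_def hi_def vel_def)
  qed
  have seg: "(x, z) \<in> closed_segment (fst e) (snd e) \<longleftrightarrow> lo e \<le> z \<and> z \<le> hi e \<and> x = ln e z" if e: "e \<in> S" for e x z
  proof
    have lt: "lo e < hi e" using upw[of "fst e" "snd e"] e by (simp add: lo_def hi_def)
    {
      assume "(x, z) \<in> closed_segment (fst e) (snd e)"
      then obtain u where u: "0 \<le> u" "u \<le> 1" "(x, z) = (1 - u) *\<^sub>R fst e + u *\<^sub>R snd e"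
        unfolding closed_segment_def by blast
      then have x: "x = (1 - u) *\<^sub>R fst (fst e) + u *\<^sub>R fst (snd e)" and z: "z = lo e + u * (hi e - lo e)"
        by (auto simp: lo_def hi_def prod_eq_iff algebra_simps)
      have "u * (hi e - lo e) \<le> 1 * (hi e - lo e)" "0 \<le> u * (hi e - lo e)" using u lt by (auto intro!: mult_right_mono)
      moreover have "x = ln e z"
      proof -
        have "(z - snd (fst e)) *\<^sub>R vel e = u *\<^sub>R (fst (snd e) - fst (fst e))"
          using lt z by (simp add: vel_def lo_def hi_def)
        then show ?thesis unfolding x ln_def by (simp add: algebra_simps)
      qed
      ultimately show "lo e \<le> z \<and> z \<le> hi e \<and> x = ln e z" using z by simp
    }
    {
      assume h: "lo e \<le> z \<and> z \<le> hi e \<and> x = ln e z"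
      define u where "u = (z - lo e) / (hi e - lo e)"
      have u: "0 \<le> u" "u \<le> 1" using h lt by (auto simp: u_def)
      have z: "z = (1 - u) * lo e + u * hi e"
      proof -
        have "u * (hi e - lo e) = z - lo e" using lt by (simp add: u_def)
        then show ?thesis by (simp add: algebra_simps)
      qed
      have "x = fst (fst e) + u *\<^sub>R (fst (snd e) - fst (fst e))"
        using h by (simp add: ln_def vel_def u_def lo_def hi_def)
      then have "(x, z) = (1 - u) *\<^sub>R fst e + u *\<^sub>R snd e"
        using z by (simp add: prod_eq_iff lo_def hi_def algebra_simps)
      then show "(x, z) \<in> closed_segment (fst e) (snd e)" unfolding closed_segment_def using u by blast
    }
  qed
  interpret strands S ln lo hi vel "snd A" "fst A"
  proof
    show "finite S" "S \<noteq> {}" by (rule fin, rule ne)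
    show "lo e < hi e" if "e \<in> S" for e using upw[of "fst e" "snd e"] that by (simp add: lo_def hi_def)
    show "ln e z = ln e w + (z - w) *\<^sub>R vel e" for e z w
      unfolding ln_def by (simp add: scaleR_left.diff algebra_simps)
  next
    fix e e' z assume e: "e \<in> S" "e' \<in> S" "e \<noteq> e'" "lo e \<le> z" "z \<le> hi e" "lo e' \<le> z" "z \<le> hi e'" "ln e z = ln e' z"
    have "(ln e z, z) \<in> closed_segment (fst e) (snd e) \<inter> closed_segment (fst e') (snd e')"
      using seg e by simp
    then have "(ln e z, z) \<in> {fst e, snd e} \<inter> {fst e', snd e'}"
      using disj[of "fst e" "snd e" "fst e'" "snd e'"] e by (auto simp: prod_eq_iff)
    then show "(z = lo e \<or> z = hi e) \<and> (z = lo e' \<or> z = hi e')"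
      unfolding lo_def hi_def by (metis IntD1 IntD2 insertE singletonD snd_conv)
  next
    fix e assume e: "e \<in> S" "hi e < snd A"
    then have "snd e \<noteq> A" by (auto simp: hi_def)
    then obtain Q' where Q: "(snd e, Q') \<in> S" using up[of "fst e" "snd e"] e by auto
    have lo: "lo (snd e, Q') = hi e" by (simp add: lo_def hi_def)
    have "ln (snd e, Q') (hi e) = ln e (hi e)"
      using ends(1)[OF Q] ends(2)[OF e(1)] lo by simp
    then show "\<exists>e'\<in>S. lo e' = hi e \<and> ln e' (hi e) = ln e (hi e)" using Q lo by blast
  next
    fix e assume e: "e \<in> S"
    show "hi e \<le> snd A" using up[of "fst e" "snd e"] e by (auto simp: hi_def)
    assume "hi e = snd A"
    then have "snd e = A" using up[of "fst e" "snd e"] e by (auto simp: hi_def)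
    then show "ln e (snd A) = fst A" using ends(2)[OF e] by (simp add: hi_def)
  qed
  have K: "K = (\<Union>(P, Q)\<in>S. closed_segment P Q)"
  proof (rule Set.set_eqI)
    fix p :: "complex \<times> real"
    have "p \<in> K \<longleftrightarrow> (\<exists>e\<in>S. lo e \<le> snd p \<and> snd p \<le> hi e \<and> fst p = ln e (snd p))"
      unfolding K_def by (auto simp: prod_eq_iff)
    also have "\<dots> \<longleftrightarrow> (\<exists>e\<in>S. p \<in> closed_segment (fst e) (snd e))"
      using seg[of _ "fst p" "snd p"] by auto
    finally show "p \<in> K \<longleftrightarrow> p \<in> (\<Union>(P, Q)\<in>S. closed_segment P Q)" by (auto simp: case_prod_unfold)
  qed
  define b where "b = (0 :: complex, Min (lo ` S) - 1)"
  have "freely_generated (- K) b"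
    by (rule freely_generated_complement) (use fin in \<open>simp add: b_def\<close>)
  then show ?thesis using a freely_generated_base unfolding K by blast
qed

section \<open>Collapsing a triangle through a free side\<close>

locale triangle_lens =
  fixes A B C :: "'a::euclidean_space" and \<beta> \<gamma> :: "'a \<Rightarrow> real"
  assumes lin: "linear \<beta>" "linear \<gamma>"
    and coords: "\<beta> (B - A) = 1" "\<beta> (C - A) = 0" "\<gamma> (B - A) = 0" "\<gamma> (C - A) = 1"
begin

definition b :: "'a \<Rightarrow> real" where "b x = \<beta> (x - A)"
definition c :: "'a \<Rightarrow> real" where "c x = \<gamma> (x - A)"
text \<open>The projection along the plane of the triangle that complements the coordinates
  \<open>\<beta>\<close> and \<open>\<gamma>\<close>; it is usually not orthogonal. Its norm
  \<open>s\<close> measures how far a point is from that plane.\<close>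

definition res :: "'a \<Rightarrow> 'a" where "res w = w - \<beta> w *\<^sub>R (B - A) - \<gamma> w *\<^sub>R (C - A)"
definition s :: "'a \<Rightarrow> real" where "s x = norm (res (x - A))"

lemma lin_res: "linear res"
  by (rule linearI) (simp_all add: res_def linear_add[OF lin(1)] linear_add[OF lin(2)] linear_scale[OF lin(1)]
      linear_scale[OF lin(2)] algebra_simps)

lemma b_line: "b (P + r *\<^sub>R w) = b P + r * \<beta> w"
  by (simp add: b_def linear_add[OF lin(1)] linear_scale[OF lin(1)] linear_diff[OF lin(1)])
lemma c_line: "c (P + r *\<^sub>R w) = c P + r * \<gamma> w"
  by (simp add: c_def linear_add[OF lin(2)] linear_scale[OF lin(2)] linear_diff[OF lin(2)])
lemma res_line: "res (P + r *\<^sub>R w - A) = res (P - A) + r *\<^sub>R res w"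
  by (simp add: linear_add[OF lin_res] linear_scale[OF lin_res] linear_diff[OF lin_res])

lemma s_line: "s P = 0 \<Longrightarrow> 0 \<le> r \<Longrightarrow> s (P + r *\<^sub>R w) = r * norm (res w)"
  by (simp add: s_def res_line)

lemma vertices: "b A = 0" "c A = 0" "s A = 0" "b B = 1" "c B = 0" "s B = 0" "b C = 0" "c C = 1" "s C = 0"
  by (simp_all add: b_def c_def s_def res_def coords linear_0[OF lin(1)] linear_0[OF lin(2)])

lemma hull: "x \<in> convex hull {A, B, C} \<longleftrightarrow> s x = 0 \<and> 0 \<le> b x \<and> 0 \<le> c x \<and> b x + c x \<le> 1"
proof
  assume "x \<in> convex hull {A, B, C}"
  then obtain u v where u: "0 \<le> u" "0 \<le> v" "u + v \<le> 1" "x = A + u *\<^sub>R (B - A) + v *\<^sub>R (C - A)"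
    unfolding convex_hull_3_alt by blast
  have "b x = u" "c x = v"
    unfolding u(4) b_line c_line by (simp_all add: vertices coords)
  moreover have "s x = 0" unfolding u(4) s_def res_line
    by (simp add: res_def coords linear_0[OF lin(1)] linear_0[OF lin(2)])
  ultimately show "s x = 0 \<and> 0 \<le> b x \<and> 0 \<le> c x \<and> b x + c x \<le> 1" using u by simp
next
  assume h: "s x = 0 \<and> 0 \<le> b x \<and> 0 \<le> c x \<and> b x + c x \<le> 1"
  then have "x - A = b x *\<^sub>R (B - A) + c x *\<^sub>R (C - A)" by (simp add: s_def res_def b_def c_def algebra_simps)
  then have "x = A + b x *\<^sub>R (B - A) + c x *\<^sub>R (C - A)" by (simp add: algebra_simps)
  then show "x \<in> convex hull {A, B, C}" unfolding convex_hull_3_alt using h by blast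
qed

text \<open>Contains the triangle without its sides \<open>A B\<close> and \<open>A C\<close> and
  bulges beyond the third side. Its thickness is bounded by multiples of \<open>b\<close> and
  \<open>c\<close> and so tapers off at these two sides and at all corners; this lets it avoid edges
  that end in a corner.\<close>

definition lens :: "real \<Rightarrow> 'a set" where
  "lens e = {x. s x < e * b x \<and> s x < e * c x \<and> b x + c x - 1 < e * c x \<and> b x + c x - 1 < e * b x}"

lemma cont [continuous_intros]:
  assumes "continuous_on X f"
  shows "continuous_on X (\<lambda>x. b (f x))" "continuous_on X (\<lambda>x. c (f x))" "continuous_on X (\<lambda>x. s (f x))"
proof -
  have f: "continuous_on UNIV (\<lambda>x. x - A)" by (intro continuous_intros)
  have "continuous_on UNIV b" "continuous_on UNIV c" "continuous_on UNIV s"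
    unfolding b_def c_def s_def
    using linear_continuous_on_compose[OF f lin(1)] linear_continuous_on_compose[OF f lin(2)]
      continuous_on_norm[OF linear_continuous_on_compose[OF f lin_res]] by auto
  then show "continuous_on X (\<lambda>x. b (f x))" "continuous_on X (\<lambda>x. c (f x))" "continuous_on X (\<lambda>x. s (f x))"
    using assms by (auto intro: continuous_on_compose2)
qed

lemma open_lens: "open (lens e)"
  unfolding lens_def by (intro open_Collect_conj open_Collect_less continuous_intros)

lemma comb:
  "b ((1 - u) *\<^sub>R x + u *\<^sub>R y) = (1 - u) * b x + u * b y"
  "c ((1 - u) *\<^sub>R x + u *\<^sub>R y) = (1 - u) * c x + u * c y"
  "res ((1 - u) *\<^sub>R x + u *\<^sub>R y - A) = (1 - u) *\<^sub>R res (x - A) + u *\<^sub>R res (y - A)"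
proof -
  have e: "(1 - u) *\<^sub>R x + u *\<^sub>R y = x + u *\<^sub>R (y - x)" by (simp add: algebra_simps)
  have d: "\<beta> (y - x) = b y - b x" "\<gamma> (y - x) = c y - c x" "res (y - x) = res (y - A) - res (x - A)"
    by (simp_all add: b_def c_def linear_diff[OF lin(1)] linear_diff[OF lin(2)] linear_diff[OF lin_res])
  show "b ((1 - u) *\<^sub>R x + u *\<^sub>R y) = (1 - u) * b x + u * b y"
    unfolding e b_line d by (simp add: algebra_simps)
  show "c ((1 - u) *\<^sub>R x + u *\<^sub>R y) = (1 - u) * c x + u * c y"
    unfolding e c_line d by (simp add: algebra_simps)
  show "res ((1 - u) *\<^sub>R x + u *\<^sub>R y - A) = (1 - u) *\<^sub>R res (x - A) + u *\<^sub>R res (y - A)"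
    unfolding e res_line d by (simp add: algebra_simps)
qed

lemma s_comb: "0 \<le> u \<Longrightarrow> u \<le> 1 \<Longrightarrow> s ((1 - u) *\<^sub>R x + u *\<^sub>R y) \<le> (1 - u) * s x + u * s y"
  unfolding s_def comb by (rule order_trans[OF norm_triangle_ineq]) simp

lemma convex_lens: "convex (lens e)"
proof -
  have sc: "convex {x. s x < e * f x}" if f: "\<And>u x y. f ((1 - u) *\<^sub>R x + u *\<^sub>R y) = (1 - u) * f x + u * f y" for f :: "'a \<Rightarrow> real"
    unfolding convex_alt
  proof (intro ballI allI impI)
    fix x y and u :: real assume xy: "x \<in> {x. s x < e * f x}" "y \<in> {x. s x < e * f x}" and u: "0 \<le> u \<and> u \<le> (1::real)"
    have "(1 - u) * s x + u * s y < (1 - u) * (e * f x) + u * (e * f y)"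
    proof (cases "u = 0")
      case False
      then have "u * s y < u * (e * f y)" using xy u by simp
      moreover have "(1 - u) * s x \<le> (1 - u) * (e * f x)" using xy u by (intro mult_left_mono) auto
      ultimately show ?thesis by linarith
    qed (use xy in simp)
    also have "\<dots> = e * f ((1 - u) *\<^sub>R x + u *\<^sub>R y)" unfolding f by (simp add: algebra_simps)
    finally show "(1 - u) *\<^sub>R x + u *\<^sub>R y \<in> {x. s x < e * f x}"
      using s_comb[of u x y] u by simp
  qed
  have ab: "affine_fun b" "affine_fun c" by (auto simp: affine_fun_def comb)
  have abc: "affine_fun (\<lambda>x. b x + c x - 1)"
    unfolding affine_fun_def comb by (simp add: algebra_simps)
  have "lens e = {x. s x < e * b x} \<inter> {x. s x < e * c x} \<inter> {x. b x + c x - 1 < e * c x} \<inter> {x. b x + c x - 1 < e * b x}"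
    by (auto simp: lens_def)
  then show ?thesis
    using sc[of b] sc[of c] convex_affine_less[OF abc affine_fun_scale[OF ab(1)]] convex_affine_less[OF abc affine_fun_scale[OF ab(2)]]
    by (simp add: comb convex_Int)
qed

lemma lens_pos: "0 < e \<Longrightarrow> x \<in> lens e \<Longrightarrow> 0 < b x \<and> 0 < c x"
proof -
  assume e: "0 < e" and x: "x \<in> lens e"
  have "0 \<le> s x" by (simp add: s_def)
  then have "0 < e * b x" "0 < e * c x" using x by (auto simp: lens_def)
  then show ?thesis using e by (simp add: zero_less_mult_iff)
qed

text \<open>\<open>\<phi>\<close> is positive off the triangle and smaller than \<open>e\<close> on
  the lens, so its minimum over \<open>K\<close> bounds the admissible \<open>e\<close>. The bound
  \<open>1/2\<close> keeps both coordinates below 1 on the lens.\<close>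

lemma lens_avoids_compact:
  assumes K: "compact K" "K \<inter> convex hull {A, B, C} = {}"
  shows "\<exists>e0>0. \<forall>e. 0 < e \<and> e \<le> e0 \<longrightarrow> lens e \<inter> K = {}"
proof (cases "K = {}")
  case True then show ?thesis by (intro exI[of _ 1]) auto
next
  case False
  define \<phi> where "\<phi> x = max (s x) (max (- b x) (max (- c x) (b x + c x - 1)))" for x
  have "continuous_on K \<phi>" unfolding \<phi>_def by (intro continuous_intros)
  then obtain k where k: "k \<in> K" "\<And>x. x \<in> K \<Longrightarrow> \<phi> k \<le> \<phi> x"
    using continuous_attains_inf[OF K(1) False] by blast
  have "0 < \<phi> k"
  proof (rule ccontr)
    assume "\<not> 0 < \<phi> k"
    moreover have "0 \<le> s k" by (simp add: s_def)
    ultimately have "k \<in> convex hull {A, B, C}" unfolding hull \<phi>_def by auto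
    then show False using k(1) K(2) by blast
  qed
  moreover have "lens e \<inter> K = {}" if e: "0 < e" "e \<le> min (1/2) (\<phi> k)" for e
  proof (rule ccontr)
    assume "lens e \<inter> K \<noteq> {}"
    then obtain x where x: "x \<in> lens e" "x \<in> K" by blast
    have pos: "0 < b x" "0 < c x" using lens_pos[OF e(1) x(1)] by auto
    have l: "s x < e * b x" "b x + c x - 1 < e * c x" "b x + c x - 1 < e * b x" using x(1) by (auto simp: lens_def)
    have "e * c x \<le> c x / 2" "e * b x \<le> b x / 2" using pos e by (auto simp: field_simps)
    then have bc: "b x < 1" "c x < 1" using l pos by linarith+
    have "e * b x < e * 1" "e * c x < e * 1" by (rule mult_strict_left_mono; use bc e in simp)+
    then have "s x < e" "b x + c x - 1 < e" using l by linarith+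
    then have "\<phi> x < e" unfolding \<phi>_def using pos e by simp
    then show False using k(2)[OF x(2)] e by simp
  qed
  ultimately show ?thesis by (intro exI[of _ "min (1/2) (\<phi> k)"]) auto
qed

text \<open>At a corner the decisive condition of the lens is homogeneous in the distance
  \<open>r\<close> along the spoke, so one comparison of slopes settles the whole segment. A spoke
  that leaves the plane is too steep for small \<open>e\<close>; one within the plane meets at most
  the bulge beyond the third side, whose slope at the corner tends to 0 with
  \<open>e\<close>.\<close>

lemma lens_avoids_spoke:
  assumes V: "V \<in> {A, B, C}" and D: "closed_segment V Q \<inter> convex hull {A, B, C} = {V}"
  shows "\<exists>e0>0. \<forall>e. 0 < e \<and> e \<le> e0 \<longrightarrow> lens e \<inter> closed_segment V Q = {}"
proof -
  define w where "w = Q - V"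
  define b1 c1 s1 where "b1 = \<beta> w" and "c1 = \<gamma> w" and "s1 = norm (res w)"
  have sV: "s V = 0" using V vertices by auto
  have pt: "b (V + r *\<^sub>R w) = b V + r * b1" "c (V + r *\<^sub>R w) = c V + r * c1" for r
    by (simp_all add: b_line c_line b1_def c1_def)
  have pts: "s (V + r *\<^sub>R w) = r * s1" if "0 \<le> r" for r using s_line[OF sV that] by (simp add: s1_def)
  have onseg: "V + r *\<^sub>R w \<in> closed_segment V Q" if "0 \<le> r" "r \<le> 1" for r
    unfolding closed_segment_def w_def using that by (auto intro!: exI[of _ r] simp: algebra_simps)
  have out: False if r: "0 < r" "r \<le> 1" and h: "s1 = 0" "0 \<le> b V + r * b1" "0 \<le> c V + r * c1" "b V + r * b1 + (c V + r * c1) \<le> 1" and w: "w \<noteq> 0" for r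
  proof -
    have "V + r *\<^sub>R w \<in> convex hull {A, B, C}" unfolding hull pt using pts[of r] r h by simp
    then have "V + r *\<^sub>R w \<in> {V}" using D onseg[of r] r by (metis IntI less_imp_le)
    then show False using r w by simp
  qed
  have s10: "0 \<le> s1" by (simp add: s1_def)
  have red: "\<exists>e0>0. \<forall>e. 0 < e \<and> e \<le> e0 \<longrightarrow> lens e \<inter> closed_segment V Q = {}"
    if k: "\<exists>e0>0. \<forall>e r. 0 < e \<and> e \<le> e0 \<and> 0 < r \<and> r \<le> 1 \<longrightarrow> V + r *\<^sub>R w \<notin> lens e"
  proof -
    obtain e0 where e0: "e0 > 0" "\<And>e r. 0 < e \<Longrightarrow> e \<le> e0 \<Longrightarrow> 0 < r \<Longrightarrow> r \<le> 1 \<Longrightarrow> V + r *\<^sub>R w \<notin> lens e" using k by blast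
    have "lens e \<inter> closed_segment V Q = {}" if e: "0 < e" "e \<le> e0" for e
    proof (rule ccontr)
      assume "lens e \<inter> closed_segment V Q \<noteq> {}"
      then obtain r where r: "0 \<le> r" "r \<le> 1" "(1 - r) *\<^sub>R V + r *\<^sub>R Q \<in> lens e" unfolding closed_segment_def by blast
      have l: "V + r *\<^sub>R w \<in> lens e" using r(3) by (simp add: w_def algebra_simps)
      have "V \<notin> lens e" using lens_pos[OF e(1), of V] V vertices by auto
      then have "r \<noteq> 0" using l by auto
      then show False using e0(2)[OF e, of r] r l by simp
    qed
    then show ?thesis using e0(1) by blast
  qed
  show ?thesis
  proof (cases "s1 = 0")
    case False
    then have s1: "0 < s1" using s10 by simp
    define m where "m = \<bar>b1\<bar> + \<bar>c1\<bar> + 1"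
    have m: "0 < m" by (simp add: m_def)
    show ?thesis
    proof (rule red, intro exI[of _ "s1 / m"] conjI allI impI notI)
      show "0 < s1 / m" using s1 m by simp
      fix e r assume h: "0 < e \<and> e \<le> s1 / m \<and> 0 < r \<and> r \<le> 1" and l: "V + r *\<^sub>R w \<in> lens e"
      have "r * s1 < e * (b V + r * b1)" "r * s1 < e * (c V + r * c1)"
        using l h pts[of r] by (auto simp: lens_def pt)
      \<comment> \<open>At every corner one of the two coordinates vanishes; the bound on
        \<open>s\<close> by that coordinate is the homogeneous one.\<close>
      moreover have "b V = 0 \<or> c V = 0" using V vertices by auto
      ultimately have "r * s1 < r * (e * b1) \<or> r * s1 < r * (e * c1)" by (auto simp: algebra_simps)
      then have "s1 < e * b1 \<or> s1 < e * c1" using h by simp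
      moreover have "e * b1 \<le> e * m" "e * c1 \<le> e * m" using h by (auto simp: m_def intro!: mult_left_mono)
      moreover have "e * m \<le> s1" using h m by (simp add: pos_le_divide_eq)
      ultimately show False by linarith
    qed
  next
    case True
    \<comment> \<open>the spoke lies in the plane of the triangle and points out of it\<close>
    have le: "\<exists>e0>0. \<forall>e r. 0 < e \<and> e \<le> e0 \<and> 0 < r \<and> r \<le> 1 \<longrightarrow> V + r *\<^sub>R w \<notin> lens e"
      if side: "x = 0 \<and> y = 1" and xy: "\<And>r. x + r * x1 = c (V + r *\<^sub>R w) \<and> y + r * y1 = b (V + r *\<^sub>R w) \<or> x + r * x1 = b (V + r *\<^sub>R w) \<and> y + r * y1 = c (V + r *\<^sub>R w)"
        and w0: "0 < x1 \<Longrightarrow> w \<noteq> 0" for x x1 y y1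
    proof (cases "0 < x1")
      case False
      show ?thesis
      proof (intro exI[of _ 1] conjI allI impI notI)
        fix e r assume h: "0 < e \<and> e \<le> 1 \<and> 0 < r \<and> r \<le> 1" and l: "V + r *\<^sub>R w \<in> lens e"
        have "0 < x + r * x1" using lens_pos[OF _ l] h xy[of r] by auto
        moreover have "r * x1 \<le> 0" using False h by (simp add: mult_nonneg_nonpos)
        ultimately show False using side by simp
      qed simp
    next
      case pos: True
      have sum: "0 < x1 + y1"
      proof (rule ccontr)
        assume n: "\<not> 0 < x1 + y1"
        define r where "r = 1 / (\<bar>y1\<bar> + 1)"
        have r: "0 < r" "r \<le> 1" by (auto simp: r_def)
        have "r * \<bar>y1\<bar> \<le> 1" by (simp add: r_def)
        then have "0 \<le> y + r * y1" using side abs_ge_minus_self[of "r * y1"] r by (simp add: abs_mult)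
        moreover have "0 \<le> x + r * x1" using side pos r by simp
        moreover have "(x + r * x1) + (y + r * y1) \<le> 1"
        proof -
          have "r * (x1 + y1) \<le> 0" using n r by (simp add: mult_nonneg_nonpos)
          then show ?thesis using side by (simp add: algebra_simps)
        qed
        moreover have "w \<noteq> 0" by (rule w0[OF pos])
        ultimately show False using out[OF r True] xy[of r] by (auto simp: pt add.commute)
      qed
      show ?thesis
      proof (intro exI[of _ "(x1 + y1) / x1"] conjI allI impI notI)
        show "0 < (x1 + y1) / x1" using sum pos by simp
        fix e r assume h: "0 < e \<and> e \<le> (x1 + y1) / x1 \<and> 0 < r \<and> r \<le> 1" and l: "V + r *\<^sub>R w \<in> lens e"
        have "(x + r * x1) + (y + r * y1) - 1 < e * (x + r * x1)" using l xy[of r] by (auto simp: lens_def add.commute)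
        then have "r * (x1 + y1) < r * (e * x1)" using side by (simp add: algebra_simps)
        then have "x1 + y1 < e * x1" using h by simp
        moreover have "e * x1 \<le> x1 + y1" using h pos by (simp add: pos_le_divide_eq)
        ultimately show False by simp
      qed
    qed
    have wbc: "0 < b1 \<Longrightarrow> w \<noteq> 0" "0 < c1 \<Longrightarrow> w \<noteq> 0"
      using linear_0[OF lin(1)] linear_0[OF lin(2)] by (auto simp: b1_def c1_def)
    consider "V = A" | "V = B" | "V = C" using V by blast
    then show ?thesis
    proof cases
      case 2
      then have v: "b V = 1" "c V = 0" by (simp_all add: vertices)
      show ?thesis
      proof (rule red, rule le[of 0 1 c1 b1])
        show "0 + r * c1 = c (V + r *\<^sub>R w) \<and> 1 + r * b1 = b (V + r *\<^sub>R w) \<or>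
          0 + r * c1 = b (V + r *\<^sub>R w) \<and> 1 + r * b1 = c (V + r *\<^sub>R w)" for r
          unfolding pt v by simp
      qed (use wbc in auto)
    next
      case 3
      then have v: "b V = 0" "c V = 1" by (simp_all add: vertices)
      show ?thesis
      proof (rule red, rule le[of 0 1 b1 c1])
        show "0 + r * b1 = c (V + r *\<^sub>R w) \<and> 1 + r * c1 = b (V + r *\<^sub>R w) \<or>
          0 + r * b1 = b (V + r *\<^sub>R w) \<and> 1 + r * c1 = c (V + r *\<^sub>R w)" for r
          unfolding pt v by simp
      qed (use wbc in auto)
    next
      case 1
      show ?thesis
      proof (rule red, intro exI[of _ 1] conjI allI impI notI)
        fix e r assume h: "0 < e \<and> e \<le> 1 \<and> 0 < r \<and> r \<le> 1" and l: "V + r *\<^sub>R w \<in> lens e"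
        have v: "b V = 0" "c V = 0" using 1 by (simp_all add: vertices)
        have "0 < r * b1" "0 < r * c1" using lens_pos[OF _ l, unfolded pt v] h by auto
        then have bc: "0 < b1" "0 < c1" using h by (auto simp: zero_less_mult_iff)
        define t where "t = 1 / (b1 + c1 + 1)"
        have t: "0 < t" "t \<le> 1" using bc by (auto simp: t_def)
        have "t * (b1 + c1) \<le> 1" using bc by (simp add: t_def)
        moreover have "w \<noteq> 0" using bc linear_0[OF lin(1)] by (auto simp: b1_def)
        ultimately show False using out[OF t True] 1 bc t by (simp add: vertices algebra_simps)
      qed simp
    qed
  qed
qed

text \<open>The triangle can be collapsed from its third side onto the two sides that belong to
  \<open>G\<close>. On the complement this is a push towards a point \<open>o'\<close> of the lens
  just beyond the third side, damped by a Urysohn function that is 1 on the triangle and 0 outside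
  the lens. By \<open>star\<close>, points of the lens outside the triangle are not pushed into
  it.\<close>

lemma slide_eq:
  assumes F: "finite F" "\<And>P Q. (P, Q) \<in> F \<Longrightarrow> closed_segment P Q \<inter> convex hull {A, B, C} = {} \<or>
      (\<exists>V\<in>{P, Q} \<inter> {A, B, C}. closed_segment P Q \<inter> convex hull {A, B, C} = {V})"
    and G: "G = closed_segment A B \<union> closed_segment A C \<union> (\<Union>(P, Q)\<in>F. closed_segment P Q)"
    and a: "a \<notin> G" "a \<notin> convex hull {A, B, C}"
  shows "pi1_eq (- (G \<union> convex hull {A, B, C})) (- G) a"
    and "path_connected (- G) \<Longrightarrow> path_connected (- (G \<union> convex hull {A, B, C}))"
proof -
  let ?D = "convex hull {A, B, C}"
  have av: "\<exists>e0>0. \<forall>e. 0 < e \<and> e \<le> e0 \<longrightarrow> lens e \<inter> closed_segment (fst f) (snd f) = {}" if f: "f \<in> insert (a, a) F" for f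
  proof (cases "closed_segment (fst f) (snd f) \<inter> ?D = {}")
    case True
    then show ?thesis by (intro lens_avoids_compact compact_segment)
  next
    case False
    then have "f \<in> F" using f a by auto
    then obtain V where V: "V \<in> {fst f, snd f}" "V \<in> {A, B, C}" "closed_segment (fst f) (snd f) \<inter> ?D = {V}"
      using F(2)[of "fst f" "snd f"] False by auto
    then show ?thesis
      using lens_avoids_spoke[OF V(2), of "snd f"] lens_avoids_spoke[OF V(2), of "fst f"]
      by (auto simp: closed_segment_commute)
  qed
  then obtain e0 where e0: "\<And>f. f \<in> insert (a, a) F \<Longrightarrow> e0 f > 0 \<and> (\<forall>e. 0 < e \<and> e \<le> e0 f \<longrightarrow> lens e \<inter> closed_segment (fst f) (snd f) = {})"
    by metis
  have fin: "finite (e0 ` insert (a, a) F)" using F(1) by simp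
  define e where "e = Min (e0 ` insert (a, a) F)"
  have "e \<in> e0 ` insert (a, a) F" unfolding e_def by (rule Min_in[OF fin]) simp
  then have e: "0 < e" using e0 by auto
  have el: "e \<le> e0 f" if "f \<in> insert (a, a) F" for f unfolding e_def using fin that by (intro Min_le) auto
  define L where "L = lens e"
  have disj: "L \<inter> closed_segment (fst f) (snd f) = {}" if "f \<in> insert (a, a) F" for f
    unfolding L_def using e0[OF that] e el[OF that] by blast
  have aL: "a \<notin> L" using disj[of "(a, a)"] by auto
  have side: "c x = 0" if "x \<in> closed_segment A B" for x
    using that unfolding closed_segment_def by (auto simp: comb vertices)
  have side': "b x = 0" if "x \<in> closed_segment A C" for x
    using that unfolding closed_segment_def by (auto simp: comb vertices)
  have LG: "L \<inter> G = {}"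
  proof (rule ccontr)
    assume "L \<inter> G \<noteq> {}"
    then obtain x where x: "x \<in> L" "x \<in> G" by blast
    have pos: "0 < b x" "0 < c x" using lens_pos[OF e] x by (auto simp: L_def)
    then have "x \<in> (\<Union>(P, Q)\<in>F. closed_segment P Q)" using x(2) side side' unfolding G by fastforce
    then show False using disj x(1) by fastforce
  qed
  have compG: "compact G" unfolding G using F(1) by (intro compact_Un compact_UN) (auto simp: case_prod_unfold)
  have DL: "?D - G \<subseteq> L"
  proof
    fix x assume x: "x \<in> ?D - G"
    have h: "s x = 0" "0 \<le> b x" "0 \<le> c x" "b x + c x \<le> 1" using x hull by auto
    have xe: "x = A + b x *\<^sub>R (B - A) + c x *\<^sub>R (C - A)" using h(1) by (simp add: s_def res_def b_def c_def algebra_simps)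
    have "c x \<noteq> 0"
    proof
      assume "c x = 0"
      then have "x = (1 - b x) *\<^sub>R A + b x *\<^sub>R B" using xe by (simp add: algebra_simps)
      then have "x \<in> closed_segment A B" unfolding closed_segment_def using h \<open>c x = 0\<close> by auto
      then show False using x G by blast
    qed
    moreover have "b x \<noteq> 0"
    proof
      assume "b x = 0"
      then have "x = (1 - c x) *\<^sub>R A + c x *\<^sub>R C" using xe by (simp add: algebra_simps)
      then have "x \<in> closed_segment A C" unfolding closed_segment_def using h \<open>b x = 0\<close> by auto
      then show False using x G by blast
    qed
    ultimately have "0 < e * b x" "0 < e * c x" using h e by auto
    then show "x \<in> L" using h by (auto simp: L_def lens_def)
  qed
  \<comment> \<open>The two coordinates add up to \<open>1 + min e 1 / 4\<close>: beyond the third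
    side, but still inside the bulge.\<close>
  define o' where "o' = A + (1/2 + min e 1 / 8) *\<^sub>R (B - A) + (1/2 + min e 1 / 8) *\<^sub>R (C - A)"
  have bo: "b o' = 1/2 + min e 1 / 8" "c o' = 1/2 + min e 1 / 8"
    unfolding o'_def b_line c_line by (simp_all add: vertices coords)
  have ro: "res (o' - A) = 0" unfolding o'_def res_line
    by (simp add: res_def coords linear_0[OF lin(1)] linear_0[OF lin(2)])
  have oL: "o' \<in> L"
  proof -
    have "s o' = 0" using ro by (simp add: s_def)
    moreover have "0 < e * b o'" using e by (simp add: bo)
    moreover have "b o' + c o' - 1 < e * b o'"
    proof -
      have "b o' + c o' - 1 = min e 1 / 4" by (simp add: bo)
      also have "\<dots> < e * (1/2)" using e by simp
      also have "\<dots> \<le> e * b o'" using e by (intro mult_left_mono) (auto simp: bo)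
      finally show ?thesis .
    qed
    moreover have "c o' = b o'" by (simp add: bo)
    ultimately show ?thesis unfolding L_def lens_def mem_Collect_eq by (simp only: simp_thms)
  qed
  have star: "(1 - u) *\<^sub>R x + u *\<^sub>R o' \<notin> ?D" if x: "x \<in> L" "x \<notin> ?D" and u: "0 \<le> u" "u \<le> 1" for x u
  proof
    assume "(1 - u) *\<^sub>R x + u *\<^sub>R o' \<in> ?D"
    then have h: "res ((1 - u) *\<^sub>R x + u *\<^sub>R o' - A) = 0" "b ((1 - u) *\<^sub>R x + u *\<^sub>R o') + c ((1 - u) *\<^sub>R x + u *\<^sub>R o') \<le> 1"
      unfolding hull by (auto simp: s_def)
    have sumo: "1 < b o' + c o'" using e by (simp add: bo)
    have eq: "b ((1 - u) *\<^sub>R x + u *\<^sub>R o') + c ((1 - u) *\<^sub>R x + u *\<^sub>R o') = (1 - u) * (b x + c x) + u * (b o' + c o')"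
      unfolding comb by (simp add: algebra_simps)
    show False
    proof (cases "u = 1")
      case True
      then show False using h(2) sumo eq by simp
    next
      case False
      then have "res (x - A) = 0" using h(1) unfolding comb ro by simp
      then have "s x = 0" by (simp add: s_def)
      moreover have "0 < b x" "0 < c x" using lens_pos[OF e] x by (auto simp: L_def)
      ultimately have "1 < b x + c x" using x(2) unfolding hull by auto
      then have "(1 - u) * 1 < (1 - u) * (b x + c x)" using u False by (intro mult_strict_left_mono) auto
      moreover have "u * 1 \<le> u * (b o' + c o')" using u sumo by (intro mult_left_mono) auto
      ultimately show False using h(2) eq by simp
    qed
  qed
  let ?M = "- G" and ?X = "- (G \<union> ?D)"
  have LM: "L \<subseteq> ?M" using LG by blast
  have cl1: "closedin (top_of_set ?M) (?D - G)"
  proof -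
    have "compact ?D" by (intro finite_imp_compact_convex_hull) simp
    then have "closedin (top_of_set ?M) (?M \<inter> ?D)" by (intro closedin_closed_Int compact_imp_closed)
    moreover have "?M \<inter> ?D = ?D - G" by blast
    ultimately show ?thesis by simp
  qed
  have cl2: "closedin (top_of_set ?M) (?M - L)"
  proof -
    have "closed (- L)" unfolding L_def using open_lens by (simp add: closed_def)
    then have "closedin (top_of_set ?M) (?M \<inter> - L)" by (rule closedin_closed_Int)
    then show ?thesis by (simp add: Diff_eq)
  qed
  have dj: "(?D - G) \<inter> (?M - L) = {}" using DL by blast
  obtain f where f: "continuous_on ?M f" "\<And>x. x \<in> ?M \<Longrightarrow> f x \<in> closed_segment 1 (0::real)"
    "\<And>x. x \<in> ?D - G \<Longrightarrow> f x = 1" "\<And>x. x \<in> ?M - L \<Longrightarrow> f x = 0"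
    by (rule Urysohn_local[OF cl1 cl2 dj, of 1 "0::real"]) blast
  have f01: "0 \<le> f x" "f x \<le> 1" if "x \<in> ?M" for x using f(2)[OF that] by (auto simp: closed_segment_eq_real_ivl)
  define H where "H t x = x + (t * f x) *\<^sub>R (o' - x)" for t :: real and x
  have Hc: "H t x = (1 - t * f x) *\<^sub>R x + (t * f x) *\<^sub>R o'" for t x by (simp add: H_def algebra_simps)
  have tf: "0 \<le> t * f x" "t * f x \<le> 1" if "t \<in> {0..1}" "x \<in> ?M" for t x
    using that f01[OF that(2)] by (auto intro: mult_le_one)
  have HL: "H t x \<in> L" if "t \<in> {0..1}" "x \<in> L" for t x
    unfolding Hc using convex_lens oL that tf[of t x] LM unfolding L_def convex_alt by blast
  have Hn: "H t x = x" if "x \<in> ?M" "x \<notin> L" for t x using f(4)[of x] that by (simp add: H_def)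
  have HM: "H t x \<in> ?M" if "t \<in> {0..1}" "x \<in> ?M" for t x
    using HL[of t x] Hn[of x t] that LM by (cases "x \<in> L") auto
  have HX: "H t x \<in> ?X" if t: "t \<in> {0..1}" and x: "x \<in> ?X" for t x
  proof (cases "x \<in> L")
    case True
    have "H t x \<notin> ?D" unfolding Hc using star[OF True] x tf[OF t, of x] by auto
    then show ?thesis using HM[OF t, of x] x by auto
  qed (use Hn[of x t] x in auto)
  have H1: "H 1 x \<in> ?X" if x: "x \<in> ?M" for x
  proof (cases "x \<in> ?D")
    case True
    then have "H 1 x = o'" using f(3)[of x] x by (simp add: H_def)
    moreover have "o' \<notin> ?D" using e unfolding hull by (simp add: bo min_le_iff_disj)
    ultimately show ?thesis using oL LM by auto
  qed (use HX[of 1 x] x in auto)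
  have contH: "continuous_on ({0..1} \<times> ?M) (\<lambda>y. H (fst y) (snd y))"
  proof -
    have "continuous_on ({0..1::real} \<times> ?M) (\<lambda>y. f (snd y))"
      by (rule continuous_on_compose2[OF f(1) continuous_on_snd[OF continuous_on_id]]) auto
    then show ?thesis unfolding H_def by (intro continuous_intros)
  qed
  have aX: "a \<in> ?X" using a by blast
  note dd = pi1_eq_deform2[where A="?X" and B'="?X" and B="?M" and a=a and F=H and G="\<lambda>t x. x"]
  have Ha: "H t a = a" for t using Hn[of a t] a aL by auto
  have H0: "H 0 x = x" for x by (simp add: H_def)
  have sub: "?X \<subseteq> ?M" by blast
  have id: "continuous_on ({0..1::real} \<times> ?X) (\<lambda>y. snd y)" by (intro continuous_intros)
  show "pi1_eq ?X ?M a"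
    by (rule dd(1)[OF subset_refl sub aX contH H0 HM HX Ha H1 id]) auto
  show "path_connected ?X" if "path_connected ?M"
    by (rule dd(2)[OF subset_refl sub aX contH H0 HM HX Ha H1 id _ _ _ _ _ that]) auto
qed

end

lemma slide:
  fixes A B C :: "'a::euclidean_space"
  assumes ind: "\<not> collinear {A, B, C}"
    and F: "finite F" "\<And>P Q. (P, Q) \<in> F \<Longrightarrow> closed_segment P Q \<inter> convex hull {A, B, C} = {} \<or>
      (\<exists>V\<in>{P, Q} \<inter> {A, B, C}. closed_segment P Q \<inter> convex hull {A, B, C} = {V})"
    and G: "G = closed_segment A B \<union> closed_segment A C \<union> (\<Union>(P, Q)\<in>F. closed_segment P Q)"
    and a: "a \<notin> G" "a \<notin> convex hull {A, B, C}"
  shows "pi1_eq (- (G \<union> convex hull {A, B, C})) (- G) a"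
    and "path_connected (- G) \<Longrightarrow> path_connected (- (G \<union> convex hull {A, B, C}))"
proof -
  have i: "independent {B - A, C - A}" "B - A \<noteq> C - A"
  proof -
    have "\<not> affine_dependent {A, B, C}" "A \<noteq> B" "A \<noteq> C" "B \<noteq> C"
      using ind affine_dependent_imp_collinear_3 by (auto simp: insert_commute)
    then have "independent ((\<lambda>x. - A + x) ` ({A, B, C} - {A}))"
      using affine_dependent_iff_dependent2[of A "{A, B, C}"] by simp
    moreover have "{A, B, C} - {A} = {B, C}" using \<open>A \<noteq> B\<close> \<open>A \<noteq> C\<close> by auto
    ultimately show "independent {B - A, C - A}" by simp
    show "B - A \<noteq> C - A" using \<open>B \<noteq> C\<close> by simp
  qed
  obtain \<beta> :: "'a \<Rightarrow> real" where \<beta>: "linear \<beta>" "\<forall>x\<in>{B - A, C - A}. \<beta> x = (if x = B - A then 1 else 0)"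
    using linear_independent_extend[OF i(1), of "\<lambda>x. if x = B - A then 1 else 0"] by blast
  obtain \<gamma> :: "'a \<Rightarrow> real" where \<gamma>: "linear \<gamma>" "\<forall>x\<in>{B - A, C - A}. \<gamma> x = (if x = C - A then 1 else 0)"
    using linear_independent_extend[OF i(1), of "\<lambda>x. if x = C - A then 1 else 0"] by blast
  interpret triangle_lens A B C \<beta> \<gamma>
    by (rule triangle_lens.intro) (use \<beta> \<gamma> i(2) in auto)
  show "pi1_eq (- (G \<union> convex hull {A, B, C})) (- G) a" by (rule slide_eq(1)[OF F G a])
  show "path_connected (- G) \<Longrightarrow> path_connected (- (G \<union> convex hull {A, B, C}))" by (rule slide_eq(2)[OF F G a])
qed

section \<open>Local maxima of a bipartite graph\<close>

lemma segment_snd_bounds: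
  fixes P Q :: "complex \<times> real"
  assumes "x \<in> closed_segment P Q"
  shows "min (snd P) (snd Q) \<le> snd x" "snd x \<le> max (snd P) (snd Q)"
proof -
  obtain u where u: "0 \<le> u" "u \<le> 1" "x = (1 - u) *\<^sub>R P + u *\<^sub>R Q"
    using assms unfolding closed_segment_def by blast
  have x: "snd x = (1 - u) * snd P + u * snd Q" using u by simp
  have "(1 - u) * min (snd P) (snd Q) \<le> (1 - u) * snd P" "u * min (snd P) (snd Q) \<le> u * snd Q"
    "(1 - u) * snd P \<le> (1 - u) * max (snd P) (snd Q)" "u * snd Q \<le> u * max (snd P) (snd Q)"
    using u by (intro mult_left_mono; simp)+
  moreover have "(1 - u) * m + u * m = m" for m :: real by (simp add: algebra_simps)
  ultimately show "min (snd P) (snd Q) \<le> snd x" "snd x \<le> max (snd P) (snd Q)" unfolding x by (metis add_mono)+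
qed

lemma in_triangleE:
  assumes "x \<in> convex hull {a, b, c}"
  obtains u v where "0 \<le> u" "0 \<le> v" "u + v \<le> 1" "x = a + u *\<^sub>R (b - a) + v *\<^sub>R (c - a)"
proof -
  have "x \<in> {a + u *\<^sub>R (b - a) + v *\<^sub>R (c - a) |u v. 0 \<le> u \<and> 0 \<le> v \<and> u + v \<le> 1}"
    using assms by (simp only: convex_hull_3_alt)
  then show thesis by (elim CollectE exE conjE) (rule that)
qed

lemma in_triangleI:
  assumes "0 \<le> u" "0 \<le> v" "u + v \<le> 1" "x = a + u *\<^sub>R (b - a) + v *\<^sub>R (c - a)"
  shows "x \<in> convex hull {a, b, c}"
  unfolding convex_hull_3_alt by (intro CollectI exI[of _ u] exI[of _ v] conjI assms)

text \<open>A linear embedding of a complete bipartite graph, given by the images of its two colour classes.\<close>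

locale coloured =
  fixes R B :: "'a::euclidean_space set"
  assumes fin: "finite R" "finite B" and ne: "R \<noteq> {}" "B \<noteq> {}" and RB: "R \<inter> B = {}"
    and no_mid: "\<And>r b w. r \<in> R \<Longrightarrow> b \<in> B \<Longrightarrow> w \<in> R \<union> B \<Longrightarrow> w \<noteq> r \<Longrightarrow> w \<noteq> b \<Longrightarrow> w \<notin> closed_segment r b"
    and cross: "\<And>r b r' b'. r \<in> R \<Longrightarrow> b \<in> B \<Longrightarrow> r' \<in> R \<Longrightarrow> b' \<in> B \<Longrightarrow> (r, b) \<noteq> (r', b') \<Longrightarrow>
      closed_segment r b \<inter> closed_segment r' b' \<subseteq> {r, b} \<inter> {r', b'}"
begin

definition graph :: "'a set" where "graph = (\<Union>r\<in>R. \<Union>b\<in>B. closed_segment r b)"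

lemma swap: "coloured B R"
proof
  show "w \<notin> closed_segment r b" if "r \<in> B" "b \<in> R" "w \<in> B \<union> R" "w \<noteq> r" "w \<noteq> b" for r b w
    using no_mid[of b r w] that by (auto simp: closed_segment_commute)
  show "closed_segment r b \<inter> closed_segment r' b' \<subseteq> {r, b} \<inter> {r', b'}"
    if "r \<in> B" "b \<in> R" "r' \<in> B" "b' \<in> R" "(r, b) \<noteq> (r', b')" for r b r' b'
    using cross[of b r b' r'] that by (auto simp: closed_segment_commute[of r] closed_segment_commute[of r'])
qed (use fin ne RB in auto)

text \<open>Of two red points on one ray from a blue point, the nearer would lie on the edge to the
  farther.\<close>

lemma same_side:
  assumes "p \<in> R" "q \<in> R" "o' \<in> B" "p \<noteq> q" "p - o' = \<mu> *\<^sub>R (q - o')" "0 < \<mu>"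
  shows False
proof (cases "\<mu> \<le> 1")
  case True
  have e: "p = (1 - \<mu>) *\<^sub>R o' + \<mu> *\<^sub>R q" using assms(5) by (simp add: algebra_simps)
  have "p \<in> closed_segment o' q"
    unfolding closed_segment_def by (intro CollectI exI[of _ \<mu>] conjI e) (use True assms(6) in auto)
  then have "p \<in> closed_segment q o'" by (metis closed_segment_commute)
  then show False using no_mid[of q o' p] assms RB by auto
next
  case False
  have "q - o' = (1 / \<mu>) *\<^sub>R (p - o')" using assms(5,6) by simp
  then have e: "q = (1 - 1 / \<mu>) *\<^sub>R o' + (1 / \<mu>) *\<^sub>R p" by (simp add: algebra_simps)
  have "q \<in> closed_segment o' p"
    unfolding closed_segment_def by (intro CollectI exI[of _ "1 / \<mu>"] conjI e) (use False in auto)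
  then have "q \<in> closed_segment p o'" by (metis closed_segment_commute)
  then show False using no_mid[of p o' q] assms RB by auto
qed

end

locale coloured_heights = coloured R B for R B :: "(complex \<times> real) set" +
  assumes inj: "inj_on snd (R \<union> B)"
begin

definition arcs :: "((complex \<times> real) \<times> (complex \<times> real)) set" where
  "arcs = {(P, Q). snd P < snd Q \<and> (P \<in> R \<and> Q \<in> B \<or> P \<in> B \<and> Q \<in> R)}"

lemma finite_arcs: "finite arcs"
  by (rule finite_subset[of _ "(R \<union> B) \<times> (R \<union> B)"]) (use fin in \<open>auto simp: arcs_def\<close>)

lemma height_neq: "p \<in> R \<Longrightarrow> q \<in> B \<Longrightarrow> snd p \<noteq> snd q"
  using inj RB by (metis IntI UnI1 UnI2 empty_iff inj_onD)

lemma graph_arcs: "graph = (\<Union>(P, Q)\<in>arcs. closed_segment P Q)"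
proof
  show "graph \<subseteq> (\<Union>(P, Q)\<in>arcs. closed_segment P Q)"
  proof
    fix x assume "x \<in> graph"
    then obtain r b where rb: "r \<in> R" "b \<in> B" "x \<in> closed_segment r b" by (auto simp: graph_def)
    show "x \<in> (\<Union>(P, Q)\<in>arcs. closed_segment P Q)"
    proof (cases "snd r < snd b")
      case True then show ?thesis using rb by (intro UN_I[of "(r, b)"]) (auto simp: arcs_def)
    next
      case False
      then have "snd b < snd r" using height_neq[OF rb(1,2)] by simp
      then show ?thesis using rb by (intro UN_I[of "(b, r)"]) (auto simp: arcs_def closed_segment_commute)
    qed
  qed
  show "(\<Union>(P, Q)\<in>arcs. closed_segment P Q) \<subseteq> graph"
  proof
    fix x assume "x \<in> (\<Union>(P, Q)\<in>arcs. closed_segment P Q)"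
    then obtain P Q where PQ: "(P, Q) \<in> arcs" "x \<in> closed_segment P Q" by blast
    then have "x \<in> closed_segment Q P" by (metis closed_segment_commute)
    then show "x \<in> graph" using PQ unfolding graph_def arcs_def by blast
  qed
qed

lemma arcs_cross:
  assumes "(P, Q) \<in> arcs" "(P', Q') \<in> arcs" "(P, Q) \<noteq> (P', Q')"
  shows "closed_segment P Q \<inter> closed_segment P' Q' \<subseteq> {P, Q} \<inter> {P', Q'}"
proof -
  have lt: "snd P < snd Q" "snd P' < snd Q'" using assms by (auto simp: arcs_def)
  consider "P \<in> R" "Q \<in> B" "P' \<in> R" "Q' \<in> B" | "P \<in> R" "Q \<in> B" "P' \<in> B" "Q' \<in> R"
    | "P \<in> B" "Q \<in> R" "P' \<in> R" "Q' \<in> B" | "P \<in> B" "Q \<in> R" "P' \<in> B" "Q' \<in> R"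
    using assms by (auto simp: arcs_def)
  then show ?thesis
  proof cases
    case 1 then show ?thesis using cross[of P Q P' Q'] assms by simp
  next
    case 2
    then have "(P, Q) \<noteq> (Q', P')" using lt by auto
    then show ?thesis using cross[of P Q Q' P'] 2 by (auto simp: closed_segment_commute[of P'])
  next
    case 3
    then have "(Q, P) \<noteq> (P', Q')" using lt by auto
    then show ?thesis using cross[of Q P P' Q'] 3 by (auto simp: closed_segment_commute[of P])
  next
    case 4 then show ?thesis using cross[of Q P Q' P'] assms by (auto simp: closed_segment_commute[of P] closed_segment_commute[of P'])
  qed
qed

definition tops :: "(complex \<times> real) set" where "tops = {r \<in> R. \<forall>b\<in>B. snd b < snd r}"

lemma not_top: "r \<in> R \<Longrightarrow> r \<notin> tops \<Longrightarrow> \<exists>b\<in>B. snd r < snd b"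
proof -
  assume r: "r \<in> R" "r \<notin> tops"
  then obtain b where b: "b \<in> B" "\<not> snd b < snd r" unfolding tops_def by blast
  then show ?thesis using height_neq[OF r(1) b(1)] by (intro bexI[of _ b]) auto
qed

text \<open>Every blue vertex continues upwards to \<open>r1\<close>, and every red vertex other
  than \<open>r1\<close> to some blue vertex above it.\<close>

lemma free_one_top:
  assumes "tops = {r1}" and a: "a \<notin> graph"
  shows "freely_generated (- graph) a"
  unfolding graph_arcs
proof (rule freely_generated_segments[where A=r1])
  have r1: "r1 \<in> R" "\<And>b. b \<in> B \<Longrightarrow> snd b < snd r1" using assms(1) by (auto simp: tops_def)
  show "finite arcs" by (rule finite_arcs)
  obtain b where "b \<in> B" using ne by blast
  then have "(b, r1) \<in> arcs" using r1 by (auto simp: arcs_def)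
  then show "arcs \<noteq> {}" by blast
  show "snd P < snd Q" if "(P, Q) \<in> arcs" for P Q using that by (simp add: arcs_def)
  show "closed_segment P Q \<inter> closed_segment P' Q' \<subseteq> {P, Q} \<inter> {P', Q'}"
    if "(P, Q) \<in> arcs" "(P', Q') \<in> arcs" "(P, Q) \<noteq> (P', Q')" for P Q P' Q' using arcs_cross[OF that] .
  show "Q = r1 \<or> snd Q < snd r1 \<and> (\<exists>Q'. (Q, Q') \<in> arcs)" if PQ: "(P, Q) \<in> arcs" for P Q
  proof (cases "Q \<in> B")
    case True
    then have "(Q, r1) \<in> arcs" using r1(1) r1(2)[OF True] by (simp add: arcs_def)
    then show ?thesis using r1(2)[OF True] by blast
  next
    case False
    then have Q: "Q \<in> R" using PQ by (auto simp: arcs_def)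
    show ?thesis
    proof (cases "Q = r1")
      case False
      then obtain b where b: "b \<in> B" "snd Q < snd b" using not_top[OF Q] assms(1) by blast
      then have "(Q, b) \<in> arcs" using Q by (simp add: arcs_def)
      moreover have "snd Q < snd r1" using b(2) r1(2)[OF b(1)] by linarith
      ultimately show ?thesis by blast
    qed simp
  qed
  show "a \<notin> (\<Union>(P, Q)\<in>arcs. closed_segment P Q)" using a graph_arcs by simp
qed

text \<open>\<open>slide\<close> is used twice for one triangle. From the corner \<open>r1\<close>
  it adds the triangle to the modified graph \<open>G'\<close>, whose complement is free by
  \<open>freely_generated_segments\<close>; from the corner \<open>b1\<close> it removes the
  triangle from the original graph. Both graphs have the same union with the triangle.\<close>

lemma free_two_tops:
  assumes tops: "tops = {r1, r2}" and lt: "snd r2 < snd r1" and a: "a \<notin> graph"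
  shows "freely_generated (- graph) a"
proof -
  have r1: "r1 \<in> R" "\<And>b. b \<in> B \<Longrightarrow> snd b < snd r1" and r2: "r2 \<in> R" "\<And>b. b \<in> B \<Longrightarrow> snd b < snd r2"
    using tops by (auto simp: tops_def)
  have r12: "r1 \<noteq> r2" using lt by auto
  have "Max (snd ` B) \<in> snd ` B" using fin ne by (intro Max_in) auto
  then obtain b1 where b1: "b1 \<in> B" "Max (snd ` B) = snd b1" by (elim imageE)
  have b1max: "snd b \<le> snd b1" if "b \<in> B" for b unfolding b1(2)[symmetric] using fin that by simp
  have b1max': "snd b < snd b1" if "b \<in> B" "b \<noteq> b1" for b
    using b1max[OF that(1)] inj b1(1) that by (metis UnI2 inj_onD le_less)
  have h: "snd b1 < snd r2" "snd b1 < snd r1" using r2(2)[OF b1(1)] r1(2)[OF b1(1)] .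
  let ?D = "convex hull {b1, r1, r2}"
  have Dlow: "snd b1 \<le> snd x \<and> snd x \<le> snd r1" if x: "x \<in> ?D" for x
  proof -
    obtain u v where u: "0 \<le> u" "0 \<le> v" "u + v \<le> 1" "x = b1 + u *\<^sub>R (r1 - b1) + v *\<^sub>R (r2 - b1)"
      by (rule in_triangleE[OF x])
    have sx: "snd x = snd b1 + u * (snd r1 - snd b1) + v * (snd r2 - snd b1)" using u(4) by simp
    have "0 \<le> u * (snd r1 - snd b1)" "0 \<le> v * (snd r2 - snd b1)" using u h by auto
    moreover have "v * (snd r2 - snd b1) \<le> v * (snd r1 - snd b1)" using u lt by (intro mult_left_mono) auto
    moreover have "(u + v) * (snd r1 - snd b1) \<le> 1 * (snd r1 - snd b1)" using u h by (intro mult_right_mono) auto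
    ultimately show ?thesis unfolding sx by (simp add: distrib_right)
  qed
  have nc: "\<not> collinear {b1, r1, r2}"
  proof
    assume "collinear {b1, r1, r2}"
    then consider "b1 \<in> closed_segment r1 r2" | "r1 \<in> closed_segment r2 b1" | "r2 \<in> closed_segment b1 r1"
      unfolding collinear_between_cases between_mem_segment by blast
    then show False
    proof cases
      case 1 then show False using segment_snd_bounds[OF 1] h by auto
    next
      case 2 then show False using segment_snd_bounds[OF 2] h lt by auto
    next
      case 3
      then have "r2 \<in> closed_segment r1 b1" by (simp add: closed_segment_commute)
      moreover have "r2 \<noteq> b1" using h by auto
      ultimately show False using no_mid[of r1 b1 r2] r1(1) r2(1) b1(1) r12 by simp
    qed
  qed
  \<comment> \<open>An edge from \<open>r\<close> running into the triangle would either end inside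
    it, which is impossible since the triangle lies no lower than \<open>b1\<close> and
    \<open>b\<close> lies below \<open>b1\<close>, or cross the side from \<open>q\<close> to
    \<open>b1\<close>, which is an edge of the graph.\<close>
  have spoke: "closed_segment r b \<inter> ?D = {r}"
    if r: "r \<in> R" "q \<in> R" "r \<noteq> q" "{r, q} = {r1, r2}" and b: "b \<in> B" "b \<noteq> b1" for r q b
  proof -
    have D: "?D = convex hull {r, b1, q}"
      using r(4) by (auto simp: doubleton_eq_iff insert_commute)
    have "x = r" if x: "x \<in> closed_segment r b" "x \<in> ?D" for x
    proof (rule ccontr)
      assume ne: "x \<noteq> r"
      obtain l where l: "0 \<le> l" "l \<le> 1" "x = (1 - l) *\<^sub>R r + l *\<^sub>R b" using x(1) unfolding closed_segment_def by blast
      have l0: "0 < l" using l ne by (cases "l = 0") auto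
      obtain u v where u: "0 \<le> u" "0 \<le> v" "u + v \<le> 1" "x = r + u *\<^sub>R (b1 - r) + v *\<^sub>R (q - r)"
        using x(2) unfolding D by (rule in_triangleE)
      have "l *\<^sub>R (b - r) = u *\<^sub>R (b1 - r) + v *\<^sub>R (q - r)" using l(3) u(4) by (simp add: algebra_simps)
      then have "(1 / l) *\<^sub>R (l *\<^sub>R (b - r)) = (1 / l) *\<^sub>R (u *\<^sub>R (b1 - r) + v *\<^sub>R (q - r))" by simp
      then have br: "b - r = (u / l) *\<^sub>R (b1 - r) + (v / l) *\<^sub>R (q - r)" using l0 by (simp add: scaleR_add_right)
      define u' v' where "u' = u / l" and "v' = v / l"
      have uv: "0 \<le> u'" "0 \<le> v'" using u l0 by (auto simp: u'_def v'_def)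
      have br': "b = r + u' *\<^sub>R (b1 - r) + v' *\<^sub>R (q - r)" using br by (simp add: u'_def v'_def algebra_simps)
      show False
      proof (cases "u' + v' \<le> 1")
        case True
        then have "b \<in> ?D" unfolding D using uv br' by (intro in_triangleI)
        then show False using Dlow[of b] b1max'[OF b] by simp
      next
        case False
        \<comment> \<open>The parameter at which the edge from \<open>r\<close> to \<open>b\<close>
          crosses the line through \<open>b1\<close> and \<open>q\<close>.\<close>
        define m where "m = 1 / (u' + v')"
        have m: "0 < m" "m \<le> 1" "m * u' + m * v' = 1" using False by (auto simp: m_def add_divide_distrib[symmetric])
        define y where "y = r + m *\<^sub>R (b - r)"
        have yr: "y = (1 - m) *\<^sub>R r + m *\<^sub>R b" by (simp add: y_def algebra_simps)
        have "y \<in> closed_segment r b"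
          unfolding closed_segment_def by (intro CollectI exI[of _ m] conjI yr) (use m in auto)
        moreover have "y \<in> closed_segment q b1"
        proof -
          have "b - r = u' *\<^sub>R (b1 - r) + v' *\<^sub>R (q - r)" using br' by simp
          then have "y = r + (m * u') *\<^sub>R (b1 - r) + (m * v') *\<^sub>R (q - r)" by (simp add: y_def scaleR_add_right)
          also have "\<dots> = (1 - (m * u' + m * v')) *\<^sub>R r + (m * u') *\<^sub>R b1 + (m * v') *\<^sub>R q" by (simp add: algebra_simps)
          also have "\<dots> = (m * v') *\<^sub>R q + (m * u') *\<^sub>R b1" by (simp add: m(3))
          also have "m * v' = 1 - m * u'" using m(3) by linarith
          finally have yq: "y = (1 - m * u') *\<^sub>R q + (m * u') *\<^sub>R b1" .
          have "0 \<le> m * u'" "0 \<le> m * v'" using m uv by auto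
          then have "m * u' \<le> 1" using m(3) by linarith
          then show ?thesis
            unfolding closed_segment_def by (intro CollectI exI[of _ "m * u'"] conjI yq \<open>0 \<le> m * u'\<close>)
        qed
        ultimately have "y \<in> {r, b} \<inter> {q, b1}" using cross[of r b q b1] r b b1 by blast
        then show False using r b b1 RB by auto
      qed
    qed
    moreover have "r \<in> ?D" unfolding D by (rule hull_inc) simp
    ultimately show ?thesis by auto
  qed
  define F where "F = arcs - {(b1, r1), (b1, r2)}"
  have Fseg: "closed_segment P Q \<inter> ?D = {} \<or> (\<exists>V\<in>{P, Q} \<inter> {b1, r1, r2}. closed_segment P Q \<inter> ?D = {V})"
    if PQ: "(P, Q) \<in> F" for P Q
  proof -
    obtain r b where rb: "r \<in> R" "b \<in> B" "(P, Q) = (r, b) \<or> (P, Q) = (b, r)" and plt: "snd P < snd Q"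
    proof -
      have "snd P < snd Q" "P \<in> R \<and> Q \<in> B \<or> P \<in> B \<and> Q \<in> R" using PQ by (simp_all add: F_def arcs_def)
      then show ?thesis using that[of P Q] that[of Q P] by blast
    qed
    have seg: "closed_segment P Q = closed_segment r b" using rb by (auto simp: closed_segment_commute)
    have set: "{P, Q} = {r, b}" using rb by auto
    show ?thesis unfolding seg set
    proof (cases "r = r1 \<or> r = r2")
      case True
      have "b \<noteq> b1"
      proof
        assume "b = b1"
        then have "snd b < snd r" using True h by auto
        then have "(P, Q) = (b1, r)" using rb(3) plt \<open>b = b1\<close> by auto
        then show False using PQ True by (auto simp: F_def)
      qed
      moreover have "\<exists>q\<in>R. r \<noteq> q \<and> {r, q} = {r1, r2}" using True r1(1) r2(1) r12 by auto
      then obtain q where q: "q \<in> R" "r \<noteq> q" "{r, q} = {r1, r2}" by blast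
      ultimately have "closed_segment r b \<inter> ?D = {r}" using spoke[OF rb(1) q rb(2)] by blast
      then show "closed_segment r b \<inter> ?D = {} \<or> (\<exists>V\<in>{r, b} \<inter> {b1, r1, r2}. closed_segment r b \<inter> ?D = {V})" using True by auto
    next
      case False
      then have "r \<notin> tops" using tops by simp
      from not_top[OF rb(1) this] obtain b' where b': "b' \<in> B" "snd r < snd b'" by blast
      \<comment> \<open>The remaining red vertices lie below \<open>b1\<close>, so their edges stay
        below the triangle and touch it at most in \<open>b1\<close>.\<close>
      then have rl: "snd r < snd b1" using b1max[OF b'(1)] by linarith
      show "closed_segment r b \<inter> ?D = {} \<or> (\<exists>V\<in>{r, b} \<inter> {b1, r1, r2}. closed_segment r b \<inter> ?D = {V})"
      proof (cases "b = b1")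
        case False
        have "closed_segment r b \<inter> ?D = {}"
        proof (rule equals0I)
          fix x assume x: "x \<in> closed_segment r b \<inter> ?D"
          then have "snd x \<le> max (snd r) (snd b)" "snd b1 \<le> snd x"
            using segment_snd_bounds(2)[of x r b] Dlow[of x] by auto
          then show False using rl b1max'[OF rb(2) False] by (auto simp: max_def split: if_splits)
        qed
        then show ?thesis ..
      next
        case True
        have "x = b1" if x: "x \<in> closed_segment r b" "x \<in> ?D" for x
        proof -
          obtain l where l: "0 \<le> l" "l \<le> 1" "x = (1 - l) *\<^sub>R r + l *\<^sub>R b1" using x(1) True unfolding closed_segment_def by blast
          have "snd x = (1 - l) * snd r + l * snd b1" using l(3) by simp
          then have "(1 - l) * (snd b1 - snd r) \<le> 0" using Dlow[OF x(2)] by (simp add: algebra_simps)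
          then have "l = 1" using l rl by (simp add: mult_le_0_iff)
          then show ?thesis using l(3) by simp
        qed
        moreover have "b1 \<in> ?D" by (rule hull_inc) simp
        ultimately have "closed_segment r b \<inter> ?D = {b1}" using True by auto
        then show ?thesis using True by auto
      qed
    qed
  qed
  have finF: "finite F" using finite_arcs by (simp add: F_def)
  have arcsF: "arcs = insert (b1, r1) (insert (b1, r2) F)"
    using r1 r2 b1 h by (auto simp: F_def arcs_def)
  have G: "graph = closed_segment b1 r1 \<union> closed_segment b1 r2 \<union> (\<Union>(P, Q)\<in>F. closed_segment P Q)"
    unfolding graph_arcs arcsF by auto
  define S where "S = insert (b1, r1) (insert (r2, r1) F)"
  define G' where "G' = closed_segment r1 b1 \<union> closed_segment r1 r2 \<union> (\<Union>(P, Q)\<in>F. closed_segment P Q)"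
  have G': "G' = (\<Union>(P, Q)\<in>S. closed_segment P Q)"
    unfolding S_def G'_def by (auto simp: closed_segment_commute)
  have D': "convex hull {r1, b1, r2} = ?D" by (simp add: insert_commute)
  have sideD: "closed_segment r2 r1 \<subseteq> ?D" "closed_segment b1 r1 \<subseteq> ?D" "closed_segment b1 r2 \<subseteq> ?D"
    by (intro closed_segment_subset_convex_hull hull_inc; simp)+
  define a0 where "a0 = (0 :: complex, Min (snd ` (R \<union> B)) - 1)"
  have low: "snd a0 < snd p" if "p \<in> R \<union> B" for p
  proof -
    have "Min (snd ` (R \<union> B)) \<le> snd p" using fin that by (intro Min_le) auto
    then show ?thesis by (simp add: a0_def)
  qed
  have a0D: "a0 \<notin> ?D" using Dlow[of a0] low[of b1] b1 by auto
  have a0F: "a0 \<notin> closed_segment P Q" if "(P, Q) \<in> arcs" for P Q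
    using segment_snd_bounds(1)[of a0 P Q] low[of P] low[of Q] that by (auto simp: arcs_def)
  have a0G: "a0 \<notin> graph" unfolding graph_arcs using a0F by auto
  have a0G': "a0 \<notin> G'" unfolding G'_def using a0D a0F sideD by (auto simp: F_def closed_segment_commute)
  have freeG': "freely_generated (- G') a0"
    unfolding G'
  proof (rule freely_generated_segments[where A=r1])
    show "finite S" "S \<noteq> {}" using finF by (auto simp: S_def)
    show "snd P < snd Q" if "(P, Q) \<in> S" for P Q using that h lt by (auto simp: S_def F_def arcs_def)
    show "a0 \<notin> (\<Union>(P, Q)\<in>S. closed_segment P Q)" using a0G' G' by simp
    show "Q = r1 \<or> snd Q < snd r1 \<and> (\<exists>Q'. (Q, Q') \<in> S)" if PQ: "(P, Q) \<in> S" for P Q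
    proof (cases "Q \<in> B")
      case True
      then have "(Q, r1) \<in> S" using r1(1) r1(2)[OF True] r12 True by (auto simp: S_def F_def arcs_def)
      then show ?thesis using r1(2)[OF True] by blast
    next
      case False
      then have Q: "Q \<in> R" using PQ r1 by (auto simp: S_def F_def arcs_def)
      consider "Q = r1" | "Q = r2" | "Q \<noteq> r1" "Q \<noteq> r2" by blast
      then show ?thesis
      proof cases
        case 2
        then have "(Q, r1) \<in> S" "snd Q < snd r1" using lt by (simp_all add: S_def)
        then show ?thesis by blast
      next
        case 3
        then have "Q \<notin> tops" using tops by simp
        from not_top[OF Q this] obtain b where b: "b \<in> B" "snd Q < snd b" by blast
        have "Q \<noteq> b1" using Q b1 RB by auto
        then have "(Q, b) \<in> S" using b Q by (simp add: S_def F_def arcs_def)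
        moreover have "snd Q < snd r1" using b(2) r1(2)[OF b(1)] by linarith
        ultimately show ?thesis by blast
      qed simp
    qed
    have new: "closed_segment r2 r1 \<inter> closed_segment P Q \<subseteq> {r2, r1} \<inter> {P, Q}" if "(P, Q) \<in> insert (b1, r1) F" for P Q
    proof (cases "(P, Q) = (b1, r1)")
      case True
      have "closed_segment r2 r1 \<inter> closed_segment r1 b1 = {r1}"
        using nc by (intro Int_closed_segment disjI2) (simp add: insert_commute)
      then show ?thesis using True by (auto simp: closed_segment_commute)
    next
      case False
      then have PQ: "(P, Q) \<in> F" using that by blast
      show ?thesis
      proof
        fix x assume x: "x \<in> closed_segment r2 r1 \<inter> closed_segment P Q"
        then have "x \<in> closed_segment P Q \<inter> ?D" using sideD by blast
        then have V: "x \<in> {P, Q} \<inter> {b1, r1, r2}" using Fseg[OF PQ] by auto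
        have "x \<noteq> b1" using segment_snd_bounds(1)[of x r2 r1] x h by auto
        then show "x \<in> {r2, r1} \<inter> {P, Q}" using V by auto
      qed
    qed
    show "closed_segment P Q \<inter> closed_segment P' Q' \<subseteq> {P, Q} \<inter> {P', Q'}"
      if PQ: "(P, Q) \<in> S" "(P', Q') \<in> S" "(P, Q) \<noteq> (P', Q')" for P Q P' Q'
    proof -
      consider "(P, Q) = (r2, r1)" "(P', Q') \<in> insert (b1, r1) F" | "(P', Q') = (r2, r1)" "(P, Q) \<in> insert (b1, r1) F"
        | "(P, Q) \<in> arcs" "(P', Q') \<in> arcs"
        using PQ unfolding S_def arcsF by blast
      then show ?thesis
      proof cases
        case 1 then show ?thesis using new[OF 1(2)] by auto
      next
        case 2 then show ?thesis using new[OF 2(2)] by blast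
      next
        case 3 then show ?thesis by (rule arcs_cross[OF _ _ PQ(3)])
      qed
    qed
  qed
  have nc': "\<not> collinear {r1, b1, r2}" using nc by (simp add: insert_commute)
  have Fseg': "closed_segment P Q \<inter> convex hull {r1, b1, r2} = {} \<or>
      (\<exists>V\<in>{P, Q} \<inter> {r1, b1, r2}. closed_segment P Q \<inter> convex hull {r1, b1, r2} = {V})" if "(P, Q) \<in> F" for P Q
    using Fseg[OF that] unfolding D' by (simp add: insert_commute)
  have same: "G' \<union> ?D = graph \<union> ?D"
    unfolding G G'_def using sideD by (auto simp: closed_segment_commute)
  have "path_connected (- G')" using freeG' by (simp add: freely_generated_def)
  then have "freely_generated (- (G' \<union> ?D)) a0"
    using freely_generated_antimono[OF slide(1)[OF nc' finF Fseg' G'_def a0G'] freeG' slide(2)[OF nc' finF Fseg' G'_def a0G']]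
      a0D unfolding D' by blast
  then have "freely_generated (- (graph \<union> ?D)) a0" by (simp add: same)
  then have "freely_generated (- graph) a0"
    using freely_generated_mono[OF slide(1)[OF nc finF Fseg G a0G a0D]] by blast
  then show ?thesis using a freely_generated_base by blast
qed

lemma free_tops:
  assumes "tops \<noteq> {}" "card tops \<le> 2" and a: "a \<notin> graph"
  shows "freely_generated (- graph) a"
proof -
  have fin_tops: "finite tops" using fin by (simp add: tops_def)
  then have "card tops = 1 \<or> card tops = 2" using assms by (auto simp: le_Suc_eq numeral_2_eq_2)
  then show ?thesis
  proof
    assume "card tops = 1"
    then obtain r where "tops = {r}" by (auto simp: card_1_singleton_iff)
    then show ?thesis using free_one_top a by blast
  next
    assume "card tops = 2"
    then obtain r r' where r: "tops = {r, r'}" "r \<noteq> r'" by (auto simp: card_2_iff)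
    then have "r \<in> R" "r' \<in> R" by (auto simp: tops_def)
    then have "snd r \<noteq> snd r'" using inj r by (metis UnI1 inj_onD)
    then consider "snd r' < snd r" | "snd r < snd r'" by linarith
    then show ?thesis
      using free_two_tops[of r r'] free_two_tops[of r' r] r a by cases (auto simp: insert_commute)
  qed
qed

end

section \<open>Choice of a direction\<close>

lemma finite_affine_zero:
  fixes a b :: real
  assumes "a \<noteq> 0 \<or> b \<noteq> 0"
  shows "finite {t. a + t * b = 0}"
proof (cases "b = 0")
  case False
  have "{t. a + t * b = 0} \<subseteq> {- a / b}" using False by (auto simp: field_simps)
  then show ?thesis by (rule finite_subset) simp
qed (use assms in simp)

definition nonorthogonal :: "'a::euclidean_space set \<Rightarrow> 'a \<Rightarrow> bool" where
  "nonorthogonal D k \<longleftrightarrow> (\<forall>d\<in>D. k \<bullet> d \<noteq> 0)"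

lemma finite_exceptions:
  assumes "finite D" "nonorthogonal D g"
  shows "finite {t. \<not> nonorthogonal D (k + t *\<^sub>R g)}"
proof -
  have "{t. \<not> nonorthogonal D (k + t *\<^sub>R g)} = (\<Union>d\<in>D. {t. k \<bullet> d + t * (g \<bullet> d) = 0})"
    by (auto simp: nonorthogonal_def inner_add_left)
  moreover have "finite {t. k \<bullet> d + t * (g \<bullet> d) = 0}" if "d \<in> D" for d
    by (rule finite_affine_zero) (use that assms(2) in \<open>simp add: nonorthogonal_def\<close>)
  ultimately show ?thesis using assms(1) by simp
qed

text \<open>On a line through \<open>d\<close> in a direction that is good for \<open>D\<close>,
  each vector of \<open>insert d D\<close> excludes only finitely many parameters.\<close>

lemma nonorthogonal_exists:
  assumes "finite D" "0 \<notin> D"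
  shows "\<exists>k. nonorthogonal D k"
  using assms
proof (induction D)
  case empty then show ?case by (simp add: nonorthogonal_def)
next
  case (insert d D)
  then obtain g where g: "nonorthogonal D g" by auto
  have "finite ({t. \<not> nonorthogonal D (d + t *\<^sub>R g)} \<union> {t. d \<bullet> d + t * (g \<bullet> d) = 0})"
    using finite_exceptions[OF insert(1) g] finite_affine_zero[of "d \<bullet> d"] insert.prems by auto
  then obtain t where "t \<notin> {t. \<not> nonorthogonal D (d + t *\<^sub>R g)} \<union> {t. d \<bullet> d + t * (g \<bullet> d) = 0}"
    using ex_new_if_finite[OF infinite_UNIV_char_0] by blast
  then have "nonorthogonal (insert d D) (d + t *\<^sub>R g)" by (auto simp: nonorthogonal_def inner_add_left)
  then show ?case by blast
qed

text \<open>The extra vector \<open>e\<close> becomes the third axis later: the direction must have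
  a nonzero third coordinate for the change of coordinates to be invertible.\<close>

definition differences :: "'a::euclidean_space \<Rightarrow> 'a set \<Rightarrow> 'a set" where
  "differences e V = insert e {p - q |p q. p \<in> V \<and> q \<in> V \<and> p \<noteq> q}"

lemma finite_differences: "finite V \<Longrightarrow> finite (differences e V)"
proof -
  assume "finite V"
  then have "finite (insert e ((\<lambda>(p, q). p - q) ` (V \<times> V)))" by simp
  then show ?thesis by (rule rev_finite_subset) (auto simp: differences_def)
qed

lemma zero_differences: "e \<noteq> 0 \<Longrightarrow> 0 \<notin> differences e V"
  by (auto simp: differences_def)

definition upper :: "'a::euclidean_space set \<Rightarrow> 'a set \<Rightarrow> 'a \<Rightarrow> 'a set" where
  "upper X Y k = {x \<in> X. \<forall>y\<in>Y. k \<bullet> y < k \<bullet> x}"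

text \<open>The products in the last clause are the minors \<open>(d \<bullet> k) * (d' \<bullet>
  k') - (d' \<bullet> k) * (d \<bullet> k')\<close>. While such a minor is nonzero, no direction on
  the line through \<open>k\<close> and \<open>k'\<close> is orthogonal to both \<open>d\<close> and
  \<open>d'\<close>; thus on the way from \<open>k\<close> to \<open>k'\<close> only parallel
  differences become horizontal together.\<close>

definition relatively_nonorthogonal :: "'a::euclidean_space set \<Rightarrow> 'a \<Rightarrow> 'a \<Rightarrow> bool" where
  "relatively_nonorthogonal D k k' \<longleftrightarrow> nonorthogonal D k \<and> nonorthogonal D k' \<and>
     (\<forall>d\<in>D. \<forall>d'\<in>D. (d \<bullet> k) *\<^sub>R d' \<noteq> (d' \<bullet> k) *\<^sub>R d \<longrightarrow> ((d \<bullet> k) *\<^sub>R d' - (d' \<bullet> k) *\<^sub>R d) \<bullet> k' \<noteq> 0)"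

lemma relatively_nonorthogonal_exists:
  assumes "finite D" "0 \<notin> D" "nonorthogonal D k1" "nonorthogonal D k2"
  shows "\<exists>k'. relatively_nonorthogonal D k1 k' \<and> relatively_nonorthogonal D k2 k'"
proof -
  define W where "W k = (\<lambda>(d, d'). (d \<bullet> k) *\<^sub>R d' - (d' \<bullet> k) *\<^sub>R d) ` (D \<times> D) - {0}" for k
  have "finite (D \<union> W k1 \<union> W k2)" "0 \<notin> D \<union> W k1 \<union> W k2" using assms by (auto simp: W_def)
  from nonorthogonal_exists[OF this] obtain k' where k': "nonorthogonal (D \<union> W k1 \<union> W k2) k'" ..
  have W: "(d \<bullet> k) *\<^sub>R d' - (d' \<bullet> k) *\<^sub>R d \<in> W k"
    if "d \<in> D" "d' \<in> D" "(d \<bullet> k) *\<^sub>R d' \<noteq> (d' \<bullet> k) *\<^sub>R d" for d d' k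
    unfolding W_def by (intro DiffI image_eqI[of _ _ "(d, d')"]) (use that in auto)
  have kD: "nonorthogonal D k'" using k' by (simp add: nonorthogonal_def)
  have "relatively_nonorthogonal D k k'" if k: "nonorthogonal D k" and sub: "W k \<subseteq> D \<union> W k1 \<union> W k2" for k
    unfolding relatively_nonorthogonal_def
  proof (intro conjI ballI impI k kD)
    fix d d' assume "d \<in> D" "d' \<in> D" "(d \<bullet> k) *\<^sub>R d' \<noteq> (d' \<bullet> k) *\<^sub>R d"
    then have "(d \<bullet> k) *\<^sub>R d' - (d' \<bullet> k) *\<^sub>R d \<in> D \<union> W k1 \<union> W k2" using W sub by blast
    then show "((d \<bullet> k) *\<^sub>R d' - (d' \<bullet> k) *\<^sub>R d) \<bullet> k' \<noteq> 0"
      using k' unfolding nonorthogonal_def inner_commute[of _ k'] by blast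
  qed
  from this[OF assms(3)] this[OF assms(4)] show ?thesis by (intro exI[of _ k'] conjI) auto
qed

lemma parallel_if_orthogonal_between:
  assumes rel: "relatively_nonorthogonal D k1 k2" and d: "d \<in> D" "d' \<in> D"
    and t: "((1 - t) *\<^sub>R k1 + t *\<^sub>R k2) \<bullet> d = 0" "((1 - t) *\<^sub>R k1 + t *\<^sub>R k2) \<bullet> d' = 0"
  shows "d' = ((k1 \<bullet> d') / (k1 \<bullet> d)) *\<^sub>R d"
proof -
  have nz: "k1 \<bullet> d \<noteq> 0" using rel d by (auto simp: relatively_nonorthogonal_def nonorthogonal_def)
  have e: "(1 - t) * (k1 \<bullet> d) + t * (k2 \<bullet> d) = 0" "(1 - t) * (k1 \<bullet> d') + t * (k2 \<bullet> d') = 0"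
    using t by (simp_all add: inner_add_left)
  have "t \<noteq> 0" using e(1) nz by auto
  moreover have "t * ((k1 \<bullet> d) * (k2 \<bullet> d') - (k1 \<bullet> d') * (k2 \<bullet> d)) = 0"
    using e by algebra
  ultimately have "((d \<bullet> k1) *\<^sub>R d' - (d' \<bullet> k1) *\<^sub>R d) \<bullet> k2 = 0"
    by (simp add: inner_diff_left inner_commute[of d] inner_commute[of d'])
  then have "(d \<bullet> k1) *\<^sub>R d' = (d' \<bullet> k1) *\<^sub>R d"
    using rel d unfolding relatively_nonorthogonal_def by blast
  then have "(1 / (k1 \<bullet> d)) *\<^sub>R ((k1 \<bullet> d) *\<^sub>R d') = (1 / (k1 \<bullet> d)) *\<^sub>R ((k1 \<bullet> d') *\<^sub>R d)"
    by (simp add: inner_commute)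
  then show ?thesis using nz by simp
qed

context coloured
begin

text \<open>With weak inequalities, the parameters having three highest red vertices and those
  having three highest blue ones form two closed sets. They cover the segment of directions, so by
  connectedness they meet, and at a common parameter both colours have three vertices at the same
  height.\<close>

lemma big_same_colour:
  assumes rel: "relatively_nonorthogonal (differences e (R \<union> B)) k1 k2"
    and big: "\<And>k. nonorthogonal (differences e (R \<union> B)) k \<Longrightarrow> 3 \<le> card (upper R B k) \<or> 3 \<le> card (upper B R k)"
    and k1: "3 \<le> card (upper R B k1)" and k2: "3 \<le> card (upper B R k2)"
  shows False
proof -
  let ?D = "differences e (R \<union> B)"
  define kt where "kt t = (1 - t) *\<^sub>R k1 + t *\<^sub>R k2" for t
  define C where "C X Y = {t. \<exists>A. A \<subseteq> X \<and> card A = 3 \<and> (\<forall>x\<in>A. \<forall>y\<in>Y. kt t \<bullet> y \<le> kt t \<bullet> x)}" for X Y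
  have closed: "closed (C X Y)" if "finite X" for X Y
  proof -
    have "C X Y = (\<Union>A\<in>{A. A \<subseteq> X \<and> card A = 3}. \<Inter>x\<in>A. \<Inter>y\<in>Y. {t. kt t \<bullet> y \<le> kt t \<bullet> x})"
      by (auto simp: C_def)
    moreover have "closed (\<Inter>x\<in>A. \<Inter>y\<in>Y. {t. kt t \<bullet> y \<le> kt t \<bullet> x})" for A
      unfolding kt_def by (intro closed_INT ballI closed_Collect_le continuous_intros)
    moreover have "finite {A. A \<subseteq> X \<and> card A = 3}" using that by simp
    ultimately show ?thesis by (metis (no_types, lifting) closed_UN)
  qed
  have in_C: "t \<in> C X Y" if c: "3 \<le> card (upper X Y (kt t))" for t X Y
  proof -
    obtain A where A: "A \<subseteq> upper X Y (kt t)" "card A = 3" by (rule obtain_subset_with_card_n[OF c])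
    then have "A \<subseteq> X \<and> card A = 3 \<and> (\<forall>x\<in>A. \<forall>y\<in>Y. kt t \<bullet> y \<le> kt t \<bullet> x)"
      unfolding upper_def by (auto intro: less_imp_le)
    then show ?thesis unfolding C_def by blast
  qed
  let ?C = "C R B \<union> C B R"
  have clC: "closed ?C" using closed fin by (intro closed_Un) auto
  have fin_bad: "finite {t. \<not> nonorthogonal ?D (kt t)}"
  proof -
    have gk: "nonorthogonal ?D k1" using rel by (simp add: relatively_nonorthogonal_def)
    have "{t. \<not> nonorthogonal ?D (kt t)} = (\<Union>d\<in>?D. {t. k1 \<bullet> d + t * ((k2 - k1) \<bullet> d) = 0})"
      by (auto simp: nonorthogonal_def kt_def inner_add_left inner_diff_left algebra_simps)
    moreover have "finite {t. k1 \<bullet> d + t * ((k2 - k1) \<bullet> d) = 0}" if "d \<in> ?D" for d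
      by (rule finite_affine_zero) (use that gk in \<open>simp add: nonorthogonal_def\<close>)
    ultimately show ?thesis using finite_differences[of "R \<union> B"] fin by simp
  qed
  \<comment> \<open>Generic parameters are covered by hypothesis. The rest is finite as well as
    open, hence empty, so degenerate parameters are covered too.\<close>
  have "{0<..<1} - ?C \<subseteq> {t. \<not> nonorthogonal ?D (kt t)}" using big in_C by blast
  then have "finite ({0<..<1} - ?C)" using fin_bad finite_subset by blast
  moreover have "open ({0<..<1::real} - ?C)" using clC by (intro open_Diff) auto
  ultimately have "{0<..<1} - ?C = {}" by (rule finite_imp_not_open)
  then have "closure {0<..<1} \<subseteq> ?C" using clC by (intro closure_minimal) auto
  then have sub: "{0..1} \<subseteq> ?C" by simp
  have "0 \<in> C R B" "1 \<in> C B R" using k1 k2 by (auto intro!: in_C simp: kt_def)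
  then have "C R B \<inter> C B R \<inter> {0..1} \<noteq> {}"
    using connected_closedD[of "{0..1::real}" "C R B" "C B R"] closed fin sub connected_Icc[of 0 "1::real"] by force
  then obtain t where "t \<in> C R B" "t \<in> C B R" by blast
  then obtain A A' where A: "A \<subseteq> R" "card A = 3" "\<And>x y. x \<in> A \<Longrightarrow> y \<in> B \<Longrightarrow> kt t \<bullet> y \<le> kt t \<bullet> x"
    and A': "A' \<subseteq> B" "card A' = 3" "\<And>x y. x \<in> A' \<Longrightarrow> y \<in> R \<Longrightarrow> kt t \<bullet> y \<le> kt t \<bullet> x"
    unfolding C_def by fast
  obtain b where b: "b \<in> A'" using A'(2) by fastforce
  obtain x y z where xyz: "A = {x, y, z}" "x \<noteq> y" "x \<noteq> z" "y \<noteq> z" using A(2) by (auto simp: card_3_iff)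
  have zero: "kt t \<bullet> (r - b) = 0" if "r \<in> A" for r
    using A(3)[OF that, of b] A'(3)[OF b, of r] A(1) A'(1) b that by (fastforce simp: inner_diff_right)
  have D: "r - b \<in> ?D" if "r \<in> A" for r
    using that A(1) A'(1) b RB by (fastforce simp: differences_def)
  have nz: "k1 \<bullet> (r - b) \<noteq> 0" if "r \<in> A" for r
    using rel D[OF that] by (simp add: relatively_nonorthogonal_def nonorthogonal_def)
  have differ: "\<not> 0 < (k1 \<bullet> (r - b)) / (k1 \<bullet> (q - b))" if "r \<in> A" "q \<in> A" "r \<noteq> q" for r q
  proof
    assume pos: "0 < (k1 \<bullet> (r - b)) / (k1 \<bullet> (q - b))"
    have "r - b = ((k1 \<bullet> (r - b)) / (k1 \<bullet> (q - b))) *\<^sub>R (q - b)"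
      using parallel_if_orthogonal_between[OF rel D[OF that(2)] D[OF that(1)]] zero that unfolding kt_def by blast
    then show False using same_side[of r q b, OF _ _ _ that(3) _ pos] that A(1) A'(1) b by blast
  qed
  have "\<not> 0 < k1 \<bullet> (x - b) / (k1 \<bullet> (y - b))" "\<not> 0 < k1 \<bullet> (x - b) / (k1 \<bullet> (z - b))" "\<not> 0 < k1 \<bullet> (y - b) / (k1 \<bullet> (z - b))"
    using differ xyz by auto
  moreover have "k1 \<bullet> (x - b) \<noteq> 0" "k1 \<bullet> (y - b) \<noteq> 0" "k1 \<bullet> (z - b) \<noteq> 0" using nz xyz by auto
  ultimately show False unfolding zero_less_divide_iff by linarith
qed

text \<open>A red vertex above all blue ones for \<open>k\<close> lies below them all for
  \<open>- k\<close>. The two sets of at least three vertices are therefore disjoint and exhaust a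
  class of at most six, so no red vertex ever separates two blue ones by height.\<close>

lemma not_always_big:
  assumes card: "card R \<le> 6" "2 \<le> card B" and e: "e \<noteq> 0"
    and big: "\<And>k. nonorthogonal (differences e (R \<union> B)) k \<Longrightarrow> 3 \<le> card (upper R B k)"
  shows False
proof -
  let ?D = "differences e (R \<union> B)"
  obtain r where r: "r \<in> R" using ne by blast
  obtain A where A: "A \<subseteq> B" "card A = 2" by (rule obtain_subset_with_card_n[OF card(2)])
  then obtain b b' where b: "b \<in> B" "b' \<in> B" "b \<noteq> b'" by (auto simp: card_2_iff)
  have gen: "0 < (k \<bullet> (b - r)) * (k \<bullet> (b' - r))" if k: "nonorthogonal ?D k" for k
  proof -
    have k': "nonorthogonal ?D (- k)" using k by (simp add: nonorthogonal_def)
    have "upper R B k \<inter> upper R B (- k) = {}" using b(1) unfolding upper_def by fastforce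
    moreover have fU: "finite (upper R B k)" "finite (upper R B (- k))" using fin by (simp_all add: upper_def)
    ultimately have "card (upper R B k \<union> upper R B (- k)) = card (upper R B k) + card (upper R B (- k))"
      by (intro card_Un_disjoint)
    then have "card R \<le> card (upper R B k \<union> upper R B (- k))" using big[OF k] big[OF k'] card(1) by linarith
    then have "upper R B k \<union> upper R B (- k) = R" by (intro card_seteq fin) (auto simp: upper_def)
    then have "(k \<bullet> b < k \<bullet> r \<and> k \<bullet> b' < k \<bullet> r) \<or> (k \<bullet> b > k \<bullet> r \<and> k \<bullet> b' > k \<bullet> r)"
      using r b unfolding upper_def by fastforce
    then show ?thesis by (auto simp: inner_diff_right zero_less_mult_iff)
  qed
  have fD: "finite ?D" using finite_differences[of "R \<union> B"] fin by simp
  from nonorthogonal_exists[OF fD zero_differences[OF e]] obtain g where g: "nonorthogonal ?D g" ..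
  \<comment> \<open>Passes from generic to all directions: on a line through \<open>k\<close> in a
    good direction, the violating parameters would form an open set that is finite and
    nonempty.\<close>
  have nonneg: "0 \<le> (k \<bullet> (b - r)) * (k \<bullet> (b' - r))" for k
  proof (rule ccontr)
    assume neg: "\<not> 0 \<le> (k \<bullet> (b - r)) * (k \<bullet> (b' - r))"
    let ?N = "{t. ((k + t *\<^sub>R g) \<bullet> (b - r)) * ((k + t *\<^sub>R g) \<bullet> (b' - r)) < 0}"
    have "?N \<subseteq> {t. \<not> nonorthogonal ?D (k + t *\<^sub>R g)}" using gen by force
    then have "finite ?N" by (rule finite_subset[OF _ finite_exceptions[OF fD g]])
    moreover have "open ?N" by (intro open_Collect_less continuous_intros)
    ultimately have "?N = {}" by (rule finite_imp_not_open)
    moreover have "0 \<in> ?N" using neg by simp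
    ultimately show False by blast
  qed
  define d d' where "d = b - r" and "d' = b' - r"
  have nz: "d \<noteq> 0" "d' \<noteq> 0" using r b RB by (auto simp: d_def d'_def)
  then have dd: "0 < d \<bullet> d" by simp
  define \<mu> where "\<mu> = (d \<bullet> d') / (d \<bullet> d)"
  define p where "p = d' - \<mu> *\<^sub>R d"
  have pd: "p \<bullet> d = 0" using dd by (simp add: p_def \<mu>_def inner_diff_left inner_commute[of d d'])
  have "p \<bullet> p = p \<bullet> (d' - \<mu> *\<^sub>R d)" by (simp only: p_def[symmetric])
  then have pd': "p \<bullet> d' = p \<bullet> p" by (simp add: inner_diff_right pd)
  have "p = 0"
  proof (rule ccontr)
    assume "p \<noteq> 0"
    then have pp: "0 < p \<bullet> p" by simp
    \<comment> \<open>\<open>p\<close> is the part of \<open>d'\<close> orthogonal to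
      \<open>d\<close>; this scale makes the test direction \<open>s *\<^sub>R p - d\<close>
      negative on \<open>d\<close> and equal to 1 on \<open>d'\<close>.\<close>
    define s where "s = (d \<bullet> d' + 1) / (p \<bullet> p)"
    have "(s *\<^sub>R p - d) \<bullet> d = - (d \<bullet> d)" using pd by (simp add: inner_diff_left)
    moreover have "(s *\<^sub>R p - d) \<bullet> d' = 1" using pp by (simp add: inner_diff_left pd' s_def)
    ultimately have "((s *\<^sub>R p - d) \<bullet> d) * ((s *\<^sub>R p - d) \<bullet> d') < 0" using dd by simp
    then show False using nonneg[of "s *\<^sub>R p - d"] by (simp add: d_def d'_def)
  qed
  then have par: "d' = \<mu> *\<^sub>R d" by (simp add: p_def)
  have "0 \<le> (d \<bullet> d) * (d \<bullet> d')" using nonneg[of d] by (simp add: d_def d'_def)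
  then have "0 \<le> \<mu>" using dd by (simp add: \<mu>_def zero_le_mult_iff)
  moreover have "\<mu> \<noteq> 0" using par nz by auto
  ultimately have "0 < \<mu>" by simp
  then show False
    using coloured.same_side[OF swap b(2,1) r, of \<mu>] b(3) par by (simp add: d_def d'_def)
qed

lemma good_direction:
  assumes card: "card R \<le> 6" "2 \<le> card R" "card B \<le> 6" "2 \<le> card B" and e: "e \<noteq> 0"
  shows "\<exists>k. k \<bullet> e \<noteq> 0 \<and> inj_on ((\<bullet>) k) (R \<union> B) \<and>
    (upper R B k \<noteq> {} \<and> card (upper R B k) \<le> 2 \<or> upper B R k \<noteq> {} \<and> card (upper B R k) \<le> 2)"
proof (rule ccontr)
  assume no: "\<not> ?thesis"
  let ?D = "differences e (R \<union> B)"
  have D: "finite ?D" "0 \<notin> ?D" using finite_differences[of "R \<union> B"] zero_differences[OF e] fin by auto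
  have big: "3 \<le> card (upper R B k) \<or> 3 \<le> card (upper B R k)" if k: "nonorthogonal ?D k" for k
  proof -
    have inj: "inj_on ((\<bullet>) k) (R \<union> B)"
    proof (rule inj_onI)
      fix p q assume pq: "p \<in> R \<union> B" "q \<in> R \<union> B" "k \<bullet> p = k \<bullet> q"
      show "p = q"
      proof (rule ccontr)
        assume "p \<noteq> q"
        then have "p - q \<in> ?D" using pq by (auto simp: differences_def)
        then have "k \<bullet> (p - q) \<noteq> 0" using k unfolding nonorthogonal_def by blast
        then show False using pq(3) by (simp add: inner_diff_right)
      qed
    qed
    have "k \<bullet> e \<noteq> 0" using k by (simp add: nonorthogonal_def differences_def)
    moreover have "upper R B k \<noteq> {} \<or> upper B R k \<noteq> {}"
    proof -
      have "Max ((\<bullet>) k ` (R \<union> B)) \<in> (\<bullet>) k ` (R \<union> B)" using fin ne by (intro Max_in) auto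
      then obtain w where w: "w \<in> R \<union> B" "Max ((\<bullet>) k ` (R \<union> B)) = k \<bullet> w" by (elim imageE)
      have "k \<bullet> v < k \<bullet> w" if "v \<in> R \<union> B" "v \<noteq> w" for v
      proof -
        have "k \<bullet> v \<le> Max ((\<bullet>) k ` (R \<union> B))" using fin that by (intro Max_ge) auto
        then have "k \<bullet> v \<le> k \<bullet> w" by (simp add: w(2))
        moreover have "k \<bullet> v \<noteq> k \<bullet> w" using inj_onD[OF inj _ that(1) w(1)] that(2) by blast
        ultimately show ?thesis by simp
      qed
      then have "w \<in> upper R B k \<or> w \<in> upper B R k" using w(1) RB unfolding upper_def by blast
      then show ?thesis by blast
    qed
    ultimately show ?thesis using no inj not_less_eq_eq[of _ 2] by (auto simp: numeral_3_eq_3 numeral_2_eq_2 not_le)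
  qed
  \<comment> \<open>Two given directions need not be generic relative to each other; a third one
    that is generic relative to both mediates.\<close>
  have one: "(3 \<le> card (upper R B k) \<longrightarrow> 3 \<le> card (upper R B k')) \<and> (3 \<le> card (upper B R k) \<longrightarrow> 3 \<le> card (upper B R k'))"
    if k: "nonorthogonal ?D k" "nonorthogonal ?D k'" for k k'
  proof -
    obtain l where l: "relatively_nonorthogonal ?D k l" "relatively_nonorthogonal ?D k' l"
      using relatively_nonorthogonal_exists[OF D k] by blast
    have gl: "nonorthogonal ?D l" using l by (simp add: relatively_nonorthogonal_def)
    have big': "3 \<le> card (upper B R k) \<or> 3 \<le> card (upper R B k)" if "nonorthogonal (differences e (B \<union> R)) k" for k
      using big[of k] that by (auto simp: Un_commute)
    have l': "relatively_nonorthogonal (differences e (B \<union> R)) k l" "relatively_nonorthogonal (differences e (B \<union> R)) k' l"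
      using l by (simp_all add: Un_commute)
    note n = big_same_colour[OF l(1) big] big_same_colour[OF l(2) big]
      coloured.big_same_colour[OF swap l'(1) big'] coloured.big_same_colour[OF swap l'(2) big']
    show ?thesis using n big[OF k(1)] big[OF k(2)] big[OF gl] by blast
  qed
  obtain k where k: "nonorthogonal ?D k" using nonorthogonal_exists[OF D] by blast
  from big[OF k] show False
  proof
    assume "3 \<le> card (upper R B k)"
    then show False using not_always_big[OF card(1,4) e] one[OF k] by blast
  next
    assume "3 \<le> card (upper B R k)"
    then have "3 \<le> card (upper B R k')" if "nonorthogonal (differences e (B \<union> R)) k'" for k'
      using one[OF k, of k'] that by (simp add: Un_commute)
    then show False using coloured.not_always_big[OF swap card(3,2) e] by blast
  qed
qed

end

section \<open>Linear embeddings\<close>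

text \<open>Outside a star-shaped set every point can recede from the centre along its ray.
  \<open>push\<close> recedes by a radius \<open>c\<close> of \<open>S\<close> and so maps all of
  \<open>- {b}\<close> into the complement; a homotopy in the punctured space, which is simply
  connected from dimension 3 on, is thereby carried into the complement of \<open>S\<close>.\<close>

lemma simply_connected_complement_star:
  fixes b :: "'a::euclidean_space"
  assumes S: "bounded S" "b \<in> S" and star: "\<And>x. x \<in> S \<Longrightarrow> closed_segment b x \<subseteq> S" and dim: "3 \<le> DIM('a)"
  shows "simply_connected (- S)"
proof -
  obtain c where c: "\<And>x. x \<in> S \<Longrightarrow> norm (x - b) \<le> c"
    using S(1) unfolding bounded_any_center[of S b] dist_norm by (auto simp: norm_minus_commute)
  have c0: "0 \<le> c" using c[OF S(2)] by simp
  have ray: "b + s *\<^sub>R (P - b) \<notin> S" if P: "P \<notin> S" and s: "1 \<le> s" for P s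
  proof
    assume x: "b + s *\<^sub>R (P - b) \<in> S"
    have e: "P = (1 - 1 / s) *\<^sub>R b + (1 / s) *\<^sub>R (b + s *\<^sub>R (P - b))" using s by (simp add: algebra_simps)
    have "P \<in> closed_segment b (b + s *\<^sub>R (P - b))"
      unfolding closed_segment_def by (rule CollectI, rule exI[of _ "1 / s"], intro conjI, rule e) (use s in auto)
    then show False using star[OF x] P by blast
  qed
  define push where "push P = b + (1 + c / norm (P - b)) *\<^sub>R (P - b)" for P
  have cont: "continuous_on (- {b}) push"
    unfolding push_def by (intro continuous_intros) auto
  have push: "push P \<notin> S" if "P \<noteq> b" for P
  proof
    assume "push P \<in> S"
    then have "norm (push P - b) \<le> c" by (rule c)
    moreover have "norm (push P - b) = (1 + c / norm (P - b)) * norm (P - b)"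
      using c0 by (simp add: push_def)
    moreover have "(1 + c / norm (P - b)) * norm (P - b) = norm (P - b) + c" using that by (simp add: distrib_right)
    ultimately show False using that by simp
  qed
  have to_push: "homotopic_loops (- S) p (push \<circ> p)"
    if p: "path p" "path_image p \<subseteq> - S" "pathfinish p = pathstart p" for p
  proof (rule homotopic_loops_linear)
    have nb: "path_image p \<subseteq> - {b}" using p(2) S(2) by blast
    show "path (push \<circ> p)" by (rule path_continuous_image[OF p(1)]) (rule continuous_on_subset[OF cont nb])
    show "pathfinish (push \<circ> p) = pathstart (push \<circ> p)" using p(3) by (simp add: pathstart_compose pathfinish_compose)
    show "closed_segment (p t) ((push \<circ> p) t) \<subseteq> - S" if t: "t \<in> {0..1}" for t
    proof
      fix x assume "x \<in> closed_segment (p t) ((push \<circ> p) t)"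
      then obtain u where u: "0 \<le> u" "u \<le> 1" "x = (1 - u) *\<^sub>R p t + u *\<^sub>R push (p t)"
        unfolding closed_segment_def by auto
      have "p t \<notin> S" using p(2) t unfolding path_image_def by blast
      moreover have "x = b + (1 + u * (c / norm (p t - b))) *\<^sub>R (p t - b)"
        unfolding u(3) push_def by (simp add: algebra_simps)
      moreover have "0 \<le> u * (c / norm (p t - b))" using u c0 by simp
      ultimately show "x \<in> - S" using ray[of "p t" "1 + u * (c / norm (p t - b))"] by simp
    qed
  qed (use p in auto)
  show ?thesis
    unfolding simply_connected_def
  proof (intro allI impI, elim conjE)
    fix p q :: "real \<Rightarrow> 'a"
    assume p: "path p" "pathfinish p = pathstart p" "path_image p \<subseteq> - S"
      and q: "path q" "pathfinish q = pathstart q" "path_image q \<subseteq> - S"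
    have nb: "path_image p \<subseteq> - {b}" "path_image q \<subseteq> - {b}" using p(3) q(3) S(2) by blast+
    have "homotopic_loops (- {b}) p q"
      using simply_connected_punctured_universe[OF dim, of b] p q nb unfolding simply_connected_def by blast
    then have "homotopic_loops (- S) (push \<circ> p) (push \<circ> q)"
      by (rule homotopic_loops_continuous_image[OF _ cont]) (use push in blast)
    then show "homotopic_loops (- S) p q"
      using to_push[OF p(1,3,2)] to_push[OF q(1,3,2)] homotopic_loops_trans homotopic_loops_sym by blast
  qed
qed

context coloured
begin

lemma graph_swap: "coloured.graph B R = graph"
proof -
  have "closed_segment r b = closed_segment b r" for r b :: 'a by (rule closed_segment_commute)
  then show ?thesis unfolding graph_def coloured.graph_def[OF swap] by blast
qed

lemma linear_image:
  fixes T :: "'a \<Rightarrow> 'b::euclidean_space"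
  assumes T: "linear T" "inj T"
  shows "coloured (T ` R) (T ` B)" and "coloured.graph (T ` R) (T ` B) = T ` graph"
proof -
  have seg: "closed_segment (T p) (T q) = T ` closed_segment p q" for p q
    by (rule closed_segment_linear_image[OF T(1)])
  show col: "coloured (T ` R) (T ` B)"
  proof
    show "T ` R \<inter> T ` B = {}" using RB T(2) by (metis image_Int image_empty)
    fix r b w assume w: "r \<in> T ` R" "b \<in> T ` B" "w \<in> T ` R \<union> T ` B" "w \<noteq> r" "w \<noteq> b"
    then obtain r' b' w' where e: "r = T r'" "r' \<in> R" "b = T b'" "b' \<in> B" "w = T w'" "w' \<in> R \<union> B" by blast
    then have "w' \<notin> closed_segment r' b'" using no_mid w(4,5) by blast
    then show "w \<notin> closed_segment r b" unfolding e(1,3,5) seg using T(2) by (simp add: inj_image_mem_iff)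
  next
    fix r b r' b' assume h: "r \<in> T ` R" "b \<in> T ` B" "r' \<in> T ` R" "b' \<in> T ` B" "(r, b) \<noteq> (r', b')"
    then obtain s d s' d' where e: "r = T s" "s \<in> R" "b = T d" "d \<in> B" "r' = T s'" "s' \<in> R" "b' = T d'" "d' \<in> B" by blast
    then have "closed_segment s d \<inter> closed_segment s' d' \<subseteq> {s, d} \<inter> {s', d'}" using h(5) by (intro cross) auto
    then have "T ` (closed_segment s d \<inter> closed_segment s' d') \<subseteq> {r, b} \<inter> {r', b'}" unfolding e(1,3,5,7) by blast
    then show "closed_segment r b \<inter> closed_segment r' b' \<subseteq> {r, b} \<inter> {r', b'}"
      unfolding e(1,3,5,7) seg image_Int[OF T(2)] .
  qed (use fin ne in auto)
  show "coloured.graph (T ` R) (T ` B) = T ` graph"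
    unfolding coloured.graph_def[OF col] graph_def by (simp add: seg image_UN)
qed

end

lemma freely_generated_direction:
  fixes X Y :: "(real^3) set"
  assumes "coloured X Y" and k: "k $ 3 \<noteq> 0" and inj: "inj_on ((\<bullet>) k) (X \<union> Y)"
    and up: "upper X Y k \<noteq> {}" "card (upper X Y k) \<le> 2" and a: "a \<notin> coloured.graph X Y"
  shows "freely_generated (- coloured.graph X Y) a"
proof -
  interpret C: coloured X Y by fact
  \<comment> \<open>The third coordinate is exchanged for the height \<open>k \<bullet> P\<close>;
    \<open>S\<close> solves for it by dividing by \<open>k $ 3\<close>.\<close>
  define T where "T P = (Complex (P $ 1) (P $ 2), k \<bullet> P)" for P :: "real^3"
  define S where "S = (\<lambda>(w, z). vector [Re w, Im w, (z - k $ 1 * Re w - k $ 2 * Im w) / k $ 3] :: real^3)"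
  have k3: "k \<bullet> P = k $ 1 * P $ 1 + k $ 2 * P $ 2 + k $ 3 * P $ 3" for P by (simp add: inner_vec_def sum_3)
  have ST: "S (T P) = P" for P using k by (simp add: S_def T_def k3 vec_eq_iff forall_3)
  have TS: "T (S y) = y" for y using k by (cases y) (simp add: S_def T_def k3)
  have bij: "bij T" using ST TS by (intro o_bij[of S]) auto
  then have injT: "inj T" by (rule bij_is_inj)
  have lin: "linear T"
    by (rule linearI) (auto simp: T_def complex_eq_iff inner_add_right)
  have contT: "continuous_on UNIV T" using lin by (rule linear_continuous_on[OF linear_conv_bounded_linear[THEN iffD1]])
  have linS: "linear S"
    by (rule linearI) (auto simp: S_def vec_eq_iff forall_3 algebra_simps add_divide_distrib diff_divide_distrib)
  have contS: "continuous_on UNIV S" using linS by (rule linear_continuous_on[OF linear_conv_bounded_linear[THEN iffD1]])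
  have col: "coloured (T ` X) (T ` Y)" by (rule C.linear_image[OF lin injT])
  have graph: "coloured.graph (T ` X) (T ` Y) = T ` C.graph" by (rule C.linear_image[OF lin injT])
  have snd: "snd (T P) = k \<bullet> P" for P by (simp add: T_def)
  interpret H: coloured_heights "T ` X" "T ` Y"
  proof (intro coloured_heights.intro col coloured_heights_axioms.intro inj_onI)
    fix p q assume "p \<in> T ` X \<union> T ` Y" "q \<in> T ` X \<union> T ` Y" "snd p = snd q"
    then obtain p' q' where pq: "p = T p'" "p' \<in> X \<union> Y" "q = T q'" "q' \<in> X \<union> Y" by blast
    then show "p = q" using inj_onD[OF inj _ pq(2,4)] \<open>snd p = snd q\<close> snd by simp
  qed
  have tops: "H.tops = T ` upper X Y k" unfolding H.tops_def upper_def using snd by auto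
  have "card (T ` upper X Y k) \<le> 2"
    using card_image_le[of "upper X Y k" T] C.fin up(2) by (simp add: upper_def)
  then have "freely_generated (- (T ` C.graph)) (T a)"
    using H.free_tops[of "T a"] up(1) a injT unfolding tops graph by (simp add: inj_image_mem_iff)
  then have "freely_generated (T ` (- C.graph)) (T a)" by (simp add: bij_image_Compl_eq[OF bij])
  then show ?thesis
    by (rule freely_generated_homeomorphic[where S=S])
      (use a ST continuous_on_subset[OF contT] continuous_on_subset[OF contS] in auto)
qed

lemma freely_generated_single_centre:
  fixes X :: "(real^3) set"
  assumes "coloured X {b}" and a: "a \<notin> coloured.graph X {b}"
  shows "freely_generated (- coloured.graph X {b}) a"
proof (rule freely_generated_simply_connected)
  interpret C: coloured X "{b}" by fact
  show "a \<in> - C.graph" using a by simp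
  show "simply_connected (- C.graph)"
  proof (rule simply_connected_complement_star)
    show "bounded C.graph" using C.fin unfolding C.graph_def by (intro bounded_UN ballI) (auto intro: bounded_closed_segment)
    show "b \<in> C.graph" using C.ne by (auto simp: C.graph_def)
    fix x assume "x \<in> C.graph"
    then obtain r where r: "r \<in> X" "x \<in> closed_segment r b" by (auto simp: C.graph_def)
    then have "closed_segment b x \<subseteq> closed_segment r b" by (intro closed_segment_subset) auto
    then show "closed_segment b x \<subseteq> C.graph" using r(1) by (auto simp: C.graph_def)
  qed simp
qed

lemma coloured_freely_generated:
  fixes R B :: "(real^3) set"
  assumes col: "coloured R B" and card: "card R \<le> 6" "card B \<le> 6" and a: "a \<notin> coloured.graph R B"
  shows "freely_generated (- coloured.graph R B) a"
proof -
  interpret C: coloured R B by fact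
  have sw: "coloured.graph B R = coloured.graph R B" by (rule C.graph_swap)
  have "card R \<noteq> 0" "card B \<noteq> 0" using C.fin C.ne by auto
  \<comment> \<open>\<open>good_direction\<close> asks for two vertices of each colour, so stars are
    split off.\<close>
  then consider "card R = 1" | "card B = 1" | "2 \<le> card R" "2 \<le> card B" by linarith
  then show ?thesis
  proof cases
    case 1
    then obtain b where b: "R = {b}" by (auto simp: card_1_singleton_iff)
    show ?thesis
      using freely_generated_single_centre[of B b a] C.swap a sw unfolding b by simp
  next
    case 2
    then obtain b where b: "B = {b}" by (auto simp: card_1_singleton_iff)
    show ?thesis using freely_generated_single_centre[of R b a] col a unfolding b by simp
  next
    case 3
    have "axis 3 1 \<noteq> (0 :: real^3)" by (simp add: axis_eq_0_iff)
    from C.good_direction[OF card(1) 3(1) card(2) 3(2) this] obtain k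
      where k: "k \<bullet> axis 3 1 \<noteq> 0" "inj_on ((\<bullet>) k) (R \<union> B)"
        and up: "upper R B k \<noteq> {} \<and> card (upper R B k) \<le> 2 \<or> upper B R k \<noteq> {} \<and> card (upper B R k) \<le> 2" by blast
    have k3: "k $ 3 \<noteq> 0" using k(1) by (simp add: inner_axis)
    from up show ?thesis
    proof
      assume "upper R B k \<noteq> {} \<and> card (upper R B k) \<le> 2"
      then show ?thesis using freely_generated_direction[OF col k3 k(2) _ _ a] by blast
    next
      assume "upper B R k \<noteq> {} \<and> card (upper B R k) \<le> 2"
      then show ?thesis
        using freely_generated_direction[OF C.swap k3, of a] k(2) a unfolding sw by (simp add: Un_commute)
    qed
  qed
qed

theorem theorem4:
  fixes n m :: nat
  assumes "1 \<le> n" "n \<le> 6" "1 \<le> m" "m \<le> 6"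
  shows "linearly_free (Knm_vertices n m) (Knm_edges n m)"
  unfolding linearly_free_def free_embedding_def
proof (intro allI impI ballI)
  let ?V = "Knm_vertices n m" and ?E = "Knm_edges n m"
  fix \<phi> :: "nat + nat \<Rightarrow> real^3" and a
  assume emb: "linear_embedding ?V ?E \<phi>" and a: "a \<in> - graph_image ?V ?E \<phi>"
  have inj: "inj_on \<phi> ?V"
    and mid: "\<And>e w. e \<in> ?E \<Longrightarrow> w \<in> ?V \<Longrightarrow> w \<notin> e \<Longrightarrow> \<phi> w \<notin> edge_segment \<phi> e"
    and cr: "\<And>e1 e2. e1 \<in> ?E \<Longrightarrow> e2 \<in> ?E \<Longrightarrow> e1 \<noteq> e2 \<Longrightarrow> edge_segment \<phi> e1 \<inter> edge_segment \<phi> e2 = \<phi> ` (e1 \<inter> e2)"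
    using emb unfolding linear_embedding_def by auto
  define R B where "R = (\<lambda>i. \<phi> (Inl i)) ` {..<n}" and "B = (\<lambda>j. \<phi> (Inr j)) ` {..<m}"
  have seg: "edge_segment \<phi> {Inl i, Inr j} = closed_segment (\<phi> (Inl i)) (\<phi> (Inr j))" for i j
    by (simp add: edge_segment_def segment_convex_hull)
  have E: "{Inl i, Inr j} \<in> ?E" if "i < n" "j < m" for i j using that by (auto simp: Knm_edges_def)
  have V: "Inl i \<in> ?V" if "i < n" for i using that by (simp add: Knm_vertices_def)
  have V': "Inr j \<in> ?V" if "j < m" for j using that by (simp add: Knm_vertices_def)
  have RBV: "R \<union> B = \<phi> ` ?V" by (auto simp: R_def B_def Knm_vertices_def)
  have col: "coloured R B"
  proof
    show "finite R" "finite B" by (simp_all add: R_def B_def)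
    show "R \<noteq> {}" "B \<noteq> {}" using assms by (auto simp: R_def B_def lessThan_empty_iff)
    have "\<phi> (Inl i) \<noteq> \<phi> (Inr j)" if "i < n" "j < m" for i j
      using inj_onD[OF inj _ V[OF that(1)] V'[OF that(2)]] by blast
    then show "R \<inter> B = {}" by (auto simp: R_def B_def)
    fix r b w assume h: "r \<in> R" "b \<in> B" "w \<in> R \<union> B" "w \<noteq> r" "w \<noteq> b"
    then obtain i j where ij: "r = \<phi> (Inl i)" "i < n" "b = \<phi> (Inr j)" "j < m" by (auto simp: R_def B_def)
    from h(3) obtain v where v: "w = \<phi> v" "v \<in> ?V" unfolding RBV by blast
    have "v \<notin> {Inl i, Inr j}" using h(4,5) v ij by auto
    then show "w \<notin> closed_segment r b" using mid[OF E[OF ij(2,4)] v(2)] unfolding seg v(1) ij by blast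
  next
    fix r b r' b' assume h: "r \<in> R" "b \<in> B" "r' \<in> R" "b' \<in> B" "(r, b) \<noteq> (r', b')"
    from h(1,2) obtain i j where ij: "r = \<phi> (Inl i)" "i < n" "b = \<phi> (Inr j)" "j < m" by (auto simp: R_def B_def)
    from h(3,4) obtain i' j' where ij': "r' = \<phi> (Inl i')" "i' < n" "b' = \<phi> (Inr j')" "j' < m" by (auto simp: R_def B_def)
    have "{Inl i, Inr j} \<noteq> {Inl i', Inr j'}" using h(5) ij ij' by (auto simp: doubleton_eq_iff)
    from cr[OF E[OF ij(2,4)] E[OF ij'(2,4)] this]
    show "closed_segment r b \<inter> closed_segment r' b' \<subseteq> {r, b} \<inter> {r', b'}" unfolding seg ij ij' by auto
  qed
  have "graph_image ?V ?E \<phi> = coloured.graph R B"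
  proof -
    have U: "\<Union> (edge_segment \<phi> ` ?E) = coloured.graph R B"
    proof (intro subset_antisym subsetI)
      fix x assume "x \<in> \<Union> (edge_segment \<phi> ` ?E)"
      then obtain e where e: "e \<in> ?E" "x \<in> edge_segment \<phi> e" by blast
      from e(1) obtain i j where ij: "e = {Inl i, Inr j}" "i < n" "j < m" unfolding Knm_edges_def by blast
      have "x \<in> closed_segment (\<phi> (Inl i)) (\<phi> (Inr j))" using e(2) unfolding ij(1) seg .
      then show "x \<in> coloured.graph R B" unfolding coloured.graph_def[OF col] unfolding R_def B_def using ij(2,3) by blast
    next
      fix x assume "x \<in> coloured.graph R B"
      then obtain i j where ij: "i < n" "j < m" "x \<in> closed_segment (\<phi> (Inl i)) (\<phi> (Inr j))"
        unfolding coloured.graph_def[OF col] unfolding R_def B_def by blast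
      then have "x \<in> edge_segment \<phi> {Inl i, Inr j}" unfolding seg by blast
      then show "x \<in> \<Union> (edge_segment \<phi> ` ?E)" using E[OF ij(1,2)] by blast
    qed
    \<comment> \<open>Both classes are nonempty, so no vertex is isolated and the edges already
      cover the vertices.\<close>
    have "\<phi> ` ?V \<subseteq> coloured.graph R B"
      unfolding RBV[symmetric]
    proof
      have ne: "R \<noteq> {}" "B \<noteq> {}" using coloured.ne[OF col] by auto
      then obtain r b where rb: "r \<in> R" "b \<in> B" by blast
      fix w assume "w \<in> R \<union> B"
      then have "w \<in> closed_segment w b \<and> w \<in> R \<or> w \<in> closed_segment r w \<and> w \<in> B" by auto
      then show "w \<in> coloured.graph R B" unfolding coloured.graph_def[OF col] using rb by blast
    qed
    then show ?thesis unfolding graph_image_def U by blast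
  qed
  moreover have "card R \<le> 6" "card B \<le> 6"
    using card_image_le[of "{..<n}" "\<lambda>i. \<phi> (Inl i)"] card_image_le[of "{..<m}" "\<lambda>j. \<phi> (Inr j)"] assms
    by (simp_all add: R_def B_def)
  ultimately have "freely_generated (- graph_image ?V ?E \<phi>) a"
    using coloured_freely_generated[OF col, of a] a by simp
  then show "is_free_group (fundamental_group (- graph_image ?V ?E \<phi>) a)" by (rule is_free_group_pi1[OF a])
qed

end
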